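(* Let $G$ be a locally compact group and $H$ an open subgroup of $G$. Identify $L(H)$ with $\{\lambda_\ell^G(h):h\in H\}''\subseteq L(G)$. Let $\mu$ be the $G$-invariant Radon measure on $G/H$ obtained from the rho-function $\rho\equiv 1$, that is, the one satisfying $$\int_G f(x)\,d\mu_G(x)=\int_{G/H}\int_H f(xh)\,d\mu_H(h)\,d\mu(xH)\qquad (f\in C_c(G)),$$ and let $C=\mu(\{H\})$ be the mass of the point $H\in G/H$. Then $$\varphi_G|_{L(H)}=C^{-1}\cdot\varphi_H .$$
   Context: Let $\mu_G,\mu_H$ be arbitrarily fixed left Haar measures on $G$ and $H$. The left regular representation on $L^2(G)=L^2(G,\mu_G)$ is $(\lambda_\ell^G(g)\xi)(h)=\xi(g^{-1}h)$, and $L(G)=\{\lambda_\ell^G(g):g\in G\}''\subseteq \mathbb{B}(L^2(G))$; similarly for $H$ with $\mu_H$. There is a $*$-isomorphism $\Phi\colon L(H)\to\{\lambda_\ell^G(h):h\in H\}''\subseteq L(G)$ of von Neumann algebras with $\Phi(\lambda_\ell^H(h))=\lambda_\ell^G(h)$ for $h\in H$; $L(H)$ is identified with its image under $\Phi$, and $\varphi_H$ is regarded as a weight on this image via $\Phi$. A vector $\xi\in L^2(G)$ is left bounded if there is $\pi_l(\xi)\in\mathbb{B}(L^2(G))$ with $\pi_l(\xi)f=\xi*f$ for all $f\in C_c(G)$. The Plancherel weight $\varphi_G$ on $L(G)_+$ is the normal faithful semifinite weight defined by $\varphi_G(x)=\|\xi\|_2^2$ if $x=\pi_l(\xi)^*\pi_l(\xi)$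 for some left bounded $\xi\in L^2(G)$, and $\varphi_G(x)=\infty$ otherwise. It depends on $\mu_G$. $\varphi_H$ is defined analogously using $\mu_H$. A rho-function for $(G,H)$ is a continuous function $\rho\colon G\to(0,\infty)$ with $\rho(xh)=\frac{\Delta_H(h)}{\Delta_G(h)}\rho(x)$ for $x\in G,h\in H$, where $\Delta_G,\Delta_H$ are the modular functions. When $H$ is open, $\Delta_G|_H=\Delta_H$, so $\rho\equiv1$ is a rho-function. *)

theory Defs
  imports "HOL-Analysis.Analysis" "HOL-Algebra.Left_Coset"
begin

section \<open>Locally compact groups and Haar measures\<close>

locale locally_compact_group = group G for G (structure) +
  fixes T :: "'a topology"
  assumes topspace_eq: "topspace T = carrier G"
    and continuous_mult: "continuous_map (prod_topology T T) T (\<lambda>(x, y). x \<otimes> y)"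
    and continuous_inv: "continuous_map T T (\<lambda>x. inv x)"
    and hausdorff: "Hausdorff_space T"
    and locally_compact: "locally_compact_space T"

definition borel_of :: "'a topology \<Rightarrow> 'a measure" where
  "borel_of T = sigma (topspace T) {U. openin T U}"

text \<open>
  Radon measures on a locally compact Hausdorff space in Folland's convention: inner regularity
  is required on open sets only, and no \<open>\<sigma>\<close>-finiteness is assumed.
\<close>
definition radon_measure :: "'a topology \<Rightarrow> 'a measure \<Rightarrow> bool" where
  "radon_measure T M \<longleftrightarrow>
     sets M = sets (borel_of T) \<and>
     (\<forall>K. compactin T K \<longrightarrow> emeasure M K < \<infinity>) \<and>
     (\<forall>A\<in>sets M. emeasure M A = (INF U\<in>{U. openin T U \<and> A \<subseteq> U}. emeasure M U)) \<and>
     (\<forall>U. openin T U \<longrightarrow> emeasure M U = (SUP K\<in>{K. compactin T K \<and> K \<subseteq> U}. emeasure M K))"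

definition left_haar_measure ::
    "('a, 'b) monoid_scheme \<Rightarrow> 'a topology \<Rightarrow> 'a measure \<Rightarrow> bool" where
  "left_haar_measure G T M \<longleftrightarrow>
     radon_measure T M \<and> emeasure M (space M) \<noteq> 0 \<and>
     (\<forall>g\<in>carrier G. \<forall>A\<in>sets M. emeasure M (g <#\<^bsub>G\<^esub> A) = emeasure M A)"

text \<open>Values of \<open>f\<close> outside the underlying space are irrelevant.\<close>
definition compactly_supported :: "'a topology \<Rightarrow> ('a \<Rightarrow> complex) set" where
  "compactly_supported T =
     {f. continuous_map T euclidean f \<and> compactin T (T closure_of {x \<in> topspace T. f x \<noteq> 0})}"

definition coset_topology ::
    "('a, 'b) monoid_scheme \<Rightarrow> 'a topology \<Rightarrow> 'a set \<Rightarrow> 'a set topology" where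
  "coset_topology G T H =
     topology (\<lambda>\<U>. \<U> \<subseteq> lcosets\<^bsub>G\<^esub> H \<and> openin T {x \<in> topspace T. x <#\<^bsub>G\<^esub> H \<in> \<U>})"

lemma openin_coset_topology:
  "openin (coset_topology G T H) \<U> \<longleftrightarrow>
     \<U> \<subseteq> lcosets\<^bsub>G\<^esub> H \<and> openin T {x \<in> topspace T. x <#\<^bsub>G\<^esub> H \<in> \<U>}"
proof -
  let ?pre = "\<lambda>\<U>. {x \<in> topspace T. x <#\<^bsub>G\<^esub> H \<in> \<U>}"
  have Int: "?pre (\<U> \<inter> \<V>) = ?pre \<U> \<inter> ?pre \<V>" for \<U> \<V> by auto
  have Un: "?pre (\<Union>\<K>) = (\<Union>\<U>\<in>\<K>. ?pre \<U>)" for \<K> by auto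
  have "istopology (\<lambda>\<U>. \<U> \<subseteq> lcosets\<^bsub>G\<^esub> H \<and> openin T (?pre \<U>))"
    unfolding istopology_def Int Un by (auto intro!: openin_Int)
  then show ?thesis
    by (simp add: coset_topology_def topology_inverse')
qed

section \<open>The Hilbert space of square-integrable functions and its bounded operators\<close>

definition L2_fun :: "'a measure \<Rightarrow> ('a \<Rightarrow> complex) set" where
  "L2_fun M = {f \<in> borel_measurable M. integrable M (\<lambda>x. (cmod (f x))\<^sup>2)}"

definition ae_rel :: "'a measure \<Rightarrow> (('a \<Rightarrow> complex) \<times> ('a \<Rightarrow> complex)) set" where
  "ae_rel M = {(f, g). f \<in> L2_fun M \<and> g \<in> L2_fun M \<and> (AE x in M. f x = g x)}"

type_synonym 'a l2 = "('a \<Rightarrow> complex) set"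

definition L2 :: "'a measure \<Rightarrow> 'a l2 set" where
  "L2 M = L2_fun M // ae_rel M"

text \<open>
  For a representative \<open>f\<close> this is its class in \<open>L2 M\<close>; for a function that is not almost
  everywhere equal to a member of \<open>L2_fun M\<close> it is empty, hence not in \<open>L2 M\<close>.
\<close>
definition l2_class :: "'a measure \<Rightarrow> ('a \<Rightarrow> complex) \<Rightarrow> 'a l2" where
  "l2_class M f = {g \<in> L2_fun M. AE x in M. f x = g x}"

definition l2_rep :: "'a l2 \<Rightarrow> 'a \<Rightarrow> complex" where
  "l2_rep \<xi> = (SOME f. f \<in> \<xi>)"

definition l2_add :: "'a measure \<Rightarrow> 'a l2 \<Rightarrow> 'a l2 \<Rightarrow> 'a l2" where
  "l2_add M \<xi> \<eta> = l2_class M (\<lambda>x. l2_rep \<xi> x + l2_rep \<eta> x)"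

definition l2_scale :: "'a measure \<Rightarrow> complex \<Rightarrow> 'a l2 \<Rightarrow> 'a l2" where
  "l2_scale M c \<xi> = l2_class M (\<lambda>x. c * l2_rep \<xi> x)"

definition l2_inner :: "'a measure \<Rightarrow> 'a l2 \<Rightarrow> 'a l2 \<Rightarrow> complex" where
  "l2_inner M \<xi> \<eta> = (\<integral>x. l2_rep \<xi> x * cnj (l2_rep \<eta> x) \<partial>M)"

definition l2_norm :: "'a measure \<Rightarrow> 'a l2 \<Rightarrow> real" where
  "l2_norm M \<xi> = sqrt (\<integral>x. (cmod (l2_rep \<xi> x))\<^sup>2 \<partial>M)"

text \<open>
  Operators are extensional functions on \<open>L2 M\<close> (\<open>undefined\<close> elsewhere), so that
  equality of operators is equality of functions.
\<close>
definition bounded_ops :: "'a measure \<Rightarrow> ('a l2 \<Rightarrow> 'a l2) set" where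
  "bounded_ops M = {A \<in> L2 M \<rightarrow>\<^sub>E L2 M.
     (\<forall>\<xi>\<in>L2 M. \<forall>\<eta>\<in>L2 M. A (l2_add M \<xi> \<eta>) = l2_add M (A \<xi>) (A \<eta>)) \<and>
     (\<forall>c. \<forall>\<xi>\<in>L2 M. A (l2_scale M c \<xi>) = l2_scale M c (A \<xi>)) \<and>
     (\<exists>K. \<forall>\<xi>\<in>L2 M. l2_norm M (A \<xi>) \<le> K * l2_norm M \<xi>)}"

definition op_add ::
    "'a measure \<Rightarrow> ('a l2 \<Rightarrow> 'a l2) \<Rightarrow> ('a l2 \<Rightarrow> 'a l2) \<Rightarrow> 'a l2 \<Rightarrow> 'a l2" where
  "op_add M A B = (\<lambda>\<xi>\<in>L2 M. l2_add M (A \<xi>) (B \<xi>))"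

definition op_scale :: "'a measure \<Rightarrow> complex \<Rightarrow> ('a l2 \<Rightarrow> 'a l2) \<Rightarrow> 'a l2 \<Rightarrow> 'a l2" where
  "op_scale M c A = (\<lambda>\<xi>\<in>L2 M. l2_scale M c (A \<xi>))"

definition op_mult ::
    "'a measure \<Rightarrow> ('a l2 \<Rightarrow> 'a l2) \<Rightarrow> ('a l2 \<Rightarrow> 'a l2) \<Rightarrow> 'a l2 \<Rightarrow> 'a l2" where
  "op_mult M A B = compose (L2 M) A B"

definition op_adj :: "'a measure \<Rightarrow> ('a l2 \<Rightarrow> 'a l2) \<Rightarrow> 'a l2 \<Rightarrow> 'a l2" where
  "op_adj M A = (THE B. B \<in> bounded_ops M \<and>
     (\<forall>\<xi>\<in>L2 M. \<forall>\<eta>\<in>L2 M. l2_inner M (A \<xi>) \<eta> = l2_inner M \<xi> (B \<eta>)))"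

definition commutant :: "'a measure \<Rightarrow> ('a l2 \<Rightarrow> 'a l2) set \<Rightarrow> ('a l2 \<Rightarrow> 'a l2) set" where
  "commutant M S = {A \<in> bounded_ops M. \<forall>B\<in>S. op_mult M A B = op_mult M B A}"

definition positive_part :: "'a measure \<Rightarrow> ('a l2 \<Rightarrow> 'a l2) set \<Rightarrow> ('a l2 \<Rightarrow> 'a l2) set" where
  "positive_part M \<A> =
     {A \<in> \<A>. \<forall>\<xi>\<in>L2 M. Im (l2_inner M (A \<xi>) \<xi>) = 0 \<and> 0 \<le> Re (l2_inner M (A \<xi>) \<xi>)}"

definition star_isomorphism ::
    "'a measure \<Rightarrow> ('a l2 \<Rightarrow> 'a l2) set \<Rightarrow> 'b measure \<Rightarrow> ('b l2 \<Rightarrow> 'b l2) set \<Rightarrow>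
     (('a l2 \<Rightarrow> 'a l2) \<Rightarrow> ('b l2 \<Rightarrow> 'b l2)) \<Rightarrow> bool" where
  "star_isomorphism M \<A> N \<B> \<Phi> \<longleftrightarrow>
     bij_betw \<Phi> \<A> \<B> \<and>
     (\<forall>A\<in>\<A>. \<forall>B\<in>\<A>. \<Phi> (op_add M A B) = op_add N (\<Phi> A) (\<Phi> B)) \<and>
     (\<forall>c. \<forall>A\<in>\<A>. \<Phi> (op_scale M c A) = op_scale N c (\<Phi> A)) \<and>
     (\<forall>A\<in>\<A>. \<forall>B\<in>\<A>. \<Phi> (op_mult M A B) = op_mult N (\<Phi> A) (\<Phi> B)) \<and>
     (\<forall>A\<in>\<A>. \<Phi> (op_adj M A) = op_adj N (\<Phi> A))"

section \<open>Group von Neumann algebras and Plancherel weights\<close>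

definition left_regular ::
    "('a, 'b) monoid_scheme \<Rightarrow> 'a measure \<Rightarrow> 'a \<Rightarrow> 'a l2 \<Rightarrow> 'a l2" where
  "left_regular G M g = (\<lambda>\<xi>\<in>L2 M. l2_class M (\<lambda>x. l2_rep \<xi> (inv\<^bsub>G\<^esub> g \<otimes>\<^bsub>G\<^esub> x)))"

text \<open>
  The double commutant of the left translations by elements of \<open>S\<close>. The group von Neumann
  algebra \<open>L(G)\<close> is the case \<open>S = carrier G\<close>.
\<close>
definition translation_vN ::
    "('a, 'b) monoid_scheme \<Rightarrow> 'a measure \<Rightarrow> 'a set \<Rightarrow> ('a l2 \<Rightarrow> 'a l2) set" where
  "translation_vN G M S = commutant M (commutant M (left_regular G M ` S))"

abbreviation group_vN :: "('a, 'b) monoid_scheme \<Rightarrow> 'a measure \<Rightarrow> ('a l2 \<Rightarrow> 'a l2) set" where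
  "group_vN G M \<equiv> translation_vN G M (carrier G)"

definition convolution ::
    "('a, 'b) monoid_scheme \<Rightarrow> 'a measure \<Rightarrow> ('a \<Rightarrow> complex) \<Rightarrow> ('a \<Rightarrow> complex) \<Rightarrow> 'a \<Rightarrow> complex"
  where "convolution G M f g x = (\<integral>y. f y * g (inv\<^bsub>G\<^esub> y \<otimes>\<^bsub>G\<^esub> x) \<partial>M)"

definition is_left_convolution_op ::
    "('a, 'b) monoid_scheme \<Rightarrow> 'a topology \<Rightarrow> 'a measure \<Rightarrow> 'a l2 \<Rightarrow> ('a l2 \<Rightarrow> 'a l2) \<Rightarrow> bool" where
  "is_left_convolution_op G T M \<xi> A \<longleftrightarrow> A \<in> bounded_ops M \<and>
     (\<forall>f\<in>compactly_supported T. A (l2_class M f) = l2_class M (convolution G M (l2_rep \<xi>) f))"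

definition left_bounded :: "('a, 'b) monoid_scheme \<Rightarrow> 'a topology \<Rightarrow> 'a measure \<Rightarrow> 'a l2 set" where
  "left_bounded G T M = {\<xi> \<in> L2 M. \<exists>A. is_left_convolution_op G T M \<xi> A}"

definition left_conv_op ::
    "('a, 'b) monoid_scheme \<Rightarrow> 'a topology \<Rightarrow> 'a measure \<Rightarrow> 'a l2 \<Rightarrow> 'a l2 \<Rightarrow> 'a l2" where
  "left_conv_op G T M \<xi> = (THE A. is_left_convolution_op G T M \<xi> A)"

text \<open>
  Meant for \<open>x\<close> in the positive part of \<open>group_vN G M\<close>. The norm of \<open>\<xi>\<close> does not depend on the
  choice of \<open>\<xi>\<close> with \<open>x = \<pi>\<^sub>l(\<xi>)\<^sup>* \<pi>\<^sub>l(\<xi>)\<close>.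
\<close>
definition plancherel_weight ::
    "('a, 'b) monoid_scheme \<Rightarrow> 'a topology \<Rightarrow> 'a measure \<Rightarrow> ('a l2 \<Rightarrow> 'a l2) \<Rightarrow> ennreal" where
  "plancherel_weight G T M x =
     (let represents = (\<lambda>\<xi>. \<xi> \<in> left_bounded G T M \<and>
            x = op_mult M (op_adj M (left_conv_op G T M \<xi>)) (left_conv_op G T M \<xi>))
      in if \<exists>\<xi>. represents \<xi> then ennreal ((l2_norm M (SOME \<xi>. represents \<xi>))\<^sup>2) else \<infinity>)"

end

theory Submission
  imports Defs
begin

text \<open>
  By the integral formula \<open>\<mu>G\<close> restricts to \<open>C \<mu>H\<close> on \<open>H\<close>, so extension by zero
  \<open>E: L\<^sup>2(H) \<rightarrow> L\<^sup>2(G)\<close> is \<open>\<surd>C\<close> times an isometry, and it intertwines the left translations by \<open>H\<close>.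

  The hypotheses only make \<open>\<Phi>\<close> a \<open>*\<close>-isomorphism that matches these translations, but then
  \<open>\<Phi>(y) E = E y\<close> for all \<open>y\<close> in \<open>L(H)\<close>. Indeed \<open>\<Phi>\<close> is an order isomorphism and hence preserves
  suprema of chains of effects; by Zorn's lemma, for every vector \<open>z\<close>, every nonzero effect
  dominates a nonzero effect below which \<open>\<langle>\<Phi>(\<cdot>) z, z\<rangle>\<close> is bounded by a vector functional
  \<open>\<langle>\<cdot> \<xi>, \<xi>\<rangle>\<close>. This gives enough vectors \<open>w\<close> with \<open>\<parallel>\<Phi>(x) w\<parallel> \<le> \<parallel>x v\<parallel>\<close> for some \<open>v\<close>, and such \<open>w\<close> have
  the same inner products with \<open>\<Phi>(x) E k\<close> and \<open>E x k\<close>.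

  Right convolutions by functions in \<open>C\<^sub>c\<close> are bounded (Schur test) and commute with \<open>L(G)\<close>. By
  means of symmetric approximate units, \<open>\<pi>(\<xi>)\<^sup>* \<pi>(\<xi>)\<close> determines \<open>\<parallel>\<xi>\<parallel>\<close>, and \<open>x = \<pi>(\<xi>)\<^sup>* \<pi>(\<xi>)\<close> implies
  \<open>\<surd>x = \<pi>(\<eta>)\<close> for some \<open>\<eta>\<close>. If \<open>x = \<Phi>(y)\<close>, then \<open>\<surd>x = \<Phi>(\<surd>y)\<close>, so \<open>\<surd>y = \<pi>(\<eta>)\<close> on \<open>L\<^sup>2(H)\<close> yields
  \<open>\<surd>x = \<pi>(C\<^sup>-\<^sup>1 E \<eta>)\<close>, and restriction to \<open>H\<close> gives the converse. The factor is
  \<open>\<parallel>C\<^sup>-\<^sup>1 E \<eta>\<parallel>\<^sup>2 = C\<^sup>-\<^sup>1 \<parallel>\<eta>\<parallel>\<^sup>2\<close>. Modular functions and commutation theorems are not involved.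
\<close>

section \<open>The Hilbert space of square-integrable functions\<close>

text \<open>Knowing \<open>\<Phi>\<close> on translations determines it algebraically only on their
  span; reaching the double commutant takes some continuity. The order is the one piece of topology
  that an algebraic isomorphism preserves, because positive elements are squares. Hence effects,
  chains and Zorn's lemma in a statement about groups.

  A vector \<open>\<xi>\<close> with \<open>x = \<pi>(\<xi>)\<^sup>* \<pi>(\<xi>)\<close> is far
  from unique: left translation of \<open>\<xi>\<close> by any element of \<open>G\<close> leaves
  \<open>x\<close> unchanged. So \<open>\<xi>\<close> need not be supported in \<open>H\<close>, nor
  \<open>\<pi>(\<xi>)\<close> lie in the copy of \<open>L(H)\<close>, even if \<open>x\<close> does.
  The root of \<open>x\<close> stays in that copy and can be pulled back along
  \<open>\<Phi>\<close>.

  As for the constant, convolution by \<open>E \<eta>\<close> integrates over \<open>H\<close>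
  against \<open>\<mu>G\<close>, which gives \<open>C\<close> times the extension of convolution by
  \<open>\<eta>\<close>. So the vector has to be divided by \<open>C\<close>; its squared norm
  carries \<open>1 / C\<^sup>2\<close> from the division and \<open>C\<close> from \<open>E\<close>.

  Haar measures need not be \<sigma>-finite here, so the measure theory rests on regularity and
  compact supports.\<close>

lemma L2_fun_measurable [measurable_dest]: "f \<in> L2_fun M \<Longrightarrow> f \<in> borel_measurable M"
  and L2_fun_integrable: "f \<in> L2_fun M \<Longrightarrow> integrable M (\<lambda>x. (cmod (f x))\<^sup>2)"
  by (auto simp: L2_fun_def)

lemma borel_measurable_cnj [measurable (raw)]:
  "f \<in> borel_measurable M \<Longrightarrow> (\<lambda>x. cnj (f x)) \<in> borel_measurable M"
  by (rule measurable_compose[OF _ borel_measurable_continuous_onI])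
    (auto intro: continuous_intros)

lemma cmod_add_sq: "(cmod (a + b))\<^sup>2 \<le> 2 * (cmod a)\<^sup>2 + 2 * (cmod b)\<^sup>2"
proof -
  have "(cmod (a + b))\<^sup>2 \<le> (cmod a + cmod b)\<^sup>2"
    by (simp add: norm_triangle_ineq power_mono)
  also have "\<dots> \<le> 2 * (cmod a)\<^sup>2 + 2 * (cmod b)\<^sup>2"
    using sum_squares_bound[of "cmod a" "cmod b"] by (simp add: power2_sum)
  finally show ?thesis .
qed

lemma L2_fun_bound:
  assumes "f \<in> borel_measurable M" "integrable M g" "\<And>x. x \<in> space M \<Longrightarrow> (cmod (f x))\<^sup>2 \<le> g x"
  shows "f \<in> L2_fun M"
proof -
  have "integrable M (\<lambda>x. (cmod (f x))\<^sup>2)"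
    using assms(1) by (intro Bochner_Integration.integrable_bound[OF assms(2)]) (auto intro!: AE_I2 dest: assms(3))
  then show ?thesis using assms(1) by (simp add: L2_fun_def)
qed

lemma L2_fun_add: "f \<in> L2_fun M \<Longrightarrow> g \<in> L2_fun M \<Longrightarrow> (\<lambda>x. f x + g x) \<in> L2_fun M"
  by (rule L2_fun_bound[where g="\<lambda>x. 2 * (cmod (f x))\<^sup>2 + 2 * (cmod (g x))\<^sup>2"])
    (auto simp: L2_fun_def intro: cmod_add_sq)

lemma L2_fun_scale: "f \<in> L2_fun M \<Longrightarrow> (\<lambda>x. c * f x) \<in> L2_fun M"
  by (auto simp: L2_fun_def norm_mult power_mult_distrib)

lemma L2_fun_zero [simp]: "(\<lambda>x. 0) \<in> L2_fun M"
  by (simp add: L2_fun_def)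

lemma L2_fun_diff: "f \<in> L2_fun M \<Longrightarrow> g \<in> L2_fun M \<Longrightarrow> (\<lambda>x. f x - g x) \<in> L2_fun M"
  using L2_fun_add[of f M "\<lambda>x. -1 * g x"] L2_fun_scale[of g M "-1"] by simp

lemma L2_fun_mult_integrable:
  assumes "f \<in> L2_fun M" "g \<in> L2_fun M"
  shows "integrable M (\<lambda>x. f x * g x)"
proof (rule Bochner_Integration.integrable_bound)
  show "integrable M (\<lambda>x. (cmod (f x))\<^sup>2 + (cmod (g x))\<^sup>2)"
    using assms by (simp add: L2_fun_def)
  show "(\<lambda>x. f x * g x) \<in> borel_measurable M"
    using assms by measurable
  have "cmod a * cmod b \<le> (cmod a)\<^sup>2 + (cmod b)\<^sup>2" for a b
  proof -
    have "0 \<le> cmod a * cmod b" by simp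
    then show ?thesis using sum_squares_bound[of "cmod a" "cmod b"] by linarith
  qed
  then show "AE x in M. norm (f x * g x) \<le> norm ((cmod (f x))\<^sup>2 + (cmod (g x))\<^sup>2)"
    by (simp add: norm_mult)
qed

lemma L2_fun_cnj: "f \<in> L2_fun M \<Longrightarrow> (\<lambda>x. cnj (f x)) \<in> L2_fun M"
  unfolding L2_fun_def by (auto intro: borel_measurable_cnj)

section \<open>Square-integrable functions modulo null functions\<close>

lemma l2_class_Image: "f \<in> L2_fun M \<Longrightarrow> l2_class M f = ae_rel M `` {f}"
  by (auto simp: l2_class_def ae_rel_def)

lemma l2_class_in [simp]: "f \<in> L2_fun M \<Longrightarrow> l2_class M f \<in> L2 M"
  by (simp add: l2_class_Image L2_def quotientI)

lemma L2_cases: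
  assumes "\<xi> \<in> L2 M" obtains f where "f \<in> L2_fun M" "\<xi> = l2_class M f"
  using assms by (auto simp: L2_def l2_class_Image elim!: quotientE)

lemma l2_class_self: "f \<in> L2_fun M \<Longrightarrow> f \<in> l2_class M f"
  by (simp add: l2_class_def)

text \<open>If the functions agree almost everywhere with no member of \<open>L2_fun\<close>, both
  classes are empty; so the equation holds for arbitrary functions.\<close>

lemma l2_class_cong_AE: "AE x in M. f x = g x \<Longrightarrow> l2_class M f = l2_class M g"
  by (auto simp: l2_class_def)

lemma l2_class_cong: "(\<And>x. x \<in> space M \<Longrightarrow> f x = g x) \<Longrightarrow> l2_class M f = l2_class M g"
  by (rule l2_class_cong_AE) (rule AE_I2)

lemma l2_class_eqD: "f \<in> L2_fun M \<Longrightarrow> l2_class M f = l2_class M g \<Longrightarrow> AE x in M. f x = g x"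
  using l2_class_self[of f M] by (auto simp: l2_class_def)

lemma l2_rep_in:
  assumes "\<xi> \<in> L2 M" shows "l2_rep \<xi> \<in> \<xi>"
  using assms l2_class_self unfolding l2_rep_def by (metis L2_cases someI)

lemma l2_rep [simp]:
  assumes "\<xi> \<in> L2 M"
  shows l2_rep_L2_fun: "l2_rep \<xi> \<in> L2_fun M" and l2_class_rep: "l2_class M (l2_rep \<xi>) = \<xi>"
proof -
  obtain f where f: "f \<in> L2_fun M" "\<xi> = l2_class M f" using assms by (rule L2_cases)
  have "l2_rep \<xi> \<in> l2_class M f" using l2_rep_in[OF assms] f by simp
  then show "l2_rep \<xi> \<in> L2_fun M" "l2_class M (l2_rep \<xi>) = \<xi>"
    unfolding f(2) by (auto simp: l2_class_def)
qed

lemma l2_rep_class: "f \<in> L2_fun M \<Longrightarrow> AE x in M. l2_rep (l2_class M f) x = f x"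
  by (rule l2_class_eqD) auto

lemma l2_rep_measurable [measurable]: "\<xi> \<in> L2 M \<Longrightarrow> l2_rep \<xi> \<in> borel_measurable M"
  using l2_rep_L2_fun L2_fun_measurable by blast

section \<open>Linear structure, inner product and norm of classes\<close>

definition l2_zero :: "'a measure \<Rightarrow> 'a l2" where "l2_zero M = l2_class M (\<lambda>_. 0)"

definition l2_diff :: "'a measure \<Rightarrow> 'a l2 \<Rightarrow> 'a l2 \<Rightarrow> 'a l2" where
  "l2_diff M \<xi> \<eta> = l2_add M \<xi> (l2_scale M (-1) \<eta>)"

lemma l2_add_class:
  assumes "f \<in> L2_fun M" "g \<in> L2_fun M"
  shows "l2_add M (l2_class M f) (l2_class M g) = l2_class M (\<lambda>x. f x + g x)"
  unfolding l2_add_def using l2_rep_class[OF assms(1)] l2_rep_class[OF assms(2)]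
  by (intro l2_class_cong_AE) auto

lemma l2_scale_class:
  assumes "f \<in> L2_fun M"
  shows "l2_scale M c (l2_class M f) = l2_class M (\<lambda>x. c * f x)"
  unfolding l2_scale_def using l2_rep_class[OF assms(1)]
  by (intro l2_class_cong_AE) auto

lemma l2_diff_class:
  assumes "f \<in> L2_fun M" "g \<in> L2_fun M"
  shows "l2_diff M (l2_class M f) (l2_class M g) = l2_class M (\<lambda>x. f x - g x)"
  unfolding l2_diff_def l2_scale_class[OF assms(2)] l2_add_class[OF assms(1) L2_fun_scale[OF assms(2)]]
  by simp

lemma l2_inner_class:
  assumes "f \<in> L2_fun M" "g \<in> L2_fun M"
  shows "l2_inner M (l2_class M f) (l2_class M g) = (\<integral>x. f x * cnj (g x) \<partial>M)"
proof -
  have "AE x in M. l2_rep (l2_class M f) x * cnj (l2_rep (l2_class M g) x) = f x * cnj (g x)"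
    using l2_rep_class[OF assms(1)] l2_rep_class[OF assms(2)] by eventually_elim simp
  then show ?thesis
    unfolding l2_inner_def using assms
    by (intro integral_cong_AE borel_measurable_times borel_measurable_cnj) (auto dest: L2_fun_measurable)
qed

lemma l2_norm_class:
  assumes "f \<in> L2_fun M"
  shows "l2_norm M (l2_class M f) = sqrt (\<integral>x. (cmod (f x))\<^sup>2 \<partial>M)"
proof -
  have "AE x in M. (cmod (l2_rep (l2_class M f) x))\<^sup>2 = (cmod (f x))\<^sup>2"
    using l2_rep_class[OF assms(1)] by eventually_elim simp
  then have "(\<integral>x. (cmod (l2_rep (l2_class M f) x))\<^sup>2 \<partial>M) = (\<integral>x. (cmod (f x))\<^sup>2 \<partial>M)"
    using assms L2_fun_measurable[OF assms] L2_fun_measurable[OF l2_rep_L2_fun[OF l2_class_in[OF assms]]]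
    by (intro integral_cong_AE) auto
  then show ?thesis by (simp add: l2_norm_def)
qed

lemma l2_norm_class_sq:
  assumes "f \<in> L2_fun M"
  shows "(l2_norm M (l2_class M f))\<^sup>2 = (\<integral>x. (cmod (f x))\<^sup>2 \<partial>M)"
  using assms by (simp add: l2_norm_class)

lemma l2_zero_in [simp]: "l2_zero M \<in> L2 M"
  by (simp add: l2_zero_def)

lemma l2_add_in [simp]: "\<xi> \<in> L2 M \<Longrightarrow> \<eta> \<in> L2 M \<Longrightarrow> l2_add M \<xi> \<eta> \<in> L2 M"
  by (simp add: l2_add_def L2_fun_add)

lemma l2_scale_in [simp]: "\<xi> \<in> L2 M \<Longrightarrow> l2_scale M c \<xi> \<in> L2 M"
  by (simp add: l2_scale_def L2_fun_scale)

lemma l2_diff_in [simp]: "\<xi> \<in> L2 M \<Longrightarrow> \<eta> \<in> L2 M \<Longrightarrow> l2_diff M \<xi> \<eta> \<in> L2 M"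
  by (simp add: l2_diff_def)

lemma l2_inner_add_left [simp]:
  assumes "\<xi> \<in> L2 M" "\<eta> \<in> L2 M" "\<zeta> \<in> L2 M"
  shows "l2_inner M (l2_add M \<xi> \<eta>) \<zeta> = l2_inner M \<xi> \<zeta> + l2_inner M \<eta> \<zeta>"
proof -
  obtain f g h where *: "f \<in> L2_fun M" "\<xi> = l2_class M f" "g \<in> L2_fun M" "\<eta> = l2_class M g"
    "h \<in> L2_fun M" "\<zeta> = l2_class M h"
    using assms by (meson L2_cases)
  show ?thesis unfolding *(2,4,6) using *
    by (simp add: l2_add_class l2_inner_class L2_fun_add distrib_right L2_fun_mult_integrable L2_fun_cnj)
qed

lemma l2_inner_scale_left [simp]:
  assumes "\<xi> \<in> L2 M" "\<zeta> \<in> L2 M"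
  shows "l2_inner M (l2_scale M c \<xi>) \<zeta> = c * l2_inner M \<xi> \<zeta>"
proof -
  obtain f h where *: "f \<in> L2_fun M" "\<xi> = l2_class M f" "h \<in> L2_fun M" "\<zeta> = l2_class M h"
    using assms by (meson L2_cases)
  show ?thesis unfolding *(2,4) using *
    by (simp add: l2_scale_class l2_inner_class L2_fun_scale mult.assoc)
qed

text \<open>Conjugation preserves integrability, and a non-integrable function has integral 0. So
  the identity holds for arbitrary sets and serves as an unconditional rewrite rule.\<close>

lemma l2_inner_commute:
  "l2_inner M \<eta> \<xi> = cnj (l2_inner M \<xi> \<eta>)"
proof -
  have "cnj (l2_inner M \<xi> \<eta>) = (\<integral>x. cnj (l2_rep \<xi> x * cnj (l2_rep \<eta> x)) \<partial>M)"
    unfolding l2_inner_def by (rule Bochner_Integration.integral_cnj[symmetric])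
  also have "\<dots> = l2_inner M \<eta> \<xi>" unfolding l2_inner_def by (simp add: mult.commute)
  finally show ?thesis ..
qed

lemma l2_inner_add_right [simp]:
  assumes "\<xi> \<in> L2 M" "\<eta> \<in> L2 M" "\<zeta> \<in> L2 M"
  shows "l2_inner M \<zeta> (l2_add M \<xi> \<eta>) = l2_inner M \<zeta> \<xi> + l2_inner M \<zeta> \<eta>"
  using assms by (metis complex_cnj_add l2_inner_add_left l2_inner_commute)

lemma l2_inner_scale_right [simp]:
  assumes "\<xi> \<in> L2 M" "\<zeta> \<in> L2 M"
  shows "l2_inner M \<zeta> (l2_scale M c \<xi>) = cnj c * l2_inner M \<zeta> \<xi>"
  using assms by (metis complex_cnj_mult l2_inner_scale_left l2_inner_commute)

lemma l2_inner_diff_left [simp]: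
  "\<xi> \<in> L2 M \<Longrightarrow> \<eta> \<in> L2 M \<Longrightarrow> \<zeta> \<in> L2 M \<Longrightarrow>
    l2_inner M (l2_diff M \<xi> \<eta>) \<zeta> = l2_inner M \<xi> \<zeta> - l2_inner M \<eta> \<zeta>"
  by (simp add: l2_diff_def)

lemma l2_inner_diff_right [simp]:
  "\<xi> \<in> L2 M \<Longrightarrow> \<eta> \<in> L2 M \<Longrightarrow> \<zeta> \<in> L2 M \<Longrightarrow>
    l2_inner M \<zeta> (l2_diff M \<xi> \<eta>) = l2_inner M \<zeta> \<xi> - l2_inner M \<zeta> \<eta>"
  by (simp add: l2_diff_def)

lemma l2_inner_zero [simp]:
  assumes "\<xi> \<in> L2 M"
  shows "l2_inner M (l2_zero M) \<xi> = 0" and "l2_inner M \<xi> (l2_zero M) = 0"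
proof -
  obtain f where "f \<in> L2_fun M" "\<xi> = l2_class M f" using assms by (meson L2_cases)
  then show "l2_inner M (l2_zero M) \<xi> = 0" "l2_inner M \<xi> (l2_zero M) = 0"
    by (simp_all add: l2_zero_def l2_inner_class)
qed

lemma l2_inner_self: "l2_inner M \<xi> \<xi> = of_real ((l2_norm M \<xi>)\<^sup>2)"
proof -
  have "l2_inner M \<xi> \<xi> = (\<integral>x. of_real ((cmod (l2_rep \<xi> x))\<^sup>2) \<partial>M)"
    unfolding l2_inner_def complex_norm_square by simp
  also have "\<dots> = of_real (\<integral>x. (cmod (l2_rep \<xi> x))\<^sup>2 \<partial>M)" by (rule integral_complex_of_real)
  finally show ?thesis by (simp add: l2_norm_def)
qed

lemma l2_norm_nonneg [simp]: "0 \<le> l2_norm M \<xi>"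
  by (simp add: l2_norm_def)

lemma l2_norm_sq: "(l2_norm M \<xi>)\<^sup>2 = Re (l2_inner M \<xi> \<xi>)"
  by (simp add: l2_inner_self)

lemma l2_norm_eq_0D:
  assumes "\<xi> \<in> L2 M" "l2_norm M \<xi> = 0" shows "\<xi> = l2_zero M"
proof -
  obtain f where f: "f \<in> L2_fun M" "\<xi> = l2_class M f" using assms by (meson L2_cases)
  then have "(\<integral>x. (cmod (f x))\<^sup>2 \<partial>M) = 0" using assms l2_norm_class[OF f(1)] by simp
  then have "AE x in M. (cmod (f x))\<^sup>2 = 0"
    using integral_nonneg_eq_0_iff_AE[OF L2_fun_integrable[OF f(1)]] by simp
  then show ?thesis unfolding f(2) l2_zero_def by (intro l2_class_cong_AE) auto
qed

lemma l2_diff_eq_zeroD: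
  assumes "\<xi> \<in> L2 M" "\<eta> \<in> L2 M" "l2_diff M \<xi> \<eta> = l2_zero M" shows "\<xi> = \<eta>"
proof -
  obtain f g where f: "f \<in> L2_fun M" "\<xi> = l2_class M f" and g: "g \<in> L2_fun M" "\<eta> = l2_class M g"
    using assms by (meson L2_cases)
  have "l2_class M (\<lambda>x. f x - g x) = l2_class M (\<lambda>_. 0)"
    using assms(3) unfolding f(2) g(2) l2_diff_class[OF f(1) g(1)] l2_zero_def .
  then have "AE x in M. f x - g x = 0" by (rule l2_class_eqD[OF L2_fun_diff[OF f(1) g(1)]])
  then show ?thesis unfolding f(2) g(2) by (intro l2_class_cong_AE) auto
qed

lemma l2_eqI:
  assumes "\<xi> \<in> L2 M" "\<eta> \<in> L2 M" "\<And>\<zeta>. \<zeta> \<in> L2 M \<Longrightarrow> l2_inner M \<xi> \<zeta> = l2_inner M \<eta> \<zeta>"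
  shows "\<xi> = \<eta>"
proof -
  have "l2_inner M (l2_diff M \<xi> \<eta>) (l2_diff M \<xi> \<eta>) = 0"
    using assms by simp
  then have "l2_norm M (l2_diff M \<xi> \<eta>) = 0" by (simp add: l2_inner_self)
  then show ?thesis using assms by (meson l2_diff_eq_zeroD l2_diff_in l2_norm_eq_0D)
qed

lemma l2_eqI':
  assumes "\<xi> \<in> L2 M" "\<eta> \<in> L2 M" "\<And>\<zeta>. \<zeta> \<in> L2 M \<Longrightarrow> l2_inner M \<zeta> \<xi> = l2_inner M \<zeta> \<eta>"
  shows "\<xi> = \<eta>"
  using assms by (metis l2_eqI l2_inner_commute)

lemma l2_norm_zero [simp]: "l2_norm M (l2_zero M) = 0"
  using l2_inner_self[of M "l2_zero M"] by simp

lemma l2_norm_scale [simp]: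
  assumes "\<xi> \<in> L2 M" shows "l2_norm M (l2_scale M c \<xi>) = cmod c * l2_norm M \<xi>"
proof -
  have "complex_of_real ((l2_norm M (l2_scale M c \<xi>))\<^sup>2) = of_real ((cmod c * l2_norm M \<xi>)\<^sup>2)"
    using assms unfolding l2_inner_self[symmetric] power_mult_distrib of_real_mult
    unfolding complex_norm_square by (simp add: mult.commute)
  then have "(l2_norm M (l2_scale M c \<xi>))\<^sup>2 = (cmod c * l2_norm M \<xi>)\<^sup>2"
    using of_real_eq_iff by blast
  then show ?thesis by (simp add: power2_eq_iff_nonneg)
qed

text \<open>The source of the Cauchy-Schwarz inequalities for vectors and for positive operators:
  the quadratic in \<open>t\<close> is the squared length of \<open>\<xi> - t b \<eta>\<close> for a
  positive form with diagonal entries \<open>a\<close>, \<open>c\<close> and off-diagonal entry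
  \<open>b\<close>. Its value at \<open>t = 1 / c\<close> is the claim; for \<open>c = 0\<close> it
  is affine in \<open>t\<close>, and a large \<open>t\<close> forces \<open>b = 0\<close>. Applied
  with \<open>a = 0\<close> it shows that a first variation vanishes.\<close>

lemma sesquilinear_discriminant:
  fixes a c :: real and b :: complex
  assumes "\<And>t. 0 \<le> a - 2 * t * (cmod b)\<^sup>2 + t\<^sup>2 * (cmod b)\<^sup>2 * c" "0 \<le> a" "0 \<le> c"
  shows "(cmod b)\<^sup>2 \<le> a * c"
proof (cases "c = 0")
  case True
  show ?thesis
  proof (rule ccontr)
    assume "\<not> ?thesis"
    then have "b \<noteq> 0" using assms by auto
    define t where "t = (a + 1) / (cmod b)\<^sup>2"
    have "t * (cmod b)\<^sup>2 = a + 1" using \<open>b \<noteq> 0\<close> by (simp add: t_def)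
    moreover have "0 \<le> a - 2 * (t * (cmod b)\<^sup>2)" using assms(1)[of t] True by simp
    ultimately show False using assms(2) by simp
  qed
next
  case False
  then show ?thesis using assms(1)[of "1 / c"] assms(3)
    by (simp add: field_simps power2_eq_square)
qed

lemma l2_Cauchy_Schwarz:
  assumes "\<xi> \<in> L2 M" "\<eta> \<in> L2 M"
  shows "cmod (l2_inner M \<xi> \<eta>) \<le> l2_norm M \<xi> * l2_norm M \<eta>"
proof -
  let ?b = "l2_inner M \<xi> \<eta>"
  have "0 \<le> (l2_norm M \<xi>)\<^sup>2 - 2 * t * (cmod ?b)\<^sup>2 + t\<^sup>2 * (cmod ?b)\<^sup>2 * (l2_norm M \<eta>)\<^sup>2" for t :: real
  proof -
    \<comment> \<open>The factor \<open>?b\<close> in the coefficient makes both cross terms equal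
      to the real number \<open>t |?b|\<^sup>2\<close>.\<close>
    let ?d = "l2_diff M \<xi> (l2_scale M (of_real t * ?b) \<eta>)"
    have "l2_inner M ?d ?d = l2_inner M \<xi> \<xi> - 2 * of_real t * (?b * cnj ?b)
        + (of_real t)\<^sup>2 * (?b * cnj ?b) * l2_inner M \<eta> \<eta>"
      using assms by (simp add: l2_inner_commute[of M \<eta> \<xi>] algebra_simps power2_eq_square)
    also have "\<dots> = of_real ((l2_norm M \<xi>)\<^sup>2 - 2 * t * (cmod ?b)\<^sup>2 + t\<^sup>2 * (cmod ?b)\<^sup>2 * (l2_norm M \<eta>)\<^sup>2)"
      unfolding l2_inner_self complex_norm_square[symmetric] by simp
    finally have "(l2_norm M ?d)\<^sup>2 = (l2_norm M \<xi>)\<^sup>2 - 2 * t * (cmod ?b)\<^sup>2 + t\<^sup>2 * (cmod ?b)\<^sup>2 * (l2_norm M \<eta>)\<^sup>2"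
      unfolding l2_inner_self using of_real_eq_iff by blast
    then show ?thesis by (metis zero_le_power2)
  qed
  from sesquilinear_discriminant[OF this] have "(cmod ?b)\<^sup>2 \<le> (l2_norm M \<xi> * l2_norm M \<eta>)\<^sup>2"
    by (simp add: power_mult_distrib)
  then show ?thesis by (rule power2_le_imp_le) simp
qed

lemma l2_norm_triangle:
  assumes "\<xi> \<in> L2 M" "\<eta> \<in> L2 M"
  shows "l2_norm M (l2_add M \<xi> \<eta>) \<le> l2_norm M \<xi> + l2_norm M \<eta>"
proof (rule power2_le_imp_le)
  have "(l2_norm M (l2_add M \<xi> \<eta>))\<^sup>2 = (l2_norm M \<xi>)\<^sup>2 + (l2_norm M \<eta>)\<^sup>2 + 2 * Re (l2_inner M \<xi> \<eta>)"
    using assms by (simp add: l2_norm_sq l2_inner_commute[of M \<eta> \<xi>])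
  also have "Re (l2_inner M \<xi> \<eta>) \<le> l2_norm M \<xi> * l2_norm M \<eta>"
    using l2_Cauchy_Schwarz[OF assms] complex_Re_le_cmod order_trans by blast
  finally show "(l2_norm M (l2_add M \<xi> \<eta>))\<^sup>2 \<le> (l2_norm M \<xi> + l2_norm M \<eta>)\<^sup>2"
    by (simp add: power2_sum)
qed simp

lemma l2_norm_triangle_diff:
  assumes "\<xi> \<in> L2 M" "\<eta> \<in> L2 M" "\<zeta> \<in> L2 M"
  shows "l2_norm M (l2_diff M \<xi> \<zeta>) \<le> l2_norm M (l2_diff M \<xi> \<eta>) + l2_norm M (l2_diff M \<eta> \<zeta>)"
proof -
  have "l2_diff M \<xi> \<zeta> = l2_add M (l2_diff M \<xi> \<eta>) (l2_diff M \<eta> \<zeta>)"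
    by (rule l2_eqI[of _ M]) (use assms in auto)
  then show ?thesis using assms by (simp add: l2_norm_triangle)
qed

lemma l2_norm_diff_commute:
  assumes "\<xi> \<in> L2 M" "\<eta> \<in> L2 M"
  shows "l2_norm M (l2_diff M \<xi> \<eta>) = l2_norm M (l2_diff M \<eta> \<xi>)"
proof -
  have "l2_diff M \<xi> \<eta> = l2_scale M (-1) (l2_diff M \<eta> \<xi>)"
    by (rule l2_eqI[of _ M]) (use assms in auto)
  then show ?thesis using assms by simp
qed

lemma l2_norm_diff_ge:
  assumes "\<xi> \<in> L2 M" "\<eta> \<in> L2 M"
  shows "\<bar>l2_norm M \<xi> - l2_norm M \<eta>\<bar> \<le> l2_norm M (l2_diff M \<xi> \<eta>)"
proof -
  have z: "l2_diff M \<zeta> (l2_zero M) = \<zeta>" if "\<zeta> \<in> L2 M" for \<zeta>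
    by (rule l2_eqI[of _ M]) (use that in auto)
  show ?thesis
    using l2_norm_triangle_diff[of \<xi> M \<eta> "l2_zero M"] l2_norm_triangle_diff[of \<eta> M \<xi> "l2_zero M"] assms
      l2_norm_diff_commute[of \<xi> M \<eta>]
    by (simp add: z)
qed

text \<open>Riesz-Fischer. A subsequence with fast decaying increments converges almost everywhere;
  Fatou's lemma along it, with one index held fixed, gives both the membership of the limit and the
  convergence of the whole sequence.\<close>

lemma L2_fun_complete:
  assumes f: "\<And>n. f n \<in> L2_fun M"
    and cauchy: "\<And>e. e > 0 \<Longrightarrow> \<exists>N. \<forall>m\<ge>N. \<forall>n\<ge>N. (\<integral>x. (cmod (f m x - f n x))\<^sup>2 \<partial>M) < e"
  obtains g where "g \<in> L2_fun M" "(\<lambda>n. \<integral>x. (cmod (f n x - g x))\<^sup>2 \<partial>M) \<longlonglongrightarrow> 0"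
proof -
  have [measurable]: "f n \<in> borel_measurable M" for n using f by (rule L2_fun_measurable)
  have int: "integrable M (\<lambda>x. (cmod (f m x - f n x))\<^sup>2)" for m n
    using L2_fun_integrable[OF L2_fun_diff[OF f f]] .
  have nn: "(\<integral>\<^sup>+x. ennreal ((cmod (f m x - f n x))\<^sup>2) \<partial>M) = ennreal (\<integral>x. (cmod (f m x - f n x))\<^sup>2 \<partial>M)" for m n
    by (rule nn_integral_eq_integral[OF int]) simp
  have "\<exists>N. \<forall>m\<ge>N. \<forall>n\<ge>N. (\<integral>x. (cmod (f m x - f n x))\<^sup>2 \<partial>M) < (1/4) ^ k" for k :: nat
    by (rule cauchy) simp
  then obtain N where N: "\<And>k m n. m \<ge> N k \<Longrightarrow> n \<ge> N k \<Longrightarrow> (\<integral>x. (cmod (f m x - f n x))\<^sup>2 \<partial>M) < (1/4) ^ k"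
    by metis
  \<comment> \<open>Adding up the thresholds makes the subsequence monotone and at the same time at
    least \<open>N k\<close> and \<open>k\<close>.\<close>
  define R where "R k = k + (\<Sum>i\<le>k. N i)" for k
  have RN: "R k \<ge> N k" "R k \<ge> k" "R (Suc k) \<ge> R k" for k
    unfolding R_def using member_le_sum[of k "{..k}" N] by auto
  define h where "h k x = (cmod (f (R (Suc k)) x - f (R k) x))\<^sup>2" for k x
  have [measurable]: "h k \<in> borel_measurable M" for k unfolding h_def by measurable
  \<comment> \<open>The weights \<open>2^k\<close> leave a summable bound. Finiteness of the
    weighted sum then keeps \<open>h k x\<close> below a constant times \<open>(1/2)^k\<close> for
    almost every \<open>x\<close>, so the increments themselves are geometrically summable.\<close>
  have hint: "(\<integral>\<^sup>+x. ennreal (2^k * h k x) \<partial>M) \<le> ennreal ((1/2)^k)" for k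
  proof -
    have "(\<integral>\<^sup>+x. ennreal (2^k * h k x) \<partial>M) = ennreal (2^k) * (\<integral>\<^sup>+x. ennreal (h k x) \<partial>M)"
      by (subst nn_integral_cmult[symmetric]) (auto simp: ennreal_mult' )
    also have "(\<integral>\<^sup>+x. ennreal (h k x) \<partial>M) \<le> ennreal ((1/4)^k)"
      unfolding h_def nn using N[of k "R (Suc k)" "R k"] RN[of k] by (intro ennreal_leI) simp
    finally have "(\<integral>\<^sup>+x. ennreal (2^k * h k x) \<partial>M) \<le> ennreal (2^k * (1/4)^k)"
      by (simp add: ennreal_mult mult_left_mono)
    also have "(2::real)^k * (1/4)^k = (1/2)^k" by (simp flip: power_mult_distrib)
    finally show ?thesis .
  qed
  have "(\<integral>\<^sup>+x. (\<Sum>k. ennreal (2^k * h k x)) \<partial>M) = (\<Sum>k. \<integral>\<^sup>+x. ennreal (2^k * h k x) \<partial>M)"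
    by (rule nn_integral_suminf) simp
  also have "\<dots> \<le> (\<Sum>k. ennreal ((1/2)^k))" by (intro suminf_le hint) auto
  also have "\<dots> < \<infinity>" by (subst suminf_ennreal2) (auto simp: summable_geometric)
  finally have "(\<integral>\<^sup>+x. (\<Sum>k. ennreal (2^k * h k x)) \<partial>M) \<noteq> \<infinity>" by simp
  then have AE_fin: "AE x in M. (\<Sum>k. ennreal (2^k * h k x)) \<noteq> \<infinity>"
    by (intro nn_integral_noteq_infinite) auto
  have conv: "convergent (\<lambda>k. f (R k) x)" if fin: "(\<Sum>k. ennreal (2^k * h k x)) \<noteq> \<infinity>" for x
  proof -
    obtain S where S: "(\<Sum>k. ennreal (2^k * h k x)) = ennreal S" "S \<ge> 0"
      using fin by (cases "\<Sum>k. ennreal (2^k * h k x)") auto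
    have le: "2^k * h k x \<le> S" for k
    proof -
      have "ennreal (2^k * h k x) \<le> (\<Sum>k. ennreal (2^k * h k x))"
        using sum_le_suminf[of "\<lambda>k. ennreal (2^k * h k x)" "{k}"] by simp
      then show ?thesis using S by simp
    qed
    have bd: "cmod (f (R (Suc k)) x - f (R k) x) \<le> sqrt S * (sqrt (1/2)) ^ k" for k
    proof (rule power2_le_imp_le)
      have "h k x \<le> S * (1/2)^k" using le[of k] by (simp add: field_simps)
      also have "S * (1/2)^k = (sqrt S * (sqrt (1/2)) ^ k)\<^sup>2"
        unfolding power_mult_distrib power_mult[symmetric] mult.commute[of k 2]
        unfolding power_mult
        using S by simp
      finally show "(cmod (f (R (Suc k)) x - f (R k) x))\<^sup>2 \<le> (sqrt S * (sqrt (1/2)) ^ k)\<^sup>2" by (simp add: h_def)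
    qed (use S in simp)
    have sm: "summable (\<lambda>k. sqrt S * (sqrt (1/2)) ^ k)"
      by (intro summable_mult summable_geometric) simp
    have "summable (\<lambda>k. f (R (Suc k)) x - f (R k) x)"
      by (rule summable_comparison_test'[OF sm bd])
    then have "convergent (\<lambda>n. \<Sum>k<n. f (R (Suc k)) x - f (R k) x)"
      by (simp add: summable_iff_convergent)
    then have "convergent (\<lambda>n. f (R n) x - f (R 0) x)"
      by (simp only: sum_lessThan_telescope[of "\<lambda>n. f (R n) x"])
    then have "convergent (\<lambda>n. (f (R n) x - f (R 0) x) + f (R 0) x)" by (intro convergent_add convergent_const)
    then show ?thesis by simp
  qed
  define g where "g x = lim (\<lambda>k. f (R k) x)" for x
  have [measurable]: "g \<in> borel_measurable M" unfolding g_def by measurable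
  have lim: "AE x in M. (\<lambda>k. f (R k) x) \<longlonglongrightarrow> g x"
    using AE_fin by eventually_elim (use conv in \<open>auto simp: g_def convergent_LIMSEQ_iff\<close>)
  have fatou: "(\<integral>\<^sup>+x. ennreal ((cmod (f m x - g x))\<^sup>2) \<partial>M) \<le> ennreal e"
    if e: "e > 0" "\<And>m n. m \<ge> K \<Longrightarrow> n \<ge> K \<Longrightarrow> (\<integral>x. (cmod (f m x - f n x))\<^sup>2 \<partial>M) < e" and m: "m \<ge> K" for e K m
  proof -
    have "AE x in M. ennreal ((cmod (f m x - g x))\<^sup>2) = liminf (\<lambda>k. ennreal ((cmod (f m x - f (R k) x))\<^sup>2))"
      using lim
    proof eventually_elim
      case (elim x)
      then have "(\<lambda>k. ennreal ((cmod (f m x - f (R k) x))\<^sup>2)) \<longlonglongrightarrow> ennreal ((cmod (f m x - g x))\<^sup>2)"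
        by (intro tendsto_intros) auto
      from lim_imp_Liminf[OF _ this] show ?case by (simp del: tendsto_ennreal_iff)
    qed
    then have "(\<integral>\<^sup>+x. ennreal ((cmod (f m x - g x))\<^sup>2) \<partial>M)
        = (\<integral>\<^sup>+x. liminf (\<lambda>k. ennreal ((cmod (f m x - f (R k) x))\<^sup>2)) \<partial>M)"
      by (rule nn_integral_cong_AE)
    also have "\<dots> \<le> liminf (\<lambda>k. \<integral>\<^sup>+x. ennreal ((cmod (f m x - f (R k) x))\<^sup>2) \<partial>M)"
      by (intro nn_integral_liminf) measurable
    also have "\<dots> \<le> ennreal e"
    proof (rule Liminf_le)
      have "(\<integral>\<^sup>+x. ennreal ((cmod (f m x - f (R k) x))\<^sup>2) \<partial>M) \<le> ennreal e" if "k \<ge> K" for k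
        unfolding nn using e(2)[of m "R k"] m RN(2)[of k] that by (intro ennreal_leI) auto
      then show "\<forall>\<^sub>F k in sequentially. (\<integral>\<^sup>+x. ennreal ((cmod (f m x - f (R k) x))\<^sup>2) \<partial>M) \<le> ennreal e"
        by (rule eventually_sequentiallyI)
    qed simp
    finally show ?thesis .
  qed
  have diffL2: "(\<lambda>x. f m x - g x) \<in> L2_fun M"
    and le: "(\<integral>x. (cmod (f m x - g x))\<^sup>2 \<partial>M) \<le> e"
    if e: "e > 0" "\<And>m n. m \<ge> K \<Longrightarrow> n \<ge> K \<Longrightarrow> (\<integral>x. (cmod (f m x - f n x))\<^sup>2 \<partial>M) < e" and m: "m \<ge> K" for e K m
  proof -
    note * = fatou[of e K m, OF that]
    show "(\<lambda>x. f m x - g x) \<in> L2_fun M"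
      unfolding L2_fun_def using * by (auto simp: integrable_iff_bounded less_top[symmetric] top_unique)
    then have "ennreal (\<integral>x. (cmod (f m x - g x))\<^sup>2 \<partial>M) \<le> ennreal e"
      using * nn_integral_eq_integral[of M "\<lambda>x. (cmod (f m x - g x))\<^sup>2"] by (simp add: L2_fun_def)
    then show "(\<integral>x. (cmod (f m x - g x))\<^sup>2 \<partial>M) \<le> e" using e by simp
  qed
  have "g \<in> L2_fun M"
  proof -
    obtain K where "\<And>m n. m \<ge> K \<Longrightarrow> n \<ge> K \<Longrightarrow> (\<integral>x. (cmod (f m x - f n x))\<^sup>2 \<partial>M) < 1"
      using cauchy[of 1] by auto
    then have "(\<lambda>x. f K x - g x) \<in> L2_fun M" using diffL2[of 1 K K] by simp
    then show ?thesis using L2_fun_diff[OF f[of K]] by fastforce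
  qed
  moreover have "(\<lambda>n. \<integral>x. (cmod (f n x - g x))\<^sup>2 \<partial>M) \<longlonglongrightarrow> 0"
  proof (rule LIMSEQ_I)
    fix r :: real assume "r > 0"
    then obtain K where "\<And>m n. m \<ge> K \<Longrightarrow> n \<ge> K \<Longrightarrow> (\<integral>x. (cmod (f m x - f n x))\<^sup>2 \<partial>M) < r/2"
      using cauchy[of "r/2"] by auto
    then have "(\<integral>x. (cmod (f n x - g x))\<^sup>2 \<partial>M) \<le> r/2" if "n \<ge> K" for n using le[of "r/2" K n] that \<open>r > 0\<close> by simp
    then show "\<exists>no. \<forall>n\<ge>no. norm ((\<integral>x. (cmod (f n x - g x))\<^sup>2 \<partial>M) - 0) < r"
      using \<open>r > 0\<close> by (intro exI[of _ K]) fastforce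
  qed
  ultimately show ?thesis by (rule that)
qed

lemma l2_complete:
  assumes X: "\<And>n. X n \<in> L2 M"
    and cauchy: "\<And>e. e > 0 \<Longrightarrow> \<exists>N. \<forall>m\<ge>N. \<forall>n\<ge>N. l2_norm M (l2_diff M (X m) (X n)) < e"
  obtains \<xi> where "\<xi> \<in> L2 M" "(\<lambda>n. l2_norm M (l2_diff M (X n) \<xi>)) \<longlonglongrightarrow> 0"
proof -
  define f where "f n = l2_rep (X n)" for n
  have f: "f n \<in> L2_fun M" and Xf: "X n = l2_class M (f n)" for n
    using X by (simp_all add: f_def)
  have nrm: "(l2_norm M (l2_diff M (l2_class M g) (l2_class M h)))\<^sup>2 = (\<integral>x. (cmod (g x - h x))\<^sup>2 \<partial>M)"
    if "g \<in> L2_fun M" "h \<in> L2_fun M" for g h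
    using that by (simp add: l2_diff_class l2_norm_class_sq L2_fun_diff)
  obtain g where g: "g \<in> L2_fun M" "(\<lambda>n. \<integral>x. (cmod (f n x - g x))\<^sup>2 \<partial>M) \<longlonglongrightarrow> 0"
  proof (rule L2_fun_complete[OF f])
    fix e :: real assume "e > 0"
    then obtain N where N: "\<forall>m\<ge>N. \<forall>n\<ge>N. l2_norm M (l2_diff M (X m) (X n)) < sqrt e"
      using cauchy[of "sqrt e"] by auto
    have "(\<integral>x. (cmod (f m x - f n x))\<^sup>2 \<partial>M) < e" if "m \<ge> N" "n \<ge> N" for m n
    proof -
      have "(l2_norm M (l2_diff M (X m) (X n)))\<^sup>2 < (sqrt e)\<^sup>2"
        using N that by (intro power_strict_mono) auto
      then show ?thesis using \<open>e > 0\<close> f by (simp add: Xf nrm)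
    qed
    then show "\<exists>N. \<forall>m\<ge>N. \<forall>n\<ge>N. (\<integral>x. (cmod (f m x - f n x))\<^sup>2 \<partial>M) < e" by blast
  qed blast
  have "(\<lambda>n. sqrt (\<integral>x. (cmod (f n x - g x))\<^sup>2 \<partial>M)) \<longlonglongrightarrow> sqrt 0"
    using g(2) by (rule tendsto_real_sqrt)
  then have "(\<lambda>n. l2_norm M (l2_diff M (X n) (l2_class M g))) \<longlonglongrightarrow> 0"
    using f g(1) by (simp add: Xf l2_diff_class l2_norm_class L2_fun_diff)
  then show ?thesis using g(1) by (intro that[of "l2_class M g"]) auto
qed

section \<open>Bounded operators\<close>

text \<open>Two measures, since the embedding \<open>E\<close> leads from \<open>L2 \<mu>H\<close>
  to \<open>L2 \<mu>G\<close>. Extensionality is split off in \<open>bounded_ops_iff\<close>, so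
  that unrestricted functions such as right convolutions qualify.\<close>

definition bounded_map :: "'a measure \<Rightarrow> 'b measure \<Rightarrow> ('a l2 \<Rightarrow> 'b l2) \<Rightarrow> bool" where
  "bounded_map M N A \<longleftrightarrow> A \<in> L2 M \<rightarrow> L2 N \<and>
     (\<forall>\<xi>\<in>L2 M. \<forall>\<eta>\<in>L2 M. A (l2_add M \<xi> \<eta>) = l2_add N (A \<xi>) (A \<eta>)) \<and>
     (\<forall>c. \<forall>\<xi>\<in>L2 M. A (l2_scale M c \<xi>) = l2_scale N c (A \<xi>)) \<and>
     (\<exists>K. \<forall>\<xi>\<in>L2 M. l2_norm N (A \<xi>) \<le> K * l2_norm M \<xi>)"

lemma bounded_ops_iff: "A \<in> bounded_ops M \<longleftrightarrow> bounded_map M M A \<and> A \<in> extensional (L2 M)"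
  by (auto simp: bounded_ops_def bounded_map_def PiE_def)

lemma bounded_mapI:
  assumes "\<And>\<xi>. \<xi> \<in> L2 M \<Longrightarrow> A \<xi> \<in> L2 N"
    and "\<And>\<xi> \<eta>. \<xi> \<in> L2 M \<Longrightarrow> \<eta> \<in> L2 M \<Longrightarrow> A (l2_add M \<xi> \<eta>) = l2_add N (A \<xi>) (A \<eta>)"
    and "\<And>c \<xi>. \<xi> \<in> L2 M \<Longrightarrow> A (l2_scale M c \<xi>) = l2_scale N c (A \<xi>)"
    and "\<And>\<xi>. \<xi> \<in> L2 M \<Longrightarrow> l2_norm N (A \<xi>) \<le> K * l2_norm M \<xi>"
  shows "bounded_map M N A"
  unfolding bounded_map_def using assms(1-3) by (auto intro!: exI[of _ K] assms(4))

lemma bounded_map_restrict [simp]: "bounded_map M N (\<lambda>\<xi>\<in>L2 M. A \<xi>) \<longleftrightarrow> bounded_map M N A"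
  unfolding bounded_map_def by (simp add: Pi_iff)

lemma restrict_in_bounded_ops [simp]: "(\<lambda>\<xi>\<in>L2 M. A \<xi>) \<in> bounded_ops M \<longleftrightarrow> bounded_map M M A"
  by (simp add: bounded_ops_iff)

lemma bounded_map_in [simp]: "bounded_map M N A \<Longrightarrow> \<xi> \<in> L2 M \<Longrightarrow> A \<xi> \<in> L2 N"
  by (auto simp: bounded_map_def)

lemma bounded_map_add:
  "bounded_map M N A \<Longrightarrow> \<xi> \<in> L2 M \<Longrightarrow> \<eta> \<in> L2 M \<Longrightarrow> A (l2_add M \<xi> \<eta>) = l2_add N (A \<xi>) (A \<eta>)"
  by (auto simp: bounded_map_def)

lemma bounded_map_scale:
  "bounded_map M N A \<Longrightarrow> \<xi> \<in> L2 M \<Longrightarrow> A (l2_scale M c \<xi>) = l2_scale N c (A \<xi>)"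
  by (auto simp: bounded_map_def)

lemma bounded_map_diff:
  "bounded_map M N A \<Longrightarrow> \<xi> \<in> L2 M \<Longrightarrow> \<eta> \<in> L2 M \<Longrightarrow> A (l2_diff M \<xi> \<eta>) = l2_diff N (A \<xi>) (A \<eta>)"
  by (simp add: l2_diff_def bounded_map_add bounded_map_scale)

lemma l2_zero_simps [simp]:
  "l2_add M (l2_zero M) (l2_zero M) = l2_zero M" "l2_scale M c (l2_zero M) = l2_zero M"
  by (rule l2_eqI[of _ M]; simp)+

lemma l2_scale_add:
  "\<xi> \<in> L2 M \<Longrightarrow> \<eta> \<in> L2 M \<Longrightarrow> l2_scale M c (l2_add M \<xi> \<eta>) = l2_add M (l2_scale M c \<xi>) (l2_scale M c \<eta>)"
  by (rule l2_eqI[of _ M]) (auto simp: distrib_left)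

lemma l2_scale_scale: "\<xi> \<in> L2 M \<Longrightarrow> l2_scale M c (l2_scale M d \<xi>) = l2_scale M (c * d) \<xi>"
  by (rule l2_eqI[of _ M]) auto

lemma l2_add_swap:
  assumes "\<xi> \<in> L2 M" "\<eta> \<in> L2 M" "\<xi>' \<in> L2 M" "\<eta>' \<in> L2 M"
  shows "l2_add M (l2_add M \<xi> \<eta>) (l2_add M \<xi>' \<eta>') = l2_add M (l2_add M \<xi> \<xi>') (l2_add M \<eta> \<eta>')"
  by (rule l2_eqI[of _ M]) (use assms in auto)

lemma l2_scale_0: "\<xi> \<in> L2 M \<Longrightarrow> l2_scale M 0 \<xi> = l2_zero M"
  by (rule l2_eqI[of _ M]) auto

lemma bounded_map_zero:
  assumes "bounded_map M N A" shows "A (l2_zero M) = l2_zero N"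
  using bounded_map_scale[OF assms l2_zero_in, of 0] assms
  by (simp add: l2_scale_0)

text \<open>The bound is made strictly positive because later estimates divide by it.\<close>

lemma bounded_map_bound:
  assumes "bounded_map M N A"
  obtains K where "K > 0" "\<And>\<xi>. \<xi> \<in> L2 M \<Longrightarrow> l2_norm N (A \<xi>) \<le> K * l2_norm M \<xi>"
proof -
  obtain K where K: "\<forall>\<xi>\<in>L2 M. l2_norm N (A \<xi>) \<le> K * l2_norm M \<xi>"
    using assms by (auto simp: bounded_map_def)
  have "l2_norm N (A \<xi>) \<le> (\<bar>K\<bar> + 1) * l2_norm M \<xi>" if "\<xi> \<in> L2 M" for \<xi>
  proof -
    have "K * l2_norm M \<xi> \<le> (\<bar>K\<bar> + 1) * l2_norm M \<xi>" by (intro mult_right_mono) auto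
    then show ?thesis using K that by fastforce
  qed
  then show ?thesis by (intro that[of "\<bar>K\<bar> + 1"]) auto
qed

lemma bounded_map_compose:
  assumes A: "bounded_map M N A" and B: "bounded_map N P B"
  shows "bounded_map M P (\<lambda>\<xi>. B (A \<xi>))"
proof -
  obtain K where K: "K > 0" "\<And>\<xi>. \<xi> \<in> L2 M \<Longrightarrow> l2_norm N (A \<xi>) \<le> K * l2_norm M \<xi>"
    by (rule bounded_map_bound[OF A]) blast
  obtain K' where K': "K' > 0" "\<And>\<xi>. \<xi> \<in> L2 N \<Longrightarrow> l2_norm P (B \<xi>) \<le> K' * l2_norm N \<xi>"
    by (rule bounded_map_bound[OF B]) blast
  show ?thesis
  proof (rule bounded_mapI)
    fix \<xi> assume "\<xi> \<in> L2 M"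
    then have "l2_norm P (B (A \<xi>)) \<le> K' * l2_norm N (A \<xi>)" using A by (intro K') simp
    also have "\<dots> \<le> K' * (K * l2_norm M \<xi>)" using K' K \<open>\<xi> \<in> L2 M\<close> by (intro mult_left_mono) auto
    finally show "l2_norm P (B (A \<xi>)) \<le> (K' * K) * l2_norm M \<xi>" by simp
  qed (use A B in \<open>auto simp: bounded_map_add bounded_map_scale\<close>)
qed

lemma bounded_ops_map: "A \<in> bounded_ops M \<Longrightarrow> bounded_map M M A"
  by (simp add: bounded_ops_iff)

lemma bounded_ops_in [simp]: "A \<in> bounded_ops M \<Longrightarrow> \<xi> \<in> L2 M \<Longrightarrow> A \<xi> \<in> L2 M"
  using bounded_ops_map bounded_map_in by blast

lemma bounded_ops_eqI:
  assumes "A \<in> bounded_ops M" "B \<in> bounded_ops M" "\<And>\<xi>. \<xi> \<in> L2 M \<Longrightarrow> A \<xi> = B \<xi>"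
  shows "A = B"
  using assms by (intro extensionalityI[of A "L2 M"]) (auto simp: bounded_ops_iff)

section \<open>The algebra of bounded operators\<close>

definition op_id :: "'a measure \<Rightarrow> 'a l2 \<Rightarrow> 'a l2" where "op_id M = (\<lambda>\<xi>\<in>L2 M. \<xi>)"
definition op_zero :: "'a measure \<Rightarrow> 'a l2 \<Rightarrow> 'a l2" where "op_zero M = (\<lambda>\<xi>\<in>L2 M. l2_zero M)"
definition op_diff ::
    "'a measure \<Rightarrow> ('a l2 \<Rightarrow> 'a l2) \<Rightarrow> ('a l2 \<Rightarrow> 'a l2) \<Rightarrow> 'a l2 \<Rightarrow> 'a l2" where
  "op_diff M A B = op_add M A (op_scale M (-1) B)"

lemma op_apply [simp]:
  assumes "\<xi> \<in> L2 M"
  shows "op_id M \<xi> = \<xi>" "op_zero M \<xi> = l2_zero M" "op_add M A B \<xi> = l2_add M (A \<xi>) (B \<xi>)"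
    "op_scale M c A \<xi> = l2_scale M c (A \<xi>)" "op_mult M A B \<xi> = A (B \<xi>)"
    "op_diff M A B \<xi> = l2_diff M (A \<xi>) (B \<xi>)"
  using assms by (simp_all add: op_id_def op_zero_def op_add_def op_scale_def op_mult_def op_diff_def
      compose_def l2_diff_def)

lemma op_id_in [simp]: "op_id M \<in> bounded_ops M"
  unfolding op_id_def restrict_in_bounded_ops by (rule bounded_mapI[where K=1]) auto

lemma op_zero_in [simp]: "op_zero M \<in> bounded_ops M"
  unfolding op_zero_def restrict_in_bounded_ops
  by (rule bounded_mapI[where K=0]) auto

lemma op_mult_in [simp]: "A \<in> bounded_ops M \<Longrightarrow> B \<in> bounded_ops M \<Longrightarrow> op_mult M A B \<in> bounded_ops M"
  unfolding op_mult_def compose_def restrict_in_bounded_ops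
  by (rule bounded_map_compose) (auto intro: bounded_ops_map)

lemma op_scale_in [simp]:
  assumes "A \<in> bounded_ops M" shows "op_scale M c A \<in> bounded_ops M"
proof -
  have A: "bounded_map M M A" using assms by (rule bounded_ops_map)
  have "bounded_map M M (l2_scale M c)"
    by (rule bounded_mapI[where K="cmod c"]) (auto simp: l2_scale_add l2_scale_scale mult.commute)
  from bounded_map_compose[OF A this] show ?thesis
    unfolding op_scale_def by simp
qed

lemma op_add_in [simp]:
  assumes "A \<in> bounded_ops M" "B \<in> bounded_ops M" shows "op_add M A B \<in> bounded_ops M"
proof -
  note AB = assms[THEN bounded_ops_map]
  obtain K where K: "K > 0" "\<And>\<xi>. \<xi> \<in> L2 M \<Longrightarrow> l2_norm M (A \<xi>) \<le> K * l2_norm M \<xi>"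
    by (rule bounded_map_bound[OF AB(1)]) blast
  obtain K' where K': "K' > 0" "\<And>\<xi>. \<xi> \<in> L2 M \<Longrightarrow> l2_norm M (B \<xi>) \<le> K' * l2_norm M \<xi>"
    by (rule bounded_map_bound[OF AB(2)]) blast
  show ?thesis unfolding op_add_def restrict_in_bounded_ops
  proof (rule bounded_mapI)
    fix \<xi> assume \<xi>: "\<xi> \<in> L2 M"
    have "l2_norm M (l2_add M (A \<xi>) (B \<xi>)) \<le> l2_norm M (A \<xi>) + l2_norm M (B \<xi>)"
      using \<xi> assms by (intro l2_norm_triangle) auto
    also have "\<dots> \<le> (K + K') * l2_norm M \<xi>" using K(2)[OF \<xi>] K'(2)[OF \<xi>] by (simp add: distrib_right)
    finally show "l2_norm M (l2_add M (A \<xi>) (B \<xi>)) \<le> (K + K') * l2_norm M \<xi>" .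
  qed (use assms AB in \<open>auto simp: bounded_map_add bounded_map_scale l2_scale_add l2_add_swap\<close>)
qed

lemma op_diff_in [simp]: "A \<in> bounded_ops M \<Longrightarrow> B \<in> bounded_ops M \<Longrightarrow> op_diff M A B \<in> bounded_ops M"
  by (simp add: op_diff_def)

section \<open>Limits of vectors and the Riesz representation theorem\<close>

lemma l2_parallelogram:
  assumes "\<xi> \<in> L2 M" "\<eta> \<in> L2 M"
  shows "(l2_norm M (l2_add M \<xi> \<eta>))\<^sup>2 + (l2_norm M (l2_diff M \<xi> \<eta>))\<^sup>2 = 2 * (l2_norm M \<xi>)\<^sup>2 + 2 * (l2_norm M \<eta>)\<^sup>2"
  using assms by (simp add: l2_norm_sq)

lemma l2_tendsto_inner:
  assumes X: "\<And>n. X n \<in> L2 M" "\<xi> \<in> L2 M" "((\<lambda>n. l2_norm M (l2_diff M (X n) \<xi>)) \<longlongrightarrow> 0) F"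
    and Z: "\<zeta> \<in> L2 M"
  shows "((\<lambda>n. l2_inner M (X n) \<zeta>) \<longlongrightarrow> l2_inner M \<xi> \<zeta>) F"
proof (rule LIM_zero_cancel, rule tendsto_norm_zero_cancel, rule tendsto_sandwich[where f="\<lambda>_. 0"])
  show "\<forall>\<^sub>F n in F. norm (l2_inner M (X n) \<zeta> - l2_inner M \<xi> \<zeta>) \<le> l2_norm M (l2_diff M (X n) \<xi>) * l2_norm M \<zeta>"
    using X Z by (intro always_eventually allI) (metis l2_Cauchy_Schwarz l2_diff_in l2_inner_diff_left)
  show "((\<lambda>n. l2_norm M (l2_diff M (X n) \<xi>) * l2_norm M \<zeta>) \<longlongrightarrow> 0) F"
    using tendsto_mult_right[OF X(3), of "l2_norm M \<zeta>"] by simp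
qed auto

lemma l2_tendsto_norm:
  assumes X: "\<And>n. X n \<in> L2 M" "\<xi> \<in> L2 M" "((\<lambda>n. l2_norm M (l2_diff M (X n) \<xi>)) \<longlongrightarrow> 0) F"
  shows "((\<lambda>n. l2_norm M (X n)) \<longlongrightarrow> l2_norm M \<xi>) F"
proof (rule LIM_zero_cancel, rule tendsto_rabs_zero_cancel, rule tendsto_sandwich[where f="\<lambda>_. 0"])
  show "\<forall>\<^sub>F n in F. \<bar>l2_norm M (X n) - l2_norm M \<xi>\<bar> \<le> l2_norm M (l2_diff M (X n) \<xi>)"
    using X by (intro always_eventually allI l2_norm_diff_ge)
qed (use X(3) in auto)

text \<open>Minimise \<open>\<parallel>d\<parallel>\<^sup>2 - 2 Re (F d)\<close> over \<open>D\<close>. The third conclusion says that \<open>u\<close> lies in the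
  closure of \<open>D\<close>.\<close>
lemma Riesz_subspace:
  assumes D: "D \<subseteq> L2 M" "l2_zero M \<in> D" "\<And>\<xi> \<eta>. \<xi> \<in> D \<Longrightarrow> \<eta> \<in> D \<Longrightarrow> l2_add M \<xi> \<eta> \<in> D"
      "\<And>c \<xi>. \<xi> \<in> D \<Longrightarrow> l2_scale M c \<xi> \<in> D"
    and F: "\<And>\<xi> \<eta>. \<xi> \<in> D \<Longrightarrow> \<eta> \<in> D \<Longrightarrow> F (l2_add M \<xi> \<eta>) = F \<xi> + F \<eta>"
      "\<And>c \<xi>. \<xi> \<in> D \<Longrightarrow> F (l2_scale M c \<xi>) = c * F \<xi>"
      "\<And>\<xi>. \<xi> \<in> D \<Longrightarrow> cmod (F \<xi>) \<le> K * l2_norm M \<xi>" "0 \<le> K"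
  obtains u where "u \<in> L2 M" "\<And>\<xi>. \<xi> \<in> D \<Longrightarrow> l2_inner M \<xi> u = F \<xi>"
    "\<And>\<zeta>. \<zeta> \<in> L2 M \<Longrightarrow> (\<And>\<xi>. \<xi> \<in> D \<Longrightarrow> l2_inner M \<xi> \<zeta> = 0) \<Longrightarrow> l2_inner M u \<zeta> = 0"
    "l2_norm M u \<le> K"
proof -
  have DL: "\<xi> \<in> D \<Longrightarrow> \<xi> \<in> L2 M" for \<xi> using D(1) by auto
  define J where "J \<xi> = (l2_norm M \<xi>)\<^sup>2 - 2 * Re (F \<xi>)" for \<xi>
  define m where "m = Inf (J ` D)"
  have ReF: "\<bar>Re (F \<xi>)\<bar> \<le> K * l2_norm M \<xi>" if "\<xi> \<in> D" for \<xi>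
    using F(3)[OF that] abs_Re_le_cmod order_trans by blast
  \<comment> \<open>With \<open>n\<close> the norm of \<open>\<xi>\<close>, \<open>J \<xi> \<ge>
    n\<^sup>2 - 2 K n = (n - K)\<^sup>2 - K\<^sup>2\<close>.\<close>
  have "- K\<^sup>2 \<le> J \<xi>" if "\<xi> \<in> D" for \<xi>
    using ReF[OF that] zero_le_power2[of "l2_norm M \<xi> - K"] by (simp add: J_def power2_diff algebra_simps)
  then have bdd: "bdd_below (J ` D)" by (auto intro!: bdd_belowI[of _ "- K\<^sup>2"])
  have mle: "m \<le> J \<xi>" if "\<xi> \<in> D" for \<xi> unfolding m_def using bdd that by (intro cInf_lower) auto
  have "\<exists>\<xi>\<in>D. J \<xi> < m + 1 / real (Suc n)" for n
    using cInf_lessD[of "J ` D" "m + 1 / real (Suc n)"] D(2) by (auto simp: m_def)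
  then obtain d where d: "\<And>n. d n \<in> D" "\<And>n. J (d n) < m + 1 / real (Suc n)" by metis
  have dL: "d n \<in> L2 M" for n using d DL by auto
  \<comment> \<open>The midpoint of two near-minimisers cannot fall below \<open>m\<close>, so the
    parallelogram law keeps them close together.\<close>
  have par: "(l2_norm M (l2_diff M (d i) (d j)))\<^sup>2 \<le> 2 / real (Suc i) + 2 / real (Suc j)" for i j
  proof -
    let ?e = "l2_scale M (1/2) (l2_add M (d i) (d j))"
    have "?e \<in> D" using d D by auto
    then have "m \<le> J ?e" by (rule mle)
    moreover have "J ?e = (l2_norm M (l2_add M (d i) (d j)))\<^sup>2 / 4 - Re (F (d i)) - Re (F (d j))"
      using dL d(1) D(3) by (simp add: J_def F power_mult_distrib power_divide add_divide_distrib)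
    then have "(l2_norm M (l2_diff M (d i) (d j)))\<^sup>2 = 2 * J (d i) + 2 * J (d j) - 4 * J ?e"
      using l2_parallelogram[OF dL dL, of i j] unfolding J_def by argo
    ultimately show ?thesis using d(2)[of i] d(2)[of j] by argo
  qed
  obtain u where u: "u \<in> L2 M" "(\<lambda>n. l2_norm M (l2_diff M (d n) u)) \<longlonglongrightarrow> 0"
  proof (rule l2_complete[of d M])
    fix e :: real assume "e > 0"
    obtain N where N: "4 / e\<^sup>2 < real N" using reals_Archimedean2 by blast
    have Np: "0 < real N" using N \<open>e > 0\<close> by (meson divide_pos_pos less_trans zero_less_numeral zero_less_power)
    have "l2_norm M (l2_diff M (d i) (d j)) < e" if "i \<ge> N" "j \<ge> N" for i j
    proof (rule power2_less_imp_less)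
      have "2 / real (Suc i) \<le> 2 / real N" "2 / real (Suc j) \<le> 2 / real N"
        using that Np by (auto intro!: divide_left_mono)
      moreover have "4 / real N < e\<^sup>2" using N Np \<open>e > 0\<close> by (simp add: field_simps)
      ultimately show "(l2_norm M (l2_diff M (d i) (d j)))\<^sup>2 < e\<^sup>2" using par[of i j] by simp
    qed (use \<open>e > 0\<close> in simp)
    then show "\<exists>N. \<forall>m\<ge>N. \<forall>n\<ge>N. l2_norm M (l2_diff M (d m) (d n)) < e" by blast
  qed (use dL in auto)
  have lim: "(\<lambda>n. l2_inner M (d n) \<zeta>) \<longlonglongrightarrow> l2_inner M u \<zeta>" if "\<zeta> \<in> L2 M" for \<zeta>
    by (rule l2_tendsto_inner[OF dL u that])
  \<comment> \<open>The first variation at \<open>u\<close>. As \<open>u\<close> is only a limit of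
    members of \<open>D\<close>, it is derived at \<open>d n\<close> with an error of
    \<open>1 / (n + 1)\<close>.\<close>
  have var: "0 \<le> 2 * Re (l2_inner M \<xi> u - F \<xi>) + (l2_norm M \<xi>)\<^sup>2" if "\<xi> \<in> D" for \<xi>
  proof (rule tendsto_le)
    show "\<forall>\<^sub>F n in sequentially. - 1 / real (Suc n) \<le> 2 * Re (cnj (l2_inner M (d n) \<xi>) - F \<xi>) + (l2_norm M \<xi>)\<^sup>2"
    proof (intro always_eventually allI)
      fix n
      have "m \<le> J (l2_add M (d n) \<xi>)" using d that D by (intro mle) auto
      also have "\<dots> = J (d n) + 2 * Re (cnj (l2_inner M (d n) \<xi>) - F \<xi>) + (l2_norm M \<xi>)\<^sup>2"
        using dL d(1) that DL[OF that]
        by (simp add: J_def l2_norm_sq F(1) l2_inner_commute[of M \<xi> "d n"])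
      finally show "- 1 / real (Suc n) \<le> 2 * Re (cnj (l2_inner M (d n) \<xi>) - F \<xi>) + (l2_norm M \<xi>)\<^sup>2"
        using d(2)[of n] by simp
    qed
    show "(\<lambda>n. - 1 / real (Suc n)) \<longlonglongrightarrow> 0"
      using tendsto_minus[OF LIMSEQ_inverse_real_of_nat] by (simp add: field_simps)
    show "(\<lambda>n. 2 * Re (cnj (l2_inner M (d n) \<xi>) - F \<xi>) + (l2_norm M \<xi>)\<^sup>2) \<longlonglongrightarrow>
       2 * Re (l2_inner M \<xi> u - F \<xi>) + (l2_norm M \<xi>)\<^sup>2"
      unfolding l2_inner_commute[of M \<xi> u] by (intro tendsto_intros lim DL that)
  qed simp
  have rep: "l2_inner M \<xi> u = F \<xi>" if "\<xi> \<in> D" for \<xi>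
  proof -
    define w where "w = l2_inner M \<xi> u - F \<xi>"
    have "0 \<le> 0 - 2 * t * (cmod w)\<^sup>2 + t\<^sup>2 * (cmod w)\<^sup>2 * (l2_norm M \<xi>)\<^sup>2" for t :: real
    proof -
      \<comment> \<open>The phase of \<open>w\<close> turns the linear term into
        \<open>- t |w|\<^sup>2\<close>, so that the discriminant lemma applies with constant term
        0.\<close>
      let ?e = "l2_scale M (- (of_real t * cnj w)) \<xi>"
      have "l2_inner M ?e u - F ?e = - (of_real t) * (w * cnj w)"
        using DL[OF that] u(1) by (simp add: F(2)[OF that] w_def algebra_simps)
      also have "\<dots> = - of_real (t * (cmod w)\<^sup>2)" unfolding complex_norm_square[symmetric] by simp
      finally have *: "l2_inner M ?e u - F ?e = - of_real (t * (cmod w)\<^sup>2)" .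
      have "?e \<in> D" using that D by auto
      from var[OF this, unfolded *] show ?thesis using DL[OF that]
        by (simp add: norm_mult power_mult_distrib algebra_simps)
    qed
    from sesquilinear_discriminant[OF this] have "w = 0" by simp
    then show ?thesis by (simp add: w_def)
  qed
  have orth: "l2_inner M u \<zeta> = 0" if "\<zeta> \<in> L2 M" "\<And>\<xi>. \<xi> \<in> D \<Longrightarrow> l2_inner M \<xi> \<zeta> = 0" for \<zeta>
    using lim[OF that(1)] that(2) d(1) by (simp add: LIMSEQ_const_iff)
  \<comment> \<open>Again along the minimising sequence:
    \<open>\<parallel>u\<parallel>\<^sup>2\<close> is the limit of \<open>Re (F (d n))\<close>,
    which is at most \<open>K \<parallel>d n\<parallel>\<close>.\<close>
  have "(l2_norm M u)\<^sup>2 \<le> K * l2_norm M u"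
  proof (rule tendsto_le)
    show "(\<lambda>n. K * l2_norm M (d n)) \<longlonglongrightarrow> K * l2_norm M u"
      by (intro tendsto_intros l2_tendsto_norm[OF dL u])
    show "(\<lambda>n. Re (l2_inner M (d n) u)) \<longlonglongrightarrow> (l2_norm M u)\<^sup>2"
      unfolding l2_norm_sq by (intro tendsto_intros lim u)
    show "\<forall>\<^sub>F n in sequentially. Re (l2_inner M (d n) u) \<le> K * l2_norm M (d n)"
      using ReF[OF d(1)] by (intro always_eventually) (simp add: rep d abs_le_iff)
  qed simp
  then have "l2_norm M u \<le> K"
    using F(4) mult_right_le_imp_le[of "l2_norm M u" "l2_norm M u" K]
    by (cases "l2_norm M u = 0") (simp_all add: power2_eq_square less_le)
  with that[OF u(1) rep] orth show ?thesis by blast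
qed



section \<open>Adjoints, positivity and commutants\<close>

text \<open>The Riesz theorem gives one vector for each \<open>\<eta>\<close>; linearity of
  \<open>B\<close> comes from the uniqueness of these vectors.\<close>

lemma op_adjoint_exists:
  assumes A: "bounded_map M N A"
  obtains B where "bounded_map N M B" "B \<in> extensional (L2 N)"
    "\<And>\<xi> \<eta>. \<xi> \<in> L2 M \<Longrightarrow> \<eta> \<in> L2 N \<Longrightarrow> l2_inner N (A \<xi>) \<eta> = l2_inner M \<xi> (B \<eta>)"
proof -
  obtain K where K: "K > 0" "\<And>\<xi>. \<xi> \<in> L2 M \<Longrightarrow> l2_norm N (A \<xi>) \<le> K * l2_norm M \<xi>"
    by (rule bounded_map_bound[OF A]) blast
  have "\<exists>u\<in>L2 M. (\<forall>\<xi>\<in>L2 M. l2_inner N (A \<xi>) \<eta> = l2_inner M \<xi> u) \<and> l2_norm M u \<le> K * l2_norm N \<eta>"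
    if \<eta>: "\<eta> \<in> L2 N" for \<eta>
  proof (rule Riesz_subspace[of "L2 M" M "\<lambda>\<xi>. l2_inner N (A \<xi>) \<eta>" "K * l2_norm N \<eta>"])
    fix \<xi> assume \<xi>: "\<xi> \<in> L2 M"
    have "cmod (l2_inner N (A \<xi>) \<eta>) \<le> l2_norm N (A \<xi>) * l2_norm N \<eta>"
      using A \<xi> \<eta> by (intro l2_Cauchy_Schwarz) auto
    also have "\<dots> \<le> K * l2_norm M \<xi> * l2_norm N \<eta>" using K(2)[OF \<xi>] by (intro mult_right_mono) auto
    finally show "cmod (l2_inner N (A \<xi>) \<eta>) \<le> K * l2_norm N \<eta> * l2_norm M \<xi>" by (simp add: mult_ac)
  next
    fix u assume "u \<in> L2 M" "\<And>\<xi>. \<xi> \<in> L2 M \<Longrightarrow> l2_inner M \<xi> u = l2_inner N (A \<xi>) \<eta>" "l2_norm M u \<le> K * l2_norm N \<eta>"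
    then show ?thesis by (intro bexI[of _ u]) auto
  qed (use A \<eta> K in \<open>auto simp: bounded_map_add bounded_map_scale\<close>)
  then obtain B where B: "\<And>\<eta>. \<eta> \<in> L2 N \<Longrightarrow> B \<eta> \<in> L2 M"
    "\<And>\<xi> \<eta>. \<xi> \<in> L2 M \<Longrightarrow> \<eta> \<in> L2 N \<Longrightarrow> l2_inner N (A \<xi>) \<eta> = l2_inner M \<xi> (B \<eta>)"
    "\<And>\<eta>. \<eta> \<in> L2 N \<Longrightarrow> l2_norm M (B \<eta>) \<le> K * l2_norm N \<eta>"
    by metis
  have "bounded_map N M B"
  proof (rule bounded_mapI[where K=K])
    show "B (l2_add N \<xi> \<eta>) = l2_add M (B \<xi>) (B \<eta>)" if "\<xi> \<in> L2 N" "\<eta> \<in> L2 N" for \<xi> \<eta>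
      by (rule l2_eqI'[of _ M]) (use A that B(1) in \<open>auto simp: B(2)[symmetric]\<close>)
    show "B (l2_scale N c \<xi>) = l2_scale M c (B \<xi>)" if "\<xi> \<in> L2 N" for c \<xi>
      by (rule l2_eqI'[of _ M]) (use A that B(1) in \<open>auto simp: B(2)[symmetric]\<close>)
  qed (use B in auto)
  then show ?thesis
    by (intro that[of "\<lambda>\<xi>\<in>L2 N. B \<xi>"]) (auto simp: B(2))
qed

lemma op_adj:
  assumes A: "A \<in> bounded_ops M"
  shows op_adj_in [simp]: "op_adj M A \<in> bounded_ops M"
    and op_adj_inner: "\<And>\<xi> \<eta>. \<xi> \<in> L2 M \<Longrightarrow> \<eta> \<in> L2 M \<Longrightarrow> l2_inner M \<xi> (op_adj M A \<eta>) = l2_inner M (A \<xi>) \<eta>"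
proof -
  let ?P = "\<lambda>B. B \<in> bounded_ops M \<and>
     (\<forall>\<xi>\<in>L2 M. \<forall>\<eta>\<in>L2 M. l2_inner M (A \<xi>) \<eta> = l2_inner M \<xi> (B \<eta>))"
  obtain B where "?P B"
    using op_adjoint_exists[OF bounded_ops_map[OF A]] unfolding bounded_ops_iff by metis
  moreover have "C = B" if "?P C" for C
    using that \<open>?P B\<close> by (intro bounded_ops_eqI[of C M B] l2_eqI'[of _ M]) auto
  ultimately have "?P (op_adj M A)" unfolding op_adj_def by (rule theI)
  then show "op_adj M A \<in> bounded_ops M"
    "\<And>\<xi> \<eta>. \<xi> \<in> L2 M \<Longrightarrow> \<eta> \<in> L2 M \<Longrightarrow> l2_inner M \<xi> (op_adj M A \<eta>) = l2_inner M (A \<xi>) \<eta>"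
    by auto
qed

lemma op_adj_inner':
  "A \<in> bounded_ops M \<Longrightarrow> \<xi> \<in> L2 M \<Longrightarrow> \<eta> \<in> L2 M \<Longrightarrow> l2_inner M (op_adj M A \<xi>) \<eta> = l2_inner M \<xi> (A \<eta>)"
  by (metis op_adj_inner l2_inner_commute)

lemma op_adj_unique:
  assumes "A \<in> bounded_ops M" "B \<in> bounded_ops M"
    "\<And>\<xi> \<eta>. \<xi> \<in> L2 M \<Longrightarrow> \<eta> \<in> L2 M \<Longrightarrow> l2_inner M (A \<xi>) \<eta> = l2_inner M \<xi> (B \<eta>)"
  shows "op_adj M A = B"
  using assms by (intro bounded_ops_eqI[of _ M] l2_eqI'[of _ M]) (auto simp: op_adj_inner)

lemma op_adj_adj [simp]: "A \<in> bounded_ops M \<Longrightarrow> op_adj M (op_adj M A) = A"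
  by (rule op_adj_unique) (auto simp: op_adj_inner')

section \<open>Positive operators and effects\<close>

definition pos_op :: "'a measure \<Rightarrow> ('a l2 \<Rightarrow> 'a l2) \<Rightarrow> bool" where
  "pos_op M A \<longleftrightarrow> A \<in> bounded_ops M \<and>
     (\<forall>\<xi>\<in>L2 M. Im (l2_inner M (A \<xi>) \<xi>) = 0 \<and> 0 \<le> Re (l2_inner M (A \<xi>) \<xi>))"

text \<open>Only the real parts of the quadratic forms are compared. On positive operators this is
  the usual order, and \<open>op_le_antisym\<close> is stated for those.\<close>

definition op_le :: "'a measure \<Rightarrow> ('a l2 \<Rightarrow> 'a l2) \<Rightarrow> ('a l2 \<Rightarrow> 'a l2) \<Rightarrow> bool" where
  "op_le M A B \<longleftrightarrow> (\<forall>\<xi>\<in>L2 M. Re (l2_inner M (A \<xi>) \<xi>) \<le> Re (l2_inner M (B \<xi>) \<xi>))"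

text \<open>The operator interval between 0 and 1. Increasing chains in it are bounded and thus have
  suprema, as Zorn's lemma requires.\<close>

definition effect :: "'a measure \<Rightarrow> ('a l2 \<Rightarrow> 'a l2) \<Rightarrow> bool" where
  "effect M A \<longleftrightarrow> pos_op M A \<and> op_le M A (op_id M)"

lemma positive_part_iff: "\<A> \<subseteq> bounded_ops M \<Longrightarrow> A \<in> positive_part M \<A> \<longleftrightarrow> A \<in> \<A> \<and> pos_op M A"
  by (auto simp: positive_part_def pos_op_def)

lemma pos_op_in [simp]: "pos_op M A \<Longrightarrow> A \<in> bounded_ops M"
  by (simp add: pos_op_def)

lemma effect_pos [simp]: "effect M A \<Longrightarrow> pos_op M A"
  by (simp add: effect_def)

lemma effect_le_norm: "effect M A \<Longrightarrow> \<xi> \<in> L2 M \<Longrightarrow> Re (l2_inner M (A \<xi>) \<xi>) \<le> (l2_norm M \<xi>)\<^sup>2"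
  by (simp add: effect_def op_le_def l2_norm_sq)

lemma op_le_trans: "op_le M A B \<Longrightarrow> op_le M B C \<Longrightarrow> op_le M A C"
  unfolding op_le_def by force

text \<open>The imaginary part at \<open>\<xi> + \<eta>\<close> relates the imaginary parts of the
  two mixed terms, the one at \<open>\<xi> + \<i> \<eta>\<close> their real parts.\<close>

lemma hermitian_form_symmetric:
  assumes A: "A \<in> bounded_ops M" and im: "\<And>\<xi>. \<xi> \<in> L2 M \<Longrightarrow> Im (l2_inner M (A \<xi>) \<xi>) = 0"
    and \<xi>: "\<xi> \<in> L2 M" and \<eta>: "\<eta> \<in> L2 M"
  shows "l2_inner M (A \<xi>) \<eta> = l2_inner M \<xi> (A \<eta>)"
proof -
  note simps = bounded_map_add[OF bounded_ops_map[OF A]] bounded_map_scale[OF bounded_ops_map[OF A]]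
  have 1: "Im (l2_inner M (A \<xi>) \<eta>) + Im (l2_inner M (A \<eta>) \<xi>) = 0"
    using im[of "l2_add M \<xi> \<eta>"] im[OF \<xi>] im[OF \<eta>] \<xi> \<eta> A by (simp add: simps)
  have 2: "Re (l2_inner M (A \<eta>) \<xi>) - Re (l2_inner M (A \<xi>) \<eta>) = 0"
    using im[of "l2_add M \<xi> (l2_scale M \<i> \<eta>)"] im[OF \<xi>] im[OF \<eta>] \<xi> \<eta> A by (simp add: simps)
  show ?thesis unfolding l2_inner_commute[of M \<xi> "A \<eta>"] using 1 2 by (simp add: complex_eq_iff)
qed

lemma pos_op_symmetric:
  "pos_op M A \<Longrightarrow> \<xi> \<in> L2 M \<Longrightarrow> \<eta> \<in> L2 M \<Longrightarrow> l2_inner M (A \<xi>) \<eta> = l2_inner M \<xi> (A \<eta>)"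
  unfolding pos_op_def by (blast intro: hermitian_form_symmetric)

lemma pos_op_adj: "pos_op M A \<Longrightarrow> op_adj M A = A"
  by (rule op_adj_unique) (auto simp: pos_op_symmetric)

lemma pos_op_nonneg: "pos_op M A \<Longrightarrow> \<xi> \<in> L2 M \<Longrightarrow> 0 \<le> Re (l2_inner M (A \<xi>) \<xi>)"
  and pos_op_Im: "pos_op M A \<Longrightarrow> \<xi> \<in> L2 M \<Longrightarrow> Im (l2_inner M (A \<xi>) \<xi>) = 0"
  by (auto simp: pos_op_def)

lemma pos_op_inner: "pos_op M A \<Longrightarrow> \<xi> \<in> L2 M \<Longrightarrow> l2_inner M (A \<xi>) \<xi> = of_real (Re (l2_inner M (A \<xi>) \<xi>))"
  by (simp add: pos_op_Im complex_eq_iff)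

lemma pos_opI:
  assumes "A \<in> bounded_ops M" "\<And>\<xi>. \<xi> \<in> L2 M \<Longrightarrow> l2_inner M (A \<xi>) \<xi> = of_real (r \<xi>)" "\<And>\<xi>. \<xi> \<in> L2 M \<Longrightarrow> 0 \<le> r \<xi>"
  shows "pos_op M A"
  using assms by (simp add: pos_op_def)

lemma pos_op_adj_mult: "A \<in> bounded_ops M \<Longrightarrow> pos_op M (op_mult M (op_adj M A) A)"
  by (rule pos_opI[where r="\<lambda>\<xi>. (l2_norm M (A \<xi>))\<^sup>2"]) (auto simp: op_adj_inner' l2_inner_self)

text \<open>Over the complex numbers an operator whose quadratic form vanishes is zero: the test
  vectors \<open>\<xi> + \<eta>\<close> and \<open>\<xi> + \<i> \<eta>\<close> give two independent
  equations for the mixed terms.\<close>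

lemma op_le_antisym:
  assumes "pos_op M A" "pos_op M B" "op_le M A B" "op_le M B A"
  shows "A = B"
proof (rule bounded_ops_eqI[of _ M])
  let ?D = "op_diff M A B"
  have D: "?D \<in> bounded_ops M" using assms by simp
  have 0: "l2_inner M (?D \<xi>) \<xi> = 0" if "\<xi> \<in> L2 M" for \<xi>
    using assms that pos_op_Im[of M A \<xi>] pos_op_Im[of M B \<xi>] unfolding op_le_def
    by (auto simp: complex_eq_iff intro: antisym)
  note simps = bounded_map_add[OF bounded_ops_map[OF D]] bounded_map_scale[OF bounded_ops_map[OF D]]
  fix \<xi> assume \<xi>: "\<xi> \<in> L2 M"
  have "l2_inner M (?D \<xi>) \<eta> = 0" if \<eta>: "\<eta> \<in> L2 M" for \<eta>
  proof -
    have 1: "l2_inner M (?D \<xi>) \<eta> = l2_inner M \<xi> (?D \<eta>)"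
      by (rule hermitian_form_symmetric[OF D _ \<xi> \<eta>]) (use 0 in simp)
    have "l2_inner M (?D \<xi>) \<eta> + l2_inner M (?D \<eta>) \<xi> = 0"
      using 0[of "l2_add M \<xi> \<eta>"] 0[OF \<xi>] 0[OF \<eta>] \<xi> \<eta> D by (simp add: simps add.commute del: op_apply)
    moreover have "\<i> * l2_inner M (?D \<eta>) \<xi> - \<i> * l2_inner M (?D \<xi>) \<eta> = 0"
      using 0[of "l2_add M \<xi> (l2_scale M \<i> \<eta>)"] 0[OF \<xi>] 0[OF \<eta>] \<xi> \<eta> D by (simp add: simps del: op_apply)
    ultimately show ?thesis by simp
  qed
  then show "A \<xi> = B \<xi>" using \<xi> assms by (intro l2_eqI[of _ M]) auto
qed (use assms in auto)

lemma pos_op_Cauchy_Schwarz: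
  assumes A: "pos_op M A" and \<xi>: "\<xi> \<in> L2 M" and \<eta>: "\<eta> \<in> L2 M"
  shows "(cmod (l2_inner M (A \<xi>) \<eta>))\<^sup>2 \<le> Re (l2_inner M (A \<xi>) \<xi>) * Re (l2_inner M (A \<eta>) \<eta>)"
proof (rule sesquilinear_discriminant)
  fix t :: real
  let ?b = "l2_inner M (A \<xi>) \<eta>"
  note simps = bounded_map_diff[OF bounded_ops_map[OF pos_op_in[OF A]]] bounded_map_scale[OF bounded_ops_map[OF pos_op_in[OF A]]]
  let ?d = "l2_diff M \<xi> (l2_scale M (of_real t * ?b) \<eta>)"
  obtain p q where p: "l2_inner M (A \<xi>) \<xi> = of_real p" and q: "l2_inner M (A \<eta>) \<eta> = of_real q"
    using pos_op_inner[OF A] \<xi> \<eta> by blast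
  have sw: "l2_inner M (A \<eta>) \<xi> = cnj ?b"
    using pos_op_symmetric[OF A \<xi> \<eta>] by (simp add: l2_inner_commute[of M "A \<eta>" \<xi>])
  have "l2_inner M (A ?d) ?d = l2_inner M (A \<xi>) \<xi> - 2 * of_real t * (?b * cnj ?b)
      + (of_real t)\<^sup>2 * (?b * cnj ?b) * l2_inner M (A \<eta>) \<eta>"
    using \<xi> \<eta> A by (simp add: simps sw algebra_simps power2_eq_square)
  also have "\<dots> = of_real (Re (l2_inner M (A \<xi>) \<xi>) - 2 * t * (cmod ?b)\<^sup>2 + t\<^sup>2 * (cmod ?b)\<^sup>2 * Re (l2_inner M (A \<eta>) \<eta>))"
    unfolding complex_norm_square[symmetric] p q by simp
  finally have "Re (l2_inner M (A ?d) ?d) = Re (l2_inner M (A \<xi>) \<xi>) - 2 * t * (cmod ?b)\<^sup>2 + t\<^sup>2 * (cmod ?b)\<^sup>2 * Re (l2_inner M (A \<eta>) \<eta>)"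
    by (metis Re_complex_of_real)
  then show "0 \<le> Re (l2_inner M (A \<xi>) \<xi>) - 2 * t * (cmod ?b)\<^sup>2 + t\<^sup>2 * (cmod ?b)\<^sup>2 * Re (l2_inner M (A \<eta>) \<eta>)"
    using pos_op_nonneg[OF A, of ?d] \<xi> \<eta> A by simp
qed (use assms in \<open>auto intro: pos_op_nonneg\<close>)

text \<open>Cauchy-Schwarz for the form of \<open>A\<close> at \<open>\<xi>\<close> and
  \<open>A \<xi>\<close>, in which the factor \<open>\<langle>A (A \<xi>), A \<xi>\<rangle>\<close>
  is at most \<open>\<parallel>A \<xi>\<parallel>\<^sup>2\<close>. This is
  \<open>A\<^sup>2 \<le> A\<close>, and it makes effects contractions.\<close>

lemma effect_norm_le:
  assumes A: "effect M A" and \<xi>: "\<xi> \<in> L2 M"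
  shows "(l2_norm M (A \<xi>))\<^sup>2 \<le> Re (l2_inner M (A \<xi>) \<xi>)" "l2_norm M (A \<xi>) \<le> l2_norm M \<xi>"
proof -
  let ?n = "(l2_norm M (A \<xi>))\<^sup>2"
  have A\<xi>: "A \<xi> \<in> L2 M" using A \<xi> by simp
  have "?n\<^sup>2 = (cmod (l2_inner M (A \<xi>) (A \<xi>)))\<^sup>2" by (simp add: l2_inner_self norm_power)
  also have "\<dots> \<le> Re (l2_inner M (A \<xi>) \<xi>) * Re (l2_inner M (A (A \<xi>)) (A \<xi>))"
    by (rule pos_op_Cauchy_Schwarz) (use A \<xi> in auto)
  also have "\<dots> \<le> Re (l2_inner M (A \<xi>) \<xi>) * ?n"
    using A \<xi> A\<xi> by (intro mult_left_mono effect_le_norm pos_op_nonneg) auto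
  finally have "?n * ?n \<le> Re (l2_inner M (A \<xi>) \<xi>) * ?n" by (simp add: power2_eq_square)
  then show 1: "?n \<le> Re (l2_inner M (A \<xi>) \<xi>)"
    using mult_right_le_imp_le[of ?n ?n] pos_op_nonneg[of M A \<xi>] A \<xi>
    by (cases "?n = 0") (auto simp: less_le)
  show "l2_norm M (A \<xi>) \<le> l2_norm M \<xi>"
    using order_trans[OF 1 effect_le_norm[OF A \<xi>]] by (rule power2_le_imp_le) simp
qed

section \<open>Commutants\<close>

lemma commutant_iff:
  assumes "S \<subseteq> bounded_ops M"
  shows "A \<in> commutant M S \<longleftrightarrow> A \<in> bounded_ops M \<and> (\<forall>B\<in>S. \<forall>\<xi>\<in>L2 M. A (B \<xi>) = B (A \<xi>))"
proof -
  have "op_mult M A B = op_mult M B A \<longleftrightarrow> (\<forall>\<xi>\<in>L2 M. A (B \<xi>) = B (A \<xi>))"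
    if "A \<in> bounded_ops M" "B \<in> S" for B
  proof
    assume "op_mult M A B = op_mult M B A"
    then have "op_mult M A B \<xi> = op_mult M B A \<xi>" for \<xi> by simp
    then show "\<forall>\<xi>\<in>L2 M. A (B \<xi>) = B (A \<xi>)" by (metis op_apply(5))
  next
    assume "\<forall>\<xi>\<in>L2 M. A (B \<xi>) = B (A \<xi>)"
    then show "op_mult M A B = op_mult M B A"
      using that assms by (intro bounded_ops_eqI[of _ M]) auto
  qed
  then show ?thesis by (auto simp: commutant_def)
qed

lemma commutant_subset: "commutant M S \<subseteq> bounded_ops M"
  by (auto simp: commutant_def)

lemma commutant_adj_closed:
  assumes S: "S \<subseteq> bounded_ops M" "\<And>s. s \<in> S \<Longrightarrow> op_adj M s \<in> S" and A: "A \<in> commutant M S"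
  shows "op_adj M A \<in> commutant M S"
  unfolding commutant_iff[OF S(1)]
proof (intro conjI ballI)
  have AB: "A \<in> bounded_ops M" using A commutant_subset by auto
  then show "op_adj M A \<in> bounded_ops M" by simp
  fix s \<xi> assume s: "s \<in> S" and \<xi>: "\<xi> \<in> L2 M"
  have sB: "s \<in> bounded_ops M" using s S by auto
  show "op_adj M A (s \<xi>) = s (op_adj M A \<xi>)"
  proof (rule l2_eqI'[of _ M])
    fix \<zeta> assume \<zeta>: "\<zeta> \<in> L2 M"
    have "l2_inner M \<zeta> (op_adj M A (s \<xi>)) = l2_inner M (op_adj M s (A \<zeta>)) \<xi>"
      using AB sB \<xi> \<zeta> by (simp add: op_adj_inner op_adj_inner')
    also have "op_adj M s (A \<zeta>) = A (op_adj M s \<zeta>)"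
      using A S(2)[OF s] \<zeta> unfolding commutant_iff[OF S(1)] by simp
    also have "l2_inner M \<dots> \<xi> = l2_inner M \<zeta> (s (op_adj M A \<xi>))"
      using AB sB \<xi> \<zeta> by (simp add: op_adj_inner[symmetric] op_adj_inner')
    finally show "l2_inner M \<zeta> (op_adj M A (s \<xi>)) = l2_inner M \<zeta> (s (op_adj M A \<xi>))" .
  qed (use AB sB \<xi> in auto)
qed

section \<open>Weak limits and square roots\<close>

text \<open>The limits of the matrix coefficients form a sesquilinear form of norm at most 1, which
  the Riesz theorem turns into an operator. The filter is arbitrary because the lemma serves
  sequences as well as uncountable chains.\<close>

lemma weak_limit_op:
  assumes F: "F \<noteq> bot" and Y: "\<forall>\<^sub>F i in F. Y i \<in> bounded_ops M \<and> (\<forall>\<xi>\<in>L2 M. l2_norm M (Y i \<xi>) \<le> l2_norm M \<xi>)"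
    and lim: "\<And>\<xi> \<eta>. \<xi> \<in> L2 M \<Longrightarrow> \<eta> \<in> L2 M \<Longrightarrow> \<exists>l. ((\<lambda>i. l2_inner M (Y i \<xi>) \<eta>) \<longlongrightarrow> l) F"
  obtains T where "T \<in> bounded_ops M"
    "\<And>\<xi> \<eta>. \<xi> \<in> L2 M \<Longrightarrow> \<eta> \<in> L2 M \<Longrightarrow> ((\<lambda>i. l2_inner M (Y i \<xi>) \<eta>) \<longlongrightarrow> l2_inner M (T \<xi>) \<eta>) F"
    "\<And>\<xi>. \<xi> \<in> L2 M \<Longrightarrow> l2_norm M (T \<xi>) \<le> l2_norm M \<xi>"
proof -
  obtain G where "\<And>\<xi> \<eta>. \<xi> \<in> L2 M \<Longrightarrow> \<eta> \<in> L2 M \<Longrightarrow> ((\<lambda>i. l2_inner M (Y i \<xi>) \<eta>) \<longlongrightarrow> G \<xi> \<eta>) F"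
    using lim by metis
  \<comment> \<open>Conjugated, because \<open>Riesz_subspace\<close> represents functionals that
    are linear in the first slot of the inner product.\<close>
  note G = tendsto_cnj[OF this, folded l2_inner_commute]
  have Yadd: "\<forall>\<^sub>F i in F. Y i (l2_add M \<xi> \<eta>) = l2_add M (Y i \<xi>) (Y i \<eta>) \<and> Y i \<xi> \<in> L2 M \<and> Y i \<eta> \<in> L2 M"
    if "\<xi> \<in> L2 M" "\<eta> \<in> L2 M" for \<xi> \<eta>
    using Y by eventually_elim (use that in \<open>simp add: bounded_map_add[OF bounded_ops_map]\<close>)
  have Yscale: "\<forall>\<^sub>F i in F. Y i (l2_scale M c \<xi>) = l2_scale M c (Y i \<xi>) \<and> Y i \<xi> \<in> L2 M"
    if "\<xi> \<in> L2 M" for c \<xi>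
    using Y by eventually_elim (use that in \<open>simp add: bounded_map_scale[OF bounded_ops_map]\<close>)
  have "\<exists>u\<in>L2 M. (\<forall>\<eta>\<in>L2 M. l2_inner M \<eta> u = cnj (G \<xi> \<eta>)) \<and> l2_norm M u \<le> l2_norm M \<xi>" if \<xi>: "\<xi> \<in> L2 M" for \<xi>
  proof (rule Riesz_subspace[of "L2 M" M "\<lambda>\<eta>. cnj (G \<xi> \<eta>)" "l2_norm M \<xi>"])
    fix \<eta> \<eta>' assume e: "\<eta> \<in> L2 M" "\<eta>' \<in> L2 M"
    have "((\<lambda>i. l2_inner M (l2_add M \<eta> \<eta>') (Y i \<xi>)) \<longlongrightarrow> cnj (G \<xi> \<eta>) + cnj (G \<xi> \<eta>')) F"
      by (rule Lim_transform_eventually[OF tendsto_add[OF G[OF \<xi> e(1)] G[OF \<xi> e(2)]]])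
        (use Yadd[OF \<xi> \<xi>] in eventually_elim, use e in simp)
    then show "cnj (G \<xi> (l2_add M \<eta> \<eta>')) = cnj (G \<xi> \<eta>) + cnj (G \<xi> \<eta>')"
      using tendsto_unique[OF F G] \<xi> e by simp
  next
    fix c \<eta> assume e: "\<eta> \<in> L2 M"
    have "((\<lambda>i. l2_inner M (l2_scale M c \<eta>) (Y i \<xi>)) \<longlongrightarrow> c * cnj (G \<xi> \<eta>)) F"
      by (rule Lim_transform_eventually[OF tendsto_mult_left[OF G[OF \<xi> e]]])
        (use Yadd[OF \<xi> \<xi>] in eventually_elim, use e in simp)
    then show "cnj (G \<xi> (l2_scale M c \<eta>)) = c * cnj (G \<xi> \<eta>)"
      using tendsto_unique[OF F G] \<xi> e by simp
  next
    fix \<eta> assume e: "\<eta> \<in> L2 M"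
    show "cmod (cnj (G \<xi> \<eta>)) \<le> l2_norm M \<xi> * l2_norm M \<eta>"
    proof (rule tendsto_upperbound[OF tendsto_norm[OF G[OF \<xi> e]] _ F])
      show "\<forall>\<^sub>F i in F. cmod (l2_inner M \<eta> (Y i \<xi>)) \<le> l2_norm M \<xi> * l2_norm M \<eta>"
        using Y
      proof eventually_elim
        case (elim i)
        then have "cmod (l2_inner M \<eta> (Y i \<xi>)) \<le> l2_norm M \<eta> * l2_norm M (Y i \<xi>)"
          using e \<xi> by (intro l2_Cauchy_Schwarz) auto
        also have "\<dots> \<le> l2_norm M \<eta> * l2_norm M \<xi>" using elim \<xi> by (intro mult_left_mono) auto
        finally show ?case by (simp add: mult.commute)
      qed
    qed
  next
    fix u assume "u \<in> L2 M" "\<And>\<eta>. \<eta> \<in> L2 M \<Longrightarrow> l2_inner M \<eta> u = cnj (G \<xi> \<eta>)" "l2_norm M u \<le> l2_norm M \<xi>"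
    then show ?thesis by (intro bexI[of _ u]) auto
  qed auto
  then obtain T where T: "\<And>\<xi>. \<xi> \<in> L2 M \<Longrightarrow> T \<xi> \<in> L2 M"
    "\<And>\<xi> \<eta>. \<xi> \<in> L2 M \<Longrightarrow> \<eta> \<in> L2 M \<Longrightarrow> l2_inner M \<eta> (T \<xi>) = cnj (G \<xi> \<eta>)"
    "\<And>\<xi>. \<xi> \<in> L2 M \<Longrightarrow> l2_norm M (T \<xi>) \<le> l2_norm M \<xi>"
    by metis
  have G': "((\<lambda>i. l2_inner M \<eta> (Y i \<xi>)) \<longlongrightarrow> l2_inner M \<eta> (T \<xi>)) F" if "\<xi> \<in> L2 M" "\<eta> \<in> L2 M" for \<xi> \<eta>
    using G[OF that] T(2)[OF that] by simp
  have "bounded_map M M T"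
  proof (rule bounded_mapI[where K=1])
    fix \<xi> \<eta> assume e: "\<xi> \<in> L2 M" "\<eta> \<in> L2 M"
    show "T (l2_add M \<xi> \<eta>) = l2_add M (T \<xi>) (T \<eta>)"
    proof (rule l2_eqI'[of _ M])
      fix \<zeta> assume z: "\<zeta> \<in> L2 M"
      have "((\<lambda>i. l2_inner M \<zeta> (Y i (l2_add M \<xi> \<eta>))) \<longlongrightarrow> l2_inner M \<zeta> (T \<xi>) + l2_inner M \<zeta> (T \<eta>)) F"
        by (rule Lim_transform_eventually[OF tendsto_add[OF G'[OF e(1) z] G'[OF e(2) z]]])
          (use Yadd[OF e] in eventually_elim, use z in simp)
      then show "l2_inner M \<zeta> (T (l2_add M \<xi> \<eta>)) = l2_inner M \<zeta> (l2_add M (T \<xi>) (T \<eta>))"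
        using tendsto_unique[OF F G'] e z T(1) by simp
    qed (use e T in auto)
  next
    fix c \<xi> assume e: "\<xi> \<in> L2 M"
    show "T (l2_scale M c \<xi>) = l2_scale M c (T \<xi>)"
    proof (rule l2_eqI'[of _ M])
      fix \<zeta> assume z: "\<zeta> \<in> L2 M"
      have "((\<lambda>i. l2_inner M \<zeta> (Y i (l2_scale M c \<xi>))) \<longlongrightarrow> cnj c * l2_inner M \<zeta> (T \<xi>)) F"
        by (rule Lim_transform_eventually[OF tendsto_mult_left[OF G'[OF e z]]])
          (use Yscale[OF e, of c] in eventually_elim, use z in simp)
      then show "l2_inner M \<zeta> (T (l2_scale M c \<xi>)) = l2_inner M \<zeta> (l2_scale M c (T \<xi>))"
        using tendsto_unique[OF F G'] e z T(1) by simp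
    qed (use e T in auto)
  qed (use T in auto)
  show ?thesis
  proof (rule that[of "\<lambda>\<xi>\<in>L2 M. T \<xi>"])
    fix \<xi> \<eta> assume e: "\<xi> \<in> L2 M" "\<eta> \<in> L2 M"
    show "((\<lambda>i. l2_inner M (Y i \<xi>) \<eta>) \<longlongrightarrow> l2_inner M ((\<lambda>\<xi>\<in>L2 M. T \<xi>) \<xi>) \<eta>) F"
      using tendsto_cnj[OF G'[OF e], folded l2_inner_commute] e by simp
  qed (use \<open>bounded_map M M T\<close> T in auto)
qed

text \<open>With \<open>X\<close> moved to the other slot as its adjoint, both sides are limits of
  the same matrix coefficients.\<close>

lemma weak_limit_commute:
  assumes F: "F \<noteq> bot" and T: "T \<in> bounded_ops M" and X: "X \<in> bounded_ops M"
    and lim: "\<And>\<xi> \<eta>. \<xi> \<in> L2 M \<Longrightarrow> \<eta> \<in> L2 M \<Longrightarrow> ((\<lambda>i. l2_inner M (Y i \<xi>) \<eta>) \<longlongrightarrow> l2_inner M (T \<xi>) \<eta>) F"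
    and Y: "\<forall>\<^sub>F i in F. Y i \<in> bounded_ops M \<and> (\<forall>\<xi>\<in>L2 M. X (Y i \<xi>) = Y i (X \<xi>))"
    and \<xi>: "\<xi> \<in> L2 M"
  shows "X (T \<xi>) = T (X \<xi>)"
proof (rule l2_eqI[of _ M])
  fix \<zeta> assume z: "\<zeta> \<in> L2 M"
  have "((\<lambda>i. l2_inner M (Y i (X \<xi>)) \<zeta>) \<longlongrightarrow> l2_inner M (T \<xi>) (op_adj M X \<zeta>)) F"
    by (rule Lim_transform_eventually[OF lim[OF \<xi>, of "op_adj M X \<zeta>"]])
      (use X z in simp, use Y in eventually_elim, use X z \<xi> in \<open>auto simp: op_adj_inner\<close>)
  from tendsto_unique[OF F this lim] show "l2_inner M (X (T \<xi>)) \<zeta> = l2_inner M (T (X \<xi>)) \<zeta>"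
    using X T z \<xi> by (simp add: op_adj_inner)
qed (use T X \<xi> in auto)

section \<open>Square roots of positive operators\<close>

fun sqrt_iter :: "'a measure \<Rightarrow> ('a l2 \<Rightarrow> 'a l2) \<Rightarrow> nat \<Rightarrow> 'a l2 \<Rightarrow> 'a l2" where
  "sqrt_iter M A 0 = op_zero M"
| "sqrt_iter M A (Suc n) = op_scale M (1/2) (op_add M A (op_mult M (sqrt_iter M A n) (sqrt_iter M A n)))"

fun sqrt_iter_bound :: "nat \<Rightarrow> real" where
  "sqrt_iter_bound 0 = 0"
| "sqrt_iter_bound (Suc n) = (1 + (sqrt_iter_bound n)\<^sup>2) / 2"

lemma sqrt_iter_bound_range: "0 \<le> sqrt_iter_bound n \<and> sqrt_iter_bound n \<le> 1"
proof (induction n)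
  case (Suc n)
  then have "(sqrt_iter_bound n)\<^sup>2 \<le> 1" by (simp add: power_le_one)
  then show ?case by simp
qed simp

lemma sqrt_iter_bound_mono: "sqrt_iter_bound n \<le> sqrt_iter_bound (Suc n)"
proof -
  have "2 * sqrt_iter_bound n * 1 \<le> (sqrt_iter_bound n)\<^sup>2 + 1\<^sup>2" by (rule sum_squares_bound)
  then show ?thesis by simp
qed

text \<open>With \<open>T = 1 - A\<close>, the iteration \<open>Y \<mapsto> (A + Y\<^sup>2) / 2\<close> converges to \<open>1 - \<surd>T\<close> in norm: its increments
  are dominated by those of the scalar iteration for \<open>A = 1\<close>.\<close>
lemma effect_sqrt:
  assumes T: "effect M T"
  obtains R where "pos_op M R" "op_mult M R R = T"
    "\<And>X \<xi>. X \<in> bounded_ops M \<Longrightarrow> (\<And>\<xi>. \<xi> \<in> L2 M \<Longrightarrow> X (T \<xi>) = T (X \<xi>)) \<Longrightarrow> \<xi> \<in> L2 M \<Longrightarrow> X (R \<xi>) = R (X \<xi>)"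
proof -
  define A where "A = op_diff M (op_id M) T"
  let ?Y = "sqrt_iter M A" and ?y = sqrt_iter_bound
  have TB: "T \<in> bounded_ops M" using T by simp
  have AB [simp]: "A \<in> bounded_ops M" using T by (simp add: A_def)
  have A_eff: "effect M A"
    unfolding effect_def pos_op_def op_le_def
  proof (intro conjI ballI AB)
    fix \<xi> assume \<xi>: "\<xi> \<in> L2 M"
    show "Im (l2_inner M (A \<xi>) \<xi>) = 0" "0 \<le> Re (l2_inner M (A \<xi>) \<xi>)" "Re (l2_inner M (A \<xi>) \<xi>) \<le> Re (l2_inner M (op_id M \<xi>) \<xi>)"
      using pos_op_Im[of M T \<xi>] pos_op_nonneg[of M T \<xi>] effect_le_norm[OF T \<xi>] T \<xi>
      by (auto simp: A_def l2_inner_self)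
  qed
  have YB [simp]: "?Y n \<in> bounded_ops M" for n by (induction n) auto
  have Y_norm: "l2_norm M (?Y n \<xi>) \<le> ?y n * l2_norm M \<xi>" if "\<xi> \<in> L2 M" for n \<xi>
    using that
  proof (induction n arbitrary: \<xi>)
    case (Suc n)
    have "l2_norm M (?Y (Suc n) \<xi>) = l2_norm M (l2_add M (A \<xi>) (?Y n (?Y n \<xi>))) / 2"
      using Suc.prems by simp
    also have "\<dots> \<le> (l2_norm M (A \<xi>) + l2_norm M (?Y n (?Y n \<xi>))) / 2"
      using Suc.prems by (intro divide_right_mono l2_norm_triangle) auto
    also have "\<dots> \<le> (l2_norm M \<xi> + ?y n * (?y n * l2_norm M \<xi>)) / 2"
    proof -
      have "l2_norm M (?Y n (?Y n \<xi>)) \<le> ?y n * l2_norm M (?Y n \<xi>)" using Suc by simp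
      also have "\<dots> \<le> ?y n * (?y n * l2_norm M \<xi>)"
        using Suc sqrt_iter_bound_range[of n] by (intro mult_left_mono) auto
      finally show ?thesis using effect_norm_le(2)[OF A_eff Suc.prems] by simp
    qed
    also have "\<dots> = ?y (Suc n) * l2_norm M \<xi>" by (simp add: power2_eq_square algebra_simps add_divide_distrib)
    finally show ?case .
  qed simp
  have Y_step: "l2_norm M (l2_diff M (?Y (Suc n) \<xi>) (?Y n \<xi>)) \<le> (?y (Suc n) - ?y n) * l2_norm M \<xi>" if "\<xi> \<in> L2 M" for n \<xi>
    using that
  proof (induction n arbitrary: \<xi>)
    case 0
    have "l2_diff M (?Y (Suc 0) \<xi>) (?Y 0 \<xi>) = l2_scale M (1/2) (A \<xi>)"
      by (rule l2_eqI[of _ M]) (use 0 bounded_map_zero[OF bounded_ops_map[OF op_zero_in]] in auto)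
    then show ?case using effect_norm_le(2)[OF A_eff 0] 0 by simp
  next
    case (Suc n)
    let ?a = "?Y (Suc n)" and ?b = "?Y n" and ?p = "?y (Suc n)" and ?q = "?y n"
    have p: "0 \<le> ?p" "0 \<le> ?q" "?q \<le> ?p"
      using sqrt_iter_bound_range[of n] sqrt_iter_bound_range[of "Suc n"] sqrt_iter_bound_mono[of n] by auto
    have ab [simp]: "?a \<in> bounded_ops M" "?b \<in> bounded_ops M" by (rule YB)+
    have st: "?Y (Suc (Suc n)) \<xi> = l2_scale M (1/2) (l2_add M (A \<xi>) (?a (?a \<xi>)))"
      "?a \<xi> = l2_scale M (1/2) (l2_add M (A \<xi>) (?b (?b \<xi>)))"
      using Suc.prems by simp_all
    \<comment> \<open>\<open>a\<^sup>2 - b\<^sup>2 = a (a - b) + (a - b) b\<close>, so the induction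
      hypothesis is used once at \<open>\<xi>\<close> and once at \<open>b \<xi>\<close>; therefore
      \<open>\<xi>\<close> is arbitrary in the induction.\<close>
    have "l2_diff M (?Y (Suc (Suc n)) \<xi>) (?a \<xi>)
        = l2_scale M (1/2) (l2_add M (?a (l2_diff M (?a \<xi>) (?b \<xi>))) (l2_diff M (?a (?b \<xi>)) (?b (?b \<xi>))))"
      unfolding bounded_map_diff[OF bounded_ops_map[OF ab(1)] bounded_ops_in[OF ab(1) Suc.prems] bounded_ops_in[OF ab(2) Suc.prems]]
      unfolding st(1)
    proof (rule l2_eqI[of _ M], goal_cases)
      case (3 \<zeta>)
      then have "l2_inner M (?a \<xi>) \<zeta> = (l2_inner M (A \<xi>) \<zeta> + l2_inner M (?b (?b \<xi>)) \<zeta>) / 2"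
        using Suc.prems by (subst st(2)) simp
      then show ?case using 3 Suc.prems by (simp del: sqrt_iter.simps add: field_simps)
    qed (use Suc.prems in \<open>simp_all del: sqrt_iter.simps\<close>)
    then have "l2_norm M (l2_diff M (?Y (Suc (Suc n)) \<xi>) (?a \<xi>))
        \<le> (l2_norm M (?a (l2_diff M (?a \<xi>) (?b \<xi>))) + l2_norm M (l2_diff M (?a (?b \<xi>)) (?b (?b \<xi>)))) / 2"
      using Suc.prems l2_norm_triangle[of "?a (l2_diff M (?a \<xi>) (?b \<xi>))" M "l2_diff M (?a (?b \<xi>)) (?b (?b \<xi>))"]
      by (simp del: sqrt_iter.simps)
    also have "\<dots> \<le> (?p * ((?p - ?q) * l2_norm M \<xi>) + (?p - ?q) * (?q * l2_norm M \<xi>)) / 2"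
    proof (intro divide_right_mono add_mono)
      have "l2_norm M (?a (l2_diff M (?a \<xi>) (?b \<xi>))) \<le> ?p * l2_norm M (l2_diff M (?a \<xi>) (?b \<xi>))"
        using Suc.prems by (intro Y_norm) (auto simp del: sqrt_iter.simps)
      also have "\<dots> \<le> ?p * ((?p - ?q) * l2_norm M \<xi>)"
        using p by (intro mult_left_mono Suc.IH Suc.prems)
      finally show "l2_norm M (?a (l2_diff M (?a \<xi>) (?b \<xi>))) \<le> ?p * ((?p - ?q) * l2_norm M \<xi>)" .
      have "l2_norm M (l2_diff M (?a (?b \<xi>)) (?b (?b \<xi>))) \<le> (?p - ?q) * l2_norm M (?b \<xi>)"
        using Suc.prems by (intro Suc.IH) auto
      also have "\<dots> \<le> (?p - ?q) * (?q * l2_norm M \<xi>)"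
        using p Y_norm[OF Suc.prems] by (intro mult_left_mono) auto
      finally show "l2_norm M (l2_diff M (?a (?b \<xi>)) (?b (?b \<xi>))) \<le> (?p - ?q) * (?q * l2_norm M \<xi>)" .
    qed simp
    also have "\<dots> = ((1 + ?p\<^sup>2) / 2 - (1 + ?q\<^sup>2) / 2) * l2_norm M \<xi>"
      by (simp add: power2_eq_square algebra_simps add_divide_distrib diff_divide_distrib)
    finally show ?case by simp
  qed
  have Y_diff: "l2_norm M (l2_diff M (?Y (n + k) \<xi>) (?Y n \<xi>)) \<le> (?y (n + k) - ?y n) * l2_norm M \<xi>"
    if "\<xi> \<in> L2 M" for n k \<xi>
  proof (induction k)
    case 0
    have "l2_diff M (?Y n \<xi>) (?Y n \<xi>) = l2_zero M" by (rule l2_eqI[of _ M]) (use that in auto)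
    then show ?case by simp
  next
    case (Suc k)
    have "l2_norm M (l2_diff M (?Y (n + Suc k) \<xi>) (?Y n \<xi>)) \<le>
      l2_norm M (l2_diff M (?Y (Suc (n + k)) \<xi>) (?Y (n + k) \<xi>)) + l2_norm M (l2_diff M (?Y (n + k) \<xi>) (?Y n \<xi>))"
      using that l2_norm_triangle_diff[of "?Y (Suc (n + k)) \<xi>" M "?Y (n + k) \<xi>" "?Y n \<xi>"]
      by (simp del: sqrt_iter.simps)
    then show ?case using Suc Y_step[OF that, of "n + k"]
      by (simp del: sqrt_iter.simps sqrt_iter_bound.simps add: left_diff_distrib)
  qed
  have "Bseq ?y" using sqrt_iter_bound_range by (intro BseqI[where K=1]) auto
  then have "convergent ?y"
    by (rule Bseq_mono_convergent) (metis incseq_SucI sqrt_iter_bound_mono incseqD)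
  then have yC: "Cauchy ?y" by (rule convergent_Cauchy)
  have strong: "\<exists>u\<in>L2 M. (\<lambda>n. l2_norm M (l2_diff M (?Y n \<xi>) u)) \<longlonglongrightarrow> 0" if \<xi>: "\<xi> \<in> L2 M" for \<xi>
  proof (rule l2_complete[of "\<lambda>n. ?Y n \<xi>" M])
    fix e :: real assume "e > 0"
    then have "e / (l2_norm M \<xi> + 1) > 0" by (simp add: add_nonneg_pos)
    then obtain n0 where n0: "\<And>m n. m \<ge> n0 \<Longrightarrow> n \<ge> n0 \<Longrightarrow> \<bar>?y m - ?y n\<bar> < e / (l2_norm M \<xi> + 1)"
      using CauchyD[OF yC] by (metis real_norm_def)
    have *: "l2_norm M (l2_diff M (?Y m \<xi>) (?Y n \<xi>)) < e" if "m \<ge> n" "n \<ge> n0" for m n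
    proof -
      have "l2_norm M (l2_diff M (?Y m \<xi>) (?Y n \<xi>)) \<le> (?y m - ?y n) * l2_norm M \<xi>"
        using Y_diff[OF \<xi>, of n "m - n"] that by simp
      also have "\<dots> \<le> e / (l2_norm M \<xi> + 1) * l2_norm M \<xi>"
        using n0[of m n] that by (intro mult_right_mono) auto
      also have "\<dots> < e / (l2_norm M \<xi> + 1) * (l2_norm M \<xi> + 1)"
        using \<open>e / (l2_norm M \<xi> + 1) > 0\<close> by (intro mult_strict_left_mono) auto
      also have "\<dots> = e" using l2_norm_nonneg[of M \<xi>] by (simp add: add_nonneg_eq_0_iff)
      finally show ?thesis .
    qed
    show "\<exists>N. \<forall>m\<ge>N. \<forall>n\<ge>N. l2_norm M (l2_diff M (?Y m \<xi>) (?Y n \<xi>)) < e"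
    proof (intro exI[of _ n0] allI impI)
      fix m n assume "m \<ge> n0" "n \<ge> n0"
      then show "l2_norm M (l2_diff M (?Y m \<xi>) (?Y n \<xi>)) < e"
        using *[of n m] *[of m n] l2_norm_diff_commute[of "?Y m \<xi>" M "?Y n \<xi>"] \<xi> by (cases "m \<ge> n") auto
    qed
  qed (use \<xi> in auto)
  obtain Z where Z: "Z \<in> bounded_ops M"
    "\<And>\<xi> \<eta>. \<xi> \<in> L2 M \<Longrightarrow> \<eta> \<in> L2 M \<Longrightarrow> (\<lambda>n. l2_inner M (?Y n \<xi>) \<eta>) \<longlonglongrightarrow> l2_inner M (Z \<xi>) \<eta>"
    "\<And>\<xi>. \<xi> \<in> L2 M \<Longrightarrow> l2_norm M (Z \<xi>) \<le> l2_norm M \<xi>"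
  proof (rule weak_limit_op[of sequentially ?Y M])
    show "\<forall>\<^sub>F i in sequentially. ?Y i \<in> bounded_ops M \<and> (\<forall>\<xi>\<in>L2 M. l2_norm M (?Y i \<xi>) \<le> l2_norm M \<xi>)"
    proof (intro always_eventually allI conjI ballI YB)
      fix n \<xi> assume \<xi>: "\<xi> \<in> L2 M"
      have "?y n * l2_norm M \<xi> \<le> 1 * l2_norm M \<xi>" using sqrt_iter_bound_range[of n] by (intro mult_right_mono) auto
      then show "l2_norm M (?Y n \<xi>) \<le> l2_norm M \<xi>" using Y_norm[OF \<xi>, of n] by simp
    qed
    show "\<exists>l. (\<lambda>n. l2_inner M (?Y n \<xi>) \<eta>) \<longlonglongrightarrow> l" if "\<xi> \<in> L2 M" "\<eta> \<in> L2 M" for \<xi> \<eta>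
      using strong[OF that(1)] l2_tendsto_inner[of "\<lambda>n. ?Y n \<xi>" M _ sequentially \<eta>] that by auto
  qed auto
  have Z_strong: "(\<lambda>n. l2_norm M (l2_diff M (?Y n \<xi>) (Z \<xi>))) \<longlonglongrightarrow> 0" if \<xi>: "\<xi> \<in> L2 M" for \<xi>
  proof -
    obtain u where u: "u \<in> L2 M" "(\<lambda>n. l2_norm M (l2_diff M (?Y n \<xi>) u)) \<longlonglongrightarrow> 0" using strong[OF \<xi>] by auto
    have "u = Z \<xi>"
    proof (rule l2_eqI[of _ M])
      fix \<zeta> assume z: "\<zeta> \<in> L2 M"
      show "l2_inner M u \<zeta> = l2_inner M (Z \<xi>) \<zeta>"
        using l2_tendsto_inner[of "\<lambda>n. ?Y n \<xi>" M u sequentially \<zeta>] u z \<xi> Z(2)[OF \<xi> z] LIMSEQ_unique by auto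
    qed (use u Z \<xi> in auto)
    then show ?thesis using u by simp
  qed
  have Y_sym: "l2_inner M (?Y n \<xi>) \<eta> = l2_inner M \<xi> (?Y n \<eta>)" if "\<xi> \<in> L2 M" "\<eta> \<in> L2 M" for n \<xi> \<eta>
    using that
  proof (induction n arbitrary: \<xi> \<eta>)
    case (Suc n)
    then show ?case by (simp add: pos_op_symmetric[OF effect_pos[OF A_eff]])
  qed simp
  have Z_sym: "l2_inner M (Z \<xi>) \<eta> = l2_inner M \<xi> (Z \<eta>)" if "\<xi> \<in> L2 M" "\<eta> \<in> L2 M" for \<xi> \<eta>
  proof (rule LIMSEQ_unique[OF Z(2)[OF that]])
    show "(\<lambda>n. l2_inner M (?Y n \<xi>) \<eta>) \<longlonglongrightarrow> l2_inner M \<xi> (Z \<eta>)"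
      unfolding Y_sym[OF that] using tendsto_cnj[OF Z(2)[OF that(2,1)]] by (simp flip: l2_inner_commute)
  qed
  \<comment> \<open>Passage to the limit in the recursion. The product term is
    \<open>\<langle>Y n \<xi>, Y n \<eta>\<rangle>\<close>, where the left vector converges in norm
    while the right one converges weakly and stays bounded.\<close>
  have Z_fix: "2 * l2_inner M (Z \<xi>) \<eta> = l2_inner M (A \<xi>) \<eta> + l2_inner M (Z (Z \<xi>)) \<eta>"
    if e: "\<xi> \<in> L2 M" "\<eta> \<in> L2 M" for \<xi> \<eta>
  proof -
    have "(\<lambda>n. l2_inner M (?Y n \<xi>) (?Y n \<eta>) - l2_inner M (Z \<xi>) (?Y n \<eta>)) \<longlonglongrightarrow> 0"
    proof (rule Lim_null_comparison)
      show "\<forall>\<^sub>F n in sequentially. norm (l2_inner M (?Y n \<xi>) (?Y n \<eta>) - l2_inner M (Z \<xi>) (?Y n \<eta>))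
          \<le> l2_norm M (l2_diff M (?Y n \<xi>) (Z \<xi>)) * l2_norm M \<eta>"
      proof (intro always_eventually allI)
        fix n
        have "norm (l2_inner M (?Y n \<xi>) (?Y n \<eta>) - l2_inner M (Z \<xi>) (?Y n \<eta>))
           = cmod (l2_inner M (l2_diff M (?Y n \<xi>) (Z \<xi>)) (?Y n \<eta>))" using e Z by simp
        also have "\<dots> \<le> l2_norm M (l2_diff M (?Y n \<xi>) (Z \<xi>)) * l2_norm M (?Y n \<eta>)"
          using e Z by (intro l2_Cauchy_Schwarz) auto
        also have "\<dots> \<le> l2_norm M (l2_diff M (?Y n \<xi>) (Z \<xi>)) * (?y n * l2_norm M \<eta>)"
          using Y_norm[OF e(2), of n] by (intro mult_left_mono) auto
        also have "\<dots> \<le> l2_norm M (l2_diff M (?Y n \<xi>) (Z \<xi>)) * (1 * l2_norm M \<eta>)"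
          using sqrt_iter_bound_range[of n] by (intro mult_left_mono mult_right_mono) auto
        finally show "norm (l2_inner M (?Y n \<xi>) (?Y n \<eta>) - l2_inner M (Z \<xi>) (?Y n \<eta>))
          \<le> l2_norm M (l2_diff M (?Y n \<xi>) (Z \<xi>)) * l2_norm M \<eta>" by simp
      qed
      show "(\<lambda>n. l2_norm M (l2_diff M (?Y n \<xi>) (Z \<xi>)) * l2_norm M \<eta>) \<longlonglongrightarrow> 0"
        using tendsto_mult_right[OF Z_strong[OF e(1)], of "l2_norm M \<eta>"] by simp
    qed
    moreover have "(\<lambda>n. l2_inner M (Z \<xi>) (?Y n \<eta>)) \<longlonglongrightarrow> l2_inner M (Z \<xi>) (Z \<eta>)"
      using tendsto_cnj[OF Z(2)[OF e(2), of "Z \<xi>"]] Z e by (simp flip: l2_inner_commute)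
    ultimately have "(\<lambda>n. l2_inner M (?Y n \<xi>) (?Y n \<eta>)) \<longlonglongrightarrow> l2_inner M (Z \<xi>) (Z \<eta>)"
      using tendsto_add by fastforce
    then have lim1: "(\<lambda>n. (l2_inner M (A \<xi>) \<eta> + l2_inner M (?Y n \<xi>) (?Y n \<eta>))) \<longlonglongrightarrow> (l2_inner M (A \<xi>) \<eta> + l2_inner M (Z \<xi>) (Z \<eta>))"
      by (intro tendsto_intros)
    have lim2: "(\<lambda>n. 2 * l2_inner M (?Y (Suc n) \<xi>) \<eta>) \<longlonglongrightarrow> 2 * l2_inner M (Z \<xi>) \<eta>"
      using LIMSEQ_Suc[OF Z(2)[OF e]] by (intro tendsto_intros)
    have "2 * l2_inner M (?Y (Suc n) \<xi>) \<eta> = l2_inner M (A \<xi>) \<eta> + l2_inner M (?Y n \<xi>) (?Y n \<eta>)" for n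
      using e Y_sym[of "?Y n \<xi>" \<eta> n] by simp
    from LIMSEQ_unique[OF lim1 lim2[unfolded this]] show ?thesis using Z_sym[of "Z \<xi>" \<eta>] Z e by simp
  qed
  \<comment> \<open>The fixed point equation \<open>2 Z = A + Z\<^sup>2\<close> amounts to
    \<open>(1 - Z)\<^sup>2 = 1 - A = T\<close>.\<close>
  define R where "R = op_diff M (op_id M) Z"
  have RB [simp]: "R \<in> bounded_ops M" using Z by (simp add: R_def)
  show ?thesis
  proof (rule that[of R])
    show "pos_op M R"
    proof (rule pos_opI[where r="\<lambda>\<xi>. (l2_norm M \<xi>)\<^sup>2 - Re (l2_inner M (Z \<xi>) \<xi>)"])
      fix \<xi> assume \<xi>: "\<xi> \<in> L2 M"
      have "l2_inner M (Z \<xi>) \<xi> = cnj (l2_inner M (Z \<xi>) \<xi>)"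
        using Z_sym[OF \<xi> \<xi>] l2_inner_commute by metis
      then have "Im (l2_inner M (Z \<xi>) \<xi>) = 0" by (simp add: complex_eq_iff)
      then show "l2_inner M (R \<xi>) \<xi> = of_real ((l2_norm M \<xi>)\<^sup>2 - Re (l2_inner M (Z \<xi>) \<xi>))"
        using \<xi> Z by (simp add: R_def l2_inner_self complex_eq_iff)
      have "Re (l2_inner M (Z \<xi>) \<xi>) \<le> l2_norm M (Z \<xi>) * l2_norm M \<xi>"
        using l2_Cauchy_Schwarz[of "Z \<xi>" M \<xi>] Z \<xi> complex_Re_le_cmod order_trans by (metis bounded_ops_in)
      also have "\<dots> \<le> l2_norm M \<xi> * l2_norm M \<xi>" using Z(3)[OF \<xi>] by (intro mult_right_mono) auto
      finally show "0 \<le> (l2_norm M \<xi>)\<^sup>2 - Re (l2_inner M (Z \<xi>) \<xi>)" by (simp add: power2_eq_square)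
    qed simp
    show "op_mult M R R = T"
    proof (intro bounded_ops_eqI[of _ M] l2_eqI[of _ M])
      fix \<xi> \<zeta> assume e: "\<xi> \<in> L2 M" "\<zeta> \<in> L2 M"
      show "l2_inner M (op_mult M R R \<xi>) \<zeta> = l2_inner M (T \<xi>) \<zeta>"
        using Z_fix[OF e] e Z TB by (simp add: R_def A_def bounded_map_diff[OF bounded_ops_map[OF Z(1)]])
    qed (use TB in auto)
  next
    fix X \<xi> assume X: "X \<in> bounded_ops M" "\<And>\<xi>. \<xi> \<in> L2 M \<Longrightarrow> X (T \<xi>) = T (X \<xi>)" and \<xi>: "\<xi> \<in> L2 M"
    note Xs = bounded_map_diff[OF bounded_ops_map[OF X(1)]] bounded_map_add[OF bounded_ops_map[OF X(1)]]
      bounded_map_scale[OF bounded_ops_map[OF X(1)]]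
    have XA: "X (A \<eta>) = A (X \<eta>)" if "\<eta> \<in> L2 M" for \<eta>
      using that X TB by (simp add: Xs A_def)
    have "X (?Y n \<eta>) = ?Y n (X \<eta>)" if "\<eta> \<in> L2 M" for n \<eta>
      using that
    proof (induction n arbitrary: \<eta>)
      case 0
      then show ?case using X bounded_map_zero[OF bounded_ops_map[OF X(1)]] by simp
    next
      case (Suc n)
      then show ?case using X(1) by (simp add: Xs XA)
    qed
    then have "X (Z \<xi>) = Z (X \<xi>)"
      using X Z \<xi> by (intro weak_limit_commute[of sequentially Z M X ?Y]) (auto intro: always_eventually)
    then show "X (R \<xi>) = R (X \<xi>)" using X Z \<xi> by (simp add: R_def Xs)
  qed
qed

text \<open>Division by a norm bound \<open>K\<close> reduces to effects, and the root is scaled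
  back by \<open>\<surd>K\<close>. The commutation clause is what places the root in every commutant
  that contains \<open>T\<close>.\<close>

lemma pos_op_sqrt:
  assumes T: "pos_op M T"
  obtains R where "pos_op M R" "op_mult M R R = T"
    "\<And>X \<xi>. X \<in> bounded_ops M \<Longrightarrow> (\<And>\<xi>. \<xi> \<in> L2 M \<Longrightarrow> X (T \<xi>) = T (X \<xi>)) \<Longrightarrow> \<xi> \<in> L2 M \<Longrightarrow> X (R \<xi>) = R (X \<xi>)"
proof -
  have TB: "T \<in> bounded_ops M" using T by simp
  obtain K where K: "K > 0" "\<And>\<xi>. \<xi> \<in> L2 M \<Longrightarrow> l2_norm M (T \<xi>) \<le> K * l2_norm M \<xi>"
    by (rule bounded_map_bound[OF bounded_ops_map[OF TB]]) blast
  let ?T = "op_scale M (of_real (1 / K)) T"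
  have "effect M ?T"
    unfolding effect_def pos_op_def op_le_def
  proof (intro conjI ballI)
    fix \<xi> assume \<xi>: "\<xi> \<in> L2 M"
    have "Re (l2_inner M (T \<xi>) \<xi>) \<le> l2_norm M (T \<xi>) * l2_norm M \<xi>"
      using l2_Cauchy_Schwarz[of "T \<xi>" M \<xi>] TB \<xi> complex_Re_le_cmod order_trans by (metis bounded_ops_in)
    also have "\<dots> \<le> K * l2_norm M \<xi> * l2_norm M \<xi>" using K(2)[OF \<xi>] by (intro mult_right_mono) auto
    finally show "Re (l2_inner M (?T \<xi>) \<xi>) \<le> Re (l2_inner M (op_id M \<xi>) \<xi>)"
      using \<xi> TB K by (simp add: l2_inner_self field_simps power2_eq_square)
    show "Im (l2_inner M (?T \<xi>) \<xi>) = 0" "0 \<le> Re (l2_inner M (?T \<xi>) \<xi>)"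
      using \<xi> TB K pos_op_Im[OF T \<xi>] pos_op_nonneg[OF T \<xi>] by auto
  qed (use TB in simp)
  then obtain R where R: "pos_op M R" "op_mult M R R = ?T"
    "\<And>X \<xi>. X \<in> bounded_ops M \<Longrightarrow> (\<And>\<xi>. \<xi> \<in> L2 M \<Longrightarrow> X (?T \<xi>) = ?T (X \<xi>)) \<Longrightarrow> \<xi> \<in> L2 M \<Longrightarrow> X (R \<xi>) = R (X \<xi>)"
    by (rule effect_sqrt) blast
  let ?R = "op_scale M (of_real (sqrt K)) R"
  have RB: "R \<in> bounded_ops M" using R by simp
  show ?thesis
  proof (rule that[of ?R])
    show "pos_op M ?R"
      unfolding pos_op_def using RB pos_op_Im[OF R(1)] pos_op_nonneg[OF R(1)] K by auto
    show "op_mult M ?R ?R = T"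
    proof (rule bounded_ops_eqI[of _ M])
      fix \<xi> assume \<xi>: "\<xi> \<in> L2 M"
      have "op_mult M ?R ?R \<xi> = l2_scale M (of_real K) (op_mult M R R \<xi>)"
        using \<xi> RB K by (simp add: bounded_map_scale[OF bounded_ops_map[OF RB]] l2_scale_scale flip: of_real_mult)
      also have "\<dots> = T \<xi>"
        unfolding R(2) by (rule l2_eqI[of _ M]) (use \<xi> TB K in auto)
      finally show "op_mult M ?R ?R \<xi> = T \<xi>" .
    qed (use RB TB in auto)
    fix X \<xi> assume X: "X \<in> bounded_ops M" "\<And>\<xi>. \<xi> \<in> L2 M \<Longrightarrow> X (T \<xi>) = T (X \<xi>)" and \<xi>: "\<xi> \<in> L2 M"
    have "X (R \<xi>) = R (X \<xi>)"
      using X TB \<xi> by (intro R(3)) (auto simp: bounded_map_scale[OF bounded_ops_map[OF X(1)]])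
    then show "X (?R \<xi>) = ?R (X \<xi>)"
      using X RB \<xi> by (simp add: bounded_map_scale[OF bounded_ops_map[OF X(1)]])
  qed
qed


section \<open>Monotone chains of effects\<close>

text \<open>Reduces the convergence of matrix coefficients to that of quadratic forms, where
  monotonicity can be used.\<close>

lemma polarization:
  assumes A: "A \<in> bounded_ops M" and \<xi>: "\<xi> \<in> L2 M" and \<eta>: "\<eta> \<in> L2 M"
  defines "q \<equiv> \<lambda>c. l2_inner M (A (l2_add M \<xi> (l2_scale M c \<eta>))) (l2_add M \<xi> (l2_scale M c \<eta>))"
  shows "l2_inner M (A \<xi>) \<eta> = (q 1 - q (-1) + \<i> * q \<i> - \<i> * q (-\<i>)) / 4"
  using assms by (simp add: q_def bounded_map_add[OF bounded_ops_map] bounded_map_scale[OF bounded_ops_map] algebra_simps)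

definition op_chain :: "'a measure \<Rightarrow> ('a l2 \<Rightarrow> 'a l2) set \<Rightarrow> bool" where
  "op_chain M C \<longleftrightarrow> C \<noteq> {} \<and> (\<forall>a\<in>C. \<forall>b\<in>C. op_le M a b \<or> op_le M b a)"

text \<open>The filter of tails: limits along it are limits of the chain regarded as an increasing
  net. A sequence would not do, since a chain need not have a countable cofinal part.\<close>

definition chain_filter :: "'a measure \<Rightarrow> ('a l2 \<Rightarrow> 'a l2) set \<Rightarrow> ('a l2 \<Rightarrow> 'a l2) filter" where
  "chain_filter M C = (INF a\<in>C. principal {c\<in>C. op_le M a c})"

lemma eventually_chain_filter:
  assumes "op_chain M C"
  shows "eventually P (chain_filter M C) \<longleftrightarrow> (\<exists>a\<in>C. \<forall>c\<in>C. op_le M a c \<longrightarrow> P c)"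
  unfolding chain_filter_def
proof (subst eventually_INF_base)
  fix a b assume ab: "a \<in> C" "b \<in> C"
  then have "op_le M a b \<or> op_le M b a" using assms by (auto simp: op_chain_def)
  then show "\<exists>x\<in>C. principal {c \<in> C. op_le M x c} \<le> inf (principal {c \<in> C. op_le M a c}) (principal {c \<in> C. op_le M b c})"
    using ab by (auto intro: op_le_trans)
qed (use assms in \<open>auto simp: op_chain_def eventually_principal\<close>)

lemma op_le_refl [simp]: "op_le M a a"
  by (simp add: op_le_def)

lemma chain_filter_ne_bot: "op_chain M C \<Longrightarrow> chain_filter M C \<noteq> bot"
  unfolding trivial_limit_def eventually_chain_filter using op_le_refl by blast

lemma eventually_chain_filter_in: "op_chain M C \<Longrightarrow> (\<And>c. c \<in> C \<Longrightarrow> P c) \<Longrightarrow> eventually P (chain_filter M C)"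
  unfolding eventually_chain_filter by (auto simp: op_chain_def)

text \<open>At each vector the quadratic form increases and is bounded, hence converges to its
  supremum. The family \<open>Y\<close> on a second space allows the same chain to be followed under
  \<open>\<Phi>\<close>.\<close>

lemma monotone_chain_limit:
  assumes C: "op_chain M C" and Y: "\<And>c. c \<in> C \<Longrightarrow> effect N (Y c)"
    and mono: "\<And>a b. a \<in> C \<Longrightarrow> b \<in> C \<Longrightarrow> op_le M a b \<Longrightarrow> op_le N (Y a) (Y b)"
  obtains T where "effect N T"
    "\<And>\<xi> \<eta>. \<xi> \<in> L2 N \<Longrightarrow> \<eta> \<in> L2 N \<Longrightarrow> ((\<lambda>c. l2_inner N (Y c \<xi>) \<eta>) \<longlongrightarrow> l2_inner N (T \<xi>) \<eta>) (chain_filter M C)"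
    "\<And>c. c \<in> C \<Longrightarrow> op_le N (Y c) T"
proof -
  let ?F = "chain_filter M C"
  note F = chain_filter_ne_bot[OF C]
  note ev = eventually_chain_filter_in[OF C]
  have quad: "\<exists>l. ((\<lambda>c. l2_inner N (Y c \<xi>) \<xi>) \<longlongrightarrow> l) ?F" if \<xi>: "\<xi> \<in> L2 N" for \<xi>
  proof -
    let ?r = "\<lambda>c. Re (l2_inner N (Y c \<xi>) \<xi>)"
    let ?s = "SUP c\<in>C. ?r c"
    have bdd: "bdd_above (?r ` C)"
      using effect_le_norm[OF Y \<xi>] by (auto intro!: bdd_aboveI[of _ "(l2_norm N \<xi>)\<^sup>2"])
    have "(?r \<longlongrightarrow> ?s) ?F"
    proof (rule increasing_tendsto)
      show "\<forall>\<^sub>F c in ?F. ?r c \<le> ?s" by (rule ev) (rule cSUP_upper[OF _ bdd])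
      fix x assume "x < ?s"
      then obtain a where a: "a \<in> C" "x < ?r a"
        using less_cSUP_iff[OF _ bdd] C by (auto simp: op_chain_def)
      then show "\<forall>\<^sub>F c in ?F. x < ?r c"
        unfolding eventually_chain_filter[OF C]
        using mono \<xi> by (intro bexI[of _ a]) (auto simp: op_le_def intro: less_le_trans)
    qed
    then have "((\<lambda>c. complex_of_real (?r c)) \<longlongrightarrow> of_real ?s) ?F" by (rule tendsto_of_real)
    then have "((\<lambda>c. l2_inner N (Y c \<xi>) \<xi>) \<longlongrightarrow> of_real ?s) ?F"
      by (rule Lim_transform_eventually) (rule ev, use pos_op_inner[OF effect_pos[OF Y] \<xi>] in metis)
    then show ?thesis by blast
  qed
  obtain T where T: "T \<in> bounded_ops N"
    "\<And>\<xi> \<eta>. \<xi> \<in> L2 N \<Longrightarrow> \<eta> \<in> L2 N \<Longrightarrow> ((\<lambda>c. l2_inner N (Y c \<xi>) \<eta>) \<longlongrightarrow> l2_inner N (T \<xi>) \<eta>) ?F"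
  proof (rule weak_limit_op[OF F, of Y N])
    show "\<forall>\<^sub>F c in ?F. Y c \<in> bounded_ops N \<and> (\<forall>\<xi>\<in>L2 N. l2_norm N (Y c \<xi>) \<le> l2_norm N \<xi>)"
      by (rule ev) (use Y effect_norm_le(2) in auto)
    fix \<xi> \<eta> assume e: "\<xi> \<in> L2 N" "\<eta> \<in> L2 N"
    let ?v = "\<lambda>c. l2_add N \<xi> (l2_scale N c \<eta>)"
    have "\<exists>l. ((\<lambda>c. l2_inner N (Y c (?v z)) (?v z)) \<longlongrightarrow> l) ?F" for z using e by (intro quad) simp
    then obtain l where l: "((\<lambda>c. l2_inner N (Y c (?v z)) (?v z)) \<longlongrightarrow> l z) ?F" for z by metis
    have "((\<lambda>c. (l2_inner N (Y c (?v 1)) (?v 1) - l2_inner N (Y c (?v (-1))) (?v (-1)) + \<i> * l2_inner N (Y c (?v \<i>)) (?v \<i>)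
      - \<i> * l2_inner N (Y c (?v (-\<i>))) (?v (-\<i>))) / 4) \<longlongrightarrow> (l 1 - l (-1) + \<i> * l \<i> - \<i> * l (-\<i>)) / 4) ?F"
      by (intro tendsto_intros l) simp
    then have "((\<lambda>c. l2_inner N (Y c \<xi>) \<eta>) \<longlongrightarrow> (l 1 - l (-1) + \<i> * l \<i> - \<i> * l (-\<i>)) / 4) ?F"
      by (rule Lim_transform_eventually) (rule ev, use polarization[OF _ e] Y in simp)
    then show "\<exists>l. ((\<lambda>c. l2_inner N (Y c \<xi>) \<eta>) \<longlongrightarrow> l) ?F" by blast
  qed blast
  have Re_lim: "((\<lambda>c. Re (l2_inner N (Y c \<xi>) \<xi>)) \<longlongrightarrow> Re (l2_inner N (T \<xi>) \<xi>)) ?F" if "\<xi> \<in> L2 N" for \<xi>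
    by (intro tendsto_intros T that)
  have Im_lim: "((\<lambda>c. Im (l2_inner N (Y c \<xi>) \<xi>)) \<longlongrightarrow> Im (l2_inner N (T \<xi>) \<xi>)) ?F" if "\<xi> \<in> L2 N" for \<xi>
    by (intro tendsto_intros T that)
  show ?thesis
  proof (rule that[of T])
    show "effect N T"
      unfolding effect_def pos_op_def op_le_def
    proof (intro conjI ballI T)
      fix \<xi> assume \<xi>: "\<xi> \<in> L2 N"
      have "((\<lambda>c. Im (l2_inner N (Y c \<xi>) \<xi>)) \<longlongrightarrow> 0) ?F"
        by (rule tendsto_eventually) (rule ev, use pos_op_Im[OF effect_pos[OF Y] \<xi>] in simp)
      from tendsto_unique[OF F this Im_lim[OF \<xi>]] show "Im (l2_inner N (T \<xi>) \<xi>) = 0" by simp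
      show "0 \<le> Re (l2_inner N (T \<xi>) \<xi>)"
        by (rule tendsto_lowerbound[OF Re_lim[OF \<xi>] ev F]) (use pos_op_nonneg[OF effect_pos[OF Y] \<xi>] in simp)
      show "Re (l2_inner N (T \<xi>) \<xi>) \<le> Re (l2_inner N (op_id N \<xi>) \<xi>)"
        by (rule tendsto_upperbound[OF Re_lim[OF \<xi>] ev F]) (use effect_le_norm[OF Y \<xi>] \<xi> in \<open>simp add: l2_inner_self\<close>)
    qed
    fix a assume a: "a \<in> C"
    show "op_le N (Y a) T"
      unfolding op_le_def
    proof
      fix \<xi> assume \<xi>: "\<xi> \<in> L2 N"
      have "\<forall>\<^sub>F c in ?F. Re (l2_inner N (Y a \<xi>) \<xi>) \<le> Re (l2_inner N (Y c \<xi>) \<xi>)"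
        unfolding eventually_chain_filter[OF C] using a mono \<xi> unfolding op_le_def by blast
      then show "Re (l2_inner N (Y a \<xi>) \<xi>) \<le> Re (l2_inner N (T \<xi>) \<xi>)"
        by (rule tendsto_lowerbound[OF Re_lim[OF \<xi>] _ F])
    qed
  qed (use T in blast)
qed

section \<open>Von Neumann algebras\<close>

text \<open>As the commutant of a self-adjoint set of operators the algebra is described by
  equations, from which closure under sums, products, adjoints, roots and weak limits can be read
  off.\<close>

definition vN_algebra :: "'a measure \<Rightarrow> ('a l2 \<Rightarrow> 'a l2) set \<Rightarrow> bool" where
  "vN_algebra M \<A> \<longleftrightarrow> (\<exists>S\<subseteq>bounded_ops M. (\<forall>s\<in>S. op_adj M s \<in> S) \<and> \<A> = commutant M S)"

lemma vN_algebra_bicommutant: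
  assumes "S \<subseteq> bounded_ops M" "\<And>s. s \<in> S \<Longrightarrow> op_adj M s \<in> S"
  shows "vN_algebra M (commutant M (commutant M S))"
  unfolding vN_algebra_def
  by (intro exI[of _ "commutant M S"] conjI ballI commutant_subset commutant_adj_closed[OF assms] refl)

lemma subset_bicommutant:
  assumes "S \<subseteq> bounded_ops M" shows "S \<subseteq> commutant M (commutant M S)"
  using assms by (auto simp: commutant_iff[OF commutant_subset] commutant_iff[OF assms])

context
  fixes M :: "'a measure" and \<A>
  assumes \<A>: "vN_algebra M \<A>"
begin

lemma vN_subset: "A \<in> \<A> \<Longrightarrow> A \<in> bounded_ops M"
  using \<A> by (auto simp: vN_algebra_def commutant_def)

lemma vN_commutes:
  obtains S where "S \<subseteq> bounded_ops M" "\<And>s. s \<in> S \<Longrightarrow> op_adj M s \<in> S"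
    "\<And>A. A \<in> \<A> \<longleftrightarrow> A \<in> bounded_ops M \<and> (\<forall>s\<in>S. \<forall>\<xi>\<in>L2 M. s (A \<xi>) = A (s \<xi>))"
  using \<A> unfolding vN_algebra_def by (metis commutant_iff)

lemma vN_closed:
  shows vN_id: "op_id M \<in> \<A>" and vN_zero: "op_zero M \<in> \<A>"
    and vN_add: "\<And>A B. A \<in> \<A> \<Longrightarrow> B \<in> \<A> \<Longrightarrow> op_add M A B \<in> \<A>"
    and vN_scale: "\<And>A c. A \<in> \<A> \<Longrightarrow> op_scale M c A \<in> \<A>"
    and vN_mult: "\<And>A B. A \<in> \<A> \<Longrightarrow> B \<in> \<A> \<Longrightarrow> op_mult M A B \<in> \<A>"
    and vN_adj: "\<And>A. A \<in> \<A> \<Longrightarrow> op_adj M A \<in> \<A>"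
proof -
  obtain S where S: "S \<subseteq> bounded_ops M" "\<And>s. s \<in> S \<Longrightarrow> op_adj M s \<in> S"
    "\<And>A. A \<in> \<A> \<longleftrightarrow> A \<in> bounded_ops M \<and> (\<forall>s\<in>S. \<forall>\<xi>\<in>L2 M. s (A \<xi>) = A (s \<xi>))"
    by (rule vN_commutes) blast
  have sB: "s \<in> bounded_ops M" if "s \<in> S" for s using S(1) that by auto
  note s = bounded_ops_map[OF sB]
  show "op_id M \<in> \<A>" "op_zero M \<in> \<A>" using s by (simp_all add: S(3) bounded_map_zero sB)
  show "op_add M A B \<in> \<A>" "op_mult M A B \<in> \<A>" if "A \<in> \<A>" "B \<in> \<A>" for A B
    using that s by (simp_all add: S(3) bounded_map_add sB)
  show "op_scale M c A \<in> \<A>" if "A \<in> \<A>" for A c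
    using that s by (simp add: S(3) bounded_map_scale sB)
  have "\<A> = commutant M S" using commutant_iff[OF S(1)] S(3) by fastforce
  then show "op_adj M A \<in> \<A>" if "A \<in> \<A>" for A using commutant_adj_closed[OF S(1,2)] that by simp
qed

lemma vN_diff: "A \<in> \<A> \<Longrightarrow> B \<in> \<A> \<Longrightarrow> op_diff M A B \<in> \<A>"
  by (simp add: op_diff_def vN_add vN_scale)

text \<open>The operators that define the commutant commute with \<open>T\<close>, hence with its
  root.\<close>

lemma vN_sqrt:
  assumes "pos_op M T" "T \<in> \<A>"
  obtains R where "pos_op M R" "R \<in> \<A>" "op_mult M R R = T"
proof -
  obtain S where S: "S \<subseteq> bounded_ops M"
    "\<And>A. A \<in> \<A> \<longleftrightarrow> A \<in> bounded_ops M \<and> (\<forall>s\<in>S. \<forall>\<xi>\<in>L2 M. s (A \<xi>) = A (s \<xi>))"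
    by (rule vN_commutes) blast
  obtain R where R: "pos_op M R" "op_mult M R R = T"
    "\<And>X \<xi>. X \<in> bounded_ops M \<Longrightarrow> (\<And>\<xi>. \<xi> \<in> L2 M \<Longrightarrow> X (T \<xi>) = T (X \<xi>)) \<Longrightarrow> \<xi> \<in> L2 M \<Longrightarrow> X (R \<xi>) = R (X \<xi>)"
    by (rule pos_op_sqrt[OF assms(1)]) blast
  have "R \<in> \<A>" unfolding S(2)
  proof (intro conjI ballI)
    fix s \<xi> assume s: "s \<in> S" and \<xi>: "\<xi> \<in> L2 M"
    show "s (R \<xi>) = R (s \<xi>)"
      by (rule R(3)[OF _ _ \<xi>]) (use s S(1) assms(2)[unfolded S(2)] in auto)
  qed (use R in simp)
  then show ?thesis using R that by blast
qed

text \<open>Commutation with a fixed operator survives weak limits, so a commutant is weakly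
  closed.\<close>

lemma vN_weak_limit:
  assumes "F \<noteq> bot" "T \<in> bounded_ops M" "\<forall>\<^sub>F i in F. Y i \<in> \<A>"
    "\<And>\<xi> \<eta>. \<xi> \<in> L2 M \<Longrightarrow> \<eta> \<in> L2 M \<Longrightarrow> ((\<lambda>i. l2_inner M (Y i \<xi>) \<eta>) \<longlongrightarrow> l2_inner M (T \<xi>) \<eta>) F"
  shows "T \<in> \<A>"
proof -
  obtain S where S: "S \<subseteq> bounded_ops M"
    "\<And>A. A \<in> \<A> \<longleftrightarrow> A \<in> bounded_ops M \<and> (\<forall>s\<in>S. \<forall>\<xi>\<in>L2 M. s (A \<xi>) = A (s \<xi>))"
    by (rule vN_commutes) blast
  show ?thesis unfolding S(2)
  proof (intro conjI ballI)
    fix s \<xi> assume s: "s \<in> S" and \<xi>: "\<xi> \<in> L2 M"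
    show "s (T \<xi>) = T (s \<xi>)"
    proof (rule weak_limit_commute[OF assms(1,2) _ assms(4) _ \<xi>])
      show "\<forall>\<^sub>F i in F. Y i \<in> bounded_ops M \<and> (\<forall>\<xi>\<in>L2 M. s (Y i \<xi>) = Y i (s \<xi>))"
        using assms(3) by eventually_elim (use s S(2) in auto)
    qed (use s S(1) in auto)
  qed (use assms in simp)
qed

end

section \<open>Isomorphisms of von Neumann algebras and intertwiners\<close>

lemma l2_diff_self [simp]: "\<xi> \<in> L2 M \<Longrightarrow> l2_diff M \<xi> \<xi> = l2_zero M"
  by (rule l2_eqI[of _ M]) auto

lemma effect_zero: "effect M (op_zero M)"
  by (auto simp: effect_def pos_op_def op_le_def l2_inner_self)

lemma op_le_iff_pos:
  assumes "pos_op M A" "pos_op M B"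
  shows "op_le M A B \<longleftrightarrow> pos_op M (op_diff M B A)"
  using assms pos_op_Im[OF assms(1)] pos_op_Im[OF assms(2)]
  by (auto simp: op_le_def pos_op_def)

lemma pos_op_add: "pos_op M A \<Longrightarrow> pos_op M B \<Longrightarrow> pos_op M (op_add M A B)"
  by (auto simp: pos_op_def)

lemma pos_op_eq_zero:
  assumes "pos_op M A" "\<And>\<xi>. \<xi> \<in> L2 M \<Longrightarrow> Re (l2_inner M (A \<xi>) \<xi>) \<le> 0"
  shows "A = op_zero M"
proof (rule op_le_antisym[OF assms(1) effect_pos[OF effect_zero]])
  show "op_le M A (op_zero M)" using assms by (auto simp: op_le_def)
  show "op_le M (op_zero M) A" using pos_op_nonneg[OF assms(1)] by (auto simp: op_le_def)
qed

locale vN_isomorphism =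
  fixes M :: "'a measure" and \<A> and N :: "'b measure" and \<B> and \<Phi>
  assumes vA: "vN_algebra M \<A>" and vB: "vN_algebra N \<B>" and iso: "star_isomorphism M \<A> N \<B> \<Phi>"
begin

lemma \<Phi>_bij: "bij_betw \<Phi> \<A> \<B>"
  and \<Phi>_add: "A \<in> \<A> \<Longrightarrow> B \<in> \<A> \<Longrightarrow> \<Phi> (op_add M A B) = op_add N (\<Phi> A) (\<Phi> B)"
  and \<Phi>_scale: "A \<in> \<A> \<Longrightarrow> \<Phi> (op_scale M c A) = op_scale N c (\<Phi> A)"
  and \<Phi>_mult: "A \<in> \<A> \<Longrightarrow> B \<in> \<A> \<Longrightarrow> \<Phi> (op_mult M A B) = op_mult N (\<Phi> A) (\<Phi> B)"
  and \<Phi>_adj: "A \<in> \<A> \<Longrightarrow> \<Phi> (op_adj M A) = op_adj N (\<Phi> A)"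
  using iso by (auto simp: star_isomorphism_def)

lemma \<Phi>_in: "A \<in> \<A> \<Longrightarrow> \<Phi> A \<in> \<B>"
  using \<Phi>_bij by (auto simp: bij_betw_def)

lemma \<A>_ops: "A \<in> \<A> \<Longrightarrow> A \<in> bounded_ops M" by (rule vN_subset[OF vA])
lemma \<B>_ops: "B \<in> \<B> \<Longrightarrow> B \<in> bounded_ops N" by (rule vN_subset[OF vB])
lemma \<Phi>_ops: "A \<in> \<A> \<Longrightarrow> \<Phi> A \<in> bounded_ops N" by (rule \<B>_ops[OF \<Phi>_in])

lemma \<Phi>_diff: "A \<in> \<A> \<Longrightarrow> B \<in> \<A> \<Longrightarrow> \<Phi> (op_diff M A B) = op_diff N (\<Phi> A) (\<Phi> B)"
  by (simp add: op_diff_def \<Phi>_add \<Phi>_scale vN_scale[OF vA])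

lemma \<Phi>_surj:
  assumes "B \<in> \<B>" obtains A where "A \<in> \<A>" "\<Phi> A = B"
  using assms \<Phi>_bij by (auto simp: bij_betw_def)

lemma \<Phi>_inj: "A \<in> \<A> \<Longrightarrow> B \<in> \<A> \<Longrightarrow> \<Phi> A = \<Phi> B \<Longrightarrow> A = B"
  using \<Phi>_bij by (auto simp: bij_betw_def dest: inj_onD)

text \<open>\<open>star_isomorphism\<close> does not mention units. By surjectivity
  \<open>op_id N\<close> is some \<open>\<Phi> i\<close>, and applying \<open>\<Phi>\<close> to
  \<open>1 i = i\<close> shows that \<open>\<Phi>\<close> of the unit fixes it.\<close>

lemma \<Phi>_id: "\<Phi> (op_id M) = op_id N"
proof -
  obtain i where i: "i \<in> \<A>" "\<Phi> i = op_id N" by (rule \<Phi>_surj[OF vN_id[OF vB]])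
  have "op_mult M (op_id M) i = i"
    by (rule bounded_ops_eqI[of _ M]) (use \<A>_ops[OF i(1)] in auto)
  then have "op_id N = op_mult N (\<Phi> (op_id M)) (op_id N)"
    using \<Phi>_mult[OF vN_id[OF vA] i(1)] i by simp
  also have "\<dots> = \<Phi> (op_id M)"
    by (rule bounded_ops_eqI[of _ N]) (use \<Phi>_ops[OF vN_id[OF vA]] in auto)
  finally show ?thesis ..
qed

lemma \<Phi>_zero: "\<Phi> (op_zero M) = op_zero N"
proof -
  have "op_zero M = op_scale M 0 (op_id M)"
    by (rule bounded_ops_eqI[of _ M]) (auto simp: l2_scale_0)
  then have "\<Phi> (op_zero M) = op_scale N 0 (op_id N)" by (simp add: \<Phi>_scale vN_id[OF vA] \<Phi>_id)
  also have "\<dots> = op_zero N" by (rule bounded_ops_eqI[of _ N]) (auto simp: l2_scale_0)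
  finally show ?thesis .
qed

text \<open>A positive element is a product \<open>R\<^sup>* R\<close> with \<open>R\<close> in the
  algebra, and that is an algebraic property.\<close>

lemma \<Phi>_pos:
  assumes "A \<in> \<A>" "pos_op M A" shows "pos_op N (\<Phi> A)"
proof -
  obtain R where R: "pos_op M R" "R \<in> \<A>" "op_mult M R R = A" by (rule vN_sqrt[OF vA assms(2,1)])
  have "\<Phi> A = op_mult N (op_adj N (\<Phi> R)) (\<Phi> R)"
    using R by (metis \<Phi>_mult \<Phi>_adj pos_op_adj)
  then show ?thesis using pos_op_adj_mult[OF \<Phi>_ops[OF R(2)]] by simp
qed

lemma \<Phi>_le:
  assumes "A \<in> \<A>" "B \<in> \<A>" "pos_op M A" "pos_op M B" "op_le M A B"
  shows "op_le N (\<Phi> A) (\<Phi> B)"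
  using assms by (simp add: op_le_iff_pos \<Phi>_pos vN_diff[OF vA] flip: \<Phi>_diff)

lemma pos_op_id: "pos_op M (op_id M)"
  by (rule pos_opI[where r="\<lambda>\<xi>. (l2_norm M \<xi>)\<^sup>2"]) (auto simp: l2_inner_self)

lemma \<Phi>_effect: "A \<in> \<A> \<Longrightarrow> effect M A \<Longrightarrow> effect N (\<Phi> A)"
  unfolding effect_def \<Phi>_id[symmetric] using \<Phi>_le \<Phi>_pos pos_op_id vN_id[OF vA] by blast

text \<open>Order estimates are also needed in the backward direction, to compare an upper bound in
  \<open>\<B>\<close> with the supremum in \<open>\<A>\<close>.\<close>

lemma inverse: "vN_isomorphism N \<B> M \<A> (inv_into \<A> \<Phi>)"
proof
  have inv [simp]: "inv_into \<A> \<Phi> (\<Phi> A) = A" if "A \<in> \<A>" for A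
    using \<Phi>_bij that by (simp add: bij_betw_def)
  have e: "\<exists>A\<in>\<A>. B = \<Phi> A" if "B \<in> \<B>" for B using \<Phi>_surj[OF that] by blast
  note cl = vN_add[OF vA] vN_scale[OF vA] vN_mult[OF vA] vN_adj[OF vA]
  show "star_isomorphism N \<B> M \<A> (inv_into \<A> \<Phi>)"
    unfolding star_isomorphism_def
  proof (intro conjI ballI allI)
    show "bij_betw (inv_into \<A> \<Phi>) \<B> \<A>" by (rule bij_betw_inv_into[OF \<Phi>_bij])
    show "inv_into \<A> \<Phi> (op_add N A B) = op_add M (inv_into \<A> \<Phi> A) (inv_into \<A> \<Phi> B)"
      "inv_into \<A> \<Phi> (op_mult N A B) = op_mult M (inv_into \<A> \<Phi> A) (inv_into \<A> \<Phi> B)"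
      if "A \<in> \<B>" "B \<in> \<B>" for A B
      using e[OF that(1)] e[OF that(2)] cl by (auto simp flip: \<Phi>_add \<Phi>_mult)
    show "inv_into \<A> \<Phi> (op_scale N c A) = op_scale M c (inv_into \<A> \<Phi> A)" if "A \<in> \<B>" for c A
      using e[OF that(1)] cl by (auto simp flip: \<Phi>_scale)
    show "inv_into \<A> \<Phi> (op_adj N A) = op_adj M (inv_into \<A> \<Phi> A)" if "A \<in> \<B>" for A
      using e[OF that(1)] cl by (auto simp flip: \<Phi>_adj)
  qed
qed (rule vA vB)+

text \<open>\<open>\<Phi>\<close> is an order isomorphism, so it maps the supremum of a chain to the supremum of the
  image; suprema of chains are weak limits.\<close>
lemma chain_supremum:
  assumes C: "op_chain M C" and CA: "\<And>c. c \<in> C \<Longrightarrow> c \<in> \<A> \<and> effect M c"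
  obtains T where "T \<in> \<A>" "effect M T" "\<And>c. c \<in> C \<Longrightarrow> op_le M c T"
    "\<And>\<xi> \<eta>. \<xi> \<in> L2 M \<Longrightarrow> \<eta> \<in> L2 M \<Longrightarrow> ((\<lambda>c. l2_inner M (c \<xi>) \<eta>) \<longlongrightarrow> l2_inner M (T \<xi>) \<eta>) (chain_filter M C)"
    "\<And>\<xi> \<eta>. \<xi> \<in> L2 N \<Longrightarrow> \<eta> \<in> L2 N \<Longrightarrow> ((\<lambda>c. l2_inner N (\<Phi> c \<xi>) \<eta>) \<longlongrightarrow> l2_inner N (\<Phi> T \<xi>) \<eta>) (chain_filter M C)"
proof -
  interpret inv: vN_isomorphism N \<B> M \<A> "inv_into \<A> \<Phi>" by (rule inverse)
  let ?F = "chain_filter M C"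
  note F = chain_filter_ne_bot[OF C]
  obtain T where T: "effect M T"
    "\<And>\<xi> \<eta>. \<xi> \<in> L2 M \<Longrightarrow> \<eta> \<in> L2 M \<Longrightarrow> ((\<lambda>c. l2_inner M (c \<xi>) \<eta>) \<longlongrightarrow> l2_inner M (T \<xi>) \<eta>) ?F"
    "\<And>c. c \<in> C \<Longrightarrow> op_le M c T"
    by (rule monotone_chain_limit[OF C, of M "\<lambda>c. c"]) (use CA in blast)+
  obtain U where U: "effect N U"
    "\<And>\<xi> \<eta>. \<xi> \<in> L2 N \<Longrightarrow> \<eta> \<in> L2 N \<Longrightarrow> ((\<lambda>c. l2_inner N (\<Phi> c \<xi>) \<eta>) \<longlongrightarrow> l2_inner N (U \<xi>) \<eta>) ?F"
    "\<And>c. c \<in> C \<Longrightarrow> op_le N (\<Phi> c) U"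
  proof (rule monotone_chain_limit[OF C, of N \<Phi>])
    show "effect N (\<Phi> c)" if "c \<in> C" for c using CA that \<Phi>_effect by blast
    show "op_le N (\<Phi> a) (\<Phi> b)" if "a \<in> C" "b \<in> C" "op_le M a b" for a b
      using CA[OF that(1)] CA[OF that(2)] that(3) by (intro \<Phi>_le) auto
  qed blast
  have TA: "T \<in> \<A>"
    by (rule vN_weak_limit[OF vA F _ eventually_chain_filter_in[OF C] T(2)]) (use T CA in auto)
  have UB: "U \<in> \<B>"
    by (rule vN_weak_limit[OF vB F _ eventually_chain_filter_in[OF C] U(2)]) (use U CA \<Phi>_in in auto)
  obtain V where V: "V \<in> \<A>" "\<Phi> V = U" by (rule \<Phi>_surj[OF UB])
  have iV: "inv_into \<A> \<Phi> U = V" "\<And>A. A \<in> \<A> \<Longrightarrow> inv_into \<A> \<Phi> (\<Phi> A) = A"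
    using V \<Phi>_bij by (auto simp: bij_betw_def)
  have Vp: "pos_op M V" using inv.\<Phi>_pos[OF UB] U(1) iV by simp
  \<comment> \<open>The preimage \<open>V\<close> of the limit \<open>U\<close> is an upper bound of
    \<open>C\<close>, since the inverse preserves order. Hence \<open>T \<le> V\<close> and
    \<open>\<Phi> T \<le> U\<close>; the opposite inequality holds because \<open>\<Phi> T\<close>
    bounds the image chain.\<close>
  have "op_le M c V" if "c \<in> C" for c
    using inv.\<Phi>_le[of "\<Phi> c" U] CA[OF that] UB U(1) U(3)[OF that] \<Phi>_in \<Phi>_pos iV by auto
  then have "op_le M T V"
    unfolding op_le_def
    by (intro ballI tendsto_upperbound[OF tendsto_Re[OF T(2)] eventually_chain_filter_in[OF C] F]) auto
  then have "op_le N (\<Phi> T) U" using \<Phi>_le[OF TA V(1) effect_pos[OF T(1)] Vp] V by simp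
  moreover have "op_le N U (\<Phi> T)"
  proof -
    have "op_le N (\<Phi> c) (\<Phi> T)" if "c \<in> C" for c
      using CA[OF that] T TA that by (intro \<Phi>_le) auto
    then show ?thesis unfolding op_le_def
      by (intro ballI tendsto_upperbound[OF tendsto_Re[OF U(2)] eventually_chain_filter_in[OF C] F]) auto
  qed
  ultimately have "\<Phi> T = U" using T U TA by (intro op_le_antisym) (auto intro: \<Phi>_pos)
  then show ?thesis using that[OF TA T(1) T(3) T(2)] U(2) by blast
qed

text \<open>Zorn's lemma for a set of effects, with 0 as upper bound of the empty chain. The closure
  condition hands over the supremum together with weak convergence on both sides of
  \<open>\<Phi>\<close>, so it can be checked by passing to the limit in inequalities or
  equations.\<close>

lemma maximal_effect:
  assumes Q: "\<And>e. e \<in> Q \<Longrightarrow> e \<in> \<A> \<and> effect M e" and 0: "op_zero M \<in> Q"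
    and sup: "\<And>C T. op_chain M C \<Longrightarrow> C \<subseteq> Q \<Longrightarrow> T \<in> \<A> \<Longrightarrow> effect M T \<Longrightarrow> (\<And>c. c \<in> C \<Longrightarrow> op_le M c T) \<Longrightarrow>
      (\<And>\<xi> \<eta>. \<xi> \<in> L2 M \<Longrightarrow> \<eta> \<in> L2 M \<Longrightarrow> ((\<lambda>c. l2_inner M (c \<xi>) \<eta>) \<longlongrightarrow> l2_inner M (T \<xi>) \<eta>) (chain_filter M C)) \<Longrightarrow>
      (\<And>\<xi> \<eta>. \<xi> \<in> L2 N \<Longrightarrow> \<eta> \<in> L2 N \<Longrightarrow> ((\<lambda>c. l2_inner N (\<Phi> c \<xi>) \<eta>) \<longlongrightarrow> l2_inner N (\<Phi> T \<xi>) \<eta>) (chain_filter M C)) \<Longrightarrow>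
      T \<in> Q"
  obtains m where "m \<in> Q" "\<And>a. a \<in> Q \<Longrightarrow> op_le M m a \<Longrightarrow> a = m"
proof -
  have "\<exists>m\<in>Q. \<forall>a\<in>Q. op_le M m a \<longrightarrow> a = m"
  proof (rule predicate_Zorn)
    show "partial_order_on Q (relation_of (op_le M) Q)"
      by (rule partial_order_on_relation_ofI)
        (use Q effect_pos in \<open>auto intro: op_le_trans op_le_antisym\<close>)
    fix C assume C: "C \<in> Chains (relation_of (op_le M) Q)"
    show "\<exists>u\<in>Q. \<forall>a\<in>C. op_le M a u"
    proof (cases "C = {}")
      case False
      then have CC: "op_chain M C" "C \<subseteq> Q"
        using C by (auto simp: op_chain_def Chains_def relation_of_def)
      obtain T where "T \<in> \<A>" "effect M T" "\<And>c. c \<in> C \<Longrightarrow> op_le M c T"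
        "\<And>\<xi> \<eta>. \<xi> \<in> L2 M \<Longrightarrow> \<eta> \<in> L2 M \<Longrightarrow> ((\<lambda>c. l2_inner M (c \<xi>) \<eta>) \<longlongrightarrow> l2_inner M (T \<xi>) \<eta>) (chain_filter M C)"
        "\<And>\<xi> \<eta>. \<xi> \<in> L2 N \<Longrightarrow> \<eta> \<in> L2 N \<Longrightarrow> ((\<lambda>c. l2_inner N (\<Phi> c \<xi>) \<eta>) \<longlongrightarrow> l2_inner N (\<Phi> T \<xi>) \<eta>) (chain_filter M C)"
        by (rule chain_supremum[OF CC(1)]) (use Q CC in blast)+
      then show ?thesis using sup[OF CC, of T] by blast
    qed (use 0 in auto)
  qed
  then show ?thesis using that by blast
qed

text \<open>The complement of a maximal \<open>a \<le> f\<close> with \<open>\<langle>a \<xi>, \<xi>\<rangle> \<le> \<langle>\<Phi>(a) z, z\<rangle>\<close>, where \<open>\<xi>\<close> is so long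
  that \<open>f\<close> itself violates the inequality.\<close>
lemma dominated_effect:
  assumes f: "f \<in> \<A>" "effect M f" "f \<noteq> op_zero M" and z: "z \<in> L2 N"
  obtains c \<xi> where "c \<in> \<A>" "effect M c" "op_le M c f" "c \<noteq> op_zero M" "\<xi> \<in> L2 M"
    "\<And>b. b \<in> \<A> \<Longrightarrow> pos_op M b \<Longrightarrow> op_le M b c \<Longrightarrow> Re (l2_inner N (\<Phi> b z) z) \<le> Re (l2_inner M (b \<xi>) \<xi>)"
proof -
  have fp: "pos_op M f" and fB: "f \<in> bounded_ops M" using f by auto
  obtain \<zeta> where \<zeta>: "\<zeta> \<in> L2 M" "Re (l2_inner M (f \<zeta>) \<zeta>) > 0"
    using pos_op_eq_zero[OF fp] f(3) by (meson not_le)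
  let ?\<psi> = "\<lambda>b. Re (l2_inner N (\<Phi> b z) z)"
  \<comment> \<open>Chosen so that \<open>?\<omega> f = ?\<psi> f + 1\<close>, which keeps
    \<open>f\<close> out of \<open>Q\<close>.\<close>
  define t where "t = (?\<psi> f + 1) / Re (l2_inner M (f \<zeta>) \<zeta>)"
  have \<psi>0: "0 \<le> ?\<psi> f" using pos_op_nonneg[OF \<Phi>_pos[OF f(1) fp] z] .
  define \<xi> where "\<xi> = l2_scale M (of_real (sqrt t)) \<zeta>"
  have \<xi>: "\<xi> \<in> L2 M" using \<zeta> by (simp add: \<xi>_def)
  let ?\<omega> = "\<lambda>b. Re (l2_inner M (b \<xi>) \<xi>)"
  have "t \<ge> 0" using \<zeta> \<psi>0 by (simp add: t_def)
  then have "l2_inner M (f \<xi>) \<xi> = of_real t * l2_inner M (f \<zeta>) \<zeta>"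
    using \<zeta> fB by (simp add: \<xi>_def bounded_map_scale[OF bounded_ops_map[OF fB]] flip: of_real_mult mult.assoc)
  then have f\<omega>: "?\<omega> f = ?\<psi> f + 1" using \<zeta>(2) by (simp add: t_def)
  define Q where "Q = {a \<in> \<A>. effect M a \<and> op_le M a f \<and> ?\<omega> a \<le> ?\<psi> a}"
  obtain a where a: "a \<in> Q" "\<And>b. b \<in> Q \<Longrightarrow> op_le M a b \<Longrightarrow> b = a"
  proof (rule maximal_effect[of Q])
    show "op_zero M \<in> Q"
      using vN_zero[OF vA] effect_zero[of M] \<xi> z pos_op_nonneg[OF fp] by (simp add: Q_def \<Phi>_zero op_le_def)
    fix C T assume C: "op_chain M C" "C \<subseteq> Q" and T: "T \<in> \<A>" "effect M T" "\<And>c. c \<in> C \<Longrightarrow> op_le M c T"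
      and lim: "\<And>\<xi> \<eta>. \<xi> \<in> L2 M \<Longrightarrow> \<eta> \<in> L2 M \<Longrightarrow> ((\<lambda>c. l2_inner M (c \<xi>) \<eta>) \<longlongrightarrow> l2_inner M (T \<xi>) \<eta>) (chain_filter M C)"
      "\<And>\<xi> \<eta>. \<xi> \<in> L2 N \<Longrightarrow> \<eta> \<in> L2 N \<Longrightarrow> ((\<lambda>c. l2_inner N (\<Phi> c \<xi>) \<eta>) \<longlongrightarrow> l2_inner N (\<Phi> T \<xi>) \<eta>) (chain_filter M C)"
    note ev = eventually_chain_filter_in[OF C(1)] and F = chain_filter_ne_bot[OF C(1)]
    have "?\<omega> T \<le> ?\<psi> T"
      by (rule tendsto_le[OF F tendsto_Re[OF lim(2)[OF z z]] tendsto_Re[OF lim(1)[OF \<xi> \<xi>]] ev])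
        (use C in \<open>auto simp: Q_def\<close>)
    moreover have "op_le M T f"
      unfolding op_le_def
      by (intro ballI tendsto_upperbound[OF tendsto_Re[OF lim(1)] ev F]) (use C in \<open>auto simp: Q_def op_le_def\<close>)
    ultimately show "T \<in> Q" using T by (simp add: Q_def)
  qed (auto simp: Q_def)
  have aA: "a \<in> \<A>" "pos_op M a" "op_le M a f" "?\<omega> a \<le> ?\<psi> a" and aB: "a \<in> bounded_ops M"
    using a(1) by (auto simp: Q_def)
  define c where "c = op_diff M f a"
  have cA: "c \<in> \<A>" using f aA by (simp add: c_def vN_diff[OF vA])
  have cp: "pos_op M c" using op_le_iff_pos[OF aA(2) fp] aA(3) by (simp add: c_def)
  have cf: "op_le M c f" using pos_op_nonneg[OF aA(2)] by (auto simp: op_le_def c_def aB fB)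
  have ceff: "effect M c" using cp op_le_trans[OF cf] f(2) by (simp add: effect_def)
  have "c \<noteq> op_zero M"
  proof
    assume "c = op_zero M"
    have "f = a"
    proof (rule bounded_ops_eqI[OF fB aB])
      fix \<zeta> assume \<zeta>: "\<zeta> \<in> L2 M"
      have "l2_diff M (f \<zeta>) (a \<zeta>) = l2_zero M"
        using \<open>c = op_zero M\<close> op_apply(6)[OF \<zeta>, of f a] \<zeta> by (simp add: c_def)
      from l2_diff_eq_zeroD[OF _ _ this] show "f \<zeta> = a \<zeta>" using fB aB \<zeta> by simp
    qed
    then show False using f\<omega> aA(4) by simp
  qed
  \<comment> \<open>A violating \<open>b\<close> could be added to \<open>a\<close> without leaving
    \<open>Q\<close>. Maximality then gives \<open>b = 0\<close>, for which both sides
    vanish.\<close>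
  moreover have "?\<psi> b \<le> ?\<omega> b" if b: "b \<in> \<A>" "pos_op M b" "op_le M b c" for b
  proof (rule ccontr)
    assume n: "\<not> ?\<psi> b \<le> ?\<omega> b"
    let ?s = "op_add M a b"
    have sA: "?s \<in> \<A>" using aA b by (simp add: vN_add[OF vA])
    have sp: "pos_op M ?s" using aA b by (simp add: pos_op_add)
    have sf: "op_le M ?s f" using b(3) by (auto simp: op_le_def c_def algebra_simps) (use aB b fB in \<open>simp add: algebra_simps\<close>)
    have "?\<omega> ?s = ?\<omega> a + ?\<omega> b" "?\<psi> ?s = ?\<psi> a + ?\<psi> b"
      using \<xi> z aB b(2) \<Phi>_ops[OF aA(1)] \<Phi>_ops[OF b(1)] by (simp_all add: \<Phi>_add aA(1) b(1))
    then have "?\<omega> ?s \<le> ?\<psi> ?s" using n aA(4) by linarith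
    then have "?s \<in> Q" using sA sp sf op_le_trans[OF sf] f(2) by (simp add: Q_def effect_def)
    moreover have "op_le M a ?s" using pos_op_nonneg[OF b(2)] aB b by (auto simp: op_le_def)
    ultimately have eq: "?s = a" by (rule a(2))
    have "b = op_zero M"
    proof (rule pos_op_eq_zero[OF b(2)])
      fix \<zeta> assume "\<zeta> \<in> L2 M"
      then have "l2_inner M (?s \<zeta>) \<zeta> = l2_inner M (a \<zeta>) \<zeta> + l2_inner M (b \<zeta>) \<zeta>" using aB b by simp
      then show "Re (l2_inner M (b \<zeta>) \<zeta>) \<le> 0" unfolding eq by simp
    qed
    then show False using n \<xi> z by (simp add: \<Phi>_zero)
  qed
  ultimately show ?thesis using that[OF cA ceff cf _ \<xi>] by blast
qed

text \<open>By the domination \<open>x v \<mapsto> \<langle>\<Phi>(x) w, E k\<rangle>\<close> is represented by a vector \<open>L k\<close> in the closure of \<open>\<A> v\<close>;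
  uniqueness makes \<open>L\<close> commute with \<open>S\<close>, hence with \<open>\<A>\<close>.\<close>
lemma intertwiner_dominated:
  assumes S: "S \<subseteq> bounded_ops M" "\<And>s. s \<in> S \<Longrightarrow> op_adj M s \<in> S" "\<A> = commutant M (commutant M S)"
    and E: "bounded_map M N E" "\<And>s \<xi>. s \<in> S \<Longrightarrow> \<xi> \<in> L2 M \<Longrightarrow> \<Phi> s (E \<xi>) = E (s \<xi>)"
    and v: "v \<in> L2 M" and w: "w \<in> L2 N" and vw: "\<And>x. x \<in> \<A> \<Longrightarrow> l2_norm N (\<Phi> x w) \<le> l2_norm M (x v)"
    and x: "x \<in> \<A>" and k: "k \<in> L2 M"
  shows "l2_inner N w (E (x k)) = l2_inner N w (\<Phi> x (E k))"
proof -
  have SA: "s \<in> \<A>" if "s \<in> S" for s using subset_bicommutant[OF S(1)] S(3) that by blast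
  define D where "D = (\<lambda>x. x v) ` \<A>"
  \<comment> \<open>Domination makes \<open>x v \<mapsto> \<Phi> x w\<close> well defined, although
    \<open>v\<close> need not separate the elements of \<open>\<A>\<close>.\<close>
  have wd: "\<Phi> x w = \<Phi> y w" if "x \<in> \<A>" "y \<in> \<A>" "x v = y v" for x y
  proof -
    have "op_diff M x y v = l2_zero M"
      using that v \<A>_ops[OF that(2)] by simp
    then have "l2_norm N (\<Phi> (op_diff M x y) w) \<le> 0"
      using vw[OF vN_diff[OF vA that(1,2)]] by simp
    then have "l2_norm N (l2_diff N (\<Phi> x w) (\<Phi> y w)) \<le> 0"
      using w that by (simp add: \<Phi>_diff)
    then have "l2_norm N (l2_diff N (\<Phi> x w) (\<Phi> y w)) = 0"
      by (rule antisym) simp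
    then show ?thesis
      using w \<Phi>_ops that by (meson bounded_ops_in l2_diff_eq_zeroD l2_diff_in l2_norm_eq_0D)
  qed
  define G where "G k d = l2_inner N (\<Phi> (SOME x. x \<in> \<A> \<and> x v = d) w) (E k)" for k d
  have G: "G k (x v) = l2_inner N (\<Phi> x w) (E k)" if "x \<in> \<A>" for x k
  proof -
    have "(SOME y. y \<in> \<A> \<and> y v = x v) \<in> \<A> \<and> (SOME y. y \<in> \<A> \<and> y v = x v) v = x v"
      by (rule someI[of _ x]) (use that in simp)
    then have "\<Phi> (SOME y. y \<in> \<A> \<and> y v = x v) w = \<Phi> x w" using wd that by blast
    then show ?thesis by (simp add: G_def)
  qed
  \<comment> \<open>The last clause puts \<open>u\<close> into the closure of \<open>\<A> v\<close>;
    without it \<open>u\<close> would be determined only up to vectors orthogonal to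
    \<open>\<A> v\<close>.\<close>
  define rep where "rep k u \<longleftrightarrow> u \<in> L2 M \<and> (\<forall>x\<in>\<A>. l2_inner M (x v) u = l2_inner N (\<Phi> x w) (E k)) \<and>
    (\<forall>\<zeta>\<in>L2 M. (\<forall>x\<in>\<A>. l2_inner M (x v) \<zeta> = 0) \<longrightarrow> l2_inner M u \<zeta> = 0)" for k u
  have "\<exists>u. rep k u \<and> l2_norm M u \<le> l2_norm N (E k)" if k: "k \<in> L2 M" for k
  proof (rule Riesz_subspace[of D M "G k" "l2_norm N (E k)"])
    have Ek: "E k \<in> L2 N" using E k by simp
    note cl = vN_add[OF vA] vN_scale[OF vA]
    show "D \<subseteq> L2 M" using \<A>_ops v by (auto simp: D_def)
    show "l2_zero M \<in> D" unfolding D_def using vN_zero[OF vA] v by (intro image_eqI[of _ _ "op_zero M"]) auto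
    fix d assume "d \<in> D"
    then obtain x where x: "x \<in> \<A>" "d = x v" by (auto simp: D_def)
    show "l2_scale M c d \<in> D" for c
      unfolding D_def using x v cl by (intro image_eqI[of _ _ "op_scale M c x"]) auto
    show "G k (l2_scale M c d) = c * G k d" for c
      using G[OF cl(2)[OF x(1)], of k c] G[OF x(1), of k] x v w Ek \<Phi>_ops[OF x(1)] by (simp add: \<Phi>_scale)
    show "cmod (G k d) \<le> l2_norm N (E k) * l2_norm M d"
    proof -
      have "cmod (G k d) \<le> l2_norm N (\<Phi> x w) * l2_norm N (E k)"
        unfolding x(2) G[OF x(1)] using w Ek \<Phi>_ops[OF x(1)] by (intro l2_Cauchy_Schwarz) auto
      also have "\<dots> \<le> l2_norm M d * l2_norm N (E k)" using vw[OF x(1)] x by (intro mult_right_mono) auto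
      finally show ?thesis by (simp add: mult.commute)
    qed
    fix d' assume "d' \<in> D"
    then obtain x' where x': "x' \<in> \<A>" "d' = x' v" by (auto simp: D_def)
    show "l2_add M d d' \<in> D"
      unfolding D_def using x x' v cl by (intro image_eqI[of _ _ "op_add M x x'"]) auto
    show "G k (l2_add M d d') = G k d + G k d'"
      using G[OF cl(1)[OF x(1) x'(1)], of k] G[OF x(1), of k] G[OF x'(1), of k] x x' v w Ek
        \<Phi>_ops[OF x(1)] \<Phi>_ops[OF x'(1)] by (simp add: \<Phi>_add)
  next
    fix u assume u: "u \<in> L2 M" "\<And>\<xi>. \<xi> \<in> D \<Longrightarrow> l2_inner M \<xi> u = G k \<xi>"
      "\<And>\<zeta>. \<zeta> \<in> L2 M \<Longrightarrow> (\<And>\<xi>. \<xi> \<in> D \<Longrightarrow> l2_inner M \<xi> \<zeta> = 0) \<Longrightarrow> l2_inner M u \<zeta> = 0"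
      "l2_norm M u \<le> l2_norm N (E k)"
    have "l2_inner M u \<zeta> = 0" if "\<zeta> \<in> L2 M" "\<forall>x\<in>\<A>. l2_inner M (x v) \<zeta> = 0" for \<zeta>
      using that by (intro u(3)) (auto simp: D_def)
    then have "rep k u" unfolding rep_def using u(1) u(2)[unfolded D_def] G by auto
    then show ?thesis using u(4) by blast
  qed simp
  then obtain L where L: "\<And>k. k \<in> L2 M \<Longrightarrow> rep k (L k)" "\<And>k. k \<in> L2 M \<Longrightarrow> l2_norm M (L k) \<le> l2_norm N (E k)"
    by metis
  have unique: "u = L k" if "rep k u" "k \<in> L2 M" for k u
  proof -
    note u = that(1)[unfolded rep_def] and l = L(1)[OF that(2), unfolded rep_def]
    let ?d = "l2_diff M u (L k)"
    have "\<forall>x\<in>\<A>. l2_inner M (x v) ?d = 0" using u l v \<A>_ops by auto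
    then have "l2_inner M u ?d = 0" "l2_inner M (L k) ?d = 0" using u l by auto
    then have "l2_inner M ?d ?d = 0" using u l by simp
    then have "l2_norm M ?d = 0" by (simp add: l2_inner_self)
    then show ?thesis using u l by (meson l2_diff_eq_zeroD l2_diff_in l2_norm_eq_0D)
  qed
  have LL: "L k \<in> L2 M" if "k \<in> L2 M" for k using L(1)[OF that] by (simp add: rep_def)
  have Lrep: "l2_inner M (x v) (L k) = l2_inner N (\<Phi> x w) (E k)" if "x \<in> \<A>" "k \<in> L2 M" for x k
    using L(1)[OF that(2)] that(1) by (simp add: rep_def)
  have "bounded_map M M L"
  proof -
    obtain K where K: "K > 0" "\<And>\<xi>. \<xi> \<in> L2 M \<Longrightarrow> l2_norm N (E \<xi>) \<le> K * l2_norm M \<xi>"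
      by (rule bounded_map_bound[OF E(1)]) blast
    show ?thesis
    proof (rule bounded_mapI[where K=K])
      show "l2_norm M (L k) \<le> K * l2_norm M k" if "k \<in> L2 M" for k using L(2)[OF that] K(2)[OF that] by simp
      show "L (l2_add M k k') = l2_add M (L k) (L k')" if "k \<in> L2 M" "k' \<in> L2 M" for k k'
      proof (rule unique[symmetric])
        show "rep (l2_add M k k') (l2_add M (L k) (L k'))"
          unfolding rep_def using L(1)[OF that(1)] L(1)[OF that(2)] that v w E(1) \<A>_ops \<Phi>_ops
          by (simp add: rep_def bounded_map_add)
      qed (use that in simp)
      show "L (l2_scale M c k) = l2_scale M c (L k)" if "k \<in> L2 M" for c k
      proof (rule unique[symmetric])
        show "rep (l2_scale M c k) (l2_scale M c (L k))"
          unfolding rep_def using L(1)[OF that(1)] that v w E(1) \<A>_ops \<Phi>_ops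
          by (simp add: rep_def bounded_map_scale)
      qed (use that in simp)
    qed (rule LL)
  qed
  then have LB: "(\<lambda>k\<in>L2 M. L k) \<in> bounded_ops M" by simp
  \<comment> \<open>\<open>\<A> v\<close> is invariant under \<open>s\<close> and its adjoint, so
    \<open>s (L k)\<close> meets the conditions that characterise \<open>L (s k)\<close>.\<close>
  have Ls: "L (s k) = s (L k)" if s: "s \<in> S" and k: "k \<in> L2 M" for s k
  proof (rule unique[symmetric])
    have sB: "s \<in> bounded_ops M" using s S(1) by auto
    have as: "op_adj M s \<in> \<A>" using S(2)[OF s] SA by blast
    show "rep (s k) (s (L k))"
      unfolding rep_def
    proof (intro conjI ballI impI)
      show "s (L k) \<in> L2 M" using sB LL[OF k] by simp
      fix x assume x: "x \<in> \<A>"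
      have "l2_inner M (x v) (s (L k)) = l2_inner M (op_mult M (op_adj M s) x v) (L k)"
        using sB x v LL[OF k] \<A>_ops[OF x] by (simp add: op_adj_inner')
      also have "\<dots> = l2_inner N (\<Phi> (op_mult M (op_adj M s) x) w) (E k)"
        by (rule Lrep[OF vN_mult[OF vA as x] k])
      also have "\<dots> = l2_inner N (\<Phi> x w) (\<Phi> s (E k))"
        using w x k E(1) \<Phi>_ops[OF x] \<Phi>_ops[OF SA[OF s]]
        by (simp add: \<Phi>_mult[OF as x] \<Phi>_adj[OF SA[OF s]] op_adj_inner')
      also have "\<dots> = l2_inner N (\<Phi> x w) (E (s k))" using E(2)[OF s k] by simp
      finally show "l2_inner M (x v) (s (L k)) = l2_inner N (\<Phi> x w) (E (s k))" .
    next
      fix \<zeta> assume z: "\<zeta> \<in> L2 M" "\<forall>x\<in>\<A>. l2_inner M (x v) \<zeta> = 0"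
      have "l2_inner M (x v) (op_adj M s \<zeta>) = 0" if "x \<in> \<A>" for x
        using z(2)[rule_format, OF vN_mult[OF vA SA[OF s] that]] that v z(1) sB \<A>_ops[OF that]
        by (simp add: op_adj_inner)
      then have "l2_inner M (L k) (op_adj M s \<zeta>) = 0"
        using L(1)[OF k] z(1) sB by (simp add: rep_def)
      then show "l2_inner M (s (L k)) \<zeta> = 0" using sB z(1) LL[OF k] by (simp add: op_adj_inner)
    qed
    show "s k \<in> L2 M" using sB k by simp
  qed
  have "(\<lambda>k\<in>L2 M. L k) \<in> commutant M S"
    unfolding commutant_iff[OF S(1)] using LB Ls S(1) LL by (auto simp: subset_iff)
  then have xL: "x (L k) = L (x k)"
    using x k LL \<A>_ops[OF x] unfolding S(3) commutant_iff[OF commutant_subset] by fastforce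
  have xk: "x k \<in> L2 M" using \<A>_ops[OF x] k by simp
  have xa: "op_adj M x \<in> \<A>" by (rule vN_adj[OF vA x])
  \<comment> \<open>With \<open>L\<close> in place of \<open>E\<close> the operator \<open>x\<close>
    can be moved across: it commutes with \<open>L\<close>, and \<open>\<Phi>\<close> respects
    adjoints.\<close>
  have "l2_inner N w (E (x k)) = l2_inner N (\<Phi> (op_id M) w) (E (x k))" using w by (simp add: \<Phi>_id)
  also have "\<dots> = l2_inner M v (L (x k))" using Lrep[OF vN_id[OF vA] xk] v by simp
  also have "\<dots> = l2_inner M (op_adj M x v) (L k)"
    unfolding xL[symmetric] using v k LL \<A>_ops[OF x] by (simp add: op_adj_inner')
  also have "\<dots> = l2_inner N w (\<Phi> x (E k))"
    using Lrep[OF xa k] w k E(1) \<Phi>_ops[OF x] by (simp add: \<Phi>_adj[OF x] op_adj_inner')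
  finally show ?thesis .
qed

text \<open>\<open>R\<close> consists of the vectors that do not distinguish
  \<open>\<Phi> x (E k)\<close> from \<open>E (x k)\<close>. It is a subspace invariant under
  \<open>\<Phi>\<close> and contains every dominated vector. Given \<open>w\<close>, take a maximal
  effect \<open>e\<close> with \<open>\<Phi> e w \<in> R\<close>. Were \<open>1 - e\<close> nonzero,
  it would dominate a nonzero effect \<open>c = d d\<close> below which \<open>\<Phi>\<close> at
  \<open>w\<close> is bounded by a vector functional; then \<open>\<Phi> d w\<close> is dominated,
  \<open>\<Phi> c w \<in> R\<close>, and \<open>e + c\<close> contradicts maximality. So
  \<open>e = 1\<close>, and \<open>R\<close> is the whole space.\<close>

theorem intertwiner_extends:
  assumes S: "S \<subseteq> bounded_ops M" "\<And>s. s \<in> S \<Longrightarrow> op_adj M s \<in> S" "\<A> = commutant M (commutant M S)"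
    and E: "bounded_map M N E" "\<And>s \<xi>. s \<in> S \<Longrightarrow> \<xi> \<in> L2 M \<Longrightarrow> \<Phi> s (E \<xi>) = E (s \<xi>)"
    and x: "x \<in> \<A>" and k: "k \<in> L2 M"
  shows "\<Phi> x (E k) = E (x k)"
proof -
  define R where "R = {w \<in> L2 N. \<forall>x\<in>\<A>. \<forall>k\<in>L2 M. l2_inner N w (E (x k)) = l2_inner N w (\<Phi> x (E k))}"
  have RI: "w \<in> R" if "v \<in> L2 M" "w \<in> L2 N" "\<And>x. x \<in> \<A> \<Longrightarrow> l2_norm N (\<Phi> x w) \<le> l2_norm M (x v)" for v w
    using intertwiner_dominated[OF S E that] that(2) by (simp add: R_def)
  \<comment> \<open>\<open>y\<close> moves across as its adjoint, and the defining identity is used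
    for \<open>y\<^sup>*\<close> and for \<open>y\<^sup>* x\<close>.\<close>
  have R_inv: "\<Phi> y w \<in> R" if y: "y \<in> \<A>" and w: "w \<in> R" for y w
  proof -
    have wL: "w \<in> L2 N" using w by (simp add: R_def)
    have Rw: "l2_inner N w (E (x k)) = l2_inner N w (\<Phi> x (E k))" if "x \<in> \<A>" "k \<in> L2 M" for x k
      using w that by (simp add: R_def)
    have ya: "op_adj M y \<in> \<A>" by (rule vN_adj[OF vA y])
    have "l2_inner N (\<Phi> y w) (E (x k)) = l2_inner N (\<Phi> y w) (\<Phi> x (E k))" if x: "x \<in> \<A>" and k: "k \<in> L2 M" for x k
    proof -
      have Ek: "E k \<in> L2 N" "E (x k) \<in> L2 N" "x k \<in> L2 M" using E(1) k \<A>_ops[OF x] by auto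
      have "l2_inner N (\<Phi> y w) (E (x k)) = l2_inner N w (\<Phi> (op_adj M y) (E (x k)))"
        using wL Ek \<Phi>_ops[OF y] by (simp add: \<Phi>_adj[OF y] op_adj_inner)
      also have "\<dots> = l2_inner N w (E (op_mult M (op_adj M y) x k))"
        using Rw[OF ya Ek(3)] k by simp
      also have "\<dots> = l2_inner N w (\<Phi> (op_mult M (op_adj M y) x) (E k))"
        by (rule Rw[OF vN_mult[OF vA ya x] k])
      also have "\<dots> = l2_inner N (\<Phi> y w) (\<Phi> x (E k))"
        using wL Ek \<Phi>_ops[OF y] \<Phi>_ops[OF x] by (simp add: \<Phi>_mult[OF ya x] \<Phi>_adj[OF y] op_adj_inner)
      finally show ?thesis .
    qed
    then show ?thesis using wL \<Phi>_ops[OF y] by (simp add: R_def)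
  qed
  have "w \<in> R" if z: "w \<in> L2 N" for w
  proof -
    define Q where "Q = {e \<in> \<A>. effect M e \<and> \<Phi> e w \<in> R}"
    obtain e where e: "e \<in> Q" "\<And>b. b \<in> Q \<Longrightarrow> op_le M e b \<Longrightarrow> b = e"
    proof (rule maximal_effect[of Q])
      show "op_zero M \<in> Q"
        using vN_zero[OF vA] effect_zero[of M] z E(1) \<A>_ops \<Phi>_ops by (simp add: Q_def \<Phi>_zero R_def)
      fix C T assume C: "op_chain M C" "C \<subseteq> Q" and T: "T \<in> \<A>" "effect M T"
        and lim: "\<And>\<xi> \<eta>. \<xi> \<in> L2 N \<Longrightarrow> \<eta> \<in> L2 N \<Longrightarrow> ((\<lambda>c. l2_inner N (\<Phi> c \<xi>) \<eta>) \<longlongrightarrow> l2_inner N (\<Phi> T \<xi>) \<eta>) (chain_filter M C)"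
      have "l2_inner N (\<Phi> T w) (E (x k)) = l2_inner N (\<Phi> T w) (\<Phi> x (E k))" if "x \<in> \<A>" "k \<in> L2 M" for x k
      proof (rule tendsto_unique[OF chain_filter_ne_bot[OF C(1)]])
        show "((\<lambda>c. l2_inner N (\<Phi> c w) (E (x k))) \<longlongrightarrow> l2_inner N (\<Phi> T w) (E (x k))) (chain_filter M C)"
          using that \<A>_ops E(1) z by (intro lim) auto
        have "((\<lambda>c. l2_inner N (\<Phi> c w) (\<Phi> x (E k))) \<longlongrightarrow> l2_inner N (\<Phi> T w) (\<Phi> x (E k))) (chain_filter M C)"
          using that \<Phi>_ops E(1) z by (intro lim) auto
        then show "((\<lambda>c. l2_inner N (\<Phi> c w) (E (x k))) \<longlongrightarrow> l2_inner N (\<Phi> T w) (\<Phi> x (E k))) (chain_filter M C)"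
          by (rule Lim_transform_eventually)
            (rule eventually_chain_filter_in[OF C(1)], use that C(2) in \<open>auto simp: Q_def R_def\<close>)
      qed
      then show "T \<in> Q" using T z \<Phi>_ops by (simp add: Q_def R_def)
    qed (auto simp: Q_def)
    have eA: "e \<in> \<A>" "effect M e" "\<Phi> e w \<in> R" using e(1) by (auto simp: Q_def)
    define f where "f = op_diff M (op_id M) e"
    have fA: "f \<in> \<A>" using eA by (simp add: f_def vN_diff[OF vA] vN_id[OF vA])
    have fp: "pos_op M f"
      using op_le_iff_pos[OF effect_pos[OF eA(2)] pos_op_id] eA(2) by (simp add: f_def effect_def)
    have "op_le M f (op_id M)"
      using pos_op_nonneg[OF effect_pos[OF eA(2)]] \<A>_ops[OF eA(1)] by (auto simp: op_le_def f_def)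
    then have feff: "effect M f" using fp by (simp add: effect_def)
    have "f = op_zero M"
    proof (rule ccontr)
      assume "f \<noteq> op_zero M"
      then obtain c \<xi> where c: "c \<in> \<A>" "effect M c" "op_le M c f" "c \<noteq> op_zero M" and \<xi>: "\<xi> \<in> L2 M"
        and dom: "\<And>b. b \<in> \<A> \<Longrightarrow> pos_op M b \<Longrightarrow> op_le M b c \<Longrightarrow> Re (l2_inner N (\<Phi> b w) w) \<le> Re (l2_inner M (b \<xi>) \<xi>)"
        using dominated_effect[OF fA feff _ z] by metis
      obtain d where d: "pos_op M d" "d \<in> \<A>" "op_mult M d d = c" by (rule vN_sqrt[OF vA effect_pos[OF c(2)] c(1)])
      have dB: "d \<in> bounded_ops M" using d by simp
      have dw: "\<Phi> d w \<in> L2 N" using \<Phi>_ops[OF d(2)] z by simp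
      have "\<Phi> d w \<in> R"
      proof (rule RI[of "d \<xi>"])
        fix x assume x: "x \<in> \<A>"
        obtain K where K: "K > 0" "\<And>\<zeta>. \<zeta> \<in> L2 M \<Longrightarrow> l2_norm M (x \<zeta>) \<le> K * l2_norm M \<zeta>"
          by (rule bounded_map_bound[OF bounded_ops_map[OF \<A>_ops[OF x]]]) blast
        let ?y = "op_mult M x d"
        \<comment> \<open>The square of the modulus of \<open>x d\<close>, scaled so that it lies
          below \<open>c\<close>: \<open>\<parallel>x d \<zeta>\<parallel>\<^sup>2 \<le> K\<^sup>2
          \<parallel>d \<zeta>\<parallel>\<^sup>2 = K\<^sup>2 \<langle>c \<zeta>,
          \<zeta>\<rangle>\<close>. The factor \<open>1 / K\<^sup>2\<close> cancels in the resulting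
          inequality between norms.\<close>
        let ?b = "op_scale M (of_real (1 / K\<^sup>2)) (op_mult M (op_adj M ?y) ?y)"
        have yA: "?y \<in> \<A>" by (rule vN_mult[OF vA x d(2)])
        have yB: "?y \<in> bounded_ops M" by (rule \<A>_ops[OF yA])
        have yyA: "op_mult M (op_adj M ?y) ?y \<in> \<A>" by (rule vN_mult[OF vA vN_adj[OF vA yA] yA])
        have bq: "l2_inner M (?b \<zeta>) \<zeta> = of_real ((l2_norm M (x (d \<zeta>)))\<^sup>2 / K\<^sup>2)" if "\<zeta> \<in> L2 M" for \<zeta>
          using that yB dB \<A>_ops[OF x] by (simp add: op_adj_inner' l2_inner_self)
        have "Re (l2_inner N (\<Phi> ?b w) w) \<le> Re (l2_inner M (?b \<xi>) \<xi>)"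
        proof (rule dom)
          show "?b \<in> \<A>" by (rule vN_scale[OF vA yyA])
          show "pos_op M ?b" by (rule pos_opI[OF _ bq]) (use \<A>_ops[OF yyA] in auto)
          show "op_le M ?b c"
            unfolding op_le_def
          proof
            fix \<zeta> assume \<zeta>: "\<zeta> \<in> L2 M"
            have "l2_norm M (x (d \<zeta>)) \<le> K * l2_norm M (d \<zeta>)" using K(2) dB \<zeta> by simp
            then have "(l2_norm M (x (d \<zeta>)))\<^sup>2 \<le> (K * l2_norm M (d \<zeta>))\<^sup>2" by (rule power_mono) simp
            then have "(l2_norm M (x (d \<zeta>)))\<^sup>2 / K\<^sup>2 \<le> (l2_norm M (d \<zeta>))\<^sup>2"
              using K(1) by (simp add: power_mult_distrib field_simps)
            also have "(l2_norm M (d \<zeta>))\<^sup>2 = Re (l2_inner M (c \<zeta>) \<zeta>)"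
              using \<zeta> dB pos_op_symmetric[OF d(1), of "d \<zeta>" \<zeta>] by (simp add: d(3)[symmetric] l2_norm_sq)
            finally show "Re (l2_inner M (?b \<zeta>) \<zeta>) \<le> Re (l2_inner M (c \<zeta>) \<zeta>)" using bq[OF \<zeta>] by simp
          qed
        qed
        moreover have "l2_inner N (\<Phi> ?b w) w = of_real ((l2_norm N (\<Phi> x (\<Phi> d w)))\<^sup>2 / K\<^sup>2)"
          using z dw \<Phi>_ops[OF yA] \<Phi>_ops[OF x] yyA yA vN_adj[OF vA yA] x d(2)
          by (simp add: \<Phi>_scale \<Phi>_mult \<Phi>_adj op_adj_inner' l2_inner_self)
        ultimately have "(l2_norm N (\<Phi> x (\<Phi> d w)))\<^sup>2 / K\<^sup>2 \<le> (l2_norm M (x (d \<xi>)))\<^sup>2 / K\<^sup>2"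
          using bq[OF \<xi>] by simp
        then have "(l2_norm N (\<Phi> x (\<Phi> d w)))\<^sup>2 \<le> (l2_norm M (x (d \<xi>)))\<^sup>2"
          using K(1) by (simp add: divide_le_cancel)
        then show "l2_norm N (\<Phi> x (\<Phi> d w)) \<le> l2_norm M (x (d \<xi>))" by (rule power2_le_imp_le) simp
      qed (use dB \<xi> dw in auto)
      then have "\<Phi> d (\<Phi> d w) \<in> R" by (rule R_inv[OF d(2)])
      then have cR: "\<Phi> c w \<in> R" using z d by (simp add: d(3)[symmetric] \<Phi>_mult)
      let ?s = "op_add M e c"
      have "?s \<in> Q"
      proof -
        have sA: "?s \<in> \<A>" by (rule vN_add[OF vA eA(1) c(1)])
        have "pos_op M ?s" using eA c by (simp add: pos_op_add)
        moreover have "op_le M ?s (op_id M)"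
          using c(3) \<A>_ops[OF eA(1)] \<A>_ops[OF c(1)] by (auto simp: op_le_def f_def algebra_simps)
        moreover have "\<Phi> ?s w \<in> R"
          using cR eA(3) z E(1) \<A>_ops \<Phi>_ops by (auto simp: \<Phi>_add[OF eA(1) c(1)] R_def)
        ultimately show ?thesis using sA by (simp add: Q_def effect_def)
      qed
      moreover have "op_le M e ?s"
        using pos_op_nonneg[OF effect_pos[OF c(2)]] \<A>_ops[OF eA(1)] \<A>_ops[OF c(1)] by (auto simp: op_le_def)
      ultimately have eq: "?s = e" by (rule e(2))
      have "c = op_zero M"
      proof (rule pos_op_eq_zero[OF effect_pos[OF c(2)]])
        fix \<zeta> assume "\<zeta> \<in> L2 M"
        then have "l2_inner M (?s \<zeta>) \<zeta> = l2_inner M (e \<zeta>) \<zeta> + l2_inner M (c \<zeta>) \<zeta>"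
          using \<A>_ops[OF eA(1)] \<A>_ops[OF c(1)] by simp
        then show "Re (l2_inner M (c \<zeta>) \<zeta>) \<le> 0" unfolding eq by simp
      qed
      then show False using c(4) by simp
    qed
    have "e = op_id M"
    proof (rule bounded_ops_eqI[OF \<A>_ops[OF eA(1)] op_id_in])
      fix \<zeta> assume \<zeta>: "\<zeta> \<in> L2 M"
      have "l2_diff M \<zeta> (e \<zeta>) = l2_zero M"
        using \<open>f = op_zero M\<close> op_apply(6)[OF \<zeta>, of "op_id M" e] \<zeta> by (simp add: f_def)
      from l2_diff_eq_zeroD[OF \<zeta> _ this] show "e \<zeta> = op_id M \<zeta>"
        using \<zeta> \<A>_ops[OF eA(1)] by simp
    qed
    then show ?thesis using eA(3) z by (simp add: \<Phi>_id)
  qed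
  then show ?thesis
    using x k E(1) \<A>_ops[OF x] \<Phi>_ops[OF x] by (intro l2_eqI'[of _ N]) (auto simp: R_def)
qed

end

section \<open>Continuous functions with compact support on a locally compact group\<close>

lemma continuous_map_compose1:
  "continuous_map X euclidean f \<Longrightarrow> continuous_on UNIV h \<Longrightarrow> continuous_map X euclidean (\<lambda>x. h (f x))"
  using continuous_map_compose[of X euclidean f euclidean h] by (simp add: o_def)

lemma continuous_map_compose2:
  assumes "continuous_map X euclidean f" "continuous_map X euclidean g" "continuous_on UNIV (\<lambda>(a, b). h a b)"
  shows "continuous_map X euclidean (\<lambda>x. h (f x) (g x))"
proof -
  have "continuous_map X euclidean (\<lambda>x. (f x, g x))"
    using continuous_map_pairedI[OF assms(1,2)] by (simp add: euclidean_product_topology)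
  from continuous_map_compose1[OF this assms(3)] show ?thesis by simp
qed

lemma continuous_map_metricI:
  fixes f :: "'a \<Rightarrow> 'b :: metric_space"
  assumes "\<And>x e. x \<in> topspace X \<Longrightarrow> e > 0 \<Longrightarrow> \<exists>U. openin X U \<and> x \<in> U \<and> (\<forall>y\<in>U. dist (f y) (f x) < e)"
  shows "continuous_map X euclidean f"
  unfolding continuous_map_def
proof (intro conjI allI impI)
  fix V :: "'b set" assume "openin euclidean V"
  then have V: "open V" by simp
  show "openin X {x \<in> topspace X. f x \<in> V}"
  proof (subst openin_subopen, intro ballI)
    fix x assume x: "x \<in> {x \<in> topspace X. f x \<in> V}"
    then obtain e where e: "e > 0" "\<And>z. dist z (f x) < e \<Longrightarrow> z \<in> V" using V unfolding open_dist by blast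
    obtain U where U: "openin X U" "x \<in> U" "\<forall>y\<in>U. dist (f y) (f x) < e" using assms[of x e] x e by blast
    then show "\<exists>U. openin X U \<and> x \<in> U \<and> U \<subseteq> {x \<in> topspace X. f x \<in> V}"
      using e openin_subset by (intro exI[of _ U]) blast
  qed
qed simp

context locally_compact_group
begin

lemma openin_carrier: "openin T U \<Longrightarrow> U \<subseteq> carrier G"
  using openin_subset topspace_eq by blast

lemma compactin_carrier: "compactin T K \<Longrightarrow> K \<subseteq> carrier G"
  using compactin_subset_topspace topspace_eq by blast

lemma compactin_closedin: "compactin T K \<Longrightarrow> closedin T K"
  using hausdorff by (rule compactin_imp_closedin)

lemma continuous_left_mult: "g \<in> carrier G \<Longrightarrow> continuous_map T T (\<lambda>x. g \<otimes> x)"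
  using continuous_map_compose[OF continuous_map_pairedI[of T T "\<lambda>_. g" T "\<lambda>x. x"] continuous_mult]
  by (simp add: o_def topspace_eq)

lemma openin_left_mult:
  assumes "openin T U" "g \<in> carrier G" shows "openin T {x \<in> carrier G. g \<otimes> x \<in> U}"
  using openin_continuous_map_preimage[OF continuous_left_mult[OF assms(2)] assms(1)] by (simp add: topspace_eq)

lemma openin_inv:
  assumes "openin T U" shows "openin T {x \<in> carrier G. inv x \<in> U}"
  using openin_continuous_map_preimage[OF continuous_inv assms] by (simp add: topspace_eq)

lemma l_coset_eq_preimage:
  assumes "g \<in> carrier G" "U \<subseteq> carrier G" shows "g <# U = {x \<in> carrier G. inv g \<otimes> x \<in> U}"
proof -
  have "x \<in> g <# U" if "x \<in> carrier G" "inv g \<otimes> x \<in> U" for x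
    using that assms unfolding l_coset_def by (auto intro!: bexI[of _ "inv g \<otimes> x"] simp: m_assoc[symmetric])
  moreover have "x \<in> carrier G" "inv g \<otimes> x \<in> U" if "x \<in> g <# U" for x
    using that assms by (auto simp: l_coset_def m_assoc[symmetric] subset_iff)
  ultimately show ?thesis by blast
qed

lemma openin_l_coset: "openin T U \<Longrightarrow> g \<in> carrier G \<Longrightarrow> openin T (g <# U)"
  using l_coset_eq_preimage[OF _ openin_carrier] openin_left_mult[of U "inv g"] by simp

lemma compactin_mult:
  assumes "compactin T K" "compactin T L" shows "compactin T ((\<lambda>(x, y). x \<otimes> y) ` (K \<times> L))"
  using assms by (intro image_compactin[OF _ continuous_mult]) (simp add: compactin_Times)

lemma cs_I:
  assumes "continuous_map T euclidean f" "compactin T K" "\<And>x. x \<in> carrier G \<Longrightarrow> x \<notin> K \<Longrightarrow> f x = 0"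
  shows "f \<in> compactly_supported T"
proof -
  have "Abstract_Topology.closure_of T {x \<in> topspace T. f x \<noteq> 0} \<subseteq> K"
    using assms compactin_closedin[OF assms(2)] by (intro closure_of_minimal) (auto simp: topspace_eq)
  from closed_compactin[OF assms(2) this closedin_closure_of]
  have "compactin T (Abstract_Topology.closure_of T {x \<in> topspace T. f x \<noteq> 0})" .
  then show ?thesis using assms(1) by (simp add: compactly_supported_def)
qed

lemma cs_E:
  assumes "f \<in> compactly_supported T"
  obtains K where "compactin T K" "\<And>x. x \<in> carrier G \<Longrightarrow> x \<notin> K \<Longrightarrow> f x = 0"
proof -
  let ?S = "{x \<in> topspace T. f x \<noteq> 0}"
  have "?S \<subseteq> Abstract_Topology.closure_of T ?S" by (rule closure_of_subset) auto
  moreover have "compactin T (Abstract_Topology.closure_of T ?S)" using assms by (simp add: compactly_supported_def)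
  ultimately show ?thesis using that topspace_eq by blast
qed

lemma cs_continuous: "f \<in> compactly_supported T \<Longrightarrow> continuous_map T euclidean f"
  by (simp add: compactly_supported_def)

text \<open>Functions are total on the type while group identities hold on the carrier only; this
  exchanges formulas that agree there.\<close>

lemma cs_cong:
  assumes f: "f \<in> compactly_supported T" and "\<And>x. x \<in> carrier G \<Longrightarrow> f x = g x"
  shows "g \<in> compactly_supported T"
proof -
  obtain K where K: "compactin T K" "\<And>x. x \<in> carrier G \<Longrightarrow> x \<notin> K \<Longrightarrow> f x = 0" by (rule cs_E[OF f]) blast
  have "continuous_map T euclidean g"
    by (rule continuous_map_eq[OF cs_continuous[OF f]]) (simp add: assms(2) topspace_eq)
  then show ?thesis by (rule cs_I[OF _ K(1)]) (use K(2) assms(2) in metis)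
qed

lemma cs_compose1:
  assumes "f \<in> compactly_supported T" "continuous_on UNIV h" "h 0 = 0"
  shows "(\<lambda>x. h (f x)) \<in> compactly_supported T"
proof -
  obtain K where "compactin T K" "\<And>x. x \<in> carrier G \<Longrightarrow> x \<notin> K \<Longrightarrow> f x = 0" by (rule cs_E[OF assms(1)]) blast
  then show ?thesis
    using continuous_map_compose1[OF cs_continuous[OF assms(1)] assms(2)] assms(3) by (intro cs_I[of _ K]) auto
qed

lemma cs_compose2:
  assumes "f \<in> compactly_supported T" "g \<in> compactly_supported T" "continuous_on UNIV (\<lambda>(a, b). h a b)" "h 0 0 = 0"
  shows "(\<lambda>x. h (f x) (g x)) \<in> compactly_supported T"
proof -
  obtain K where K: "compactin T K" "\<And>x. x \<in> carrier G \<Longrightarrow> x \<notin> K \<Longrightarrow> f x = 0" by (rule cs_E[OF assms(1)]) blast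
  obtain L where L: "compactin T L" "\<And>x. x \<in> carrier G \<Longrightarrow> x \<notin> L \<Longrightarrow> g x = 0" by (rule cs_E[OF assms(2)]) blast
  show ?thesis
  proof (rule cs_I)
    show "continuous_map T euclidean (\<lambda>x. h (f x) (g x))"
      by (rule continuous_map_compose2[OF cs_continuous[OF assms(1)] cs_continuous[OF assms(2)] assms(3)])
    show "compactin T (K \<union> L)" by (rule compactin_Un[OF K(1) L(1)])
    show "h (f x) (g x) = 0" if "x \<in> carrier G" "x \<notin> K \<union> L" for x
      using K(2)[of x] L(2)[of x] that assms(4) by simp
  qed
qed

lemma cs_cmod_power: "f \<in> compactly_supported T \<Longrightarrow> n > 0 \<Longrightarrow> (\<lambda>x. of_real (cmod (f x) ^ n)) \<in> compactly_supported T"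
  by (rule cs_compose1[where h="\<lambda>z. of_real (cmod z ^ n)"]) (auto intro!: continuous_intros)

lemma cs_cmod: "f \<in> compactly_supported T \<Longrightarrow> (\<lambda>x. of_real (cmod (f x))) \<in> compactly_supported T"
  using cs_cmod_power[of f 1] by simp

lemma cs_diff: "f \<in> compactly_supported T \<Longrightarrow> g \<in> compactly_supported T \<Longrightarrow> (\<lambda>x. f x - g x) \<in> compactly_supported T"
  by (rule cs_compose2[where h="\<lambda>a b. a - b"]) (auto simp: case_prod_unfold intro!: continuous_intros)

lemma cs_add: "f \<in> compactly_supported T \<Longrightarrow> g \<in> compactly_supported T \<Longrightarrow> (\<lambda>x. f x + g x) \<in> compactly_supported T"
  by (rule cs_compose2[where h="\<lambda>a b. a + b"]) (auto simp: case_prod_unfold intro!: continuous_intros)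

lemma cs_mult: "f \<in> compactly_supported T \<Longrightarrow> g \<in> compactly_supported T \<Longrightarrow> (\<lambda>x. f x * g x) \<in> compactly_supported T"
  by (rule cs_compose2[where h="\<lambda>a b. a * b"]) (auto simp: case_prod_unfold intro!: continuous_intros)

lemma cs_scale: "f \<in> compactly_supported T \<Longrightarrow> (\<lambda>x. c * f x) \<in> compactly_supported T"
  by (rule cs_compose1[where h="\<lambda>a. c * a"]) (auto intro!: continuous_intros)

lemma cs_zero: "(\<lambda>x. 0) \<in> compactly_supported T"
  by (rule cs_I[of _ "{}"]) auto

lemma cs_homeo:
  assumes f: "f \<in> compactly_supported T" and p: "continuous_map T T p" and q: "continuous_map T T q"
    and pq: "\<And>x. x \<in> carrier G \<Longrightarrow> q (p x) = x"
  shows "(\<lambda>x. f (p x)) \<in> compactly_supported T"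
proof -
  obtain K where K: "compactin T K" "\<And>x. x \<in> carrier G \<Longrightarrow> x \<notin> K \<Longrightarrow> f x = 0" by (rule cs_E[OF f]) blast
  have pc: "p x \<in> carrier G" if "x \<in> carrier G" for x
    using p that by (auto simp: continuous_map_def topspace_eq)
  show ?thesis
  proof (rule cs_I)
    show "continuous_map T euclidean (\<lambda>x. f (p x))"
      using continuous_map_compose[OF p cs_continuous[OF f]] by (simp add: o_def)
    show "compactin T (q ` K)" by (rule image_compactin[OF K(1) q])
    fix x assume "x \<in> carrier G" "x \<notin> q ` K"
    then show "f (p x) = 0" using pq[of x] by (intro K(2) pc) (auto simp: image_iff)
  qed
qed

lemma cs_inv: "f \<in> compactly_supported T \<Longrightarrow> (\<lambda>x. f (inv x)) \<in> compactly_supported T"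
  by (rule cs_homeo[OF _ continuous_inv continuous_inv]) auto

lemma cs_left_mult:
  assumes "f \<in> compactly_supported T" "g \<in> carrier G" shows "(\<lambda>x. f (g \<otimes> x)) \<in> compactly_supported T"
  using assms by (intro cs_homeo[OF assms(1) continuous_left_mult continuous_left_mult[of "inv g"]]) (auto simp: m_assoc[symmetric])

lemma cs_inv_mult:
  assumes f: "f \<in> compactly_supported T" and x: "x \<in> carrier G"
  shows "(\<lambda>y. f (inv y \<otimes> x)) \<in> compactly_supported T"
proof -
  have "(\<lambda>y. f (inv (inv x \<otimes> y))) \<in> compactly_supported T"
    using x by (intro cs_left_mult[OF cs_inv[OF f]]) simp
  then show ?thesis by (rule cs_cong) (use x in \<open>simp add: inv_mult_group\<close>)
qed

lemma cs_bounded: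
  assumes "f \<in> compactly_supported T"
  obtains B where "B \<ge> 0" "\<And>x. x \<in> carrier G \<Longrightarrow> cmod (f x) \<le> B"
proof -
  obtain K where K: "compactin T K" "\<And>x. x \<in> carrier G \<Longrightarrow> x \<notin> K \<Longrightarrow> f x = 0" by (rule cs_E[OF assms]) blast
  have "compact (f ` K)" using image_compactin[OF K(1) cs_continuous[OF assms]] by simp
  then obtain B where B: "\<And>z. z \<in> f ` K \<Longrightarrow> norm z \<le> B" by (metis compact_imp_bounded bounded_iff)
  have "cmod (f x) \<le> max B 0" if "x \<in> carrier G" for x
    using B[of "f x"] K(2)[OF that] by (cases "x \<in> K") auto
  then show ?thesis using that[of "max B 0"] by simp
qed

text \<open>The difference vanishes on the compact set \<open>K \<times> {\<one>}\<close>, so the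
  tube lemma gives one neighbourhood of \<open>\<one>\<close> for all points of
  \<open>K\<close>.\<close>

lemma uniform_continuity_right:
  assumes f: "f \<in> compactly_supported T" and "e > 0"
  obtains U where "openin T U" "\<one> \<in> U" "\<And>x u. x \<in> carrier G \<Longrightarrow> u \<in> U \<Longrightarrow> cmod (f (x \<otimes> u) - f x) < e"
proof -
  obtain K where K: "compactin T K" "\<And>x. x \<in> carrier G \<Longrightarrow> x \<notin> K \<Longrightarrow> f x = 0" by (rule cs_E[OF f]) blast
  let ?F = "\<lambda>p. f (fst p \<otimes> snd p) - f (fst p)"
  have 1: "continuous_map (prod_topology T T) euclidean (\<lambda>p. f (fst p \<otimes> snd p))"
    using continuous_map_compose[OF continuous_mult cs_continuous[OF f]] by (simp add: o_def case_prod_unfold)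
  have 2: "continuous_map (prod_topology T T) euclidean (\<lambda>p. f (fst p))"
    using continuous_map_compose[OF continuous_map_fst cs_continuous[OF f]] by (simp add: o_def)
  have "continuous_map (prod_topology T T) euclidean ?F"
    by (rule continuous_map_compose2[OF 1 2]) (auto simp: case_prod_unfold intro!: continuous_intros)
  then have W: "openin (prod_topology T T) {p \<in> topspace (prod_topology T T). ?F p \<in> ball 0 e}"
    by (rule openin_continuous_map_preimage) simp
  have "K \<times> {\<one>} \<subseteq> {p \<in> topspace (prod_topology T T). ?F p \<in> ball 0 e}"
    using compactin_carrier[OF K(1)] \<open>e > 0\<close> by (auto simp: topspace_eq)
  then obtain U V where UV: "openin T U" "openin T V" "K \<subseteq> U" "\<one> \<in> V"
    "U \<times> V \<subseteq> {p \<in> topspace (prod_topology T T). ?F p \<in> ball 0 e}"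
    using tube_lemma_left[OF W K(1), of "\<one>"] by (auto simp: topspace_eq)
  \<comment> \<open>Symmetry takes care of \<open>x \<notin> K\<close> with
    \<open>x \<otimes> u \<in> K\<close>: the estimate is then used at \<open>x \<otimes> u\<close>
    and \<open>inv u\<close>.\<close>
  define V' where "V' = V \<inter> {x \<in> carrier G. inv x \<in> V}"
  have *: "cmod (f (x \<otimes> u) - f x) < e" if "x \<in> K" "u \<in> V" for x u
  proof -
    have "(x, u) \<in> U \<times> V" using UV(3) that by auto
    then have "?F (x, u) \<in> ball 0 e" using UV(5) by blast
    then show ?thesis by simp
  qed
  show ?thesis
  proof (rule that[of V'])
    show "openin T V'" unfolding V'_def by (intro openin_Int UV openin_inv)
    show "\<one> \<in> V'" using UV by (simp add: V'_def)
    fix x u assume x: "x \<in> carrier G" and u: "u \<in> V'"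
    have uc: "u \<in> carrier G" "u \<in> V" "inv u \<in> V" using u by (auto simp: V'_def)
    consider "x \<in> K" | "x \<notin> K" "x \<otimes> u \<in> K" | "x \<notin> K" "x \<otimes> u \<notin> K" by blast
    then show "cmod (f (x \<otimes> u) - f x) < e"
    proof cases
      case 1 then show ?thesis using * uc by blast
    next
      case 2
      have "cmod (f (x \<otimes> u \<otimes> inv u) - f (x \<otimes> u)) < e" using * 2 uc by blast
      moreover have "x \<otimes> u \<otimes> inv u = x" using x uc by (simp add: m_assoc)
      ultimately show ?thesis by (simp add: norm_minus_commute)
    next
      case 3 then show ?thesis using K(2)[OF x] K(2)[of "x \<otimes> u"] x uc \<open>e > 0\<close> by simp
    qed
  qed
qed

lemma uniform_continuity_left:
  assumes f: "f \<in> compactly_supported T" and "e > 0"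
  obtains U where "openin T U" "\<one> \<in> U" "\<And>x u. x \<in> carrier G \<Longrightarrow> u \<in> U \<Longrightarrow> cmod (f (u \<otimes> x) - f x) < e"
proof -
  obtain U where U: "openin T U" "\<one> \<in> U" "\<And>x u. x \<in> carrier G \<Longrightarrow> u \<in> U \<Longrightarrow> cmod (f (inv (x \<otimes> u)) - f (inv x)) < e"
    by (rule uniform_continuity_right[OF cs_inv[OF f] assms(2)]) blast
  show ?thesis
  proof (rule that[of "{x \<in> carrier G. inv x \<in> U}"])
    fix x u assume "x \<in> carrier G" "u \<in> {x \<in> carrier G. inv x \<in> U}"
    then show "cmod (f (u \<otimes> x) - f x) < e" using U(3)[of "inv x" "inv u"] by (simp add: inv_mult_group)
  qed (use U openin_inv in auto)
qed

lemma completely_regular: "completely_regular_space T"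
  using locally_compact locally_compact_Hausdorff_imp_regular_space hausdorff
    locally_compact_regular_imp_completely_regular_space by blast

text \<open>Finitely many compact neighbourhoods give an open \<open>V\<close> and a compact
  \<open>L\<close> with \<open>K \<subseteq> V \<subseteq> L \<subseteq> U\<close>; separating
  \<open>K\<close> from the complement of \<open>V\<close> confines the support to \<open>L\<close>.
  The separation is that of completely regular spaces, since a locally compact Hausdorff space need
  not be normal.\<close>

lemma Urysohn_compact_support:
  assumes K: "compactin T K" and U: "openin T U" "K \<subseteq> U"
  obtains \<phi> :: "'a \<Rightarrow> real" and L where "(\<lambda>x. complex_of_real (\<phi> x)) \<in> compactly_supported T"
    "compactin T L" "L \<subseteq> U" "\<And>x. x \<in> carrier G \<Longrightarrow> 0 \<le> \<phi> x \<and> \<phi> x \<le> 1"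
    "\<And>x. x \<in> K \<Longrightarrow> \<phi> x = 1" "\<And>x. x \<in> carrier G \<Longrightarrow> x \<notin> L \<Longrightarrow> \<phi> x = 0"
proof -
  have "\<exists>V L. openin T V \<and> compactin T L \<and> K \<subseteq> V \<and> V \<subseteq> L \<and> L \<subseteq> U"
  proof -
    have nb: "neighbourhood_base_of (compactin T) T"
      using locally_compact locally_compact_space_neighbourhood_base hausdorff by blast
    have "\<exists>V L. openin T V \<and> compactin T L \<and> x \<in> V \<and> V \<subseteq> L \<and> L \<subseteq> U" if "x \<in> K" for x
      using nb U that unfolding neighbourhood_base_of by blast
    then obtain V L where VL: "\<And>x. x \<in> K \<Longrightarrow> openin T (V x) \<and> compactin T (L x) \<and> x \<in> V x \<and> V x \<subseteq> L x \<and> L x \<subseteq> U"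
      by metis
    obtain F where F: "finite F" "F \<subseteq> V ` K" "K \<subseteq> \<Union>F"
      using compactinD[OF K, of "V ` K"] VL by blast
    then obtain J where J: "J \<subseteq> K" "finite J" "F = V ` J" by (meson finite_subset_image)
    show ?thesis
    proof (intro exI conjI)
      show "openin T (\<Union>x\<in>J. V x)" using VL J by blast
      show "compactin T (\<Union>x\<in>J. L x)" using VL J by (intro compactin_Union) auto
    qed (use VL J F in blast)+
  qed
  then obtain V L where VL: "openin T V" "compactin T L" "K \<subseteq> V" "V \<subseteq> L" "L \<subseteq> U" by blast
  have "closedin T (topspace T - V)" "disjnt K (topspace T - V)" using VL by (auto simp: disjnt_def)
  then obtain \<phi> :: "'a \<Rightarrow> real" where \<phi>: "continuous_map T (subtopology euclidean {0..1}) \<phi>"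
      "\<phi> ` (topspace T - V) \<subseteq> {0}" "\<phi> ` K \<subseteq> {1}"
    using Urysohn_completely_regular_compact_closed[OF _ completely_regular K, of 0 1] by (metis zero_le_one)
  have z: "\<phi> x = 0" if "x \<in> carrier G" "x \<notin> L" for x using that VL(4) \<phi>(2) unfolding image_subset_iff topspace_eq by blast
  show ?thesis
  proof (rule that[of \<phi> L])
    show "(\<lambda>x. complex_of_real (\<phi> x)) \<in> compactly_supported T"
    proof (rule cs_I[OF _ VL(2)])
      show "continuous_map T euclidean (\<lambda>x. complex_of_real (\<phi> x))"
        using \<phi>(1) by (intro continuous_map_compose1[where h=complex_of_real])
          (auto simp: continuous_map_in_subtopology intro!: continuous_intros)
    qed (use z in simp)
    show "0 \<le> \<phi> x \<and> \<phi> x \<le> 1" if "x \<in> carrier G" for x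
      using \<phi>(1) that by (auto simp: continuous_map_in_subtopology topspace_eq)
  qed (use VL \<phi> z in auto)
qed

end

section \<open>Haar measure\<close>

locale haar_group = locally_compact_group G T for G (structure) and T +
  fixes \<mu> :: "'a measure"
  assumes haar: "left_haar_measure G T \<mu>"
begin

abbreviation "CC \<equiv> compactly_supported T"

lemma radon: "radon_measure T \<mu>" and not_null: "emeasure \<mu> (space \<mu>) \<noteq> 0"
  using haar by (auto simp: left_haar_measure_def)

lemma sets_\<mu>: "sets \<mu> = sets (borel_of T)"
  using radon by (simp add: radon_measure_def)

lemma space_\<mu> [simp]: "space \<mu> = carrier G"
proof -
  have "{U. openin T U} \<subseteq> Pow (topspace T)" using openin_subset by auto
  then have "space (borel_of T) = topspace T" by (simp add: borel_of_def space_measure_of)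
  then show ?thesis using sets_eq_imp_space_eq[OF sets_\<mu>] topspace_eq by simp
qed

lemma sets_\<mu>_sigma: "sets \<mu> = sigma_sets (carrier G) {U. openin T U}"
proof -
  have "{U. openin T U} \<subseteq> Pow (topspace T)" using openin_subset by auto
  then show ?thesis unfolding sets_\<mu> borel_of_def topspace_eq[symmetric] by (rule sets_measure_of)
qed

lemma open_sets: "openin T U \<Longrightarrow> U \<in> sets \<mu>"
  unfolding sets_\<mu>_sigma by (rule sigma_sets.Basic) simp

lemma closed_sets: "closedin T K \<Longrightarrow> K \<in> sets \<mu>"
  using open_sets[of "topspace T - K"] sets.compl_sets[of "topspace T - K" \<mu>]
  by (simp add: closedin_def topspace_eq double_diff)

lemma compact_sets: "compactin T K \<Longrightarrow> K \<in> sets \<mu>"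
  by (intro closed_sets compactin_closedin)

lemma compact_finite: "compactin T K \<Longrightarrow> emeasure \<mu> K < \<infinity>"
  using radon by (auto simp: radon_measure_def)

lemma outer_regular: "A \<in> sets \<mu> \<Longrightarrow> emeasure \<mu> A = (INF U\<in>{U. openin T U \<and> A \<subseteq> U}. emeasure \<mu> U)"
  using radon by (auto simp: radon_measure_def)

lemma inner_regular: "openin T U \<Longrightarrow> emeasure \<mu> U = (SUP K\<in>{K. compactin T K \<and> K \<subseteq> U}. emeasure \<mu> K)"
  using radon by (auto simp: radon_measure_def)

lemma left_invariant: "g \<in> carrier G \<Longrightarrow> A \<in> sets \<mu> \<Longrightarrow> emeasure \<mu> (g <# A) = emeasure \<mu> A"
  using haar by (auto simp: left_haar_measure_def)

lemma continuous_measurable: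
  fixes f :: "'a \<Rightarrow> 'c :: topological_space"
  assumes "continuous_map T euclidean f" shows "f \<in> borel_measurable \<mu>"
proof (rule borel_measurableI)
  fix S :: "'c set" assume "open S"
  then have "openin T {x \<in> topspace T. f x \<in> S}" by (intro openin_continuous_map_preimage[OF assms]) simp
  moreover have "f -` S \<inter> space \<mu> = {x \<in> topspace T. f x \<in> S}" by (auto simp: topspace_eq)
  ultimately show "f -` S \<inter> space \<mu> \<in> sets \<mu>" using open_sets by simp
qed

lemma cs_measurable: "f \<in> CC \<Longrightarrow> f \<in> borel_measurable \<mu>"
  by (intro continuous_measurable cs_continuous)

lemma measurable_left_mult: "g \<in> carrier G \<Longrightarrow> (\<lambda>x. g \<otimes> x) \<in> measurable \<mu> \<mu>"
proof (rule measurable_sigma_sets[OF sets_\<mu>_sigma])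
  assume g: "g \<in> carrier G"
  show "(\<lambda>x. g \<otimes> x) \<in> space \<mu> \<rightarrow> carrier G" using g by auto
  fix U assume "U \<in> {U. openin T U}"
  then have "openin T {x \<in> carrier G. g \<otimes> x \<in> U}" using openin_left_mult g by auto
  moreover have "(\<lambda>x. g \<otimes> x) -` U \<inter> space \<mu> = {x \<in> carrier G. g \<otimes> x \<in> U}" by auto
  ultimately show "(\<lambda>x. g \<otimes> x) -` U \<inter> space \<mu> \<in> sets \<mu>" using open_sets by simp
qed (use openin_carrier in auto)

lemma distr_left_mult:
  assumes g: "g \<in> carrier G" shows "distr \<mu> \<mu> (\<lambda>x. g \<otimes> x) = \<mu>"
proof (rule measure_eqI)
  fix A assume "A \<in> sets (distr \<mu> \<mu> (\<lambda>x. g \<otimes> x))"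
  then have A: "A \<in> sets \<mu>" by simp
  then have "A \<subseteq> carrier G" using sets.sets_into_space by fastforce
  then have "(\<lambda>x. g \<otimes> x) -` A \<inter> space \<mu> = inv g <# A"
    using l_coset_eq_preimage[of "inv g" A] g by auto
  then show "emeasure (distr \<mu> \<mu> (\<lambda>x. g \<otimes> x)) A = emeasure \<mu> A"
    using A g by (simp add: emeasure_distr[OF measurable_left_mult[OF g]] left_invariant)
qed simp

lemma integral_left_mult:
  fixes f :: "'a \<Rightarrow> 'c :: {banach, second_countable_topology}"
  assumes "g \<in> carrier G" "f \<in> borel_measurable \<mu>"
  shows "(\<integral>x. f (g \<otimes> x) \<partial>\<mu>) = (\<integral>x. f x \<partial>\<mu>)"
  using integral_distr[OF measurable_left_mult[OF assms(1)] assms(2)] by (simp add: distr_left_mult assms(1))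

lemma integrable_left_mult:
  fixes f :: "'a \<Rightarrow> 'c :: {banach, second_countable_topology}"
  assumes "g \<in> carrier G" "integrable \<mu> f"
  shows "integrable \<mu> (\<lambda>x. f (g \<otimes> x))"
  using integrable_distr[OF measurable_left_mult[OF assms(1)], of f] assms by (simp add: distr_left_mult)

lemma AE_left_mult:
  assumes "g \<in> carrier G" "AE x in \<mu>. P x" shows "AE x in \<mu>. P (g \<otimes> x)"
  by (rule AE_distrD[OF measurable_left_mult[OF assms(1)]]) (use assms(2) in \<open>simp only: distr_left_mult[OF assms(1)]\<close>)

lemma cs_L2: "f \<in> CC \<Longrightarrow> f \<in> L2_fun \<mu>"
  and cs_integrable: "f \<in> CC \<Longrightarrow> integrable \<mu> f"
proof -
  have *: "integrable \<mu> f" if f: "f \<in> CC" for f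
  proof -
    obtain K where K: "compactin T K" "\<And>x. x \<in> carrier G \<Longrightarrow> x \<notin> K \<Longrightarrow> f x = 0" by (rule cs_E[OF f]) blast
    obtain B where B: "B \<ge> 0" "\<And>x. x \<in> carrier G \<Longrightarrow> cmod (f x) \<le> B" by (rule cs_bounded[OF f]) blast
    have "integrable \<mu> (\<lambda>x. B * indicator K x)"
      using compact_finite[OF K(1)] compact_sets[OF K(1)] by (intro integrable_mult_right) auto
    then show ?thesis
      by (rule Bochner_Integration.integrable_bound[OF _ cs_measurable[OF f]])
        (use K(2) B in \<open>auto intro!: AE_I2 simp: indicator_def\<close>)
  qed
  then show "f \<in> CC \<Longrightarrow> integrable \<mu> f" .
  assume f: "f \<in> CC"
  have "integrable \<mu> (\<lambda>x. Re (of_real ((cmod (f x))\<^sup>2)))"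
    by (intro integrable_Re * cs_cmod_power f) simp
  then show "f \<in> L2_fun \<mu>" using cs_measurable[OF f] by (simp add: L2_fun_def)
qed

text \<open>If a nonempty open set were null, finitely many of its translates would cover each
  compact set, and inner regularity of the whole space would make the measure zero.\<close>

lemma open_pos:
  assumes U: "openin T U" "U \<noteq> {}" shows "emeasure \<mu> U > 0"
proof (rule ccontr)
  assume "\<not> emeasure \<mu> U > 0"
  then have 0: "emeasure \<mu> U = 0" by simp
  obtain u where u: "u \<in> U" "u \<in> carrier G" using U openin_carrier by blast
  have cov: "\<exists>g\<in>carrier G. x \<in> g <# U" if "x \<in> carrier G" for x
    using that u by (intro bexI[of _ "x \<otimes> inv u"]) (auto simp: l_coset_def m_assoc intro!: bexI[of _ u])
  have "emeasure \<mu> K = 0" if K: "compactin T K" for K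
  proof -
    let ?C = "(\<lambda>g. g <# U) ` carrier G"
    have "K \<subseteq> \<Union>?C" using cov compactin_carrier[OF K] by blast
    then obtain F where F: "finite F" "F \<subseteq> ?C" "K \<subseteq> \<Union>F"
      using compactinD[OF K, of ?C] openin_l_coset[OF U(1)] by blast
    have "V \<in> null_sets \<mu>" if "V \<in> F" for V
      using that F(2) 0 U(1) by (auto intro!: null_setsI simp: left_invariant open_sets openin_l_coset)
    then have "\<Union>F \<in> null_sets \<mu>" using F(1) by (intro null_sets_UN'[of F "\<lambda>x. x", simplified]) (auto intro: countable_finite)
    from null_sets_subset[OF this compact_sets[OF K] F(3)] show ?thesis by (rule null_setsD1)
  qed
  then have "emeasure \<mu> (topspace T) = 0" by (subst inner_regular) (auto simp: SUP_constant bot_ennreal)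
  then show False using not_null by (simp add: topspace_eq)
qed

end

section \<open>Density of continuous functions with compact support\<close>

lemma norm_integral_le:
  fixes f :: "'a \<Rightarrow> 'b :: {banach, second_countable_topology}"
  assumes "integrable M f" "integrable M g" "\<And>x. x \<in> space M \<Longrightarrow> norm (f x) \<le> g x"
  shows "norm (\<integral>x. f x \<partial>M) \<le> (\<integral>x. g x \<partial>M)"
proof -
  have "norm (\<integral>x. f x \<partial>M) \<le> (\<integral>x. norm (f x) \<partial>M)" by (rule integral_norm_bound)
  also have "\<dots> \<le> (\<integral>x. g x \<partial>M)" using assms by (intro integral_mono) auto
  finally show ?thesis .
qed

text \<open>Cuts a finite cover by translates into disjoint measurable pieces, on which
  \<open>integral_conv\<close> takes its samples.\<close>

lemma finite_disjoint_refinement: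
  assumes "finite J" "\<And>j. j \<in> J \<Longrightarrow> A j \<in> sets M"
  shows "\<exists>B. (\<forall>j\<in>J. B j \<in> sets M \<and> B j \<subseteq> A j) \<and> (\<Union>j\<in>J. B j) = (\<Union>j\<in>J. A j) \<and> disjoint_family_on B J"
  using assms
proof (induction J rule: finite_induct)
  case empty
  then show ?case by (simp add: disjoint_family_on_def)
next
  case (insert k J)
  then obtain B where B: "\<And>j. j \<in> J \<Longrightarrow> B j \<in> sets M \<and> B j \<subseteq> A j" "(\<Union>j\<in>J. B j) = (\<Union>j\<in>J. A j)" "disjoint_family_on B J"
    by auto
  define B' where "B' = B(k := A k - (\<Union>j\<in>J. A j))"
  have "A k - (\<Union>j\<in>J. A j) \<in> sets M" using insert by auto
  then have sets: "\<forall>j\<in>insert k J. B' j \<in> sets M \<and> B' j \<subseteq> A j" using B(1) by (auto simp: B'_def)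
  have BJ: "(\<Union>j\<in>J. B' j) = (\<Union>j\<in>J. A j)" using B(2) insert.hyps by (auto simp: B'_def)
  have "disjoint_family_on B' (insert k J)"
  proof -
    have k: "B' k \<inter> B' j = {}" if "j \<in> J" for j
    proof -
      have "j \<noteq> k" using that insert.hyps by auto
      then show ?thesis using B(1)[OF that] that by (auto simp: B'_def)
    qed
    have J: "B' i \<inter> B' j = {}" if "i \<in> J" "j \<in> J" "i \<noteq> j" for i j
    proof -
      have "i \<noteq> k" "j \<noteq> k" using that insert.hyps by auto
      then show ?thesis using disjoint_family_onD[OF B(3) that] by (simp add: B'_def)
    qed
    show ?thesis unfolding disjoint_family_on_def using k J by (metis Int_commute insertE)
  qed
  moreover have "(\<Union>j\<in>insert k J. B' j) = (\<Union>j\<in>insert k J. A j)"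
  proof -
    have "B' k = A k - (\<Union>j\<in>J. A j)" by (simp add: B'_def)
    then show ?thesis using BJ by auto
  qed
  ultimately show ?case using sets by (intro exI[of _ B'] conjI)
qed

text \<open>Split \<open>g h\<close> into \<open>g \<surd>|h|\<close> and
  \<open>h / \<surd>|h|\<close>. With a convolution kernel as the weight \<open>h\<close> this is
  the pointwise part of the Schur test.\<close>

lemma weighted_Cauchy_Schwarz:
  fixes g h :: "'a \<Rightarrow> complex"
  assumes [measurable]: "g \<in> borel_measurable M" "h \<in> borel_measurable M"
    and int: "integrable M (\<lambda>x. (cmod (g x))\<^sup>2 * cmod (h x))" "integrable M (\<lambda>x. cmod (h x))"
  shows "(cmod (\<integral>x. g x * h x \<partial>M))\<^sup>2 \<le> (\<integral>x. (cmod (g x))\<^sup>2 * cmod (h x) \<partial>M) * (\<integral>x. cmod (h x) \<partial>M)"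
proof -
  define F where "F x = g x * of_real (sqrt (cmod (h x)))" for x
  \<comment> \<open>Where \<open>h\<close> vanishes the quotient is 0 by the convention on division,
    and the identities below persist.\<close>
  define H where "H x = cnj (h x / of_real (sqrt (cmod (h x))))" for x
  have F2: "(cmod (F x))\<^sup>2 = (cmod (g x))\<^sup>2 * cmod (h x)" and H2: "(cmod (H x))\<^sup>2 = cmod (h x)" for x
    by (auto simp: F_def H_def norm_mult norm_divide power_mult_distrib power_divide power2_eq_square[of "cmod (h x)"])
  have FH: "F x * cnj (H x) = g x * h x" for x by (simp add: F_def H_def)
  have [measurable]: "F \<in> borel_measurable M" "H \<in> borel_measurable M" unfolding F_def H_def by measurable
  have L: "F \<in> L2_fun M" "H \<in> L2_fun M" using int by (simp_all add: L2_fun_def F2 H2)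
  have "cmod (\<integral>x. g x * h x \<partial>M) \<le> l2_norm M (l2_class M F) * l2_norm M (l2_class M H)"
    using l2_Cauchy_Schwarz[of "l2_class M F" M "l2_class M H"] L by (simp add: l2_inner_class FH)
  then have "(cmod (\<integral>x. g x * h x \<partial>M))\<^sup>2 \<le> (l2_norm M (l2_class M F) * l2_norm M (l2_class M H))\<^sup>2"
    by (rule power_mono) simp
  then show ?thesis using L by (simp add: power_mult_distrib l2_norm_class_sq F2 H2)
qed

context haar_group
begin

definition cs_dense :: "'a l2 \<Rightarrow> bool" where
  "cs_dense \<xi> \<longleftrightarrow> \<xi> \<in> L2 \<mu> \<and> (\<forall>e>0. \<exists>\<phi>\<in>CC. l2_norm \<mu> (l2_diff \<mu> \<xi> (l2_class \<mu> \<phi>)) < e)"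

lemma cs_dense_add:
  assumes "cs_dense \<xi>" "cs_dense \<eta>" shows "cs_dense (l2_add \<mu> \<xi> \<eta>)"
  unfolding cs_dense_def
proof (intro conjI allI impI)
  have L: "\<xi> \<in> L2 \<mu>" "\<eta> \<in> L2 \<mu>" using assms by (auto simp: cs_dense_def)
  then show "l2_add \<mu> \<xi> \<eta> \<in> L2 \<mu>" by simp
  fix e :: real assume "e > 0"
  then obtain \<phi> \<psi> where p: "\<phi> \<in> CC" "l2_norm \<mu> (l2_diff \<mu> \<xi> (l2_class \<mu> \<phi>)) < e/2"
    "\<psi> \<in> CC" "l2_norm \<mu> (l2_diff \<mu> \<eta> (l2_class \<mu> \<psi>)) < e/2"
    using assms unfolding cs_dense_def by (meson half_gt_zero)
  let ?p = "l2_class \<mu> \<phi>" and ?q = "l2_class \<mu> \<psi>"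
  have pL: "?p \<in> L2 \<mu>" "?q \<in> L2 \<mu>" using p cs_L2 by auto
  have "l2_diff \<mu> (l2_add \<mu> \<xi> \<eta>) (l2_add \<mu> ?p ?q) = l2_add \<mu> (l2_diff \<mu> \<xi> ?p) (l2_diff \<mu> \<eta> ?q)"
    by (rule l2_eqI[of _ \<mu>]) (use L pL in auto)
  then have "l2_norm \<mu> (l2_diff \<mu> (l2_add \<mu> \<xi> \<eta>) (l2_add \<mu> ?p ?q)) < e"
    using l2_norm_triangle[of "l2_diff \<mu> \<xi> ?p" \<mu> "l2_diff \<mu> \<eta> ?q"] p L pL by simp
  then show "\<exists>\<phi>\<in>CC. l2_norm \<mu> (l2_diff \<mu> (l2_add \<mu> \<xi> \<eta>) (l2_class \<mu> \<phi>)) < e"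
    using p cs_L2 by (intro bexI[of _ "\<lambda>x. \<phi> x + \<psi> x"]) (auto simp: l2_add_class intro: cs_add)
qed

lemma cs_dense_scale:
  assumes "cs_dense \<xi>" shows "cs_dense (l2_scale \<mu> c \<xi>)"
  unfolding cs_dense_def
proof (intro conjI allI impI)
  have L: "\<xi> \<in> L2 \<mu>" using assms by (auto simp: cs_dense_def)
  then show "l2_scale \<mu> c \<xi> \<in> L2 \<mu>" by simp
  fix e :: real assume "e > 0"
  then have "e / (cmod c + 1) > 0" by (simp add: add_nonneg_pos)
  then obtain \<phi> where p: "\<phi> \<in> CC" "l2_norm \<mu> (l2_diff \<mu> \<xi> (l2_class \<mu> \<phi>)) < e / (cmod c + 1)"
    using assms unfolding cs_dense_def by meson
  let ?p = "l2_class \<mu> \<phi>"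
  have pL: "?p \<in> L2 \<mu>" using p cs_L2 by auto
  have "l2_diff \<mu> (l2_scale \<mu> c \<xi>) (l2_scale \<mu> c ?p) = l2_scale \<mu> c (l2_diff \<mu> \<xi> ?p)"
    by (rule l2_eqI[of _ \<mu>]) (use L pL in \<open>auto simp: algebra_simps\<close>)
  then have "l2_norm \<mu> (l2_diff \<mu> (l2_scale \<mu> c \<xi>) (l2_scale \<mu> c ?p)) = cmod c * l2_norm \<mu> (l2_diff \<mu> \<xi> ?p)"
    using L pL by simp
  also have "\<dots> \<le> (cmod c + 1) * l2_norm \<mu> (l2_diff \<mu> \<xi> ?p)" by (intro mult_right_mono) auto
  also have "\<dots> < e" using p(2) by (subst (asm) pos_less_divide_eq) (simp_all add: add_nonneg_pos mult.commute)
  finally show "\<exists>\<phi>\<in>CC. l2_norm \<mu> (l2_diff \<mu> (l2_scale \<mu> c \<xi>) (l2_class \<mu> \<phi>)) < e"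
    using p cs_L2 by (intro bexI[of _ "\<lambda>x. c * \<phi> x"]) (auto simp: l2_scale_class intro: cs_scale)
qed

text \<open>Inner regularity is available for open sets only. Therefore \<open>A\<close> is first
  enclosed in an open \<open>U\<close>, and the compact \<open>K\<close> exhausts \<open>U\<close>
  rather than \<open>A\<close>. A cut-off function between \<open>K\<close> and \<open>U\<close>
  differs from the indicator of \<open>A\<close> at most on \<open>U - A\<close> and
  \<open>U - K\<close>.\<close>

lemma cs_dense_indicator:
  assumes A: "A \<in> sets \<mu>" "emeasure \<mu> A < \<infinity>"
  shows "cs_dense (l2_class \<mu> (indicator A))"
proof -
  have ind_L2: "(indicator B :: 'a \<Rightarrow> complex) \<in> L2_fun \<mu>" if "B \<in> sets \<mu>" "emeasure \<mu> B < \<infinity>" for B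
    by (rule L2_fun_bound[where g="indicator B"]) (use that in \<open>auto simp: indicator_def\<close>)
  have "\<exists>\<phi>\<in>CC. l2_norm \<mu> (l2_diff \<mu> (l2_class \<mu> (indicator A)) (l2_class \<mu> \<phi>)) < e" if "e > 0" for e
  proof -
    \<comment> \<open>Half of \<open>e\<^sup>2\<close> for each of the two sets \<open>U - A\<close>
      and \<open>U - K\<close>.\<close>
    define d where "d = e\<^sup>2 / 2"
    have d: "d > 0" using that by (simp add: d_def)
    have "emeasure \<mu> A < emeasure \<mu> A + ennreal d" using A(2) d by (simp add: ennreal_add_left_cancel_less)
    then have "(INF U\<in>{U. openin T U \<and> A \<subseteq> U}. emeasure \<mu> U) < emeasure \<mu> A + ennreal d"
      using outer_regular[OF A(1)] by simp
    then obtain U where U: "openin T U" "A \<subseteq> U" "emeasure \<mu> U < emeasure \<mu> A + ennreal d"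
      unfolding INF_less_iff by auto
    have Us: "U \<in> sets \<mu>" by (rule open_sets[OF U(1)])
    have Ufin: "emeasure \<mu> U < \<infinity>" using U(3) A(2) by (metis ennreal_add_less_top ennreal_less_top infinity_ennreal_def less_trans)
    have "\<exists>K. compactin T K \<and> K \<subseteq> U \<and> measure \<mu> U < measure \<mu> K + d"
    proof (rule ccontr)
      assume n: "\<not> ?thesis"
      have Kle: "emeasure \<mu> K \<le> ennreal (measure \<mu> U - d)" if "compactin T K" "K \<subseteq> U" for K
        using n that compact_finite[OF that(1)] by (auto simp: emeasure_eq_ennreal_measure less_top[symmetric] not_less intro!: ennreal_leI)
      \<comment> \<open>Taking the empty set for \<open>K\<close> shows that
        \<open>measure \<mu> U - d\<close> is nonnegative, so that \<open>ennreal\<close> does not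
        truncate it.\<close>
      have "measure \<mu> U \<ge> d" using n compactin_empty[of T] by (auto simp: not_less)
      have "emeasure \<mu> U \<le> ennreal (measure \<mu> U - d)"
        unfolding inner_regular[OF U(1)] by (rule SUP_least) (use Kle in auto)
      then show False using Ufin d \<open>measure \<mu> U \<ge> d\<close> by (auto simp: emeasure_eq_ennreal_measure less_top[symmetric])
    qed
    then obtain K where K: "compactin T K" "K \<subseteq> U" "measure \<mu> U < measure \<mu> K + d" by blast
    have Ks: "K \<in> sets \<mu>" by (rule compact_sets[OF K(1)])
    obtain \<phi> :: "'a \<Rightarrow> real" and L where \<phi>: "(\<lambda>x. complex_of_real (\<phi> x)) \<in> CC"
      "L \<subseteq> U" "\<And>x. x \<in> carrier G \<Longrightarrow> 0 \<le> \<phi> x \<and> \<phi> x \<le> 1"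
      "\<And>x. x \<in> K \<Longrightarrow> \<phi> x = 1" "\<And>x. x \<in> carrier G \<Longrightarrow> x \<notin> L \<Longrightarrow> \<phi> x = 0"
      by (rule Urysohn_compact_support[OF K(1) U(1) K(2)]) blast
    have fin: "emeasure \<mu> (U - A) < \<infinity>" "emeasure \<mu> (U - K) < \<infinity>"
      using Ufin Us by (auto intro: le_less_trans[OF emeasure_mono])
    have "(\<integral>x. (cmod (indicator A x - of_real (\<phi> x)))\<^sup>2 \<partial>\<mu>) \<le> (\<integral>x. (indicator (U - A) x + indicator (U - K) x) \<partial>\<mu>)"
    proof (rule integral_mono')
      show "integrable \<mu> (\<lambda>x. indicat_real (U - A) x + indicator (U - K) x)"
        using fin Us A Ks by (intro Bochner_Integration.integrable_add) auto
      fix x assume "x \<in> space \<mu>"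
      then have x: "x \<in> carrier G" by simp
      have sq: "(cmod (indicator A x - of_real (\<phi> x)))\<^sup>2 \<le> 1"
      proof -
        have "indicator A x - complex_of_real (\<phi> x) = of_real (indicator A x - \<phi> x)" by (simp add: indicator_def)
        then have "(cmod (indicator A x - of_real (\<phi> x))) = \<bar>indicator A x - \<phi> x\<bar>" by (metis norm_of_real)
        then show ?thesis using \<phi>(3)[OF x] by (auto simp: indicator_def intro!: power_le_one)
      qed
      consider "x \<in> U - A \<or> x \<in> U - K" | "x \<in> A" "x \<in> K" | "x \<notin> U" using U(2) K(2) by blast
      then show "(cmod (indicator A x - of_real (\<phi> x)))\<^sup>2 \<le> indicat_real (U - A) x + indicator (U - K) x"
      proof cases
        case 1 then show ?thesis using sq by (auto simp: indicator_def)
      next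
        case 2 then show ?thesis using \<phi>(4) by simp
      next
        case 3
        then have "x \<notin> A" "\<phi> x = 0" using U(2) \<phi>(2,5) x by auto
        then show ?thesis by simp
      qed
    qed auto
    also have "\<dots> = measure \<mu> (U - A) + measure \<mu> (U - K)"
    proof -
      have "(U - A) \<inter> carrier G = U - A" "(U - K) \<inter> carrier G = U - K" using openin_carrier[OF U(1)] by auto
      then show ?thesis using fin Us A Ks by (subst Bochner_Integration.integral_add) auto
    qed
    also have "measure \<mu> (U - A) = measure \<mu> U - measure \<mu> A"
      using Ufin Us A U(2) by (intro measure_Diff) auto
    also have "measure \<mu> (U - K) = measure \<mu> U - measure \<mu> K"
      using Ufin Us Ks K(2) by (intro measure_Diff) auto
    also have "measure \<mu> U - measure \<mu> A < d"
    proof -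
      have "ennreal (measure \<mu> U) < ennreal (measure \<mu> A + d)"
        using U(3) Ufin A(2) d by (simp add: emeasure_eq_ennreal_measure less_top[symmetric] ennreal_plus)
      then show ?thesis using d by (simp add: ennreal_less_iff del: ennreal_plus)
    qed
    finally have "(\<integral>x. (cmod (indicator A x - of_real (\<phi> x)))\<^sup>2 \<partial>\<mu>) < e\<^sup>2"
      using K(3) by (simp add: d_def)
    moreover have "(l2_norm \<mu> (l2_diff \<mu> (l2_class \<mu> (indicator A)) (l2_class \<mu> (\<lambda>x. of_real (\<phi> x)))))\<^sup>2
        = (\<integral>x. (cmod (indicator A x - of_real (\<phi> x)))\<^sup>2 \<partial>\<mu>)"
      using ind_L2[OF A] cs_L2[OF \<phi>(1)] by (simp add: l2_diff_class l2_norm_class_sq L2_fun_diff)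
    ultimately have "(l2_norm \<mu> (l2_diff \<mu> (l2_class \<mu> (indicator A)) (l2_class \<mu> (\<lambda>x. of_real (\<phi> x)))))\<^sup>2 < e\<^sup>2" by simp
    then have "l2_norm \<mu> (l2_diff \<mu> (l2_class \<mu> (indicator A)) (l2_class \<mu> (\<lambda>x. of_real (\<phi> x)))) < e"
      by (rule power2_less_imp_less) (use that in simp)
    then show ?thesis using \<phi>(1) by blast
  qed
  then show ?thesis using ind_L2[OF A] by (simp add: cs_dense_def)
qed

lemma cs_dense_sum:
  assumes "finite C" "\<And>c. c \<in> C \<Longrightarrow> g c \<in> L2_fun \<mu> \<and> cs_dense (l2_class \<mu> (g c))"
  shows "(\<lambda>x. \<Sum>c\<in>C. g c x) \<in> L2_fun \<mu> \<and> cs_dense (l2_class \<mu> (\<lambda>x. \<Sum>c\<in>C. g c x))"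
  using assms
proof (induction C rule: finite_induct)
  case empty
  have "cs_dense (l2_class \<mu> (\<lambda>x. 0))"
    unfolding cs_dense_def
    by (auto intro!: bexI[of _ "\<lambda>x. 0"] cs_zero simp: l2_diff_class l2_norm_class)
  then show ?case by simp
next
  case (insert c C)
  then have "g c \<in> L2_fun \<mu>" "(\<lambda>x. \<Sum>c\<in>C. g c x) \<in> L2_fun \<mu>" by auto
  then show ?case using insert cs_dense_add[of "l2_class \<mu> (g c)" "l2_class \<mu> (\<lambda>x. \<Sum>c\<in>C. g c x)"]
    by (simp add: l2_add_class L2_fun_add)
qed

text \<open>Simple functions bounded by \<open>2 |f|\<close> converge to \<open>f\<close> in L2 by
  dominated convergence; they are combinations of indicators of sets of finite measure.\<close>

lemma cs_dense_L2:
  assumes "\<xi> \<in> L2 \<mu>" shows "cs_dense \<xi>"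
proof -
  obtain f where f: "f \<in> L2_fun \<mu>" "\<xi> = l2_class \<mu> f" using assms by (rule L2_cases)
  have [measurable]: "f \<in> borel_measurable \<mu>" using f L2_fun_measurable by blast
  obtain s where "\<forall>i. simple_function \<mu> (s i)" "\<forall>x\<in>space \<mu>. (\<lambda>i. s i x) \<longlonglongrightarrow> f x"
    "\<forall>i. \<forall>x\<in>space \<mu>. dist (s i x) 0 \<le> 2 * dist (f x) 0"
    using borel_measurable_implies_sequence_metric[OF \<open>f \<in> borel_measurable \<mu>\<close>, of 0]
    by (elim exE conjE) (rule that)
  then have s: "\<And>i. simple_function \<mu> (s i)" "\<And>x. x \<in> space \<mu> \<Longrightarrow> (\<lambda>i. s i x) \<longlonglongrightarrow> f x"
    "\<And>i x. x \<in> space \<mu> \<Longrightarrow> dist (s i x) 0 \<le> 2 * dist (f x) 0"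
    by blast+
  have [measurable]: "s i \<in> borel_measurable \<mu>" for i using s(1) by (rule borel_measurable_simple_function)
  have sb: "cmod (s i x) \<le> 2 * cmod (f x)" if "x \<in> space \<mu>" for i x using s(3)[OF that] by simp
  have sL: "s i \<in> L2_fun \<mu>" for i
  proof (rule L2_fun_bound[where g="\<lambda>x. 4 * (cmod (f x))\<^sup>2"])
    show "integrable \<mu> (\<lambda>x. 4 * (cmod (f x))\<^sup>2)" using L2_fun_integrable[OF f(1)] by simp
    show "(cmod (s i x))\<^sup>2 \<le> 4 * (cmod (f x))\<^sup>2" if "x \<in> space \<mu>" for x
      using power_mono[OF sb[OF that], of i 2] by (simp add: power_mult_distrib)
  qed simp
  have sD: "cs_dense (l2_class \<mu> (s i))" for i
  proof -
    \<comment> \<open>The value 0 is left out because its level set may have infinite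
      measure.\<close>
    define C where "C = s i ` space \<mu> - {0}"
    have C: "finite C" using simple_functionD(1)[OF s(1)] by (simp add: C_def)
    define A where "A c = s i -` {c} \<inter> space \<mu>" for c
    have A: "A c \<in> sets \<mu>" for c unfolding A_def by measurable
    have Afin: "emeasure \<mu> (A c) < \<infinity>" if "c \<in> C" for c
    proof -
      have "c \<noteq> 0" using that by (simp add: C_def)
      have 1: "integrable \<mu> (\<lambda>x. (cmod (s i x))\<^sup>2 / (cmod c)\<^sup>2)" using L2_fun_integrable[OF sL] by simp
      have 2: "indicat_real (A c) \<in> borel_measurable \<mu>" using A by simp
      have "integrable \<mu> (indicat_real (A c))"
        by (rule Bochner_Integration.integrable_bound[OF 1 2]) (use \<open>c \<noteq> 0\<close> in \<open>auto simp: A_def indicator_def\<close>)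
      moreover have "A c \<inter> carrier G = A c" by (auto simp: A_def)
      ultimately show ?thesis by (simp add: integrable_indicator_iff)
    qed
    have g: "(\<lambda>x. c * indicator (A c) x) \<in> L2_fun \<mu> \<and> cs_dense (l2_class \<mu> (\<lambda>x. c * indicator (A c) x))" if "c \<in> C" for c
    proof -
      have "cs_dense (l2_class \<mu> (indicator (A c)))" by (rule cs_dense_indicator[OF A Afin[OF that]])
      moreover have "indicator (A c) \<in> L2_fun \<mu>"
        by (rule L2_fun_bound[where g="indicator (A c)"]) (use A Afin[OF that] in \<open>auto simp: indicator_def\<close>)
      ultimately show ?thesis using cs_dense_scale[of "l2_class \<mu> (indicator (A c))" c]
        by (simp add: l2_scale_class L2_fun_scale)
    qed
    have eq: "s i x = (\<Sum>c\<in>C. c * indicator (A c) x)" if x: "x \<in> space \<mu>" for x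
    proof (cases "s i x = 0")
      case True
      then show ?thesis by (auto simp: A_def indicator_def C_def intro!: sum.neutral[symmetric])
    next
      case False
      then have "s i x \<in> C" using x by (auto simp: C_def)
      have "(\<Sum>c\<in>C. c * indicator (A c) x) = (\<Sum>c\<in>C. if c = s i x then c else 0)"
        using x by (intro sum.cong) (auto simp: A_def indicator_def)
      then show ?thesis using C \<open>s i x \<in> C\<close> by simp
    qed
    have "l2_class \<mu> (s i) = l2_class \<mu> (\<lambda>x. \<Sum>c\<in>C. c * indicator (A c) x)"
      by (rule l2_class_cong[OF eq])
    then show ?thesis using cs_dense_sum[OF C g] by simp
  qed
  have lim: "(\<lambda>i. \<integral>x. (cmod (f x - s i x))\<^sup>2 \<partial>\<mu>) \<longlonglongrightarrow> (\<integral>x. 0 \<partial>\<mu>)"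
  proof (rule integral_dominated_convergence[where w="\<lambda>x. 9 * (cmod (f x))\<^sup>2"])
    show "integrable \<mu> (\<lambda>x. 9 * (cmod (f x))\<^sup>2)" using L2_fun_integrable[OF f(1)] by simp
    show "AE x in \<mu>. (\<lambda>i. (cmod (f x - s i x))\<^sup>2) \<longlonglongrightarrow> 0"
    proof (rule AE_I2)
      fix x assume "x \<in> space \<mu>"
      then have "(\<lambda>i. (cmod (f x - s i x))\<^sup>2) \<longlonglongrightarrow> (cmod (f x - f x))\<^sup>2" by (intro tendsto_intros s(2))
      then show "(\<lambda>i. (cmod (f x - s i x))\<^sup>2) \<longlonglongrightarrow> 0" by simp
    qed
    show "AE x in \<mu>. norm ((cmod (f x - s i x))\<^sup>2) \<le> 9 * (cmod (f x))\<^sup>2" for i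
    proof (rule AE_I2)
      fix x assume "x \<in> space \<mu>"
      then have "cmod (f x - s i x) \<le> 3 * cmod (f x)"
        using sb[of x i] norm_triangle_ineq4[of "f x" "s i x"] by simp
      from power_mono[OF this, of 2] show "norm ((cmod (f x - s i x))\<^sup>2) \<le> 9 * (cmod (f x))\<^sup>2"
        by (simp add: power_mult_distrib)
    qed
  qed auto
  show ?thesis unfolding cs_dense_def
  proof (intro conjI assms allI impI)
    fix e :: real assume "e > 0"
    then have "(e/2)\<^sup>2 > 0" by simp
    then obtain i where "(\<integral>x. (cmod (f x - s i x))\<^sup>2 \<partial>\<mu>) < (e/2)\<^sup>2"
      using order_tendstoD(2)[OF lim, of "(e/2)\<^sup>2"] by (auto simp: eventually_sequentially)
    then have "(l2_norm \<mu> (l2_diff \<mu> \<xi> (l2_class \<mu> (s i))))\<^sup>2 < (e/2)\<^sup>2"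
      using f sL by (simp add: l2_diff_class l2_norm_class_sq L2_fun_diff)
    then have 1: "l2_norm \<mu> (l2_diff \<mu> \<xi> (l2_class \<mu> (s i))) < e/2"
      by (rule power2_less_imp_less) (use \<open>e > 0\<close> in simp)
    obtain \<phi> where \<phi>: "\<phi> \<in> CC" "l2_norm \<mu> (l2_diff \<mu> (l2_class \<mu> (s i)) (l2_class \<mu> \<phi>)) < e/2"
      using sD[of i] \<open>e > 0\<close> unfolding cs_dense_def by (meson half_gt_zero)
    have "l2_norm \<mu> (l2_diff \<mu> \<xi> (l2_class \<mu> \<phi>)) \<le> l2_norm \<mu> (l2_diff \<mu> \<xi> (l2_class \<mu> (s i))) + l2_norm \<mu> (l2_diff \<mu> (l2_class \<mu> (s i)) (l2_class \<mu> \<phi>))"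
      using assms sL cs_L2[OF \<phi>(1)] by (intro l2_norm_triangle_diff) auto
    then show "\<exists>\<phi>\<in>CC. l2_norm \<mu> (l2_diff \<mu> \<xi> (l2_class \<mu> \<phi>)) < e" using 1 \<phi> by (intro bexI[of _ \<phi>]) auto
  qed
qed

lemma cs_approx:
  assumes "\<xi> \<in> L2 \<mu>" "e > 0"
  obtains \<phi> where "\<phi> \<in> CC" "l2_norm \<mu> (l2_diff \<mu> \<xi> (l2_class \<mu> \<phi>)) < e"
  using cs_dense_L2[OF assms(1)] assms(2) by (auto simp: cs_dense_def)

end

section \<open>Convolution\<close>

context haar_group
begin

abbreviation "conv \<equiv> convolution G \<mu>"

lemma conv_integrable:
  assumes "g \<in> L2_fun \<mu>" "f \<in> CC" "x \<in> carrier G"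
  shows "integrable \<mu> (\<lambda>y. g y * f (inv y \<otimes> x))"
  by (rule L2_fun_mult_integrable[OF assms(1) cs_L2[OF cs_inv_mult[OF assms(2,3)]]])

lemma conv_cong_AE:
  assumes "AE y in \<mu>. g y = h y" "g \<in> L2_fun \<mu>" "h \<in> L2_fun \<mu>" "f \<in> CC" "x \<in> carrier G"
  shows "conv g f x = conv h f x"
  unfolding convolution_def
proof (rule integral_cong_AE)
  show "AE y in \<mu>. g y * f (inv y \<otimes> x) = h y * f (inv y \<otimes> x)" using assms(1) by eventually_elim simp
qed (use assms conv_integrable borel_measurable_integrable in blast)+

lemma conv_diff:
  assumes "g \<in> L2_fun \<mu>" "h \<in> L2_fun \<mu>" "f \<in> CC" "x \<in> carrier G"
  shows "conv (\<lambda>y. g y - h y) f x = conv g f x - conv h f x"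
  unfolding convolution_def using assms conv_integrable
  by (simp add: left_diff_distrib)

lemma conv_add:
  assumes "g \<in> L2_fun \<mu>" "h \<in> L2_fun \<mu>" "f \<in> CC" "x \<in> carrier G"
  shows "conv (\<lambda>y. g y + h y) f x = conv g f x + conv h f x"
  unfolding convolution_def using assms conv_integrable
  by (simp add: distrib_right)

lemma conv_scale: "conv (\<lambda>y. c * g y) f x = c * conv g f x"
  unfolding convolution_def by (simp add: mult.assoc)

text \<open>\<open>inv (x \<otimes> y) \<otimes> x = inv y\<close>, so left invariance applies. This
  is why integrals of reflected functions appear in all bounds below.\<close>

lemma integral_inv_mult:
  fixes h :: "'a \<Rightarrow> complex"
  assumes "h \<in> CC" "x \<in> carrier G"
  shows "(\<integral>y. h (inv y \<otimes> x) \<partial>\<mu>) = (\<integral>y. h (inv y) \<partial>\<mu>)"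
proof -
  have "(\<integral>y. h (inv y \<otimes> x) \<partial>\<mu>) = (\<integral>y. h (inv (x \<otimes> y) \<otimes> x) \<partial>\<mu>)"
    using integral_left_mult[OF assms(2) cs_measurable[OF cs_inv_mult[OF assms]]] ..
  also have "\<dots> = (\<integral>y. h (inv y) \<partial>\<mu>)"
    using assms(2) by (intro Bochner_Integration.integral_cong) (auto simp: inv_mult_group m_assoc)
  finally show ?thesis .
qed

lemma integral_cmod_inv_mult:
  assumes "f \<in> CC" "x \<in> carrier G" "n > 0"
  shows "(\<integral>y. cmod (f (inv y \<otimes> x)) ^ n \<partial>\<mu>) = (\<integral>y. cmod (f (inv y)) ^ n \<partial>\<mu>)"
proof -
  have "complex_of_real (\<integral>y. cmod (f (inv y \<otimes> x)) ^ n \<partial>\<mu>) = of_real (\<integral>y. cmod (f (inv y)) ^ n \<partial>\<mu>)"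
    using integral_inv_mult[OF cs_cmod_power[OF assms(1,3)] assms(2)] by (simp only: integral_complex_of_real)
  then show ?thesis by (simp only: of_real_eq_iff)
qed

lemma conv_eq_translate:
  assumes "g \<in> L2_fun \<mu>" "f \<in> CC" "x \<in> carrier G"
  shows "conv g f x = (\<integral>y. g (x \<otimes> y) * f (inv y) \<partial>\<mu>)"
proof -
  have "conv g f x = (\<integral>y. g (x \<otimes> y) * f (inv (x \<otimes> y) \<otimes> x) \<partial>\<mu>)"
    unfolding convolution_def
    using integral_left_mult[OF assms(3) borel_measurable_integrable[OF conv_integrable[OF assms]]] ..
  also have "\<dots> = (\<integral>y. g (x \<otimes> y) * f (inv y) \<partial>\<mu>)"
    using assms(3) by (intro Bochner_Integration.integral_cong) (auto simp: inv_mult_group m_assoc)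
  finally show ?thesis .
qed

text \<open>Uniform in \<open>x\<close>, so it upgrades L2 convergence of the left factor to
  pointwise convergence of the convolutions.\<close>

lemma conv_bound:
  assumes g: "g \<in> L2_fun \<mu>" and f: "f \<in> CC" and x: "x \<in> carrier G"
  shows "cmod (conv g f x) \<le> l2_norm \<mu> (l2_class \<mu> g) * l2_norm \<mu> (l2_class \<mu> (\<lambda>y. f (inv y)))"
proof -
  let ?h = "\<lambda>y. cnj (f (inv y \<otimes> x))"
  have h: "?h \<in> L2_fun \<mu>" using L2_fun_cnj[OF cs_L2[OF cs_inv_mult[OF f x]]] .
  have "conv g f x = l2_inner \<mu> (l2_class \<mu> g) (l2_class \<mu> ?h)"
    using g h by (simp add: l2_inner_class convolution_def)
  also have "cmod \<dots> \<le> l2_norm \<mu> (l2_class \<mu> g) * l2_norm \<mu> (l2_class \<mu> ?h)"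
    using g h by (intro l2_Cauchy_Schwarz) auto
  also have "l2_norm \<mu> (l2_class \<mu> ?h) = l2_norm \<mu> (l2_class \<mu> (\<lambda>y. f (inv y)))"
    using h cs_L2[OF cs_inv[OF f]] integral_cmod_inv_mult[OF f x, of 2] by (simp add: l2_norm_class)
  finally show ?thesis .
qed

lemma conv_continuous:
  assumes g: "g \<in> CC" and f: "f \<in> CC"
  shows "continuous_map T euclidean (conv g f)"
proof (rule continuous_map_metricI)
  fix x and e :: real assume x: "x \<in> topspace T" and e: "e > 0"
  have xc: "x \<in> carrier G" using x by (simp add: topspace_eq)
  define N where "N = (\<integral>y. cmod (g y) \<partial>\<mu>) + 1"
  have N: "N > 0" "(\<integral>y. cmod (g y) \<partial>\<mu>) < N" by (auto simp: N_def add_nonneg_pos)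
  obtain U where U: "openin T U" "\<one> \<in> U" "\<And>x u. x \<in> carrier G \<Longrightarrow> u \<in> U \<Longrightarrow> cmod (f (x \<otimes> u) - f x) < e / N"
    by (rule uniform_continuity_right[OF f, of "e / N"]) (use e N in auto)
  have gi: "integrable \<mu> (\<lambda>y. cmod (g y))" using cs_integrable[OF g] by simp
  have "dist (conv g f z) (conv g f x) < e" if z: "z \<in> x <# U" for z
  proof -
    obtain u where u: "u \<in> U" "z = x \<otimes> u" using z by (auto simp: l_coset_def)
    have uc: "u \<in> carrier G" using u U openin_carrier by blast
    have "conv g f z - conv g f x = (\<integral>y. g y * f (inv y \<otimes> z) - g y * f (inv y \<otimes> x) \<partial>\<mu>)"
      unfolding convolution_def using u xc uc conv_integrable[OF cs_L2[OF g] f]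
      by (intro Bochner_Integration.integral_diff[symmetric]) auto
    also have "cmod \<dots> \<le> (\<integral>y. e / N * cmod (g y) \<partial>\<mu>)"
    proof (rule norm_integral_le)
      show "integrable \<mu> (\<lambda>y. g y * f (inv y \<otimes> z) - g y * f (inv y \<otimes> x))"
        using u xc uc conv_integrable[OF cs_L2[OF g] f] by (intro Bochner_Integration.integrable_diff) auto
      fix y assume "y \<in> space \<mu>"
      then have y: "y \<in> carrier G" by simp
      have "cmod (f (inv y \<otimes> x \<otimes> u) - f (inv y \<otimes> x)) \<le> e / N" using U(3)[of "inv y \<otimes> x" u] y xc u by simp
      then have "cmod (g y) * cmod (f (inv y \<otimes> z) - f (inv y \<otimes> x)) \<le> cmod (g y) * (e / N)"
        using y xc uc u(2) by (intro mult_left_mono) (simp_all add: m_assoc)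
      then show "cmod (g y * f (inv y \<otimes> z) - g y * f (inv y \<otimes> x)) \<le> e / N * cmod (g y)"
        by (simp add: norm_mult mult.commute flip: right_diff_distrib)
    qed (use gi in simp)
    also have "\<dots> = e / N * (\<integral>y. cmod (g y) \<partial>\<mu>)" by simp
    also have "\<dots> < e / N * N" using N e by (intro mult_strict_left_mono) auto
    also have "\<dots> = e" using N by simp
    finally show ?thesis by (simp add: dist_norm)
  qed
  moreover have "x \<in> x <# U" using U(2) xc by (auto simp: l_coset_def intro!: bexI[of _ "\<one>"])
  ultimately show "\<exists>U. openin T U \<and> x \<in> U \<and> (\<forall>y\<in>U. dist (conv g f y) (conv g f x) < e)"
    using openin_l_coset[OF U(1) xc] by blast
qed

lemma conv_eq_0:
  assumes "\<And>y. y \<in> carrier G \<Longrightarrow> y \<notin> K \<Longrightarrow> g y = 0" "\<And>y. y \<in> carrier G \<Longrightarrow> y \<notin> L \<Longrightarrow> f y = 0"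
    "x \<in> carrier G" "x \<notin> (\<lambda>(x, y). x \<otimes> y) ` (K \<times> L)"
  shows "conv g f x = 0"
proof -
  have "g y * f (inv y \<otimes> x) = 0" if "y \<in> carrier G" for y
  proof (cases "y \<in> K \<and> inv y \<otimes> x \<in> L")
    case True
    then have "x = y \<otimes> (inv y \<otimes> x)" using that assms(3) by (simp add: m_assoc[symmetric])
    then have "x \<in> (\<lambda>(x, y). x \<otimes> y) ` (K \<times> L)" using True by (intro image_eqI[of _ _ "(y, inv y \<otimes> x)"]) auto
    then show ?thesis using assms(4) by blast
  qed (use assms that in auto)
  then have "conv g f x = (\<integral>y. 0 \<partial>\<mu>)" unfolding convolution_def by (intro Bochner_Integration.integral_cong) auto
  then show ?thesis by simp
qed

lemma conv_cs:
  assumes g: "g \<in> CC" and f: "f \<in> CC"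
  shows "conv g f \<in> CC"
proof -
  obtain K where K: "compactin T K" "\<And>x. x \<in> carrier G \<Longrightarrow> x \<notin> K \<Longrightarrow> g x = 0" by (rule cs_E[OF g]) blast
  obtain L where L: "compactin T L" "\<And>x. x \<in> carrier G \<Longrightarrow> x \<notin> L \<Longrightarrow> f x = 0" by (rule cs_E[OF f]) blast
  show ?thesis
    by (rule cs_I[OF conv_continuous[OF g f] compactin_mult[OF K(1) L(1)]]) (rule conv_eq_0[OF K(2) L(2)])
qed

text \<open>Fubini for \<open>u(y) v(y\<^sup>-\<^sup>1 x)\<close>. To avoid product measures, \<open>y\<close> is replaced by finitely many
  sample points, with an error that is uniform in \<open>x\<close>.\<close>
lemma integral_conv:
  assumes u: "u \<in> CC" and v: "v \<in> CC"
  shows "(\<integral>x. conv u v x \<partial>\<mu>) = (\<integral>y. u y \<partial>\<mu>) * (\<integral>x. v x \<partial>\<mu>)"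
proof -
  obtain K where K: "compactin T K" "\<And>x. x \<in> carrier G \<Longrightarrow> x \<notin> K \<Longrightarrow> u x = 0" by (rule cs_E[OF u]) blast
  obtain L where L: "compactin T L" "\<And>x. x \<in> carrier G \<Longrightarrow> x \<notin> L \<Longrightarrow> v x = 0" by (rule cs_E[OF v]) blast
  define P where "P = (\<lambda>(x, y). x \<otimes> y) ` (K \<times> L)"
  have P: "compactin T P" unfolding P_def by (rule compactin_mult[OF K(1) L(1)])
  have ui: "integrable \<mu> u" and vi: "integrable \<mu> v" using u v by (auto intro: cs_integrable)
  have [measurable]: "u \<in> borel_measurable \<mu>" using cs_measurable[OF u] .
  define N where "N = (\<integral>y. cmod (u y) \<partial>\<mu>)"
  have N0: "N \<ge> 0" by (simp add: N_def)
  have main: "cmod ((\<integral>x. conv u v x \<partial>\<mu>) - (\<integral>y. u y \<partial>\<mu>) * (\<integral>x. v x \<partial>\<mu>)) \<le> e * (N * measure \<mu> P)"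
    if e: "e > 0" for e
  proof -
    obtain U where U: "openin T U" "\<one> \<in> U" "\<And>x u. x \<in> carrier G \<Longrightarrow> u \<in> U \<Longrightarrow> cmod (v (u \<otimes> x) - v x) < e"
      by (rule uniform_continuity_left[OF v e]) blast
    \<comment> \<open>For \<open>y = j \<otimes> w\<close>,
      \<open>inv y \<otimes> x = inv w \<otimes> (inv j \<otimes> x)\<close>; so it is the inverses
      of the points of \<open>W\<close> that must lie in \<open>U\<close>.\<close>
    define W where "W = {x \<in> carrier G. inv x \<in> U}"
    have W: "openin T W" "\<one> \<in> W" using U openin_inv by (auto simp: W_def)
    have jW: "openin T (j <# W)" "j <# W \<in> sets \<mu>" if "j \<in> K" for j
      using openin_l_coset[OF W(1)] open_sets compactin_carrier[OF K(1)] that by auto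
    have "K \<subseteq> \<Union>((\<lambda>j. j <# W) ` K)"
    proof
      fix j assume "j \<in> K"
      then have "j \<in> j <# W" using W(2) compactin_carrier[OF K(1)] by (auto simp: l_coset_def intro!: bexI[of _ "\<one>"])
      then show "j \<in> \<Union>((\<lambda>j. j <# W) ` K)" using \<open>j \<in> K\<close> by blast
    qed
    then obtain F where F: "finite F" "F \<subseteq> (\<lambda>j. j <# W) ` K" "K \<subseteq> \<Union>F"
      using compactinD[OF K(1), of "(\<lambda>j. j <# W) ` K"] jW(1) by blast
    then obtain J where J: "J \<subseteq> K" "finite J" "F = (\<lambda>j. j <# W) ` J" by (meson finite_subset_image)
    obtain B where B: "\<forall>j\<in>J. B j \<in> sets \<mu> \<and> B j \<subseteq> j <# W" "(\<Union>j\<in>J. B j) = (\<Union>j\<in>J. j <# W)" "disjoint_family_on B J"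
      using finite_disjoint_refinement[OF J(2), of "\<lambda>j. j <# W" \<mu>] jW(2) J(1) by blast
    have Jc: "j \<in> carrier G" if "j \<in> J" for j using that J(1) compactin_carrier[OF K(1)] by blast
    have pick: "\<exists>i\<in>J. y \<in> B i \<and> (\<forall>a :: 'a \<Rightarrow> complex. (\<Sum>j\<in>J. indicator (B j) y * a j) = a i)" if y: "y \<in> K" for y
    proof -
      obtain i where i: "i \<in> J" "y \<in> B i" using F(3) J(3) B(2) y by blast
      have "y \<notin> B j" if "j \<in> J" "j \<noteq> i" for j using disjoint_family_onD[OF B(3) that(1) i(1) that(2)] i(2) by blast
      then have "(\<Sum>j\<in>J. indicator (B j) y * a j) = (\<Sum>j\<in>J. if j = i then a j else 0)" for a :: "'a \<Rightarrow> complex"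
        using i(2) by (intro sum.cong) auto
      then show ?thesis using i J(2) by auto
    qed
    define c where "c j = (\<integral>y. u y * indicator (B j) y \<partial>\<mu>)" for j
    have cint: "integrable \<mu> (\<lambda>y. u y * indicator (B j) y)" if "j \<in> J" for j
    proof (rule Bochner_Integration.integrable_bound[OF ui])
      have [measurable]: "B j \<in> sets \<mu>" using B(1) that by blast
      show "(\<lambda>y. u y * indicator (B j) y) \<in> borel_measurable \<mu>" by measurable
    qed (auto simp: indicator_def)
    have csum: "(\<Sum>j\<in>J. c j) = (\<integral>y. u y \<partial>\<mu>)"
    proof -
      have "(\<Sum>j\<in>J. c j) = (\<integral>y. (\<Sum>j\<in>J. u y * indicator (B j) y) \<partial>\<mu>)"
        unfolding c_def using cint by (intro Bochner_Integration.integral_sum[symmetric]) auto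
      also have "\<dots> = (\<integral>y. u y \<partial>\<mu>)"
      proof (intro Bochner_Integration.integral_cong refl)
        fix y assume "y \<in> space \<mu>"
        then have y: "y \<in> carrier G" by simp
        show "(\<Sum>j\<in>J. u y * indicator (B j) y) = u y"
        proof (cases "y \<in> K")
          case True
          from pick[OF True] obtain i where "\<forall>a :: 'a \<Rightarrow> complex. (\<Sum>j\<in>J. indicator (B j) y * a j) = a i" by blast
          from this[rule_format, of "\<lambda>_. u y"] show ?thesis by (simp add: mult.commute)
        qed (use K(2)[OF y] in simp)
      qed
      finally show ?thesis .
    qed
    \<comment> \<open>The error of replacing \<open>y\<close> by the sample point \<open>j\<close>
      on each piece \<open>B j\<close>. By left invariance the sum integrates exactly to the product
      of the two integrals.\<close>
    define D where "D x = conv u v x - (\<Sum>j\<in>J. c j * v (inv j \<otimes> x))" for x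
    have vj: "integrable \<mu> (\<lambda>x. v (inv j \<otimes> x))" "(\<integral>x. v (inv j \<otimes> x) \<partial>\<mu>) = (\<integral>x. v x \<partial>\<mu>)" if "j \<in> J" for j
      using Jc[OF that] vi by (auto intro!: integrable_left_mult integral_left_mult)
    have convi: "integrable \<mu> (conv u v)" by (rule cs_integrable[OF conv_cs[OF u v]])
    have Dint: "integrable \<mu> D"
      unfolding D_def using vj convi by (intro Bochner_Integration.integrable_diff Bochner_Integration.integrable_sum) auto
    have "(\<integral>x. D x \<partial>\<mu>) = (\<integral>x. conv u v x \<partial>\<mu>) - (\<Sum>j\<in>J. c j * (\<integral>x. v x \<partial>\<mu>))"
      unfolding D_def using vj convi
      by (subst Bochner_Integration.integral_diff) (auto simp: Bochner_Integration.integral_sum)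
    also have "(\<Sum>j\<in>J. c j * (\<integral>x. v x \<partial>\<mu>)) = (\<integral>y. u y \<partial>\<mu>) * (\<integral>x. v x \<partial>\<mu>)"
      using csum by (simp flip: sum_distrib_right)
    finally have Deq: "(\<integral>x. D x \<partial>\<mu>) = (\<integral>x. conv u v x \<partial>\<mu>) - (\<integral>y. u y \<partial>\<mu>) * (\<integral>x. v x \<partial>\<mu>)" .
    \<comment> \<open>Both terms of \<open>D\<close> vanish outside the compact set
      \<open>P\<close>, so the uniform bound \<open>e * N\<close> yields a finite bound on the
      integral.\<close>
    have Dbound: "cmod (D x) \<le> e * N * indicator P x" if "x \<in> space \<mu>" for x
    proof (cases "x \<in> P")
      case False
      have x: "x \<in> carrier G" using that by simp
      have "conv u v x = 0" by (rule conv_eq_0[OF K(2) L(2) x False[unfolded P_def]])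
      moreover have "v (inv j \<otimes> x) = 0" if "j \<in> J" for j
      proof (rule L(2))
        show "inv j \<otimes> x \<in> carrier G" using Jc[OF that] x by simp
        show "inv j \<otimes> x \<notin> L"
        proof
          assume "inv j \<otimes> x \<in> L"
          moreover have "x = j \<otimes> (inv j \<otimes> x)" using Jc[OF that] x by (simp add: m_assoc[symmetric])
          ultimately have "x \<in> P" unfolding P_def using J(1) that by (intro image_eqI[of _ _ "(j, inv j \<otimes> x)"]) auto
          then show False using False by blast
        qed
      qed
      ultimately show ?thesis using False by (simp add: D_def)
    next
      case True
      have x: "x \<in> carrier G" using that by simp
      have i1: "integrable \<mu> (\<lambda>y. u y * v (inv y \<otimes> x))" by (rule conv_integrable[OF cs_L2[OF u] v x])
      have i2: "integrable \<mu> (\<lambda>y. \<Sum>j\<in>J. u y * indicator (B j) y * v (inv j \<otimes> x))"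
        using cint by (intro Bochner_Integration.integrable_sum integrable_mult_left) auto
      have "D x = (\<integral>y. u y * v (inv y \<otimes> x) \<partial>\<mu>) - (\<integral>y. (\<Sum>j\<in>J. u y * indicator (B j) y * v (inv j \<otimes> x)) \<partial>\<mu>)"
        unfolding D_def c_def convolution_def using cint by (subst Bochner_Integration.integral_sum) auto
      also have "\<dots> = (\<integral>y. u y * v (inv y \<otimes> x) - (\<Sum>j\<in>J. u y * indicator (B j) y * v (inv j \<otimes> x)) \<partial>\<mu>)"
        using i1 i2 by (rule Bochner_Integration.integral_diff[symmetric])
      also have "cmod \<dots> \<le> (\<integral>y. e * cmod (u y) \<partial>\<mu>)"
      proof (rule norm_integral_le[OF Bochner_Integration.integrable_diff[OF i1 i2]])
        show "integrable \<mu> (\<lambda>y. e * cmod (u y))" using ui by simp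
        fix y assume "y \<in> space \<mu>"
        then have y: "y \<in> carrier G" by simp
        show "cmod (u y * v (inv y \<otimes> x) - (\<Sum>j\<in>J. u y * indicator (B j) y * v (inv j \<otimes> x))) \<le> e * cmod (u y)"
        proof (cases "y \<in> K")
          case True
          from pick[OF True] obtain i where i: "i \<in> J" "y \<in> B i"
            "\<forall>a :: 'a \<Rightarrow> complex. (\<Sum>j\<in>J. indicator (B j) y * a j) = a i" by blast
          have "(\<Sum>j\<in>J. u y * indicator (B j) y * v (inv j \<otimes> x)) = u y * v (inv i \<otimes> x)"
            using i(3)[rule_format, of "\<lambda>j. v (inv j \<otimes> x)"] by (simp add: mult.assoc flip: sum_distrib_left)
          then have eq: "u y * v (inv y \<otimes> x) - (\<Sum>j\<in>J. u y * indicator (B j) y * v (inv j \<otimes> x)) = u y * (v (inv y \<otimes> x) - v (inv i \<otimes> x))"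
            by (simp add: right_diff_distrib)
          have "y \<in> i <# W" using B(1) i by blast
          then obtain w where w: "w \<in> W" "y = i \<otimes> w" by (auto simp: l_coset_def)
          have wc: "w \<in> carrier G" "inv w \<in> U" using w by (auto simp: W_def)
          have "inv y \<otimes> x = inv w \<otimes> (inv i \<otimes> x)" using w wc x Jc[OF i(1)] by (simp add: inv_mult_group m_assoc)
          then have "cmod (v (inv y \<otimes> x) - v (inv i \<otimes> x)) \<le> e"
            using U(3)[of "inv i \<otimes> x" "inv w"] wc x Jc[OF i(1)] by simp
          then show ?thesis unfolding eq norm_mult by (simp add: mult.commute[of e] mult_left_mono)
        qed (use K(2)[OF y] in simp)
      qed
      also have "\<dots> = e * N" by (simp add: N_def)
      finally show ?thesis using True by simp
    qed
    have Pi: "integrable \<mu> (\<lambda>x. e * N * indicator P x)"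
      using compact_finite[OF P] compact_sets[OF P] by (intro integrable_mult_right) auto
    have "cmod (\<integral>x. D x \<partial>\<mu>) \<le> (\<integral>x. e * N * indicator P x \<partial>\<mu>)"
      by (rule norm_integral_le[OF Dint Pi Dbound])
    also have "\<dots> = e * (N * measure \<mu> P)"
      using compactin_carrier[OF P] by (simp add: Int_absorb2)
    finally show ?thesis unfolding Deq .
  qed
  have "cmod ((\<integral>x. conv u v x \<partial>\<mu>) - (\<integral>y. u y \<partial>\<mu>) * (\<integral>x. v x \<partial>\<mu>)) \<le> 0"
  proof (rule field_le_epsilon)
    fix d :: real assume d: "d > 0"
    have pos: "N * measure \<mu> P + 1 > 0" using N0 by (simp add: add_nonneg_pos)
    have "cmod ((\<integral>x. conv u v x \<partial>\<mu>) - (\<integral>y. u y \<partial>\<mu>) * (\<integral>x. v x \<partial>\<mu>)) \<le> d / (N * measure \<mu> P + 1) * (N * measure \<mu> P)"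
      by (rule main) (use d pos in simp)
    also have "\<dots> \<le> d / (N * measure \<mu> P + 1) * (N * measure \<mu> P + 1)"
      using d pos by (intro mult_left_mono) auto
    also have "\<dots> = 0 + d" using pos by simp
    finally show "cmod ((\<integral>x. conv u v x \<partial>\<mu>) - (\<integral>y. u y \<partial>\<mu>) * (\<integral>x. v x \<partial>\<mu>)) \<le> 0 + d" .
  qed
  then show ?thesis by simp
qed

text \<open>The Schur bound: the geometric mean of the L1 norms of \<open>f\<close> and of
  \<open>f\<close> composed with inversion. For the bumps below it equals 1.\<close>

definition rconv_bound :: "('a \<Rightarrow> complex) \<Rightarrow> real" where
  "rconv_bound f = sqrt ((\<integral>x. cmod (f x) \<partial>\<mu>) * (\<integral>x. cmod (f (inv x)) \<partial>\<mu>))"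

lemma rconv_bound_nonneg [simp]: "0 \<le> rconv_bound f"
  by (simp add: rconv_bound_def)

text \<open>Schur test.\<close>
lemma conv_norm_cs:
  assumes g: "g \<in> CC" and f: "f \<in> CC"
  shows "l2_norm \<mu> (l2_class \<mu> (conv g f)) \<le> rconv_bound f * l2_norm \<mu> (l2_class \<mu> g)"
proof (rule power2_le_imp_le)
  define A where "A = (\<integral>x. cmod (f (inv x)) \<partial>\<mu>)"
  define u where "u x = complex_of_real ((cmod (g x))\<^sup>2)" for x
  define v where "v x = complex_of_real (cmod (f x))" for x
  have u: "u \<in> CC" and v: "v \<in> CC" unfolding u_def v_def using cs_cmod_power[OF g] cs_cmod[OF f] by auto
  have c: "conv g f \<in> CC" "conv u v \<in> CC" using conv_cs g f u v by auto
  \<comment> \<open>Cauchy-Schwarz with weight \<open>|f(y\<^sup>-\<^sup>1 x)|\<close>, whose total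
    mass \<open>A\<close> is the same for all \<open>x\<close>. The other factor is a convolution of
    functions in \<open>CC\<close>, which \<open>integral_conv\<close> integrates.\<close>
  have pt: "(cmod (conv g f x))\<^sup>2 \<le> A * Re (conv u v x)" if x: "x \<in> space \<mu>" for x
  proof -
    have x: "x \<in> carrier G" using that by simp
    have fx: "(\<lambda>y. f (inv y \<otimes> x)) \<in> CC" by (rule cs_inv_mult[OF f x])
    have uv: "complex_of_real ((cmod (g y))\<^sup>2 * cmod (f (inv y \<otimes> x))) = u y * v (inv y \<otimes> x)" for y
      by (simp add: u_def v_def)
    have "integrable \<mu> (\<lambda>y. Re (u y * v (inv y \<otimes> x)))"
      by (intro integrable_Re conv_integrable cs_L2 u v x)
    then have i1: "integrable \<mu> (\<lambda>y. (cmod (g y))\<^sup>2 * cmod (f (inv y \<otimes> x)))"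
      unfolding uv[symmetric] by simp
    have i2: "integrable \<mu> (\<lambda>y. cmod (f (inv y \<otimes> x)))" using cs_integrable[OF fx] by simp
    have "conv u v x = of_real (\<integral>y. (cmod (g y))\<^sup>2 * cmod (f (inv y \<otimes> x)) \<partial>\<mu>)"
      unfolding convolution_def uv[symmetric] by (rule integral_complex_of_real)
    then have "Re (conv u v x) = (\<integral>y. (cmod (g y))\<^sup>2 * cmod (f (inv y \<otimes> x)) \<partial>\<mu>)" by simp
    moreover have "(\<integral>y. cmod (f (inv y \<otimes> x)) \<partial>\<mu>) = A"
      using integral_cmod_inv_mult[OF f x, of 1] by (simp add: A_def)
    ultimately show ?thesis
      using weighted_Cauchy_Schwarz[OF cs_measurable[OF g] cs_measurable[OF fx] i1 i2]
      by (simp add: convolution_def mult.commute)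
  qed
  have "(l2_norm \<mu> (l2_class \<mu> (conv g f)))\<^sup>2 = (\<integral>x. (cmod (conv g f x))\<^sup>2 \<partial>\<mu>)"
    by (rule l2_norm_class_sq[OF cs_L2[OF c(1)]])
  also have "\<dots> \<le> (\<integral>x. A * Re (conv u v x) \<partial>\<mu>)"
    using L2_fun_integrable[OF cs_L2[OF c(1)]] cs_integrable[OF c(2)] pt
    by (intro integral_mono) auto
  also have "\<dots> = A * Re (\<integral>x. conv u v x \<partial>\<mu>)" using cs_integrable[OF c(2)] by simp
  also have "(\<integral>x. conv u v x \<partial>\<mu>) = of_real ((\<integral>x. (cmod (g x))\<^sup>2 \<partial>\<mu>) * (\<integral>x. cmod (f x) \<partial>\<mu>))"
    unfolding integral_conv[OF u v] of_real_mult unfolding u_def v_def integral_complex_of_real ..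
  also have "A * Re \<dots> = (rconv_bound f * l2_norm \<mu> (l2_class \<mu> g))\<^sup>2"
    unfolding power_mult_distrib l2_norm_class_sq[OF cs_L2[OF g]] by (simp add: rconv_bound_def A_def)
  finally show "(l2_norm \<mu> (l2_class \<mu> (conv g f)))\<^sup>2 \<le> (rconv_bound f * l2_norm \<mu> (l2_class \<mu> g))\<^sup>2" .
qed simp

text \<open>Extends the Schur bound from \<open>CC\<close> to L2. Approximants of \<open>g\<close>
  give pointwise convergence by \<open>conv_bound\<close>, which yields the measurability of the
  limit, and Fatou's lemma yields the norm estimate.\<close>

lemma conv_L2:
  assumes g: "g \<in> L2_fun \<mu>" and f: "f \<in> CC"
  shows "conv g f \<in> L2_fun \<mu>" "l2_norm \<mu> (l2_class \<mu> (conv g f)) \<le> rconv_bound f * l2_norm \<mu> (l2_class \<mu> g)"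
proof -
  let ?n = "\<lambda>g. l2_norm \<mu> (l2_class \<mu> g)"
  have gL: "l2_class \<mu> g \<in> L2 \<mu>" using g by simp
  have "\<exists>\<phi>. \<phi> \<in> CC \<and> l2_norm \<mu> (l2_diff \<mu> (l2_class \<mu> g) (l2_class \<mu> \<phi>)) < 1 / real (Suc n)" for n
    by (rule cs_approx[OF gL, of "1 / real (Suc n)"]) auto
  then obtain \<phi> where \<phi>: "\<And>n. \<phi> n \<in> CC" "\<And>n. l2_norm \<mu> (l2_diff \<mu> (l2_class \<mu> g) (l2_class \<mu> (\<phi> n))) < 1 / real (Suc n)"
    by metis
  have \<phi>L: "\<phi> n \<in> L2_fun \<mu>" for n by (rule cs_L2[OF \<phi>(1)])
  have 0: "(\<lambda>n. 1 / real (Suc n)) \<longlonglongrightarrow> 0" using LIMSEQ_inverse_real_of_nat by (simp add: inverse_eq_divide)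
  have \<phi>0: "(\<lambda>n. l2_norm \<mu> (l2_diff \<mu> (l2_class \<mu> g) (l2_class \<mu> (\<phi> n)))) \<longlonglongrightarrow> 0"
  proof (rule tendsto_sandwich[OF _ _ tendsto_const 0])
    show "\<forall>\<^sub>F n in sequentially. l2_norm \<mu> (l2_diff \<mu> (l2_class \<mu> g) (l2_class \<mu> (\<phi> n))) \<le> 1 / real (Suc n)"
      by (rule always_eventually) (rule allI, rule less_imp_le[OF \<phi>(2)])
  qed simp
  have pt: "(\<lambda>n. conv (\<phi> n) f x) \<longlonglongrightarrow> conv g f x" if x: "x \<in> space \<mu>" for x
  proof -
    let ?B = "l2_norm \<mu> (l2_class \<mu> (\<lambda>y. f (inv y)))"
    have xc: "x \<in> carrier G" using x by simp
    have "(\<lambda>n. conv g f x - conv (\<phi> n) f x) \<longlonglongrightarrow> 0"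
    proof (rule Lim_null_comparison)
      show "\<forall>\<^sub>F n in sequentially. norm (conv g f x - conv (\<phi> n) f x) \<le> l2_norm \<mu> (l2_diff \<mu> (l2_class \<mu> g) (l2_class \<mu> (\<phi> n))) * ?B"
        using conv_bound[OF L2_fun_diff[OF g \<phi>L] f xc] g \<phi>L
        by (intro always_eventually) (simp add: conv_diff[OF g \<phi>L f xc] l2_diff_class)
      show "(\<lambda>n. l2_norm \<mu> (l2_diff \<mu> (l2_class \<mu> g) (l2_class \<mu> (\<phi> n))) * ?B) \<longlonglongrightarrow> 0"
        using tendsto_mult_right[OF \<phi>0, of ?B] by simp
    qed
    from tendsto_diff[OF tendsto_const this, of "conv g f x"] show ?thesis by simp
  qed
  have meas: "conv (\<phi> n) f \<in> borel_measurable \<mu>" for n by (rule cs_measurable[OF conv_cs[OF \<phi>(1) f]])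
  have [measurable]: "conv g f \<in> borel_measurable \<mu>"
    by (rule borel_measurable_LIMSEQ_metric[OF meas pt])
  have "(\<lambda>n. (rconv_bound f * ?n (\<phi> n))\<^sup>2) \<longlonglongrightarrow> (rconv_bound f * ?n g)\<^sup>2"
  proof (intro tendsto_intros l2_tendsto_norm[where X="\<lambda>n. l2_class \<mu> (\<phi> n)"])
    show "(\<lambda>n. l2_norm \<mu> (l2_diff \<mu> (l2_class \<mu> (\<phi> n)) (l2_class \<mu> g))) \<longlonglongrightarrow> 0"
      using \<phi>0 gL \<phi>L by (subst l2_norm_diff_commute) auto
  qed (use gL \<phi>L in auto)
  then have lim: "(\<lambda>n. ennreal ((rconv_bound f * ?n (\<phi> n))\<^sup>2)) \<longlonglongrightarrow> ennreal ((rconv_bound f * ?n g)\<^sup>2)"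
    by (rule tendsto_ennrealI)
  have "(\<integral>\<^sup>+x. ennreal ((cmod (conv g f x))\<^sup>2) \<partial>\<mu>) = (\<integral>\<^sup>+x. liminf (\<lambda>n. ennreal ((cmod (conv (\<phi> n) f x))\<^sup>2)) \<partial>\<mu>)"
  proof (rule nn_integral_cong)
    fix x assume "x \<in> space \<mu>"
    then have "(\<lambda>n. ennreal ((cmod (conv (\<phi> n) f x))\<^sup>2)) \<longlonglongrightarrow> ennreal ((cmod (conv g f x))\<^sup>2)"
      by (intro tendsto_ennrealI tendsto_intros pt)
    from lim_imp_Liminf[OF _ this] show "ennreal ((cmod (conv g f x))\<^sup>2) = liminf (\<lambda>n. ennreal ((cmod (conv (\<phi> n) f x))\<^sup>2))"
      by simp
  qed
  also have "\<dots> \<le> liminf (\<lambda>n. \<integral>\<^sup>+x. ennreal ((cmod (conv (\<phi> n) f x))\<^sup>2) \<partial>\<mu>)"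
    using meas by (intro nn_integral_liminf) auto
  also have "\<dots> \<le> liminf (\<lambda>n. ennreal ((rconv_bound f * ?n (\<phi> n))\<^sup>2))"
  proof (intro Liminf_mono always_eventually allI)
    fix n
    have L: "conv (\<phi> n) f \<in> L2_fun \<mu>" by (rule cs_L2[OF conv_cs[OF \<phi>(1) f]])
    have "(\<integral>\<^sup>+x. ennreal ((cmod (conv (\<phi> n) f x))\<^sup>2) \<partial>\<mu>) = ennreal ((?n (conv (\<phi> n) f))\<^sup>2)"
      unfolding l2_norm_class_sq[OF L] by (rule nn_integral_eq_integral[OF L2_fun_integrable[OF L]]) simp
    also have "\<dots> \<le> ennreal ((rconv_bound f * ?n (\<phi> n))\<^sup>2)"
      by (intro ennreal_leI power_mono conv_norm_cs \<phi> f) simp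
    finally show "(\<integral>\<^sup>+x. ennreal ((cmod (conv (\<phi> n) f x))\<^sup>2) \<partial>\<mu>) \<le> ennreal ((rconv_bound f * ?n (\<phi> n))\<^sup>2)" .
  qed
  also have "\<dots> = ennreal ((rconv_bound f * ?n g)\<^sup>2)" by (rule lim_imp_Liminf[OF _ lim]) simp
  finally have bd: "(\<integral>\<^sup>+x. ennreal ((cmod (conv g f x))\<^sup>2) \<partial>\<mu>) \<le> ennreal ((rconv_bound f * ?n g)\<^sup>2)" .
  then have "(\<integral>\<^sup>+x. ennreal ((cmod (conv g f x))\<^sup>2) \<partial>\<mu>) < \<infinity>" using ennreal_less_top le_less_trans by fastforce
  then show L: "conv g f \<in> L2_fun \<mu>" by (simp add: L2_fun_def integrable_iff_bounded)
  have "ennreal ((?n (conv g f))\<^sup>2) \<le> ennreal ((rconv_bound f * ?n g)\<^sup>2)"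
    using bd nn_integral_eq_integral[OF L2_fun_integrable[OF L]] by (simp add: l2_norm_class_sq[OF L])
  then have "(?n (conv g f))\<^sup>2 \<le> (rconv_bound f * ?n g)\<^sup>2" by (simp add: ennreal_le_iff)
  then show "?n (conv g f) \<le> rconv_bound f * ?n g" by (rule power2_le_imp_le) simp
qed

text \<open>For fixed \<open>f\<close> this is right convolution. For fixed \<open>\<xi>\<close> and
  varying \<open>f\<close> it prescribes the operator of a left bounded vector, see
  \<open>is_left_convolution_op_iff\<close>.\<close>

definition rconv :: "('a \<Rightarrow> complex) \<Rightarrow> 'a l2 \<Rightarrow> 'a l2" where
  "rconv f \<xi> = l2_class \<mu> (conv (l2_rep \<xi>) f)"

lemma rconv_class:
  assumes "g \<in> L2_fun \<mu>" "f \<in> CC" shows "rconv f (l2_class \<mu> g) = l2_class \<mu> (conv g f)"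
  unfolding rconv_def
  using conv_cong_AE[OF l2_rep_class[OF assms(1)] l2_rep_L2_fun[OF l2_class_in[OF assms(1)]] assms]
  by (intro l2_class_cong) simp

lemma rconv_in [simp]: "\<xi> \<in> L2 \<mu> \<Longrightarrow> f \<in> CC \<Longrightarrow> rconv f \<xi> \<in> L2 \<mu>"
  by (simp add: rconv_def conv_L2)

lemma rconv_norm: "\<xi> \<in> L2 \<mu> \<Longrightarrow> f \<in> CC \<Longrightarrow> l2_norm \<mu> (rconv f \<xi>) \<le> rconv_bound f * l2_norm \<mu> \<xi>"
  using conv_L2(2)[of "l2_rep \<xi>" f] by (simp add: rconv_def)

lemma rconv_bounded:
  assumes f: "f \<in> CC" shows "bounded_map \<mu> \<mu> (rconv f)"
proof (rule bounded_mapI[where K="rconv_bound f"])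
  show "rconv f (l2_add \<mu> \<xi> \<eta>) = l2_add \<mu> (rconv f \<xi>) (rconv f \<eta>)" if "\<xi> \<in> L2 \<mu>" "\<eta> \<in> L2 \<mu>" for \<xi> \<eta>
  proof -
    obtain g h where *: "g \<in> L2_fun \<mu>" "\<xi> = l2_class \<mu> g" "h \<in> L2_fun \<mu>" "\<eta> = l2_class \<mu> h"
      using \<open>\<xi> \<in> L2 \<mu>\<close> \<open>\<eta> \<in> L2 \<mu>\<close> by (meson L2_cases)
    show ?thesis unfolding *(2,4) using * f
      by (simp add: l2_add_class rconv_class L2_fun_add conv_L2) (rule l2_class_cong, simp add: conv_add)
  qed
  show "rconv f (l2_scale \<mu> c \<xi>) = l2_scale \<mu> c (rconv f \<xi>)" if \<xi>: "\<xi> \<in> L2 \<mu>" for c \<xi>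
  proof -
    obtain g where *: "g \<in> L2_fun \<mu>" "\<xi> = l2_class \<mu> g" using \<xi> by (meson L2_cases)
    show ?thesis unfolding *(2) using * f
      by (simp add: l2_scale_class rconv_class L2_fun_scale conv_L2) (rule l2_class_cong, simp add: conv_scale)
  qed
qed (use f in \<open>auto intro: rconv_norm\<close>)

lemma rconv_diff: "f \<in> CC \<Longrightarrow> \<xi> \<in> L2 \<mu> \<Longrightarrow> \<eta> \<in> L2 \<mu> \<Longrightarrow> rconv f (l2_diff \<mu> \<xi> \<eta>) = l2_diff \<mu> (rconv f \<xi>) (rconv f \<eta>)"
  by (rule bounded_map_diff[OF rconv_bounded])

section \<open>Left translations\<close>

lemma shift_L2:
  assumes "h \<in> L2_fun \<mu>" "g \<in> carrier G" shows "(\<lambda>x. h (g \<otimes> x)) \<in> L2_fun \<mu>"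
  using assms measurable_compose[OF measurable_left_mult[OF assms(2)] L2_fun_measurable[OF assms(1)]]
    integrable_left_mult[OF assms(2) L2_fun_integrable[OF assms(1)]]
  by (simp add: L2_fun_def)

lemma left_regular_class:
  assumes "h \<in> L2_fun \<mu>" "g \<in> carrier G"
  shows "left_regular G \<mu> g (l2_class \<mu> h) = l2_class \<mu> (\<lambda>x. h (inv g \<otimes> x))"
proof -
  have "left_regular G \<mu> g (l2_class \<mu> h) = l2_class \<mu> (\<lambda>x. l2_rep (l2_class \<mu> h) (inv g \<otimes> x))"
    using assms(1) by (simp add: left_regular_def)
  also have "\<dots> = l2_class \<mu> (\<lambda>x. h (inv g \<otimes> x))"
    by (rule l2_class_cong_AE[OF AE_left_mult[OF _ l2_rep_class[OF assms(1)]]]) (use assms(2) in simp)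
  finally show ?thesis .
qed

lemma left_regular_bounded:
  assumes g: "g \<in> carrier G" shows "left_regular G \<mu> g \<in> bounded_ops \<mu>"
  unfolding bounded_ops_iff
proof
  have ig: "inv g \<in> carrier G" using g by simp
  show "bounded_map \<mu> \<mu> (left_regular G \<mu> g)"
  proof (rule bounded_mapI[where K=1])
    fix \<xi> assume "\<xi> \<in> L2 \<mu>"
    then obtain h where h: "h \<in> L2_fun \<mu>" "\<xi> = l2_class \<mu> h" by (meson L2_cases)
    note sh = shift_L2[OF h(1) ig]
    show "left_regular G \<mu> g \<xi> \<in> L2 \<mu>" unfolding h(2) left_regular_class[OF h(1) g] using sh by simp
    show "l2_norm \<mu> (left_regular G \<mu> g \<xi>) \<le> 1 * l2_norm \<mu> \<xi>"
      unfolding h(2) left_regular_class[OF h(1) g] l2_norm_class[OF sh] l2_norm_class[OF h(1)]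
      using integral_left_mult[OF ig borel_measurable_integrable[OF L2_fun_integrable[OF h(1)]]] by simp
    show "left_regular G \<mu> g (l2_scale \<mu> c \<xi>) = l2_scale \<mu> c (left_regular G \<mu> g \<xi>)" for c
      unfolding h(2) using h(1) sh g by (simp add: l2_scale_class left_regular_class L2_fun_scale)
    fix \<eta> assume "\<eta> \<in> L2 \<mu>"
    then obtain k where k: "k \<in> L2_fun \<mu>" "\<eta> = l2_class \<mu> k" by (meson L2_cases)
    show "left_regular G \<mu> g (l2_add \<mu> \<xi> \<eta>) = l2_add \<mu> (left_regular G \<mu> g \<xi>) (left_regular G \<mu> g \<eta>)"
      unfolding h(2) k(2) using h(1) k(1) sh shift_L2[OF k(1) ig] g by (simp add: l2_add_class left_regular_class L2_fun_add)
  qed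
  show "left_regular G \<mu> g \<in> extensional (L2 \<mu>)" by (simp add: left_regular_def)
qed

lemma left_regular_adj:
  assumes g: "g \<in> carrier G" shows "op_adj \<mu> (left_regular G \<mu> g) = left_regular G \<mu> (inv g)"
proof (rule op_adj_unique)
  have ig: "inv g \<in> carrier G" using g by simp
  fix \<xi> \<eta> assume "\<xi> \<in> L2 \<mu>" "\<eta> \<in> L2 \<mu>"
  then obtain h k where *: "h \<in> L2_fun \<mu>" "\<xi> = l2_class \<mu> h" "k \<in> L2_fun \<mu>" "\<eta> = l2_class \<mu> k" by (meson L2_cases)
  have m: "(\<lambda>x. h x * cnj (k (g \<otimes> x))) \<in> borel_measurable \<mu>"
    by (rule borel_measurable_integrable[OF L2_fun_mult_integrable[OF *(1) L2_fun_cnj[OF shift_L2[OF *(3) g]]]])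
  have "(\<integral>x. h (inv g \<otimes> x) * cnj (k x) \<partial>\<mu>) = (\<integral>x. h (inv g \<otimes> x) * cnj (k (g \<otimes> (inv g \<otimes> x))) \<partial>\<mu>)"
    using g by (intro Bochner_Integration.integral_cong) (auto simp: m_assoc[symmetric])
  also have "\<dots> = (\<integral>x. h x * cnj (k (g \<otimes> x)) \<partial>\<mu>)" by (rule integral_left_mult[OF ig m])
  finally show "l2_inner \<mu> (left_regular G \<mu> g \<xi>) \<eta> = l2_inner \<mu> \<xi> (left_regular G \<mu> (inv g) \<eta>)"
    unfolding *(2,4) using * g ig by (simp add: left_regular_class l2_inner_class shift_L2)
qed (use g left_regular_bounded in auto)

text \<open>\<open>inv y \<otimes> x\<close> does not change when \<open>y\<close> and
  \<open>x\<close> are multiplied by the same element from the left, and the measure is left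
  invariant.\<close>

lemma rconv_left_regular:
  assumes g: "g \<in> carrier G" and f: "f \<in> CC" and \<xi>: "\<xi> \<in> L2 \<mu>"
  shows "rconv f (left_regular G \<mu> g \<xi>) = left_regular G \<mu> g (rconv f \<xi>)"
proof -
  have ig: "inv g \<in> carrier G" using g by simp
  obtain h where h: "h \<in> L2_fun \<mu>" "\<xi> = l2_class \<mu> h" using \<xi> by (meson L2_cases)
  have "conv (\<lambda>y. h (inv g \<otimes> y)) f x = conv h f (inv g \<otimes> x)" if x: "x \<in> space \<mu>" for x
  proof -
    have xc: "x \<in> carrier G" "inv g \<otimes> x \<in> carrier G" using x g by auto
    have "conv (\<lambda>y. h (inv g \<otimes> y)) f x = (\<integral>y. h (inv g \<otimes> y) * f (inv (inv g \<otimes> y) \<otimes> (inv g \<otimes> x)) \<partial>\<mu>)"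
      unfolding convolution_def
    proof (intro Bochner_Integration.integral_cong refl)
      fix y assume "y \<in> space \<mu>"
      then have y: "y \<in> carrier G" by simp
      have "inv (inv g \<otimes> y) \<otimes> (inv g \<otimes> x) = inv y \<otimes> (g \<otimes> (inv g \<otimes> x))"
        using y g xc by (simp add: inv_mult_group m_assoc)
      also have "g \<otimes> (inv g \<otimes> x) = x" using g xc by (simp add: m_assoc[symmetric])
      finally show "h (inv g \<otimes> y) * f (inv y \<otimes> x) = h (inv g \<otimes> y) * f (inv (inv g \<otimes> y) \<otimes> (inv g \<otimes> x))" by simp
    qed
    also have "\<dots> = conv h f (inv g \<otimes> x)"
      unfolding convolution_def
      by (rule integral_left_mult[OF ig borel_measurable_integrable[OF conv_integrable[OF h(1) f xc(2)]]])
    finally show ?thesis .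
  qed
  then show ?thesis unfolding h(2)
    using h(1) f g ig by (simp add: left_regular_class rconv_class shift_L2 conv_L2) (rule l2_class_cong, simp)
qed

context
  fixes S assumes S: "S \<subseteq> carrier G" "\<And>s. s \<in> S \<Longrightarrow> inv s \<in> S"
begin

lemma left_translations:
  shows translations_ops: "left_regular G \<mu> ` S \<subseteq> bounded_ops \<mu>"
    and translations_adj: "s \<in> left_regular G \<mu> ` S \<Longrightarrow> op_adj \<mu> s \<in> left_regular G \<mu> ` S"
  using S left_regular_bounded left_regular_adj by auto

lemma translation_vN: "vN_algebra \<mu> (translation_vN G \<mu> S)"
  unfolding translation_vN_def by (rule vN_algebra_bicommutant[OF left_translations])

text \<open>Right convolutions lie in the commutant of the translations by \<open>S\<close>, so the
  double commutant commutes with them.\<close>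

lemma translation_vN_rconv:
  assumes A: "A \<in> translation_vN G \<mu> S" and f: "f \<in> CC" and \<xi>: "\<xi> \<in> L2 \<mu>"
  shows "A (rconv f \<xi>) = rconv f (A \<xi>)"
proof -
  have "(\<lambda>\<xi>\<in>L2 \<mu>. rconv f \<xi>) \<in> commutant \<mu> (left_regular G \<mu> ` S)"
    unfolding commutant_iff[OF translations_ops]
    using rconv_bounded[OF f] S(1) f left_regular_bounded by (auto simp: rconv_left_regular subset_iff)
  then have "\<forall>\<xi>\<in>L2 \<mu>. A ((\<lambda>\<xi>\<in>L2 \<mu>. rconv f \<xi>) \<xi>) = (\<lambda>\<xi>\<in>L2 \<mu>. rconv f \<xi>) (A \<xi>)" "A \<in> bounded_ops \<mu>"
    using A unfolding translation_vN_def commutant_iff[OF commutant_subset] by blast+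
  then show ?thesis using \<xi> by simp
qed

end

end

section \<open>Approximate units\<close>

context haar_group
begin

text \<open>\<open>k x = of_real (cmod (k x))\<close> says that the value is real and nonnegative.
  Symmetry makes both factors of \<open>rconv_bound\<close> equal to 1, so that right convolution by
  a bump is a contraction.\<close>

definition bump :: "'a set \<Rightarrow> ('a \<Rightarrow> complex) \<Rightarrow> bool" where
  "bump U k \<longleftrightarrow> k \<in> CC \<and> (\<integral>x. k x \<partial>\<mu>) = 1 \<and>
     (\<forall>x\<in>carrier G. k x = of_real (cmod (k x)) \<and> k (inv x) = k x \<and> (x \<notin> U \<longrightarrow> k x = 0))"

lemma bump_mono: "bump U k \<Longrightarrow> U \<subseteq> V \<Longrightarrow> bump V k"
  by (auto simp: bump_def)

lemma bump_cs: "bump U k \<Longrightarrow> k \<in> CC"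
  by (simp add: bump_def)

lemma bump_L2 [simp]: "bump U k \<Longrightarrow> l2_class \<mu> k \<in> L2 \<mu>"
  using bump_cs cs_L2 by auto

lemma bump_norm_integral:
  assumes "bump U k" shows "(\<integral>x. cmod (k x) \<partial>\<mu>) = 1"
proof -
  have "complex_of_real (\<integral>x. cmod (k x) \<partial>\<mu>) = (\<integral>x. of_real (cmod (k x)) \<partial>\<mu>)" by simp
  also have "\<dots> = (\<integral>x. k x \<partial>\<mu>)"
    using assms by (intro Bochner_Integration.integral_cong) (auto simp: bump_def)
  also have "\<dots> = 1" using assms by (simp add: bump_def)
  finally show ?thesis by simp
qed

lemma bump_rconv_bound:
  assumes "bump U k" shows "rconv_bound k = 1"
proof -
  have "(\<integral>x. cmod (k (inv x)) \<partial>\<mu>) = (\<integral>x. cmod (k x) \<partial>\<mu>)"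
    using assms by (intro Bochner_Integration.integral_cong) (auto simp: bump_def)
  then show ?thesis using bump_norm_integral[OF assms] by (simp add: rconv_bound_def)
qed

text \<open>The product of a cut-off function with its reflection is symmetric. It is nonzero on an
  open set around \<open>\<one>\<close>, hence has positive integral and can be normalised.\<close>

lemma bump_exists:
  assumes U: "openin T U" "\<one> \<in> U" obtains k where "bump U k"
proof -
  define V where "V = U \<inter> {x \<in> carrier G. inv x \<in> U}"
  have V: "openin T V" "\<one> \<in> V" using U openin_inv by (auto simp: V_def intro: openin_Int)
  have "compactin T {\<one>}" by (simp add: compactin_sing topspace_eq)
  then obtain \<phi> :: "'a \<Rightarrow> real" and L where \<phi>: "(\<lambda>x. complex_of_real (\<phi> x)) \<in> CC"
    "L \<subseteq> V" "\<And>x. x \<in> carrier G \<Longrightarrow> 0 \<le> \<phi> x \<and> \<phi> x \<le> 1"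
    "\<And>x. x \<in> {\<one>} \<Longrightarrow> \<phi> x = 1" "\<And>x. x \<in> carrier G \<Longrightarrow> x \<notin> L \<Longrightarrow> \<phi> x = 0"
    by (rule Urysohn_compact_support[OF _ V(1)]) (use V(2) in auto)
  define r where "r x = \<phi> x * \<phi> (inv x)" for x
  have r0: "0 \<le> r x" if "x \<in> carrier G" for x using \<phi>(3) that by (simp add: r_def)
  have rcs: "(\<lambda>x. complex_of_real (r x)) \<in> CC"
    using cs_mult[OF \<phi>(1) cs_inv[OF \<phi>(1)]] by (simp add: r_def)
  have ri: "integrable \<mu> r" using integrable_Re[OF cs_integrable[OF rcs]] by simp
  define I where "I = (\<integral>x. r x \<partial>\<mu>)"
  have "I \<ge> 0" unfolding I_def using r0 by (intro Bochner_Integration.integral_nonneg) auto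
  moreover have "I \<noteq> 0"
  proof
    assume "I = 0"
    then have ae: "AE x in \<mu>. r x = 0"
      using integral_nonneg_eq_0_iff_AE[OF ri AE_I2] r0 by (auto simp: I_def)
    define W where "W = {x \<in> topspace T. complex_of_real (r x) \<in> - {0}}"
    have W: "openin T W"
      unfolding W_def by (rule openin_continuous_map_preimage[OF cs_continuous[OF rcs]]) auto
    have "\<one> \<in> W" using \<phi>(4) by (simp add: W_def r_def topspace_eq)
    then have "emeasure \<mu> W > 0" using open_pos[OF W] by blast
    moreover have "emeasure \<mu> W = 0"
      using ae open_sets[OF W] by (subst (asm) AE_iff_measurable[OF _ refl]) (auto simp: W_def topspace_eq)
    ultimately show False by simp
  qed
  ultimately have I: "I > 0" by simp
  define k where "k x = complex_of_real (r x / I)" for x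
  have "bump U k"
    unfolding bump_def
  proof (intro conjI ballI)
    have k: "k = (\<lambda>x. of_real (1 / I) * of_real (r x))" by (auto simp: k_def)
    show "k \<in> CC" unfolding k by (rule cs_scale[OF rcs])
    have "(\<integral>x. k x \<partial>\<mu>) = of_real (\<integral>x. r x / I \<partial>\<mu>)" unfolding k_def by (rule integral_complex_of_real)
    also have "(\<integral>x. r x / I \<partial>\<mu>) = 1" using I by (simp add: I_def)
    finally show "(\<integral>x. k x \<partial>\<mu>) = 1" by simp
    fix x assume x: "x \<in> carrier G"
    show "k x = of_real (cmod (k x))" using r0[OF x] I by (simp add: k_def norm_divide)
    show "k (inv x) = k x" using x by (simp add: k_def r_def mult.commute)
    show "x \<notin> U \<longrightarrow> k x = 0"
    proof
      assume "x \<notin> U"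
      then have "x \<notin> L" using \<phi>(2) by (auto simp: V_def)
      then show "k x = 0" using \<phi>(5)[OF x] by (simp add: k_def r_def)
    qed
  qed
  then show ?thesis by (rule that)
qed

lemma rconv_bump_norm: "bump U k \<Longrightarrow> \<xi> \<in> L2 \<mu> \<Longrightarrow> l2_norm \<mu> (rconv k \<xi>) \<le> l2_norm \<mu> \<xi>"
  using rconv_norm[of \<xi> k] by (simp add: bump_cs bump_rconv_bound)

lemma compact_neighbourhood_one:
  obtains U N where "openin T U" "compactin T N" "\<one> \<in> U" "U \<subseteq> N"
  using locally_compact that unfolding locally_compact_space_def topspace_eq by (meson one_closed)

lemma l2_norm_uniform:
  assumes h: "h \<in> L2_fun \<mu>" and P: "compactin T P"
    and d: "0 \<le> d" "\<And>x. x \<in> carrier G \<Longrightarrow> cmod (h x) \<le> d" "\<And>x. x \<in> carrier G \<Longrightarrow> x \<notin> P \<Longrightarrow> h x = 0"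
  shows "(l2_norm \<mu> (l2_class \<mu> h))\<^sup>2 \<le> d\<^sup>2 * measure \<mu> P"
proof -
  have "(l2_norm \<mu> (l2_class \<mu> h))\<^sup>2 = (\<integral>x. (cmod (h x))\<^sup>2 \<partial>\<mu>)" by (rule l2_norm_class_sq[OF h])
  also have "\<dots> \<le> (\<integral>x. d\<^sup>2 * indicator P x \<partial>\<mu>)"
  proof (rule integral_mono[OF L2_fun_integrable[OF h]])
    show "integrable \<mu> (\<lambda>x. d\<^sup>2 * indicat_real P x)"
      using compact_finite[OF P] compact_sets[OF P] by (intro integrable_mult_right) auto
    fix x assume "x \<in> space \<mu>"
    then show "(cmod (h x))\<^sup>2 \<le> d\<^sup>2 * indicat_real P x"
      using power_mono[OF d(2)[of x], of 2] d(3)[of x] by (auto simp: indicator_def)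
  qed
  also have "\<dots> = d\<^sup>2 * measure \<mu> P" using compactin_carrier[OF P] by (simp add: Int_absorb2)
  finally show ?thesis .
qed

lemma small_scale:
  assumes "e > 0" "0 \<le> m"
  obtains d :: real where "d > 0" "d\<^sup>2 * m < e\<^sup>2"
proof
  let ?d = "e / (m + 1)"
  show "?d > 0" using assms by simp
  have "?d\<^sup>2 * m = e\<^sup>2 * (m / (m + 1)\<^sup>2)" by (simp add: power_divide)
  also have "m / (m + 1)\<^sup>2 < 1" using assms by (simp add: power2_eq_square algebra_simps add_pos_nonneg add_nonneg_pos)
  then have "e\<^sup>2 * (m / (m + 1)\<^sup>2) < e\<^sup>2 * 1" using assms by (intro mult_strict_left_mono) auto
  finally show "?d\<^sup>2 * m < e\<^sup>2" by simp
qed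

text \<open>\<open>k\<close> is a probability density, so the left side is the modulus of an average
  of \<open>h - c\<close> over \<open>U\<close>.\<close>

lemma bump_average:
  assumes k: "bump U k" and h: "integrable \<mu> (\<lambda>y. h y * k y)" and "\<And>y. y \<in> carrier G \<Longrightarrow> y \<in> U \<Longrightarrow> cmod (h y - c) \<le> d"
  shows "cmod ((\<integral>y. h y * k y \<partial>\<mu>) - c) \<le> d"
proof -
  have ki: "integrable \<mu> k" using cs_integrable[OF bump_cs[OF k]] .
  have "(\<integral>y. h y * k y \<partial>\<mu>) - c = (\<integral>y. h y * k y - c * k y \<partial>\<mu>)"
    using k ki h by (simp add: bump_def)
  also have "cmod \<dots> \<le> (\<integral>y. d * cmod (k y) \<partial>\<mu>)"
  proof (rule norm_integral_le)
    fix y assume "y \<in> space \<mu>"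
    then have y: "y \<in> carrier G" by simp
    show "cmod (h y * k y - c * k y) \<le> d * cmod (k y)"
    proof (cases "y \<in> U")
      case True
      then show ?thesis using assms(3)[OF y] by (simp add: norm_mult mult_right_mono flip: left_diff_distrib)
    qed (use k y in \<open>auto simp: bump_def\<close>)
  qed (use h ki in auto)
  also have "\<dots> = d" using bump_norm_integral[OF k] by simp
  finally show ?thesis .
qed

text \<open>By the symmetry of \<open>k\<close>, \<open>conv g k x\<close> is an average of
  \<open>g (x \<otimes> y)\<close> over \<open>y\<close> near \<open>\<one>\<close>, uniformly close
  to \<open>g x\<close>. Keeping the bumps inside a fixed compact \<open>N\<close> confines the
  error to one compact set \<open>P\<close>, which turns the uniform bound into an L2 bound.\<close>

lemma approx_unit_right_cs:
  assumes g: "g \<in> CC" and e: "e > 0"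
  obtains U where "openin T U" "\<one> \<in> U"
    "\<And>k. bump U k \<Longrightarrow> l2_norm \<mu> (l2_diff \<mu> (rconv k (l2_class \<mu> g)) (l2_class \<mu> g)) < e"
proof -
  obtain K where K: "compactin T K" "\<And>x. x \<in> carrier G \<Longrightarrow> x \<notin> K \<Longrightarrow> g x = 0" by (rule cs_E[OF g]) blast
  obtain U0 N where U0: "openin T U0" "compactin T N" "\<one> \<in> U0" "U0 \<subseteq> N" by (rule compact_neighbourhood_one)
  define P where "P = (\<lambda>(x, y). x \<otimes> y) ` (K \<times> N) \<union> K"
  have P: "compactin T P" unfolding P_def by (intro compactin_Un compactin_mult K U0)
  obtain d where d: "d > 0" "d\<^sup>2 * measure \<mu> P < e\<^sup>2" by (rule small_scale[OF e measure_nonneg])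
  obtain V where V: "openin T V" "\<one> \<in> V" "\<And>x u. x \<in> carrier G \<Longrightarrow> u \<in> V \<Longrightarrow> cmod (g (x \<otimes> u) - g x) < d"
    by (rule uniform_continuity_right[OF g d(1)]) blast
  show ?thesis
  proof (rule that[of "U0 \<inter> V"])
    fix k assume k: "bump (U0 \<inter> V) k"
    have kc: "k \<in> CC" by (rule bump_cs[OF k])
    have k0: "k y = 0" if "y \<in> carrier G" "y \<notin> N" for y using k that U0 by (auto simp: bump_def)
    let ?h = "\<lambda>x. conv g k x - g x"
    have hL: "?h \<in> L2_fun \<mu>" by (intro cs_L2 cs_diff conv_cs g kc)
    have "(l2_norm \<mu> (l2_class \<mu> ?h))\<^sup>2 \<le> d\<^sup>2 * measure \<mu> P"
    proof (rule l2_norm_uniform[OF hL P])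
      fix x assume x: "x \<in> carrier G"
      have "conv g k x = (\<integral>y. g (x \<otimes> y) * k y \<partial>\<mu>)"
        unfolding conv_eq_translate[OF cs_L2[OF g] kc x]
        using k by (intro Bochner_Integration.integral_cong) (auto simp: bump_def)
      moreover have "integrable \<mu> (\<lambda>y. g (x \<otimes> y) * k y)"
        by (intro cs_integrable cs_mult cs_left_mult g kc x)
      ultimately show "cmod (?h x) \<le> d"
        using bump_average[OF k, of "\<lambda>y. g (x \<otimes> y)" "g x" d] V(3)[OF x] by (auto intro: less_imp_le)
      show "?h x = 0" if "x \<notin> P"
        using conv_eq_0[of K g N k x] K(2) k0 x that by (auto simp: P_def)
    qed (use d in simp)
    then have "(l2_norm \<mu> (l2_class \<mu> ?h))\<^sup>2 < e\<^sup>2" using d(2) by simp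
    then have "l2_norm \<mu> (l2_class \<mu> ?h) < e" by (rule power2_less_imp_less) (use e in simp)
    then show "l2_norm \<mu> (l2_diff \<mu> (rconv k (l2_class \<mu> g)) (l2_class \<mu> g)) < e"
      using cs_L2[OF g] cs_L2[OF conv_cs[OF g kc]] kc by (simp add: rconv_class l2_diff_class)
  qed (use U0 V in auto)
qed

text \<open>The bump is the vector and \<open>f\<close> acts on it: in this form an operator that
  commutes with right convolutions can be moved past \<open>rconv f\<close> and onto the
  bump.\<close>

lemma approx_unit_left_cs:
  assumes f: "f \<in> CC" and e: "e > 0"
  obtains U where "openin T U" "\<one> \<in> U"
    "\<And>k. bump U k \<Longrightarrow> l2_norm \<mu> (l2_diff \<mu> (rconv f (l2_class \<mu> k)) (l2_class \<mu> f)) < e"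
proof -
  obtain K where K: "compactin T K" "\<And>x. x \<in> carrier G \<Longrightarrow> x \<notin> K \<Longrightarrow> f x = 0" by (rule cs_E[OF f]) blast
  obtain U0 N where U0: "openin T U0" "compactin T N" "\<one> \<in> U0" "U0 \<subseteq> N" by (rule compact_neighbourhood_one)
  define P where "P = (\<lambda>(x, y). x \<otimes> y) ` (N \<times> K) \<union> K"
  have P: "compactin T P" unfolding P_def by (intro compactin_Un compactin_mult K U0)
  obtain d where d: "d > 0" "d\<^sup>2 * measure \<mu> P < e\<^sup>2" by (rule small_scale[OF e measure_nonneg])
  obtain V where V: "openin T V" "\<one> \<in> V" "\<And>x u. x \<in> carrier G \<Longrightarrow> u \<in> V \<Longrightarrow> cmod (f (u \<otimes> x) - f x) < d"
    by (rule uniform_continuity_left[OF f d(1)]) blast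
  show ?thesis
  proof (rule that[of "U0 \<inter> {y \<in> carrier G. inv y \<in> V}"])
    fix k assume k: "bump (U0 \<inter> {y \<in> carrier G. inv y \<in> V}) k"
    have kc: "k \<in> CC" by (rule bump_cs[OF k])
    have k0: "k y = 0" if "y \<in> carrier G" "y \<notin> N" for y using k that U0 by (auto simp: bump_def)
    let ?h = "\<lambda>x. conv k f x - f x"
    have hL: "?h \<in> L2_fun \<mu>" by (intro cs_L2 cs_diff conv_cs f kc)
    have "(l2_norm \<mu> (l2_class \<mu> ?h))\<^sup>2 \<le> d\<^sup>2 * measure \<mu> P"
    proof (rule l2_norm_uniform[OF hL P])
      fix x assume x: "x \<in> carrier G"
      have "conv k f x = (\<integral>y. f (inv y \<otimes> x) * k y \<partial>\<mu>)"
        by (simp add: convolution_def mult.commute)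
      moreover have "integrable \<mu> (\<lambda>y. f (inv y \<otimes> x) * k y)"
        by (intro cs_integrable cs_mult cs_inv_mult f kc x)
      ultimately show "cmod (?h x) \<le> d"
        using bump_average[OF k, of "\<lambda>y. f (inv y \<otimes> x)" "f x" d] V(3)[OF x] by (auto intro: less_imp_le)
      show "?h x = 0" if "x \<notin> P"
        using conv_eq_0[of N k K f x] K(2) k0 x that by (auto simp: P_def)
    qed (use d in simp)
    then have "(l2_norm \<mu> (l2_class \<mu> ?h))\<^sup>2 < e\<^sup>2" using d(2) by simp
    then have "l2_norm \<mu> (l2_class \<mu> ?h) < e" by (rule power2_less_imp_less) (use e in simp)
    then show "l2_norm \<mu> (l2_diff \<mu> (rconv f (l2_class \<mu> k)) (l2_class \<mu> f)) < e"
      using cs_L2[OF f] cs_L2[OF kc] cs_L2[OF conv_cs[OF kc f]] f by (simp add: rconv_class l2_diff_class)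
  qed (use U0 V openin_inv in auto)
qed

text \<open>Bumps act as contractions, so the approximation passes from \<open>CC\<close> to its
  closure.\<close>

lemma approx_unit_right:
  assumes \<xi>: "\<xi> \<in> L2 \<mu>" and e: "e > 0"
  obtains U where "openin T U" "\<one> \<in> U" "\<And>k. bump U k \<Longrightarrow> l2_norm \<mu> (l2_diff \<mu> (rconv k \<xi>) \<xi>) < e"
proof -
  obtain \<phi> where \<phi>: "\<phi> \<in> CC" "l2_norm \<mu> (l2_diff \<mu> \<xi> (l2_class \<mu> \<phi>)) < e/3"
    by (rule cs_approx[OF \<xi>, of "e/3"]) (use e in auto)
  obtain U where U: "openin T U" "\<one> \<in> U"
    "\<And>k. bump U k \<Longrightarrow> l2_norm \<mu> (l2_diff \<mu> (rconv k (l2_class \<mu> \<phi>)) (l2_class \<mu> \<phi>)) < e/3"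
    by (rule approx_unit_right_cs[OF \<phi>(1), of "e/3"]) (use e in auto)
  show ?thesis
  proof (rule that[OF U(1,2)])
    fix k assume k: "bump U k"
    let ?p = "l2_class \<mu> \<phi>"
    have L: "?p \<in> L2 \<mu>" "rconv k \<xi> \<in> L2 \<mu>" "rconv k ?p \<in> L2 \<mu>"
      using cs_L2[OF \<phi>(1)] \<xi> bump_cs[OF k] by auto
    have "l2_norm \<mu> (l2_diff \<mu> (rconv k \<xi>) (rconv k ?p)) \<le> l2_norm \<mu> (l2_diff \<mu> \<xi> ?p)"
      using rconv_bump_norm[OF k, of "l2_diff \<mu> \<xi> ?p"] L \<xi> bump_cs[OF k] by (simp add: rconv_diff)
    moreover have "l2_norm \<mu> (l2_diff \<mu> ?p \<xi>) < e/3" using \<phi>(2) l2_norm_diff_commute[OF \<xi> L(1)] by simp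
    moreover have "l2_norm \<mu> (l2_diff \<mu> (rconv k \<xi>) \<xi>) \<le> l2_norm \<mu> (l2_diff \<mu> (rconv k \<xi>) (rconv k ?p))
        + (l2_norm \<mu> (l2_diff \<mu> (rconv k ?p) ?p) + l2_norm \<mu> (l2_diff \<mu> ?p \<xi>))"
      using l2_norm_triangle_diff[OF L(2,3) \<xi>] l2_norm_triangle_diff[OF L(3,1) \<xi>] by linarith
    ultimately show "l2_norm \<mu> (l2_diff \<mu> (rconv k \<xi>) \<xi>) < e" using U(3)[OF k] \<phi>(2) by linarith
  qed
qed

section \<open>Left bounded vectors and the Plancherel weight\<close>

lemma is_left_convolution_op_iff:
  "is_left_convolution_op G T \<mu> \<xi> A \<longleftrightarrow> A \<in> bounded_ops \<mu> \<and> (\<forall>f\<in>CC. A (l2_class \<mu> f) = rconv f \<xi>)"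
  by (simp add: is_left_convolution_op_def rconv_def)

lemma bounded_ops_eq_cs:
  assumes A: "A \<in> bounded_ops \<mu>" and B: "B \<in> bounded_ops \<mu>"
    and eq: "\<And>f. f \<in> CC \<Longrightarrow> A (l2_class \<mu> f) = B (l2_class \<mu> f)"
  shows "A = B"
proof (rule bounded_ops_eqI[OF A B])
  fix \<xi> assume \<xi>: "\<xi> \<in> L2 \<mu>"
  obtain K where K: "K > 0" "\<And>\<xi>. \<xi> \<in> L2 \<mu> \<Longrightarrow> l2_norm \<mu> (op_diff \<mu> A B \<xi>) \<le> K * l2_norm \<mu> \<xi>"
    by (rule bounded_map_bound[OF bounded_ops_map[OF op_diff_in[OF A B]]]) blast
  have "l2_norm \<mu> (op_diff \<mu> A B \<xi>) \<le> 0"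
  proof (rule field_le_epsilon)
    fix e :: real assume e: "e > 0"
    obtain \<phi> where \<phi>: "\<phi> \<in> CC" "l2_norm \<mu> (l2_diff \<mu> \<xi> (l2_class \<mu> \<phi>)) < e / K"
      by (rule cs_approx[OF \<xi>, of "e / K"]) (use e K in auto)
    have pL: "l2_class \<mu> \<phi> \<in> L2 \<mu>" using cs_L2[OF \<phi>(1)] by simp
    have "op_diff \<mu> A B \<xi> = op_diff \<mu> A B (l2_diff \<mu> \<xi> (l2_class \<mu> \<phi>))"
    proof (rule l2_eqI[of _ \<mu>])
      fix \<zeta> assume "\<zeta> \<in> L2 \<mu>"
      then show "l2_inner \<mu> (op_diff \<mu> A B \<xi>) \<zeta> = l2_inner \<mu> (op_diff \<mu> A B (l2_diff \<mu> \<xi> (l2_class \<mu> \<phi>))) \<zeta>"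
        using A B \<xi> pL eq[OF \<phi>(1)]
        by (simp add: bounded_map_diff[OF bounded_ops_map[OF A]] bounded_map_diff[OF bounded_ops_map[OF B]])
    qed (use A B \<xi> pL in auto)
    then have "l2_norm \<mu> (op_diff \<mu> A B \<xi>) \<le> K * l2_norm \<mu> (l2_diff \<mu> \<xi> (l2_class \<mu> \<phi>))"
      using K(2)[of "l2_diff \<mu> \<xi> (l2_class \<mu> \<phi>)"] \<xi> pL by simp
    also have "\<dots> \<le> K * (e / K)" using \<phi>(2) K(1) by (intro mult_left_mono) auto
    finally show "l2_norm \<mu> (op_diff \<mu> A B \<xi>) \<le> 0 + e" using K(1) by simp
  qed
  then have "l2_norm \<mu> (l2_diff \<mu> (A \<xi>) (B \<xi>)) = 0" using \<xi> by (intro antisym) auto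
  then show "A \<xi> = B \<xi>" using A B \<xi> by (meson bounded_ops_in l2_diff_eq_zeroD l2_diff_in l2_norm_eq_0D)
qed

lemma left_conv_op_eq:
  assumes "\<xi> \<in> L2 \<mu>" "is_left_convolution_op G T \<mu> \<xi> A"
  shows "left_conv_op G T \<mu> \<xi> = A"
  unfolding left_conv_op_def
  by (rule the_equality[where P="is_left_convolution_op G T \<mu> \<xi>", OF assms(2)]) (use assms(2) in \<open>auto simp: is_left_convolution_op_iff intro: bounded_ops_eq_cs\<close>)

lemma adj_mult_norm:
  assumes "A \<in> bounded_ops \<mu>" "\<xi> \<in> L2 \<mu>"
  shows "l2_inner \<mu> (op_mult \<mu> (op_adj \<mu> A) A \<xi>) \<xi> = of_real ((l2_norm \<mu> (A \<xi>))\<^sup>2)"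
  using assms by (simp add: op_adj_inner' l2_inner_self)

lemma adj_mult_eq_norm:
  assumes "A \<in> bounded_ops \<mu>" "B \<in> bounded_ops \<mu>" "op_mult \<mu> (op_adj \<mu> A) A = op_mult \<mu> (op_adj \<mu> B) B" "\<xi> \<in> L2 \<mu>"
  shows "l2_norm \<mu> (A \<xi>) = l2_norm \<mu> (B \<xi>)"
proof -
  have "complex_of_real ((l2_norm \<mu> (A \<xi>))\<^sup>2) = of_real ((l2_norm \<mu> (B \<xi>))\<^sup>2)"
    using adj_mult_norm[OF assms(1,4)] adj_mult_norm[OF assms(2,4)] assms(3) by metis
  then have "(l2_norm \<mu> (A \<xi>))\<^sup>2 = (l2_norm \<mu> (B \<xi>))\<^sup>2" using of_real_eq_iff by blast
  then show ?thesis by (simp add: power2_eq_iff_nonneg)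
qed

text \<open>\<open>\<parallel>\<xi>\<parallel>\<close> is the limit of the norms of
  \<open>rconv k \<xi>\<close>, the image of the bump \<open>k\<close> under \<open>A\<close>, as
  the bumps shrink; these norms depend on \<open>A\<^sup>* A\<close> only.\<close>

lemma left_bounded_norm_unique:
  assumes \<xi>: "\<xi> \<in> L2 \<mu>" "is_left_convolution_op G T \<mu> \<xi> A" and \<eta>: "\<eta> \<in> L2 \<mu>" "is_left_convolution_op G T \<mu> \<eta> B"
    and eq: "op_mult \<mu> (op_adj \<mu> A) A = op_mult \<mu> (op_adj \<mu> B) B"
  shows "l2_norm \<mu> \<xi> = l2_norm \<mu> \<eta>"
proof -
  have "\<bar>l2_norm \<mu> \<xi> - l2_norm \<mu> \<eta>\<bar> \<le> 0"
  proof (rule field_le_epsilon)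
    fix e :: real assume e: "e > 0"
    obtain U where U: "openin T U" "\<one> \<in> U" "\<And>k. bump U k \<Longrightarrow> l2_norm \<mu> (l2_diff \<mu> (rconv k \<xi>) \<xi>) < e/2"
      by (rule approx_unit_right[OF \<xi>(1), of "e/2"]) (use e in auto)
    obtain V where V: "openin T V" "\<one> \<in> V" "\<And>k. bump V k \<Longrightarrow> l2_norm \<mu> (l2_diff \<mu> (rconv k \<eta>) \<eta>) < e/2"
      by (rule approx_unit_right[OF \<eta>(1), of "e/2"]) (use e in auto)
    obtain k where k: "bump (U \<inter> V) k" by (rule bump_exists[of "U \<inter> V"]) (use U V in auto)
    have kU: "bump U k" "bump V k" using bump_mono[OF k] by auto
    have kc: "k \<in> CC" by (rule bump_cs[OF k])
    have "l2_norm \<mu> (rconv k \<xi>) = l2_norm \<mu> (rconv k \<eta>)"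
      using adj_mult_eq_norm[OF _ _ eq bump_L2[OF k]] \<xi>(2) \<eta>(2) kc by (auto simp: is_left_convolution_op_iff)
    then show "\<bar>l2_norm \<mu> \<xi> - l2_norm \<mu> \<eta>\<bar> \<le> 0 + e"
      using U(3)[OF kU(1)] V(3)[OF kU(2)] l2_norm_diff_ge[of "rconv k \<xi>" \<mu> \<xi>] l2_norm_diff_ge[of "rconv k \<eta>" \<mu> \<eta>]
        \<xi>(1) \<eta>(1) rconv_in[OF \<xi>(1) kc] rconv_in[OF \<eta>(1) kc] by linarith
  qed
  then show ?thesis by simp
qed

text \<open>The vector picked by \<open>SOME\<close> is unknown, but any two representing vectors
  have the same norm.\<close>

lemma plancherel_weight_eq:
  assumes \<xi>: "\<xi> \<in> L2 \<mu>" "is_left_convolution_op G T \<mu> \<xi> A"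
  shows "plancherel_weight G T \<mu> (op_mult \<mu> (op_adj \<mu> A) A) = ennreal ((l2_norm \<mu> \<xi>)\<^sup>2)"
proof -
  let ?x = "op_mult \<mu> (op_adj \<mu> A) A"
  define R where "R \<eta> \<longleftrightarrow> \<eta> \<in> left_bounded G T \<mu> \<and>
    ?x = op_mult \<mu> (op_adj \<mu> (left_conv_op G T \<mu> \<eta>)) (left_conv_op G T \<mu> \<eta>)" for \<eta>
  have "R \<xi>" using \<xi> left_conv_op_eq[OF \<xi>] by (auto simp: R_def left_bounded_def)
  then have S: "R (SOME \<eta>. R \<eta>)" by (rule someI)
  let ?\<eta> = "SOME \<eta>. R \<eta>"
  obtain B where B: "?\<eta> \<in> L2 \<mu>" "is_left_convolution_op G T \<mu> ?\<eta> B" using S by (auto simp: R_def left_bounded_def)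
  have "?x = op_mult \<mu> (op_adj \<mu> B) B" using S left_conv_op_eq[OF B] by (simp add: R_def)
  then have "l2_norm \<mu> \<xi> = l2_norm \<mu> ?\<eta>" by (rule left_bounded_norm_unique[OF \<xi> B])
  moreover have "plancherel_weight G T \<mu> ?x = (if \<exists>\<eta>. R \<eta> then ennreal ((l2_norm \<mu> ?\<eta>)\<^sup>2) else \<infinity>)"
    unfolding plancherel_weight_def Let_def R_def ..
  ultimately show ?thesis using \<open>R \<xi>\<close> by auto
qed

lemma plancherel_weight_infinite:
  assumes "\<And>\<xi> A. \<xi> \<in> L2 \<mu> \<Longrightarrow> is_left_convolution_op G T \<mu> \<xi> A \<Longrightarrow> x \<noteq> op_mult \<mu> (op_adj \<mu> A) A"
  shows "plancherel_weight G T \<mu> x = \<infinity>"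
proof -
  have "\<not> (\<xi> \<in> left_bounded G T \<mu> \<and> x = op_mult \<mu> (op_adj \<mu> (left_conv_op G T \<mu> \<xi>)) (left_conv_op G T \<mu> \<xi>))" for \<xi>
    using assms left_conv_op_eq by (auto simp: left_bounded_def)
  then show ?thesis unfolding plancherel_weight_def Let_def by simp
qed

text \<open>The vector representing \<open>a\<close> is the limit of \<open>a k\<close> for bumps \<open>k\<close> shrinking to \<open>\<one>\<close>: since
  \<open>\<parallel>a f\<parallel> = \<parallel>\<xi> * f\<parallel>\<close>, these vectors form a Cauchy net together with \<open>\<xi> * k\<close>.\<close>
lemma left_bounded_same_modulus:
  assumes \<xi>: "\<xi> \<in> L2 \<mu>" "is_left_convolution_op G T \<mu> \<xi> A" and a: "a \<in> bounded_ops \<mu>"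
    and eq: "op_mult \<mu> (op_adj \<mu> a) a = op_mult \<mu> (op_adj \<mu> A) A"
    and comm: "\<And>f \<eta>. f \<in> CC \<Longrightarrow> \<eta> \<in> L2 \<mu> \<Longrightarrow> a (rconv f \<eta>) = rconv f (a \<eta>)"
  obtains \<eta> where "\<eta> \<in> L2 \<mu>" "is_left_convolution_op G T \<mu> \<eta> a"
proof -
  have A: "A \<in> bounded_ops \<mu>" and A_cs: "\<And>f. f \<in> CC \<Longrightarrow> A (l2_class \<mu> f) = rconv f \<xi>"
    using \<xi>(2) by (auto simp: is_left_convolution_op_iff)
  note amap = bounded_ops_map[OF a] and Amap = bounded_ops_map[OF A]
  have norm_eq: "l2_norm \<mu> (a \<zeta>) = l2_norm \<mu> (A \<zeta>)" if "\<zeta> \<in> L2 \<mu>" for \<zeta>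
    by (rule adj_mult_eq_norm[OF a A eq that])
  \<comment> \<open>By \<open>norm_eq\<close>, \<open>a\<close> keeps two bumps exactly as far apart
    as \<open>A\<close> does, and \<open>A\<close> maps \<open>k\<close> to
    \<open>rconv k \<xi>\<close>, which is near \<open>\<xi>\<close>.\<close>
  have close: "l2_norm \<mu> (l2_diff \<mu> (a (l2_class \<mu> k)) (a (l2_class \<mu> k'))) \<le> d + d'"
    if k: "bump U k" "l2_norm \<mu> (l2_diff \<mu> (rconv k \<xi>) \<xi>) < d"
      and k': "bump V k'" "l2_norm \<mu> (l2_diff \<mu> (rconv k' \<xi>) \<xi>) < d'" for U V k k' d d'
  proof -
    note L = bump_L2[OF k(1)] bump_L2[OF k'(1)]
    have c: "k \<in> CC" "k' \<in> CC" using k k' bump_cs by auto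
    have "l2_norm \<mu> (l2_diff \<mu> (a (l2_class \<mu> k)) (a (l2_class \<mu> k'))) = l2_norm \<mu> (l2_diff \<mu> (rconv k \<xi>) (rconv k' \<xi>))"
      using norm_eq[of "l2_diff \<mu> (l2_class \<mu> k) (l2_class \<mu> k')"] L c
      by (simp add: bounded_map_diff[OF amap] bounded_map_diff[OF Amap] A_cs)
    also have "\<dots> \<le> l2_norm \<mu> (l2_diff \<mu> (rconv k \<xi>) \<xi>) + l2_norm \<mu> (l2_diff \<mu> \<xi> (rconv k' \<xi>))"
      using \<xi>(1) c by (intro l2_norm_triangle_diff) auto
    also have "\<dots> \<le> d + d'"
      using k(2) k'(2) l2_norm_diff_commute[of \<xi> \<mu> "rconv k' \<xi>"] \<xi>(1) c by simp
    finally show ?thesis .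
  qed
  let ?r = "\<lambda>n. 1 / real (Suc n)"
  have "\<exists>U. openin T U \<and> \<one> \<in> U \<and> (\<forall>k. bump U k \<longrightarrow> l2_norm \<mu> (l2_diff \<mu> (rconv k \<xi>) \<xi>) < ?r n)" for n
    by (rule approx_unit_right[OF \<xi>(1), of "?r n"]) auto
  then obtain U where U: "\<And>n. openin T (U n)" "\<And>n. \<one> \<in> U n"
    "\<And>n k. bump (U n) k \<Longrightarrow> l2_norm \<mu> (l2_diff \<mu> (rconv k \<xi>) \<xi>) < ?r n" by metis
  have "\<exists>k. bump (U n) k" for n by (rule bump_exists[OF U(1,2)]) blast
  then obtain k where k: "\<And>n. bump (U n) (k n)" by metis
  let ?Y = "\<lambda>n. a (l2_class \<mu> (k n))"
  have YL: "?Y n \<in> L2 \<mu>" for n using a bump_L2[OF k] by simp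
  have small: "\<exists>N. \<forall>n\<ge>N. ?r n < e" if e: "e > 0" for e :: real
  proof -
    obtain N where "inverse (real (Suc N)) < e" using reals_Archimedean[OF e] by blast
    then have "?r n < e" if "n \<ge> N" for n
      using that frac_le[of 1 1 "real (Suc N)" "real (Suc n)"] by (simp add: inverse_eq_divide)
    then show ?thesis by blast
  qed
  obtain \<eta> where \<eta>: "\<eta> \<in> L2 \<mu>" "(\<lambda>n. l2_norm \<mu> (l2_diff \<mu> (?Y n) \<eta>)) \<longlonglongrightarrow> 0"
  proof (rule l2_complete[of ?Y \<mu>])
    fix e :: real assume "e > 0"
    then obtain N where N: "\<And>n. n \<ge> N \<Longrightarrow> ?r n < e/2" using small[of "e/2"] by auto
    have "l2_norm \<mu> (l2_diff \<mu> (?Y m) (?Y n)) < e" if "m \<ge> N" "n \<ge> N" for m n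
      using close[OF k U(3)[OF k] k U(3)[OF k], of m n] N[OF that(1)] N[OF that(2)] by linarith
    then show "\<exists>N. \<forall>m\<ge>N. \<forall>n\<ge>N. l2_norm \<mu> (l2_diff \<mu> (?Y m) (?Y n)) < e" by blast
  qed (use YL in auto)
  obtain B where B: "B > 0" "\<And>\<zeta>. \<zeta> \<in> L2 \<mu> \<Longrightarrow> l2_norm \<mu> (a \<zeta>) \<le> B * l2_norm \<mu> \<zeta>"
    by (rule bounded_map_bound[OF amap]) blast
  have "a (l2_class \<mu> f) = rconv f \<eta>" if f: "f \<in> CC" for f
  proof -
    have fL: "l2_class \<mu> f \<in> L2 \<mu>" using cs_L2[OF f] by simp
    obtain C where C: "C > 0" "\<And>\<zeta>. \<zeta> \<in> L2 \<mu> \<Longrightarrow> l2_norm \<mu> (rconv f \<zeta>) \<le> C * l2_norm \<mu> \<zeta>"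
      by (rule bounded_map_bound[OF rconv_bounded[OF f]]) blast
    have "l2_norm \<mu> (l2_diff \<mu> (a (l2_class \<mu> f)) (rconv f \<eta>)) \<le> 0"
    proof (rule field_le_epsilon)
      fix e :: real assume e: "e > 0"
      \<comment> \<open>Two errors: \<open>B * d\<close> for replacing \<open>f\<close> by its
        convolution with the bump \<open>q\<close>, and \<open>C * (3 * d)\<close> for replacing the
        image of \<open>q\<close> under \<open>a\<close> by \<open>\<eta>\<close>.\<close>
      define d where "d = e / (B + 3 * C)"
      have BC: "B + 3 * C > 0" using B(1) C(1) by simp
      have "B * d + C * (3 * d) = (B + 3 * C) * d" by (simp add: algebra_simps)
      also have "\<dots> = e" using BC by (simp add: d_def)
      finally have d: "d > 0" "B * d + C * (3 * d) = e"
        using e BC by (simp_all add: d_def)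
      obtain V where V: "openin T V" "\<one> \<in> V"
        "\<And>k. bump V k \<Longrightarrow> l2_norm \<mu> (l2_diff \<mu> (rconv f (l2_class \<mu> k)) (l2_class \<mu> f)) < d"
        by (rule approx_unit_left_cs[OF f d(1)]) blast
      obtain N1 where N1: "\<And>n. n \<ge> N1 \<Longrightarrow> ?r n < d" using small[OF d(1)] by auto
      obtain N2 where N2: "\<And>n. n \<ge> N2 \<Longrightarrow> l2_norm \<mu> (l2_diff \<mu> (?Y n) \<eta>) < d"
        using order_tendstoD(2)[OF \<eta>(2) d(1)] by (auto simp: eventually_sequentially)
      define n where "n = max N1 N2"
      \<comment> \<open>The bumps \<open>k n\<close> need not fit into \<open>V\<close>, as
        \<open>G\<close> need not be first countable. A bump \<open>q\<close> inside both
        \<open>V\<close> and \<open>U n\<close> does, and \<open>close\<close> ties its image to the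
        sequence.\<close>
      obtain q where q: "bump (U n \<inter> V) q" by (rule bump_exists[of "U n \<inter> V"]) (use U V in auto)
      have qU: "bump (U n) q" "bump V q" using bump_mono[OF q] by auto
      note qL = bump_L2[OF q]
      have aq: "a (l2_class \<mu> q) \<in> L2 \<mu>" using a qL by simp
      have "l2_norm \<mu> (l2_diff \<mu> (a (l2_class \<mu> q)) (?Y n)) \<le> ?r n + ?r n"
        by (rule close[OF qU(1) U(3)[OF qU(1)] k U(3)[OF k]])
      then have "l2_norm \<mu> (l2_diff \<mu> (a (l2_class \<mu> q)) \<eta>) \<le> 3 * d"
        using l2_norm_triangle_diff[OF aq YL \<eta>(1), of n] N1[of n] N2[of n] by (simp add: n_def)
      then have 1: "l2_norm \<mu> (l2_diff \<mu> (rconv f (a (l2_class \<mu> q))) (rconv f \<eta>)) \<le> C * (3 * d)"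
        using C(2)[of "l2_diff \<mu> (a (l2_class \<mu> q)) \<eta>"] C(1) aq \<eta>(1) f
        by (simp add: rconv_diff) (meson mult_left_mono less_imp_le order_trans)
      have "l2_norm \<mu> (l2_diff \<mu> (l2_class \<mu> f) (rconv f (l2_class \<mu> q))) \<le> d"
        using V(3)[OF qU(2)] l2_norm_diff_commute[OF fL rconv_in[OF qL f]] by simp
      then have "B * l2_norm \<mu> (l2_diff \<mu> (l2_class \<mu> f) (rconv f (l2_class \<mu> q))) \<le> B * d"
        using B(1) by (intro mult_left_mono) auto
      then have 2: "l2_norm \<mu> (l2_diff \<mu> (a (l2_class \<mu> f)) (rconv f (a (l2_class \<mu> q)))) \<le> B * d"
        using B(2)[of "l2_diff \<mu> (l2_class \<mu> f) (rconv f (l2_class \<mu> q))"] fL qL f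
        by (simp add: bounded_map_diff[OF amap] comm)
      have "l2_norm \<mu> (l2_diff \<mu> (a (l2_class \<mu> f)) (rconv f \<eta>)) \<le> B * d + C * (3 * d)"
        using l2_norm_triangle_diff[of "a (l2_class \<mu> f)" \<mu> "rconv f (a (l2_class \<mu> q))" "rconv f \<eta>"] 1 2
          a fL aq \<eta>(1) f by simp
      then show "l2_norm \<mu> (l2_diff \<mu> (a (l2_class \<mu> f)) (rconv f \<eta>)) \<le> 0 + e" using d(2) by simp
    qed
    then have "l2_norm \<mu> (l2_diff \<mu> (a (l2_class \<mu> f)) (rconv f \<eta>)) = 0" by (rule antisym) simp
    then show ?thesis
      using a fL \<eta>(1) f by (meson bounded_ops_in l2_diff_eq_zeroD l2_diff_in l2_norm_eq_0D rconv_in)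
  qed
  then show ?thesis using that[OF \<eta>(1)] a by (simp add: is_left_convolution_op_iff)
qed

end

section \<open>Open subgroups\<close>

locale open_subgroup = haar_group G T \<mu>G for G (structure) and T and \<mu>G +
  fixes H :: "'a set" and \<mu>H :: "'a measure"
  assumes H: "subgroup H G" and H_open: "openin T H"
    and haar_H: "left_haar_measure (G\<lparr>carrier := H\<rparr>) (subtopology T H) \<mu>H"
begin

lemma H_carrier: "x \<in> H \<Longrightarrow> x \<in> carrier G"
  using subgroup.mem_carrier[OF H] .

lemma H_Int [simp]: "H \<inter> carrier G = H" "topspace T \<inter> H = H"
  using H_carrier by (auto simp: topspace_eq)

lemma H_inv_mult: "x \<in> H \<Longrightarrow> y \<in> carrier G \<Longrightarrow> inv y \<otimes> x \<in> H \<longleftrightarrow> y \<in> H"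
proof
  assume x: "x \<in> H" and y: "y \<in> carrier G" and yx: "inv y \<otimes> x \<in> H"
  have "x \<otimes> inv (inv y \<otimes> x) \<in> H" by (rule subgroup.m_closed[OF H x subgroup.m_inv_closed[OF H yx]])
  moreover have "x \<otimes> inv (inv y \<otimes> x) = y" using x y H_carrier by (simp add: inv_mult_group m_assoc[symmetric])
  ultimately show "y \<in> H" by simp
qed (use H in \<open>auto intro: subgroup.m_closed subgroup.m_inv_closed\<close>)

lemma H_closed: "closedin T H"
proof -
  have "openin T (topspace T - H)"
  proof (subst openin_subopen, intro ballI)
    fix x assume x: "x \<in> topspace T - H"
    then have xc: "x \<in> carrier G" by (simp add: topspace_eq)
    have "x <# H \<subseteq> topspace T - H"
    proof
      fix z assume z: "z \<in> x <# H"
      then obtain h where h: "h \<in> H" "z = x \<otimes> h" by (auto simp: l_coset_def)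
      have "z \<notin> H"
      proof
        assume "z \<in> H"
        then have "z \<otimes> inv h \<in> H" using h H by (intro subgroup.m_closed subgroup.m_inv_closed)
        moreover have "z \<otimes> inv h = x" using h H_carrier xc by (simp add: m_assoc)
        ultimately show False using x by simp
      qed
      then show "z \<in> topspace T - H" using h H_carrier xc by (simp add: topspace_eq)
    qed
    moreover have "x \<in> x <# H" by (rule lcos_self[OF xc H])
    ultimately show "\<exists>U. openin T U \<and> x \<in> U \<and> U \<subseteq> topspace T - H"
      using openin_l_coset[OF H_open xc] by blast
  qed
  then show ?thesis using openin_subset[OF H_open] by (simp add: closedin_def)
qed

text \<open>Makes the results on \<open>haar_group\<close> available a second time, for the subgroup
  with \<open>\<mu>H\<close>, under the qualifier \<open>H\<close>.\<close>

sublocale H: haar_group "G\<lparr>carrier := H\<rparr>" "subtopology T H" \<mu>H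
proof -
  let ?S = "subtopology T H"
  interpret HG: group "G\<lparr>carrier := H\<rparr>" by (rule subgroup.subgroup_is_group[OF H group_axioms])
  have top: "topspace ?S = H" by (simp add: topspace_subtopology)
  show "haar_group (G\<lparr>carrier := H\<rparr>) ?S \<mu>H"
  proof (unfold_locales)
    show "topspace ?S = carrier (G\<lparr>carrier := H\<rparr>)" by (simp add: top)
    have "continuous_map (subtopology (prod_topology T T) (H \<times> H)) T (\<lambda>(x, y). x \<otimes> y)"
      by (rule continuous_map_from_subtopology[OF continuous_mult])
    then show "continuous_map (prod_topology ?S ?S) ?S (\<lambda>(x, y). x \<otimes>\<^bsub>G\<lparr>carrier := H\<rparr>\<^esub> y)"
      using subgroup.m_closed[OF H]
      by (auto simp: subtopology_Times continuous_map_in_subtopology topspace_subtopology)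
    have "continuous_map ?S ?S (\<lambda>x. inv x)"
      using continuous_map_from_subtopology[OF continuous_inv, of H] subgroup.m_inv_closed[OF H]
      by (auto simp: continuous_map_in_subtopology topspace_subtopology)
    then show "continuous_map ?S ?S (\<lambda>x. inv\<^bsub>G\<lparr>carrier := H\<rparr>\<^esub> x)"
      by (rule continuous_map_eq) (use H in \<open>simp add: topspace_subtopology\<close>)
    show "Hausdorff_space ?S" by (rule Hausdorff_space_subtopology[OF hausdorff])
    show "locally_compact_space ?S"
      using locally_compact_space_open_subset locally_compact hausdorff H_open by blast
  qed (rule haar_H)
qed

lemma inv_H [simp]: "x \<in> H \<Longrightarrow> inv\<^bsub>G\<lparr>carrier := H\<rparr>\<^esub> x = inv x"
  by (rule m_inv_consistent[OF H])

lemma topspace_H: "topspace (subtopology T H) = H"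
  by (simp add: topspace_subtopology)

lemma openin_H: "openin (subtopology T H) U \<longleftrightarrow> openin T U \<and> U \<subseteq> H"
  by (rule openin_open_subtopology[OF H_open])

lemma compactin_H: "compactin (subtopology T H) K \<longleftrightarrow> compactin T K \<and> K \<subseteq> H"
  by (simp add: compactin_subtopology)

text \<open>Polymorphic in the values, since it is applied to complex functions and to their squared
  moduli.\<close>

definition ext :: "('a \<Rightarrow> 'c :: zero) \<Rightarrow> 'a \<Rightarrow> 'c" where
  "ext f x = (if x \<in> H then f x else 0)"

text \<open>\<open>H\<close> is open and closed, so continuity can be checked on \<open>H\<close>
  and on its complement separately.\<close>

lemma ext_cs:
  assumes f: "f \<in> H.CC" shows "ext f \<in> CC"
proof -
  obtain K where K: "compactin (subtopology T H) K" "\<And>x. x \<in> carrier (G\<lparr>carrier := H\<rparr>) \<Longrightarrow> x \<notin> K \<Longrightarrow> f x = 0"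
    by (rule H.cs_E[OF f]) blast
  show ?thesis
  proof (rule cs_I)
    show "continuous_map T euclidean (ext f)"
    proof (rule continuous_map_metricI)
      fix x and e :: real assume x: "x \<in> topspace T" and e: "e > 0"
      show "\<exists>U. openin T U \<and> x \<in> U \<and> (\<forall>y\<in>U. dist (ext f y) (ext f x) < e)"
      proof (cases "x \<in> H")
        case True
        have "openin (subtopology T H) {y \<in> topspace (subtopology T H). f y \<in> ball (f x) e}"
          by (rule openin_continuous_map_preimage[OF H.cs_continuous[OF f]]) simp
        then have "openin T {y \<in> H. f y \<in> ball (f x) e}"
          unfolding topspace_H openin_H by blast
        then show ?thesis using True e
          by (intro exI[of _ "{y \<in> H. f y \<in> ball (f x) e}"]) (auto simp: ext_def dist_commute)
      next
        case False
        then show ?thesis using x e H_closed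
          by (intro exI[of _ "topspace T - H"]) (auto simp: ext_def closedin_def)
      qed
    qed
    show "compactin T K" using K(1) compactin_H by simp
    show "ext f x = 0" if "x \<in> carrier G" "x \<notin> K" for x using K(2) that by (simp add: ext_def)
  qed
qed

lemma cs_restrict:
  assumes f: "f \<in> CC" shows "f \<in> H.CC"
proof -
  obtain K where K: "compactin T K" "\<And>x. x \<in> carrier G \<Longrightarrow> x \<notin> K \<Longrightarrow> f x = 0" by (rule cs_E[OF f]) blast
  have "compactin T (H \<inter> K)" by (rule closed_Int_compactin[OF H_closed K(1)])
  then have "compactin (subtopology T H) (H \<inter> K)" by (simp add: compactin_H)
  then show ?thesis
    by (rule H.cs_I[OF continuous_map_from_subtopology[OF cs_continuous[OF f]]]) (use K(2) H_carrier in simp)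
qed

end

section \<open>Comparison of the two Haar measures on the subgroup\<close>

locale normalized_open_subgroup = open_subgroup +
  fixes C :: real
  assumes C_pos: "C > 0"
    and integral_C: "\<And>f. f \<in> CC \<Longrightarrow> (\<And>x. x \<in> carrier G \<Longrightarrow> x \<notin> H \<Longrightarrow> f x = 0) \<Longrightarrow>
      (\<integral>x. f x \<partial>\<mu>G) = of_real C * (\<integral>x. f x \<partial>\<mu>H)"
begin

text \<open>\<open>integral_C\<close> speaks of functions in \<open>CC\<close> only; a cut-off
  function between \<open>K\<close> and \<open>U\<close> transfers it to measures.\<close>

lemma compact_open_compare:
  assumes K: "compactin T K" "K \<subseteq> U" and U: "openin T U" "U \<subseteq> H"
  shows "emeasure \<mu>G K \<le> ennreal C * emeasure \<mu>H U" "ennreal C * emeasure \<mu>H K \<le> emeasure \<mu>G U"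
proof -
  obtain \<phi> :: "'a \<Rightarrow> real" and L where \<phi>: "(\<lambda>x. complex_of_real (\<phi> x)) \<in> CC"
    "compactin T L" "L \<subseteq> U" "\<And>x. x \<in> carrier G \<Longrightarrow> 0 \<le> \<phi> x \<and> \<phi> x \<le> 1"
    "\<And>x. x \<in> K \<Longrightarrow> \<phi> x = 1" "\<And>x. x \<in> carrier G \<Longrightarrow> x \<notin> L \<Longrightarrow> \<phi> x = 0"
    by (rule Urysohn_compact_support[OF K(1) U(1) K(2)]) blast
  have \<phi>H: "(\<lambda>x. complex_of_real (\<phi> x)) \<in> H.CC" by (rule cs_restrict[OF \<phi>(1)])
  have i: "integrable \<mu>G \<phi>" "integrable \<mu>H \<phi>"
    using integrable_Re[OF cs_integrable[OF \<phi>(1)]] integrable_Re[OF H.cs_integrable[OF \<phi>H]] by simp_all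
  have "(\<integral>x. complex_of_real (\<phi> x) \<partial>\<mu>G) = of_real C * (\<integral>x. complex_of_real (\<phi> x) \<partial>\<mu>H)"
    using \<phi>(3,6) U(2) by (intro integral_C \<phi>(1)) auto
  then have "complex_of_real (\<integral>x. \<phi> x \<partial>\<mu>G) = of_real (C * (\<integral>x. \<phi> x \<partial>\<mu>H))" by simp
  then have eq: "(\<integral>x. \<phi> x \<partial>\<mu>G) = C * (\<integral>x. \<phi> x \<partial>\<mu>H)" by (simp only: of_real_eq_iff)
  have "(\<integral>\<^sup>+x. ennreal (\<phi> x) \<partial>\<mu>G) = ennreal (\<integral>x. \<phi> x \<partial>\<mu>G)"
    using \<phi>(4) by (intro nn_integral_eq_integral i AE_I2) auto
  moreover have "(\<integral>\<^sup>+x. ennreal (\<phi> x) \<partial>\<mu>H) = ennreal (\<integral>x. \<phi> x \<partial>\<mu>H)"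
    using \<phi>(4) H_carrier by (intro nn_integral_eq_integral i AE_I2) auto
  ultimately have nn: "(\<integral>\<^sup>+x. ennreal (\<phi> x) \<partial>\<mu>G) = ennreal C * (\<integral>\<^sup>+x. ennreal (\<phi> x) \<partial>\<mu>H)"
    using C_pos eq by (simp add: ennreal_mult')
  have le: "indicator K x \<le> ennreal (\<phi> x)" "ennreal (\<phi> x) \<le> indicator U x" if "x \<in> carrier G" for x
    using \<phi>(3-6) that by (auto simp: indicator_def)
  have s: "K \<in> sets \<mu>G" "U \<in> sets \<mu>G" "K \<in> sets \<mu>H" "U \<in> sets \<mu>H"
    using compact_sets[OF K(1)] open_sets[OF U(1)] H.compact_sets[of K] H.open_sets[of U] K U
    by (auto simp: compactin_H openin_H)
  have GK: "emeasure \<mu>G K \<le> (\<integral>\<^sup>+x. ennreal (\<phi> x) \<partial>\<mu>G)" and GU: "(\<integral>\<^sup>+x. ennreal (\<phi> x) \<partial>\<mu>G) \<le> emeasure \<mu>G U"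
    using s le by (auto simp flip: nn_integral_indicator intro!: nn_integral_mono)
  have HK: "emeasure \<mu>H K \<le> (\<integral>\<^sup>+x. ennreal (\<phi> x) \<partial>\<mu>H)" and HU: "(\<integral>\<^sup>+x. ennreal (\<phi> x) \<partial>\<mu>H) \<le> emeasure \<mu>H U"
    using s le H_carrier by (auto simp flip: nn_integral_indicator intro!: nn_integral_mono)
  show "emeasure \<mu>G K \<le> ennreal C * emeasure \<mu>H U"
    using GK mult_left_mono[OF HU, of "ennreal C"] unfolding nn by (auto intro: order_trans)
  show "ennreal C * emeasure \<mu>H K \<le> emeasure \<mu>G U"
    using GU mult_left_mono[OF HK, of "ennreal C"] unfolding nn by (auto intro: order_trans)
qed

text \<open>Serves to divide inequalities in \<open>ennreal\<close> by \<open>C\<close>.\<close>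

lemma C_cancel: "ennreal (1 / C) * (ennreal C * x) = x" "ennreal C * (ennreal (1 / C) * x) = x"
  using C_pos by (simp_all flip: mult.assoc ennreal_mult')

text \<open>Each inequality takes the supremum over compact subsets of \<open>U\<close>, by inner
  regularity of the measure on its smaller side.\<close>

lemma emeasure_open:
  assumes U: "openin T U" "U \<subseteq> H"
  shows "emeasure \<mu>G U = ennreal C * emeasure \<mu>H U"
proof (rule antisym)
  show "emeasure \<mu>G U \<le> ennreal C * emeasure \<mu>H U"
    unfolding inner_regular[OF U(1)] by (rule SUP_least) (use compact_open_compare(1) U in auto)
  have UH: "openin (subtopology T H) U" using U openin_H by simp
  have "emeasure \<mu>H U \<le> ennreal (1 / C) * emeasure \<mu>G U"
    unfolding H.inner_regular[OF UH]
  proof (rule SUP_least)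
    fix K assume "K \<in> {K. compactin (subtopology T H) K \<and> K \<subseteq> U}"
    then have "ennreal C * emeasure \<mu>H K \<le> emeasure \<mu>G U" using compact_open_compare(2) U by (simp add: compactin_H)
    from mult_left_mono[OF this, of "ennreal (1 / C)"] show "emeasure \<mu>H K \<le> ennreal (1 / C) * emeasure \<mu>G U"
      by (simp add: C_cancel)
  qed
  from mult_left_mono[OF this, of "ennreal C"] show "ennreal C * emeasure \<mu>H U \<le> emeasure \<mu>G U"
    by (simp add: C_cancel)
qed

lemma H_sets: "H \<in> sets \<mu>G"
  by (rule open_sets[OF H_open])

lemma sets_\<mu>H: "sets \<mu>H = sets (restrict_space \<mu>G H)"
proof -
  have "(\<inter>) H ` {U. openin T U} = {U. openin (subtopology T H) U}"
    by (auto simp: openin_H openin_Int[OF H_open] image_iff intro!: exI[of _ "_ :: 'a set"])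
  moreover have "H \<in> sigma_sets (carrier G) {U. openin T U}" using H_sets unfolding sets_\<mu>_sigma .
  ultimately have "(\<inter>) H ` sigma_sets (carrier G) {U. openin T U} = sigma_sets H {U. openin (subtopology T H) U}"
    using sigma_sets_Int[of H "carrier G" "{U. openin T U}"] H_carrier by auto
  then show ?thesis unfolding sets_restrict_space H.sets_\<mu>_sigma sets_\<mu>_sigma by simp
qed

text \<open>Outer regularity of both measures extends the equation from open sets to all Borel
  subsets of \<open>H\<close>. Open sets of \<open>G\<close> are first cut down to \<open>H\<close>,
  where \<open>emeasure_open\<close> applies.\<close>

lemma restrict_H: "restrict_space \<mu>G H = density \<mu>H (\<lambda>_. ennreal C)"
proof (rule measure_eqI)
  show "sets (restrict_space \<mu>G H) = sets (density \<mu>H (\<lambda>_. ennreal C))" by (simp add: sets_\<mu>H)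
  fix A assume "A \<in> sets (restrict_space \<mu>G H)"
  then have A: "A \<in> sets \<mu>H" "A \<subseteq> H" "A \<in> sets \<mu>G"
    using sets_\<mu>H H.space_\<mu> sets.sets_into_space[of A \<mu>H] H_sets by (auto simp: sets_restrict_space)
  have "emeasure \<mu>G A = ennreal C * emeasure \<mu>H A"
  proof (rule antisym)
    have "ennreal (1 / C) * emeasure \<mu>G A \<le> emeasure \<mu>H A"
      unfolding H.outer_regular[OF A(1)]
    proof (rule INF_greatest)
      fix U assume "U \<in> {U. openin (subtopology T H) U \<and> A \<subseteq> U}"
      then have U: "openin T U" "U \<subseteq> H" "A \<subseteq> U" by (auto simp: openin_H)
      have "emeasure \<mu>G A \<le> ennreal C * emeasure \<mu>H U"
        using emeasure_mono[OF U(3) open_sets[OF U(1)]] emeasure_open[OF U(1,2)] by simp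
      from mult_left_mono[OF this, of "ennreal (1 / C)"] show "ennreal (1 / C) * emeasure \<mu>G A \<le> emeasure \<mu>H U"
        by (simp add: C_cancel)
    qed
    from mult_left_mono[OF this, of "ennreal C"] show "emeasure \<mu>G A \<le> ennreal C * emeasure \<mu>H A"
      by (simp add: C_cancel)
    show "ennreal C * emeasure \<mu>H A \<le> emeasure \<mu>G A"
      unfolding outer_regular[OF A(3)]
    proof (rule INF_greatest)
      fix V assume "V \<in> {V. openin T V \<and> A \<subseteq> V}"
      then have V: "openin T (V \<inter> H)" "A \<subseteq> V \<inter> H" "V \<in> sets \<mu>G" using A H_open open_sets by (auto intro: openin_Int)
      have "emeasure \<mu>H A \<le> emeasure \<mu>H (V \<inter> H)"
        using V by (intro emeasure_mono H.open_sets) (auto simp: openin_H)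
      then have "ennreal C * emeasure \<mu>H A \<le> ennreal C * emeasure \<mu>H (V \<inter> H)" by (rule mult_left_mono) simp
      also have "\<dots> = emeasure \<mu>G (V \<inter> H)" using emeasure_open[OF V(1)] by simp
      also have "\<dots> \<le> emeasure \<mu>G V" using V(3) by (intro emeasure_mono) auto
      finally show "ennreal C * emeasure \<mu>H A \<le> emeasure \<mu>G V" .
    qed
  qed
  then show "emeasure (restrict_space \<mu>G H) A = emeasure (density \<mu>H (\<lambda>_. ennreal C)) A"
    using A H_sets by (simp add: emeasure_restrict_space emeasure_density nn_integral_cmult_indicator)
qed

lemma AE_H: "(AE x in \<mu>H. P x) \<longleftrightarrow> (AE x in \<mu>G. x \<in> H \<longrightarrow> P x)"
proof -
  have "(AE x in \<mu>G. x \<in> H \<longrightarrow> P x) \<longleftrightarrow> (AE x in restrict_space \<mu>G H. P x)"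
    using H_sets by (subst AE_restrict_space_iff) auto
  also have "\<dots> \<longleftrightarrow> (AE x in \<mu>H. P x)"
    unfolding restrict_H using C_pos by (subst AE_density) auto
  finally show ?thesis ..
qed

lemma measurable_H: "f \<in> borel_measurable \<mu>G \<Longrightarrow> f \<in> borel_measurable \<mu>H"
  unfolding measurable_cong_sets[OF sets_\<mu>H refl] by (rule measurable_restrict_space1)

lemma measurable_ext:
  fixes f :: "'a \<Rightarrow> 'c :: real_normed_vector"
  assumes "f \<in> borel_measurable \<mu>H"
  shows "ext f \<in> borel_measurable \<mu>G"
proof -
  have "f \<in> borel_measurable (restrict_space \<mu>G H)"
    using assms unfolding measurable_cong_sets[OF sets_\<mu>H refl] .
  then have "(\<lambda>x. indicator H x *\<^sub>R f x) \<in> borel_measurable \<mu>G"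
    using H_sets by (subst (asm) borel_measurable_restrict_space_iff) auto
  moreover have "(\<lambda>x. indicator H x *\<^sub>R f x) = ext f" by (auto simp: ext_def indicator_def)
  ultimately show ?thesis by simp
qed

lemma integral_ext:
  fixes f :: "'a \<Rightarrow> 'c :: {banach, second_countable_topology}"
  assumes f: "f \<in> borel_measurable \<mu>H"
  shows "(\<integral>x. ext f x \<partial>\<mu>G) = C *\<^sub>R (\<integral>x. f x \<partial>\<mu>H)"
proof -
  have "(\<integral>x. ext f x \<partial>\<mu>G) = (\<integral>x. indicator H x *\<^sub>R f x \<partial>\<mu>G)"
    by (intro Bochner_Integration.integral_cong) (auto simp: ext_def indicator_def)
  also have "\<dots> = (\<integral>x. f x \<partial>restrict_space \<mu>G H)"
    using H_sets by (subst integral_restrict_space) auto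
  also have "\<dots> = (\<integral>x. C *\<^sub>R f x \<partial>\<mu>H)"
    unfolding restrict_H using f C_pos by (subst integral_density) auto
  finally show ?thesis by simp
qed

lemma integrable_ext:
  fixes f :: "'a \<Rightarrow> 'c :: {banach, second_countable_topology}"
  assumes f: "f \<in> borel_measurable \<mu>H"
  shows "integrable \<mu>G (ext f) \<longleftrightarrow> integrable \<mu>H f"
proof -
  have "integrable \<mu>G (ext f) \<longleftrightarrow> integrable \<mu>G (\<lambda>x. indicator H x *\<^sub>R f x)"
    by (intro Bochner_Integration.integrable_cong) (auto simp: ext_def indicator_def)
  also have "\<dots> \<longleftrightarrow> integrable (restrict_space \<mu>G H) f"
    using H_sets by (subst integrable_restrict_space) auto
  also have "\<dots> \<longleftrightarrow> integrable \<mu>H (\<lambda>x. C *\<^sub>R f x)"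
    unfolding restrict_H using f C_pos by (subst integrable_density) auto
  also have "\<dots> \<longleftrightarrow> integrable \<mu>H f"
  proof
    assume "integrable \<mu>H (\<lambda>x. C *\<^sub>R f x)"
    then have "integrable \<mu>H (\<lambda>x. (1 / C) *\<^sub>R (C *\<^sub>R f x))" by (rule integrable_scaleR_right)
    then show "integrable \<mu>H f" using C_pos by simp
  qed (rule integrable_scaleR_right)
  finally show ?thesis .
qed

section \<open>Extension by zero on L2\<close>

lemma ext_cmod_sq: "(\<lambda>x. (cmod (ext f x))\<^sup>2) = ext (\<lambda>x. (cmod (f x))\<^sup>2)"
  by (auto simp: ext_def)

lemma ext_L2:
  assumes f: "f \<in> L2_fun \<mu>H" shows "ext f \<in> L2_fun \<mu>G"
proof -
  have "f \<in> borel_measurable \<mu>H" using L2_fun_measurable[OF f] .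
  then have "integrable \<mu>G (\<lambda>x. (cmod (ext f x))\<^sup>2)"
    unfolding ext_cmod_sq using L2_fun_integrable[OF f] by (subst integrable_ext) auto
  then show ?thesis using measurable_ext[OF L2_fun_measurable[OF f]] by (simp add: L2_fun_def)
qed

lemma ext_norm:
  assumes f: "f \<in> L2_fun \<mu>H"
  shows "(l2_norm \<mu>G (l2_class \<mu>G (ext f)))\<^sup>2 = C * (l2_norm \<mu>H (l2_class \<mu>H f))\<^sup>2"
proof -
  have "(\<lambda>x. (cmod (f x))\<^sup>2) \<in> borel_measurable \<mu>H"
    using borel_measurable_integrable[OF L2_fun_integrable[OF f]] .
  then show ?thesis
    unfolding l2_norm_class_sq[OF f] l2_norm_class_sq[OF ext_L2[OF f]] ext_cmod_sq
    by (simp add: integral_ext)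
qed

lemma L2_restrict:
  assumes f: "f \<in> L2_fun \<mu>G" shows "f \<in> L2_fun \<mu>H"
proof -
  have m: "f \<in> borel_measurable \<mu>H" by (rule measurable_H[OF L2_fun_measurable[OF f]])
  have m2: "(\<lambda>x. (cmod (f x))\<^sup>2) \<in> borel_measurable \<mu>H" using m by measurable
  have "integrable \<mu>G (ext (\<lambda>x. (cmod (f x))\<^sup>2))"
    by (rule Bochner_Integration.integrable_bound[OF L2_fun_integrable[OF f] measurable_ext[OF m2]])
      (auto simp: ext_def)
  then show ?thesis using m m2 by (simp add: L2_fun_def integrable_ext)
qed

definition E :: "'a l2 \<Rightarrow> 'a l2" where
  "E \<xi> = l2_class \<mu>G (ext (l2_rep \<xi>))"

lemma E_class:
  assumes f: "f \<in> L2_fun \<mu>H" shows "E (l2_class \<mu>H f) = l2_class \<mu>G (ext f)"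
  unfolding E_def
proof (rule l2_class_cong_AE)
  have "AE x in \<mu>G. x \<in> H \<longrightarrow> l2_rep (l2_class \<mu>H f) x = f x"
    using l2_rep_class[OF f] unfolding AE_H .
  then show "AE x in \<mu>G. ext (l2_rep (l2_class \<mu>H f)) x = ext f x"
    by eventually_elim (simp add: ext_def)
qed

lemma E_in [simp]: "\<xi> \<in> L2 \<mu>H \<Longrightarrow> E \<xi> \<in> L2 \<mu>G"
  unfolding E_def by (intro l2_class_in ext_L2 l2_rep_L2_fun)

lemma E_norm: "\<xi> \<in> L2 \<mu>H \<Longrightarrow> (l2_norm \<mu>G (E \<xi>))\<^sup>2 = C * (l2_norm \<mu>H \<xi>)\<^sup>2"
  unfolding E_def using ext_norm[OF l2_rep_L2_fun] by simp

lemma E_bounded: "bounded_map \<mu>H \<mu>G E"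
proof (rule bounded_mapI[where K="sqrt C"])
  fix \<xi> assume \<xi>: "\<xi> \<in> L2 \<mu>H"
  then show "E \<xi> \<in> L2 \<mu>G" by simp
  have "l2_norm \<mu>G (E \<xi>) = sqrt (C * (l2_norm \<mu>H \<xi>)\<^sup>2)" using E_norm[OF \<xi>] by (metis l2_norm_nonneg real_sqrt_unique)
  then show "l2_norm \<mu>G (E \<xi>) \<le> sqrt C * l2_norm \<mu>H \<xi>" by (simp add: real_sqrt_mult)
  obtain f where f: "f \<in> L2_fun \<mu>H" "\<xi> = l2_class \<mu>H f" using \<xi> by (rule L2_cases)
  show "E (l2_scale \<mu>H c \<xi>) = l2_scale \<mu>G c (E \<xi>)" for c
    unfolding f(2) using f(1) by (simp add: l2_scale_class E_class L2_fun_scale ext_L2) (rule l2_class_cong, simp add: ext_def)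
  fix \<eta> assume \<eta>: "\<eta> \<in> L2 \<mu>H"
  obtain g where g: "g \<in> L2_fun \<mu>H" "\<eta> = l2_class \<mu>H g" using \<eta> by (rule L2_cases)
  show "E (l2_add \<mu>H \<xi> \<eta>) = l2_add \<mu>G (E \<xi>) (E \<eta>)"
    unfolding f(2) g(2) using f(1) g(1) by (simp add: l2_add_class E_class L2_fun_add ext_L2) (rule l2_class_cong, simp add: ext_def)
qed

text \<open>Translation by an element of \<open>H\<close> maps \<open>H\<close> onto itself, so it
  commutes with extension by zero.\<close>

lemma E_left_regular:
  assumes h: "h \<in> H" and \<xi>: "\<xi> \<in> L2 \<mu>H"
  shows "left_regular G \<mu>G h (E \<xi>) = E (left_regular (G\<lparr>carrier := H\<rparr>) \<mu>H h \<xi>)"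
proof -
  obtain f where f: "f \<in> L2_fun \<mu>H" "\<xi> = l2_class \<mu>H f" using \<xi> by (rule L2_cases)
  have hi: "inv h \<in> H" using subgroup.m_inv_closed[OF H h] .
  have sh: "(\<lambda>x. f (inv h \<otimes> x)) \<in> L2_fun \<mu>H" using H.shift_L2[OF f(1), of "inv h"] hi by simp
  have "ext f (inv h \<otimes> x) = ext (\<lambda>x. f (inv h \<otimes> x)) x" if "x \<in> carrier G" for x
  proof -
    have "inv h \<otimes> x \<in> H \<longleftrightarrow> x \<in> H"
    proof
      assume "inv h \<otimes> x \<in> H"
      then have "h \<otimes> (inv h \<otimes> x) \<in> H" by (rule subgroup.m_closed[OF H h])
      then show "x \<in> H" using that H_carrier[OF h] by (simp add: m_assoc[symmetric])
    qed (rule subgroup.m_closed[OF H hi])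
    then show ?thesis by (simp add: ext_def)
  qed
  then show ?thesis unfolding f(2)
    using H.left_regular_class[OF f(1), of h] h sh f(1) ext_L2[OF f(1)] H_carrier[OF h]
    by (simp add: E_class left_regular_class) (rule l2_class_cong, simp)
qed

text \<open>For \<open>x \<in> H\<close> the integrand vanishes at \<open>y \<notin> H\<close>,
  because \<open>y\<^sup>-\<^sup>1 x \<in> H\<close> iff \<open>y \<in> H\<close>. Integration
  against \<open>\<mu>G\<close> then contributes the factor \<open>C\<close>.\<close>

lemma conv_ext:
  assumes g: "g \<in> L2_fun \<mu>G" and f: "f \<in> H.CC" and x: "x \<in> H"
  shows "conv g (ext f) x = of_real C * H.conv g f x"
proof -
  have "conv g (ext f) x = (\<integral>y. ext (\<lambda>y. g y * f (inv y \<otimes> x)) y \<partial>\<mu>G)"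
    unfolding convolution_def using H_inv_mult[OF x]
    by (intro Bochner_Integration.integral_cong) (auto simp: ext_def)
  also have "\<dots> = C *\<^sub>R (\<integral>y. g y * f (inv y \<otimes> x) \<partial>\<mu>H)"
  proof (rule integral_ext)
    have "(\<lambda>y. g y * f (inv\<^bsub>G\<lparr>carrier := H\<rparr>\<^esub> y \<otimes> x)) \<in> borel_measurable \<mu>H"
      using borel_measurable_integrable[OF H.conv_integrable[OF L2_restrict[OF g] f, of x]] x by simp
    then show "(\<lambda>y. g y * f (inv y \<otimes> x)) \<in> borel_measurable \<mu>H"
      by (subst measurable_cong[where g="\<lambda>y. g y * f (inv\<^bsub>G\<lparr>carrier := H\<rparr>\<^esub> y \<otimes> x)"]) auto
  qed
  also have "(\<integral>y. g y * f (inv y \<otimes> x) \<partial>\<mu>H) = H.conv g f x"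
    unfolding convolution_def by (intro Bochner_Integration.integral_cong) auto
  finally show ?thesis by (simp add: scaleR_conv_of_real)
qed

text \<open>Division by \<open>C\<close> restores mass one.\<close>

lemma bump_ext:
  assumes k: "H.bump U k" and UV: "U \<subseteq> V"
  shows "bump V (\<lambda>x. of_real (1 / C) * ext k x)"
  unfolding bump_def
proof (intro conjI ballI)
  have kc: "k \<in> H.CC" by (rule H.bump_cs[OF k])
  show "(\<lambda>x. of_real (1 / C) * ext k x) \<in> CC" by (intro cs_scale ext_cs kc)
  show "(\<integral>x. of_real (1 / C) * ext k x \<partial>\<mu>G) = 1"
    using integral_ext[OF H.cs_measurable[OF kc]] k C_pos by (simp add: H.bump_def scaleR_conv_of_real)
  fix x assume x: "x \<in> carrier G"
  have kx: "k x = of_real (cmod (k x)) \<and> k (inv x) = k x \<and> (x \<notin> U \<longrightarrow> k x = 0)" if "x \<in> H"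
    using k that by (auto simp: H.bump_def)
  show "of_real (1 / C) * ext k x = of_real (cmod (of_real (1 / C) * ext k x))"
    using kx C_pos by (cases "x \<in> H") (auto simp: ext_def norm_mult norm_divide)
  have "inv x \<in> H \<longleftrightarrow> x \<in> H" using x subgroup.m_inv_closed[OF H] by (metis inv_inv)
  then show "of_real (1 / C) * ext k (inv x) = of_real (1 / C) * ext k x" using kx by (simp add: ext_def)
  show "x \<notin> V \<longrightarrow> of_real (1 / C) * ext k x = 0" using kx UV by (auto simp: ext_def)
qed

text \<open>Both sides are evaluated on the class of a bump convolved with \<open>f\<close>, with bumps supported
  in \<open>H\<close>; no decomposition of \<open>G\<close> into cosets is needed.\<close>
lemma left_convolution_extends:
  assumes \<eta>: "\<eta> \<in> L2 \<mu>H" "is_left_convolution_op (G\<lparr>carrier := H\<rparr>) (subtopology T H) \<mu>H \<eta> b"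
    and a: "a \<in> bounded_ops \<mu>G" and aE: "\<And>\<xi>. \<xi> \<in> L2 \<mu>H \<Longrightarrow> a (E \<xi>) = E (b \<xi>)"
    and comm: "\<And>f \<xi>. f \<in> CC \<Longrightarrow> \<xi> \<in> L2 \<mu>G \<Longrightarrow> a (rconv f \<xi>) = rconv f (a \<xi>)"
  shows "is_left_convolution_op G T \<mu>G (l2_scale \<mu>G (of_real (1 / C)) (E \<eta>)) a"
  unfolding is_left_convolution_op_iff
proof (intro conjI ballI a)
  fix f assume f: "f \<in> CC"
  let ?c = "complex_of_real (1 / C)"
  have fL: "l2_class \<mu>G f \<in> L2 \<mu>G" using cs_L2[OF f] by simp
  have b: "b (l2_class \<mu>H k) = H.rconv k \<eta>" if "k \<in> H.CC" for k
    using \<eta>(2) that by (simp add: H.is_left_convolution_op_iff)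
  obtain B where B: "B > 0" "\<And>\<zeta>. \<zeta> \<in> L2 \<mu>G \<Longrightarrow> l2_norm \<mu>G (a \<zeta>) \<le> B * l2_norm \<mu>G \<zeta>"
    by (rule bounded_map_bound[OF bounded_ops_map[OF a]]) blast
  obtain D where D: "D > 0" "\<And>\<zeta>. \<zeta> \<in> L2 \<mu>H \<Longrightarrow> l2_norm \<mu>G (rconv f (E \<zeta>)) \<le> D * l2_norm \<mu>H \<zeta>"
    by (rule bounded_map_bound[OF bounded_map_compose[OF E_bounded rconv_bounded[OF f]]]) blast
  let ?v = "l2_scale \<mu>G ?c (E \<eta>)"
  have vL: "?v \<in> L2 \<mu>G" using \<eta>(1) by simp
  have "l2_norm \<mu>G (l2_diff \<mu>G (a (l2_class \<mu>G f)) (rconv f ?v)) \<le> 0"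
  proof (rule field_le_epsilon)
    fix e :: real assume e: "e > 0"
    \<comment> \<open>\<open>B * d\<close> covers the replacement of \<open>f\<close> by its
      convolution with the bump, \<open>D / C * d\<close> that of \<open>H.rconv k \<eta>\<close> by
      \<open>\<eta>\<close>.\<close>
    define d where "d = e / (B + D / C)"
    have BD: "B + D / C > 0" using B(1) D(1) C_pos by (simp add: add_pos_pos)
    have "B * d + D / C * d = (B + D / C) * d" by (simp only: distrib_right)
    also have "\<dots> = e" using BD by (simp add: d_def)
    finally have d: "d > 0" "B * d + D / C * d = e" using e BD by (simp_all add: d_def)
    obtain V where V: "openin T V" "\<one> \<in> V"
      "\<And>k. bump V k \<Longrightarrow> l2_norm \<mu>G (l2_diff \<mu>G (rconv f (l2_class \<mu>G k)) (l2_class \<mu>G f)) < d"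
      by (rule approx_unit_left_cs[OF f d(1)]) blast
    obtain U where U: "openin (subtopology T H) U" "\<one>\<^bsub>G\<lparr>carrier := H\<rparr>\<^esub> \<in> U"
      "\<And>k. H.bump U k \<Longrightarrow> l2_norm \<mu>H (l2_diff \<mu>H (H.rconv k \<eta>) \<eta>) < d"
      by (rule H.approx_unit_right[OF \<eta>(1) d(1)]) blast
    have "openin (subtopology T H) (U \<inter> V)" using U(1) V(1) by (auto simp: openin_H intro: openin_Int)
    then obtain k where k: "H.bump (U \<inter> V) k" by (rule H.bump_exists) (use U V in auto)
    have kc: "k \<in> H.CC" and kL: "l2_class \<mu>H k \<in> L2 \<mu>H" using H.bump_cs[OF k] H.bump_L2[OF k] by auto
    let ?k = "\<lambda>x. ?c * ext k x"
    have bk: "bump V ?k" by (rule bump_ext[OF k]) simp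
    have kE: "l2_class \<mu>G ?k = l2_scale \<mu>G ?c (E (l2_class \<mu>H k))"
      using H.cs_L2[OF kc] ext_L2[OF H.cs_L2[OF kc]] by (simp add: E_class l2_scale_class)
    \<comment> \<open>\<open>a\<close> commutes with \<open>rconv f\<close> and acts as
      \<open>b\<close> under \<open>E\<close>; and \<open>b\<close> sends the bump to
      \<open>H.rconv k \<eta>\<close>.\<close>
    have "a (rconv f (l2_class \<mu>G ?k)) = l2_scale \<mu>G ?c (rconv f (E (H.rconv k \<eta>)))"
    proof -
      have "a (rconv f (l2_class \<mu>G ?k)) = rconv f (a (l2_class \<mu>G ?k))" by (rule comm[OF f bump_L2[OF bk]])
      also have "a (l2_class \<mu>G ?k) = l2_scale \<mu>G ?c (E (H.rconv k \<eta>))"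
        unfolding kE using kL by (simp add: bounded_map_scale[OF bounded_ops_map[OF a]] aE b[OF kc])
      also have "rconv f \<dots> = l2_scale \<mu>G ?c (rconv f (E (H.rconv k \<eta>)))"
        using \<eta>(1) kc by (intro bounded_map_scale[OF rconv_bounded[OF f]]) simp
      finally show ?thesis .
    qed
    moreover have "rconv f ?v = l2_scale \<mu>G ?c (rconv f (E \<eta>))"
      using \<eta>(1) by (intro bounded_map_scale[OF rconv_bounded[OF f]]) simp
    ultimately have "l2_diff \<mu>G (a (rconv f (l2_class \<mu>G ?k))) (rconv f ?v)
        = l2_scale \<mu>G ?c (rconv f (E (l2_diff \<mu>H (H.rconv k \<eta>) \<eta>)))"
      using \<eta>(1) kc f
      by (simp add: bounded_map_diff[OF E_bounded] rconv_diff) (rule l2_eqI[of _ \<mu>G], auto simp: algebra_simps diff_divide_distrib)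
    then have "l2_norm \<mu>G (l2_diff \<mu>G (a (rconv f (l2_class \<mu>G ?k))) (rconv f ?v))
        = 1 / C * l2_norm \<mu>G (rconv f (E (l2_diff \<mu>H (H.rconv k \<eta>) \<eta>)))"
      using \<eta>(1) kc f C_pos by (simp add: norm_divide)
    also have "\<dots> \<le> 1 / C * (D * d)"
    proof (intro mult_left_mono)
      have "l2_norm \<mu>G (rconv f (E (l2_diff \<mu>H (H.rconv k \<eta>) \<eta>))) \<le> D * l2_norm \<mu>H (l2_diff \<mu>H (H.rconv k \<eta>) \<eta>)"
        using \<eta>(1) kc by (intro D(2)) simp
      also have "\<dots> \<le> D * d"
        using U(3)[OF H.bump_mono[OF k]] D(1) by (intro mult_left_mono) auto
      finally show "l2_norm \<mu>G (rconv f (E (l2_diff \<mu>H (H.rconv k \<eta>) \<eta>))) \<le> D * d" .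
    qed (use C_pos in simp)
    finally have 1: "l2_norm \<mu>G (l2_diff \<mu>G (a (rconv f (l2_class \<mu>G ?k))) (rconv f ?v)) \<le> D / C * d" by simp
    have kGL: "rconv f (l2_class \<mu>G ?k) \<in> L2 \<mu>G" using bump_L2[OF bk] f by simp
    have "l2_norm \<mu>G (l2_diff \<mu>G (a (l2_class \<mu>G f)) (a (rconv f (l2_class \<mu>G ?k))))
        \<le> B * l2_norm \<mu>G (l2_diff \<mu>G (l2_class \<mu>G f) (rconv f (l2_class \<mu>G ?k)))"
      using B(2)[of "l2_diff \<mu>G (l2_class \<mu>G f) (rconv f (l2_class \<mu>G ?k))"] fL kGL
      by (simp add: bounded_map_diff[OF bounded_ops_map[OF a]])
    also have "\<dots> \<le> B * d"
      using V(3)[OF bk] l2_norm_diff_commute[OF fL kGL] B(1) by (intro mult_left_mono) auto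
    finally have 2: "l2_norm \<mu>G (l2_diff \<mu>G (a (l2_class \<mu>G f)) (a (rconv f (l2_class \<mu>G ?k)))) \<le> B * d" .
    have "l2_norm \<mu>G (l2_diff \<mu>G (a (l2_class \<mu>G f)) (rconv f ?v)) \<le> B * d + D / C * d"
      using l2_norm_triangle_diff[of "a (l2_class \<mu>G f)" \<mu>G "a (rconv f (l2_class \<mu>G ?k))" "rconv f ?v"] 1 2
        a fL kGL vL f by (simp del: op_apply)
    then show "l2_norm \<mu>G (l2_diff \<mu>G (a (l2_class \<mu>G f)) (rconv f ?v)) \<le> 0 + e" using d(2) by simp
  qed
  then have "l2_norm \<mu>G (l2_diff \<mu>G (a (l2_class \<mu>G f)) (rconv f ?v)) = 0" by (rule antisym) simp
  then show "a (l2_class \<mu>G f) = rconv f ?v"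
    using a fL vL f by (meson bounded_ops_in l2_diff_eq_zeroD l2_diff_in l2_norm_eq_0D rconv_in)
qed

text \<open>\<open>a\<close> maps the class of \<open>ext f\<close> to
  \<open>rconv (ext f) \<xi>\<close>, which on \<open>H\<close> is \<open>C\<close> times a
  convolution over \<open>H\<close> by \<open>conv_ext\<close>. So \<open>b\<close> is convolution
  by \<open>C\<close> times the restriction of \<open>\<xi>\<close> to \<open>H\<close>.\<close>

lemma left_convolution_restricts:
  assumes \<xi>: "\<xi> \<in> L2 \<mu>G" "is_left_convolution_op G T \<mu>G \<xi> a"
    and b: "b \<in> bounded_ops \<mu>H" and aE: "\<And>\<zeta>. \<zeta> \<in> L2 \<mu>H \<Longrightarrow> a (E \<zeta>) = E (b \<zeta>)"
  obtains \<eta> where "\<eta> \<in> L2 \<mu>H" "is_left_convolution_op (G\<lparr>carrier := H\<rparr>) (subtopology T H) \<mu>H \<eta> b"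
proof
  let ?g = "\<lambda>x. of_real C * l2_rep \<xi> x"
  have r: "l2_rep \<xi> \<in> L2_fun \<mu>G" "l2_rep \<xi> \<in> L2_fun \<mu>H" using \<xi>(1) L2_restrict by auto
  have g: "?g \<in> L2_fun \<mu>H" by (rule L2_fun_scale[OF r(2)])
  then show "l2_class \<mu>H ?g \<in> L2 \<mu>H" by simp
  show "is_left_convolution_op (G\<lparr>carrier := H\<rparr>) (subtopology T H) \<mu>H (l2_class \<mu>H ?g) b"
    unfolding H.is_left_convolution_op_iff
  proof (intro conjI ballI b)
    fix f assume f: "f \<in> H.CC"
    have fL: "f \<in> L2_fun \<mu>H" by (rule H.cs_L2[OF f])
    have ef: "ext f \<in> CC" by (rule ext_cs[OF f])
    have "b (l2_class \<mu>H f) \<in> L2 \<mu>H" using b fL by simp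
    then obtain h where h: "h \<in> L2_fun \<mu>H" "b (l2_class \<mu>H f) = l2_class \<mu>H h" by (rule L2_cases)
    have "l2_class \<mu>G (ext h) = a (E (l2_class \<mu>H f))" using aE[of "l2_class \<mu>H f"] fL h by (simp add: E_class[OF h(1)])
    also have "\<dots> = rconv (ext f) \<xi>" using \<xi>(2) ef fL by (simp add: E_class is_left_convolution_op_iff)
    also have "\<dots> = l2_class \<mu>G (conv (l2_rep \<xi>) (ext f))" by (simp add: rconv_def)
    finally have "AE x in \<mu>G. ext h x = conv (l2_rep \<xi>) (ext f) x" by (rule l2_class_eqD[OF ext_L2[OF h(1)]])
    then have "AE x in \<mu>G. x \<in> H \<longrightarrow> h x = of_real C * H.conv (l2_rep \<xi>) f x"
      by eventually_elim (use conv_ext[OF r(1) f] in \<open>auto simp: ext_def\<close>)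
    then have "AE x in \<mu>H. h x = H.conv ?g f x" unfolding AE_H H.conv_scale .
    then have "l2_class \<mu>H h = l2_class \<mu>H (H.conv ?g f)" by (rule l2_class_cong_AE)
    then show "b (l2_class \<mu>H f) = H.rconv f (l2_class \<mu>H ?g)" using h(2) H.rconv_class[OF g f] by simp
  qed
qed

end

section \<open>The mass of the trivial coset\<close>

context open_subgroup
begin

text \<open>\<open>{H}\<close> is open because \<open>H\<close> is, hence measurable; as a point it
  is compact, hence of finite mass. If \<open>f\<close> vanishes off \<open>H\<close>, the inner
  integral is a multiple of the indicator of this point, and left invariance of
  \<open>\<mu>H\<close> makes its value at \<open>H\<close> independent of the representative that
  \<open>SOME\<close> picks.\<close>

lemma coset_mass:
  assumes radon: "radon_measure (coset_topology G T H) \<mu>"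
    and formula: "\<forall>f\<in>CC. (\<integral>x. f x \<partial>\<mu>G) = (\<integral>c. (\<integral>h. f ((SOME x. x \<in> c) \<otimes> h) \<partial>\<mu>H) \<partial>\<mu>)"
  shows "normalized_open_subgroup G T \<mu>G H \<mu>H (measure \<mu> {H})"
    and "emeasure \<mu> {H} = ennreal (measure \<mu> {H})"
proof -
  let ?Q = "coset_topology G T H"
  have coset_H: "x <# H = H \<longleftrightarrow> x \<in> H" if "x \<in> carrier G" for x
    using lcos_self[OF that H] coset_join3[OF that H] by auto
  have "{x \<in> topspace T. x <# H \<in> {H}} = H"
    using coset_H H_carrier by (auto simp: topspace_eq)
  moreover have "\<one> <# H = H" using coset_H[OF one_closed] subgroup.one_closed[OF H] by simp
  then have "H \<in> lcosets H" by (auto simp: LCOSETS_def)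
  ultimately have op: "openin ?Q {H}" using H_open by (simp add: openin_coset_topology)
  then have "H \<in> topspace ?Q" using openin_subset by blast
  then have comp: "compactin ?Q {H}" by (simp add: compactin_sing)
  have "{U. openin ?Q U} \<subseteq> Pow (topspace ?Q)" using openin_subset by auto
  then have sets: "sets \<mu> = sigma_sets (topspace ?Q) {U. openin ?Q U}" and space: "space \<mu> = topspace ?Q"
    using radon sets_eq_imp_space_eq[of \<mu> "borel_of ?Q"]
    by (simp_all add: radon_measure_def borel_of_def space_measure_of sets_measure_of)
  have Hs: "{H} \<in> sets \<mu>" unfolding sets using op by (auto intro: sigma_sets.Basic)
  have fin: "emeasure \<mu> {H} < \<infinity>" using radon comp by (auto simp: radon_measure_def)
  then show eq: "emeasure \<mu> {H} = ennreal (measure \<mu> {H})" by (intro emeasure_eq_ennreal_measure) auto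
  have formula_H: "(\<integral>x. f x \<partial>\<mu>G) = of_real (measure \<mu> {H}) * (\<integral>x. f x \<partial>\<mu>H)"
    if f: "f \<in> CC" and f0: "\<And>x. x \<in> carrier G \<Longrightarrow> x \<notin> H \<Longrightarrow> f x = 0" for f
  proof -
    have "(\<integral>h. f ((SOME x. x \<in> c) \<otimes> h) \<partial>\<mu>H) = indicator {H} c *\<^sub>R (\<integral>x. f x \<partial>\<mu>H)" if c: "c \<in> space \<mu>" for c
    proof -
      have "c \<in> lcosets H" using c openin_topspace[of ?Q] unfolding space openin_coset_topology by blast
      then obtain a where a: "a \<in> carrier G" "c = a <# H" by (auto simp: LCOSETS_def)
      define s where "s = (SOME x. x \<in> c)"
      have "a \<in> c" using lcos_self[OF a(1) H] a(2) by simp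
      then have "s \<in> c" unfolding s_def by (rule someI[where P="\<lambda>x. x \<in> c"])
      then obtain h0 where h0: "h0 \<in> H" "s = a \<otimes> h0" using a(2) by (auto simp: l_coset_def)
      have sc: "s \<in> carrier G" using h0 a H_carrier by simp
      show ?thesis
      proof (cases "a \<in> H")
        case True
        then have "s \<in> H" using h0 subgroup.m_closed[OF H] by simp
        then have "(\<integral>h. f (s \<otimes> h) \<partial>\<mu>H) = (\<integral>x. f x \<partial>\<mu>H)"
          using H.integral_left_mult[of s f] H.cs_measurable[OF cs_restrict[OF f]] by simp
        moreover have "c = H" using True a coset_H by simp
        ultimately show ?thesis by (simp add: s_def)
      next
        case False
        have "f (s \<otimes> h) = 0" if h: "h \<in> H" for h
        proof (rule f0)
          show "s \<otimes> h \<in> carrier G" using sc h H_carrier by simp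
          show "s \<otimes> h \<notin> H"
          proof
            assume sh: "s \<otimes> h \<in> H"
            have q: "h0 \<otimes> h \<in> H" by (rule subgroup.m_closed[OF H h0(1) h])
            have "s \<otimes> h \<otimes> inv (h0 \<otimes> h) \<in> H"
              by (rule subgroup.m_closed[OF H sh subgroup.m_inv_closed[OF H q]])
            moreover have "s \<otimes> h = a \<otimes> (h0 \<otimes> h)" using h h0 H_carrier a(1) by (simp add: m_assoc)
            then have "s \<otimes> h \<otimes> inv (h0 \<otimes> h) = a" using H_carrier[OF q] a(1) by (simp add: m_assoc del: inv_mult_group)
            ultimately show False using False by simp
          qed
        qed
        then have "(\<integral>h. f (s \<otimes> h) \<partial>\<mu>H) = (\<integral>h. 0 \<partial>\<mu>H)"
          by (intro Bochner_Integration.integral_cong) auto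
        moreover have "c \<noteq> H" using False a coset_H by simp
        ultimately show ?thesis by (simp add: s_def)
      qed
    qed
    then have "(\<integral>x. f x \<partial>\<mu>G) = (\<integral>c. indicator {H} c *\<^sub>R (\<integral>x. f x \<partial>\<mu>H) \<partial>\<mu>)"
      using formula f by (simp cong: Bochner_Integration.integral_cong)
    also have "\<dots> = measure \<mu> {H} *\<^sub>R (\<integral>x. f x \<partial>\<mu>H)"
      using Hs fin by simp
    finally show ?thesis by (simp add: scaleR_conv_of_real)
  qed
  \<comment> \<open>\<open>k\<close> has integral 1 and vanishes off \<open>H\<close>, so the
    formula excludes mass 0.\<close>
  obtain k where k: "bump H k"
    by (rule bump_exists[OF H_open subgroup.one_closed[OF H]])
  then have "1 = of_real (measure \<mu> {H}) * (\<integral>x. k x \<partial>\<mu>H)"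
    using formula_H[of k] by (simp add: bump_def)
  then have "measure \<mu> {H} \<noteq> 0" by auto
  then have "measure \<mu> {H} > 0" by (simp add: less_le)
  then show "normalized_open_subgroup G T \<mu>G H \<mu>H (measure \<mu> {H})"
    using formula_H by unfold_locales auto
qed

end

theorem theorem2p19:
  fixes G :: "('a, 'b) monoid_scheme" and T :: "'a topology" and H :: "'a set"
    and \<mu>G \<mu>H :: "'a measure" and \<mu> :: "'a set measure"
    and \<Phi> :: "('a l2 \<Rightarrow> 'a l2) \<Rightarrow> ('a l2 \<Rightarrow> 'a l2)"
  assumes "locally_compact_group G T"
    and "subgroup H G" and "openin T H"
    and "left_haar_measure G T \<mu>G"
    and "left_haar_measure (G\<lparr>carrier := H\<rparr>) (subtopology T H) \<mu>H"
    and "star_isomorphism \<mu>H (group_vN (G\<lparr>carrier := H\<rparr>) \<mu>H) \<mu>G (translation_vN G \<mu>G H) \<Phi>"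
    and "\<forall>h\<in>H. \<Phi> (left_regular (G\<lparr>carrier := H\<rparr>) \<mu>H h) = left_regular G \<mu>G h"
    and "radon_measure (coset_topology G T H) \<mu>"
    and "\<forall>g\<in>carrier G. \<forall>A\<in>sets \<mu>. emeasure \<mu> ((\<lambda>c. g <#\<^bsub>G\<^esub> c) ` A) = emeasure \<mu> A"
    and "\<forall>f\<in>compactly_supported T.
           (\<integral>x. f x \<partial>\<mu>G) = (\<integral>c. (\<integral>h. f ((SOME x. x \<in> c) \<otimes>\<^bsub>G\<^esub> h) \<partial>\<mu>H) \<partial>\<mu>)"
  shows "\<forall>x \<in> positive_part \<mu>G (translation_vN G \<mu>G H).
           plancherel_weight G T \<mu>G x =
             inverse (emeasure \<mu> {H}) *
             plancherel_weight (G\<lparr>carrier := H\<rparr>) (subtopology T H) \<mu>H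
               (inv_into (group_vN (G\<lparr>carrier := H\<rparr>) \<mu>H) \<Phi> x)"
proof
  interpret locally_compact_group G T by fact
  interpret S: open_subgroup G T \<mu>G H \<mu>H
    by (intro open_subgroup.intro open_subgroup_axioms.intro haar_group.intro haar_group_axioms.intro assms)
  define C where "C = measure \<mu> {H}"
  have mass: "emeasure \<mu> {H} = ennreal C" unfolding C_def by (rule S.coset_mass(2)[OF assms(8,10)])
  interpret N: normalized_open_subgroup G T \<mu>G H \<mu>H C
    unfolding C_def by (rule S.coset_mass(1)[OF assms(8,10)])
  let ?G = "G\<lparr>carrier := H\<rparr>" and ?T = "subtopology T H"
  let ?A = "group_vN ?G \<mu>H" and ?B = "translation_vN G \<mu>G H"
  have HG: "H \<subseteq> carrier G" using S.H_carrier by auto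
  note inv_closed = subgroup.m_inv_closed[OF S.H]
  have Hinv: "\<And>h. h \<in> carrier ?G \<Longrightarrow> inv\<^bsub>?G\<^esub> h \<in> carrier ?G" by (simp add: inv_closed)
  note vA = S.H.translation_vN[OF order_refl Hinv] and vB = S.translation_vN[OF HG inv_closed]
  interpret iso: vN_isomorphism \<mu>H ?A \<mu>G ?B \<Phi>
    by (rule vN_isomorphism.intro[OF vA vB assms(6)])
  \<comment> \<open>\<open>L(H)\<close> is the double commutant of the translations by
    \<open>H\<close>, and on these the claim is the equivariance of \<open>E\<close>.\<close>
  have E: "\<Phi> y (N.E k) = N.E (y k)" if "y \<in> ?A" "k \<in> L2 \<mu>H" for y k
  proof (rule iso.intertwiner_extends[OF S.H.left_translations[OF order_refl Hinv] translation_vN_def N.E_bounded _ that])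
    fix s \<xi> assume "s \<in> left_regular ?G \<mu>H ` carrier ?G" and \<xi>: "\<xi> \<in> L2 \<mu>H"
    then obtain h where h: "h \<in> H" "s = left_regular ?G \<mu>H h" by auto
    then show "\<Phi> s (N.E \<xi>) = N.E (s \<xi>)" using assms(7) N.E_left_regular[OF h(1) \<xi>] by simp
  qed
  fix x assume "x \<in> positive_part \<mu>G ?B"
  then have xB: "x \<in> ?B" and xp: "pos_op \<mu>G x"
    using positive_part_iff[of ?B \<mu>G] iso.\<B>_ops by auto
  define y where "y = inv_into ?A \<Phi> x"
  have "x \<in> \<Phi> ` ?A" using xB bij_betw_imp_surj_on[OF iso.\<Phi>_bij] by simp
  then have yA: "y \<in> ?A" and \<Phi>y: "\<Phi> y = x"
    unfolding y_def by (rule inv_into_into, rule f_inv_into_f)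
  \<comment> \<open>The root is taken inside the image of \<open>L(H)\<close>, so that it has a
    preimage \<open>b\<close>.\<close>
  obtain a where a: "pos_op \<mu>G a" "a \<in> ?B" "op_mult \<mu>G a a = x" by (rule vN_sqrt[OF vB xp xB])
  obtain b where b: "b \<in> ?A" "\<Phi> b = a" by (rule iso.\<Phi>_surj[OF a(2)])
  have aO: "a \<in> bounded_ops \<mu>G" and bO: "b \<in> bounded_ops \<mu>H" using a b iso.\<A>_ops by auto
  have x_eq: "x = op_mult \<mu>G (op_adj \<mu>G a) a" using a by (simp add: pos_op_adj)
  \<comment> \<open>Injectivity of \<open>\<Phi>\<close> pulls \<open>a\<^sup>* = a\<close> and
    \<open>a a = x\<close> back to \<open>b\<close>.\<close>
  have "\<Phi> (op_adj \<mu>H b) = \<Phi> b" using iso.\<Phi>_adj[OF b(1)] b(2) pos_op_adj[OF a(1)] by simp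
  from iso.\<Phi>_inj[OF vN_adj[OF vA b(1)] b(1) this] have "op_adj \<mu>H b = b" .
  moreover have "\<Phi> y = \<Phi> (op_mult \<mu>H b b)" using iso.\<Phi>_mult[OF b(1) b(1)] b(2) a(3) \<Phi>y by simp
  from iso.\<Phi>_inj[OF yA vN_mult[OF vA b(1) b(1)] this] have "y = op_mult \<mu>H b b" .
  ultimately have y_eq: "y = op_mult \<mu>H (op_adj \<mu>H b) b" by simp
  have aE: "a (N.E \<zeta>) = N.E (b \<zeta>)" if "\<zeta> \<in> L2 \<mu>H" for \<zeta> using E[OF b(1) that] b(2) by simp
  note a_comm = S.translation_vN_rconv[OF HG inv_closed a(2)]
  note b_comm = S.H.translation_vN_rconv[OF order_refl Hinv b(1)]
  have "plancherel_weight G T \<mu>G x = inverse (ennreal C) * plancherel_weight ?G ?T \<mu>H y"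
  \<comment> \<open>The cases are finite and infinite weight of \<open>y\<close>.\<close>
  proof (cases "\<exists>\<eta>\<in>L2 \<mu>H. \<exists>A. is_left_convolution_op ?G ?T \<mu>H \<eta> A \<and> y = op_mult \<mu>H (op_adj \<mu>H A) A")
    case True
    then obtain \<eta>0 A where \<eta>0: "\<eta>0 \<in> L2 \<mu>H" "is_left_convolution_op ?G ?T \<mu>H \<eta>0 A" "y = op_mult \<mu>H (op_adj \<mu>H A) A"
      by blast
    obtain \<eta> where \<eta>: "\<eta> \<in> L2 \<mu>H" "is_left_convolution_op ?G ?T \<mu>H \<eta> b"
      by (rule S.H.left_bounded_same_modulus[OF \<eta>0(1,2) bO _ b_comm]) (use \<eta>0(3) y_eq in auto)
    let ?v = "l2_scale \<mu>G (of_real (1 / C)) (N.E \<eta>)"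
    have vL: "?v \<in> L2 \<mu>G" using \<eta>(1) by simp
    have v: "is_left_convolution_op G T \<mu>G ?v a" by (rule N.left_convolution_extends[OF \<eta> aO aE a_comm])
    have "(l2_norm \<mu>G ?v)\<^sup>2 = (1 / C)\<^sup>2 * (C * (l2_norm \<mu>H \<eta>)\<^sup>2)"
      using \<eta>(1) by (simp add: power_mult_distrib N.E_norm norm_divide power_divide)
    also have "\<dots> = inverse C * (l2_norm \<mu>H \<eta>)\<^sup>2" using N.C_pos by (simp add: power2_eq_square field_simps)
    finally have "ennreal ((l2_norm \<mu>G ?v)\<^sup>2) = inverse (ennreal C) * ennreal ((l2_norm \<mu>H \<eta>)\<^sup>2)"
      using N.C_pos by (simp add: ennreal_mult inverse_ennreal)
    then show ?thesis
      using S.plancherel_weight_eq[OF vL v] S.H.plancherel_weight_eq[OF \<eta>] x_eq y_eq by simp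
  next
    case False
    then have "plancherel_weight ?G ?T \<mu>H y = \<infinity>" by (intro S.H.plancherel_weight_infinite) blast
    moreover have "plancherel_weight G T \<mu>G x = \<infinity>"
    proof (rule S.plancherel_weight_infinite)
      fix \<xi> A assume \<xi>: "\<xi> \<in> L2 \<mu>G" "is_left_convolution_op G T \<mu>G \<xi> A"
      show "x \<noteq> op_mult \<mu>G (op_adj \<mu>G A) A"
      proof
        \<comment> \<open>Finite weight of \<open>x\<close> would descend to \<open>y\<close>:
          replace \<open>A\<close> by the root \<open>a\<close>, then restrict the vector to
          \<open>H\<close>.\<close>
        assume "x = op_mult \<mu>G (op_adj \<mu>G A) A"
        then have eq: "op_mult \<mu>G (op_adj \<mu>G a) a = op_mult \<mu>G (op_adj \<mu>G A) A" using x_eq by simp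
        obtain \<xi>' where \<xi>': "\<xi>' \<in> L2 \<mu>G" "is_left_convolution_op G T \<mu>G \<xi>' a"
          by (rule S.left_bounded_same_modulus[OF \<xi> aO eq a_comm])
        obtain \<eta> where "\<eta> \<in> L2 \<mu>H" "is_left_convolution_op ?G ?T \<mu>H \<eta> b"
          by (rule N.left_convolution_restricts[OF \<xi>' bO aE])
        then show False using False y_eq by blast
      qed
    qed
    moreover have "inverse (ennreal C) * \<infinity> = \<infinity>"
      using N.C_pos by (simp add: inverse_ennreal ennreal_mult_top)
    ultimately show ?thesis by simp
  qed
  then show "plancherel_weight G T \<mu>G x = inverse (emeasure \<mu> {H}) * plancherel_weight ?G ?T \<mu>H (inv_into ?A \<Phi> x)"
    by (simp add: mass y_def)
qed

end
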